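(* Let $\underline{i}=(i_1,\dots,i_n)$ and $\underline{j}=(j_1,\dots,j_n)$ be sequences of vertices of an oriented simply laced Dynkin graph, and let $(S_n)_{\underline{i}}^{\underline{j}}=\{w\in S_n\mid i_k=j_{w(k)}\text{ for all }k\}$. For each $w\in(S_n)_{\underline{i}}^{\underline{j}}$ fix a reduced expression, with associated crossing diagram $\psi_w\in\mathrm{Hom}(\mathcal{E}_{\underline{i}},\mathcal{E}_{\underline{j}})$ in $\mathcal{U}^+(\mathfrak{g})$. Then for any $w\in(S_n)_{\underline{i}}^{\underline{j}}$, $$\mathbf{z}(\psi_w)=0,\qquad\mathbf{d}(\psi_w)\in\mathrm{Span}\{\psi_v\}_{v\in(S_n)_{\underline{i}}^{\underline{j}},\,v\le w},$$ where the span is taken over the left action of $R_{\underline{j}}$ (resp. over the right action of $R_{\underline{i}}$) and $\le$ is the Bruhat order. Thus $\{\psi_w\}$ induces a downfree filtration of $\mathrm{Hom}(\mathcal{E}_{\underline{i}},\mathcal{E}_{\underline{j}})$, parametrized by $(S_n)_{\underline{i}}^{\underline{j}}$ with its Bruhat order. In the associated graded, the span of $\psi_w$ is a copy of $R_n\langle p(w)\rangle$, where, for the left $R_{\underline{j}}$-action, $$p(w)=\sum_{k=1}^n\Big(\sum_{\ell>k,\ w^{-1}(\ell)<w^{-1}(k)}-j_k\cdot j_\ell\Big)x_k,$$ and, for the right $R_{\underline{i}}$-action, $$p(w)=\sum_{k=1}^n\Big(\sum_{\ell<k,\ w(\ell)>w(k)}-i_\ell\cdot i_k\Big)x_k.$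$
   Context: Conventions: $fg$ places $f$ above $g$; $x_k$ is the dot on the $k$-th strand from the left, $\psi_k$ the crossing of strands $k,k+1$. For vertices put $i\cdot i=2$, $i\cdot j=-1$ if adjacent, $0$ otherwise. $\mathcal{U}^+(\mathfrak{g})$ is the graded $\mathbb{Z}$-linear monoidal category with generating objects $\mathcal{E}_i$ and generating morphisms: dot $x:\mathcal{E}_i\to\mathcal{E}_i$ (degree $2$), crossing $\psi_{ij}:\mathcal{E}_i\mathcal{E}_j\to\mathcal{E}_j\mathcal{E}_i$ (degree $-i\cdot j$). Relations: on $\mathcal{E}_i\mathcal{E}_i$, $x_1\psi-\psi x_2=\mathrm{id}=\psi x_1-x_2\psi$; for $i\ne j$, $x_1\psi_{ij}=\psi_{ij}x_2$ and $x_2\psi_{ij}=\psi_{ij}x_1$; $\psi_{ji}\psi_{ij}$ equals $0$ if $i=j$, $\mathrm{id}$ if $i\ne j$ are not adjacent, and, for $i,j$ adjacent, (dot on the strand coloured by the tail of the edge) $-$ (dot on the strand coloured by the head); on $\mathcal{E}_i\mathcal{E}_j\mathcal{E}_k$, $\psi_1\psi_2\psi_1=\psi_2\psi_1\psi_2$ unless $i=k$ is adjacent to $j$, in which case $\psi_1\psi_2\psi_1-\psi_2\psi_1\psi_2=\varepsilon\,\mathrm{id}$ with $\varepsilon=+1$ if $i\to j$ and $-1$ if $j\to i$. Write $\mathcal{E}_{\underline{i}}=\mathcal{E}_{i_1}\cdots\mathcal{E}_{i_n}$. $\mathfrak{sl}_2$ acts by derivations for both compositions: $\mathbf{d}(x)=x^2$,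 $\mathbf{d}(\psi_{ii})=-x_1\psi_{ii}-\psi_{ii}x_2$, $\mathbf{d}(\psi_{ij})=x_1\psi_{ij}$ for $i,j$ adjacent, $\mathbf{d}(\psi_{ij})=0$ for $i\ne j$ not adjacent; $\mathbf{z}(x)=\mathrm{id}$, $\mathbf{z}(\psi_{ij})=0$; $\mathbf{h}(f)=\deg(f)f$. The $\mathfrak{sl}_2$-triple is $(\mathbf{d},\mathbf{h},-\mathbf{z})$. If $w=s_{k_1}\cdots s_{k_\ell}$ is the chosen reduced expression, $\psi_w=\psi_{k_1}\cdots\psi_{k_\ell}$ with strands coloured so that the source is $\mathcal{E}_{\underline{i}}$ and the target $\mathcal{E}_{\underline{j}}$ (the $k$-th bottom strand ends at the $w(k)$-th top position). $R_{\underline{j}}\cong R_n=\mathbb{Z}[x_1,\dots,x_n]$ acts on the left by dots on the target, $R_{\underline{i}}\cong R_n$ on the right by dots on the source; $\{\psi_w\}_{w\in(S_n)_{\underline{i}}^{\underline{j}}}$ is a basis of $\mathrm{Hom}(\mathcal{E}_{\underline{i}},\mathcal{E}_{\underline{j}})$ over either (Khovanov–Lauda). $R_n$ carries the action $\mathbf{d}=\sum x_i^2\frac{\partial}{\partial x_i}$, $\mathbf{z}=\sum\frac{\partial}{\partial x_i}$. An $(R_n,\mathfrak{sl}_2)$-module is an $R_n$-module with $\mathfrak{sl}_2$-action satisfying the Leibniz rule. For $p=\sum a_ix_i$, $R_n\langle p\rangle$ is the free rank one graded module with generator $1_p$ in degree $\sum a_i$, $\mathbf{d}(1_p)=p1_p$,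 $\mathbf{z}(1_p)=0$. A downfree filtration on an $(R_n,\mathfrak{sl}_2)$-module $M$, free and finitely generated as a graded $R_n$-module, is a splitting $M=\bigoplus_{i\in I}M_i$ ($I$ finite) into free rank one graded $R_n$-submodules with each $M_i$ preserved by $\mathbf{z}$, and a partial order on $I$ with $\mathbf{d}(M_i)\subset\bigoplus_{j\le i}M_j$; the associated graded pieces are $\bigoplus_{j\le i}M_j/\bigoplus_{j<i}M_j\cong M_i$. *)

theory Defs
  imports
    "HOL-Library.Poly_Mapping"
    "HOL-Combinatorics.Permutations"
    "HOL-Algebra.AbelCoset"
    "HOL-Algebra.Module"
begin

section \<open>Oriented simply laced Dynkin graphs\<close>

text \<open>
  The vertices are the elements of a finite type; an oriented graph is its set of arcs,
  \<open>(i, j) \<in> A\<close> meaning \<open>i \<rightarrow> j\<close>.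
\<close>

definition adjacent :: "('v \<times> 'v) set \<Rightarrow> 'v \<Rightarrow> 'v \<Rightarrow> bool" where
  "adjacent A i j \<longleftrightarrow> (i, j) \<in> A \<or> (j, i) \<in> A"

definition cart :: "('v \<times> 'v) set \<Rightarrow> 'v \<Rightarrow> 'v \<Rightarrow> int" where
  "cart A i j = (if i = j then 2 else if adjacent A i j then -1 else 0)"

text \<open>Edge sets on \<open>{..<n}\<close> of the diagrams of type \<open>A\<^sub>n\<close>, \<open>D\<^sub>n\<close>, \<open>E\<^sub>n\<close>.\<close>

definition path_edges :: "nat \<Rightarrow> nat set set" where
  "path_edges n = {{k, Suc k} | k. Suc k < n}"

inductive ADE_diagram :: "nat \<Rightarrow> nat set set \<Rightarrow> bool" where
  typeA: "n \<ge> 1 \<Longrightarrow> ADE_diagram n (path_edges n)"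
| typeD: "n \<ge> 4 \<Longrightarrow> ADE_diagram n (insert {n - 3, n - 1} (path_edges (n - 1)))"
| typeE: "n \<in> {6, 7, 8} \<Longrightarrow> ADE_diagram n (insert {2, n - 1} (path_edges (n - 1)))"

text \<open>
  \<open>asym A\<close> excludes loops and pairs of opposite arcs, so every edge carries exactly one
  orientation.  The graph may be disconnected.
\<close>

definition oriented_ADE_graph :: "('v::finite \<times> 'v) set \<Rightarrow> bool" where
  "oriented_ADE_graph A \<longleftrightarrow> asym A \<and>
     (\<forall>a. \<exists>n T f. ADE_diagram n T \<and> bij_betw f {..<n} ((A \<union> A\<inverse>)\<^sup>* `` {a}) \<and>
        (\<forall>k<n. \<forall>l<n. adjacent A (f k) (f l) \<longleftrightarrow> {k, l} \<in> T))"


section \<open>The graded monoidal category $\mathcal U^+(\mathfrak g)$\<close>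

text \<open>
  Objects are words in the vertices.  Hom spaces are free abelian groups on well-formed formal
  diagrams, modulo the axioms of a strict monoidal category and the defining relations.
  \<open>Vert D D'\<close> is \<open>D\<close> above \<open>D'\<close>; \<open>Cross i j\<close> has source \<open>[i, j]\<close> and target \<open>[j, i]\<close>.
\<close>

datatype 'v diagram =
    Ident "'v list"
  | Dot 'v
  | Cross 'v 'v
  | Vert "'v diagram" "'v diagram"
  | Horiz "'v diagram" "'v diagram"

primrec src :: "'v diagram \<Rightarrow> 'v list" where
  "src (Ident a) = a"
| "src (Dot i) = [i]"
| "src (Cross i j) = [i, j]"
| "src (Vert D D') = src D'"
| "src (Horiz D D') = src D @ src D'"

primrec tgt :: "'v diagram \<Rightarrow> 'v list" where
  "tgt (Ident a) = a"
| "tgt (Dot i) = [i]"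
| "tgt (Cross i j) = [j, i]"
| "tgt (Vert D D') = tgt D"
| "tgt (Horiz D D') = tgt D @ tgt D'"

primrec wf_diagram :: "'v diagram \<Rightarrow> bool" where
  "wf_diagram (Ident a) \<longleftrightarrow> True"
| "wf_diagram (Dot i) \<longleftrightarrow> True"
| "wf_diagram (Cross i j) \<longleftrightarrow> True"
| "wf_diagram (Vert D D') \<longleftrightarrow> wf_diagram D \<and> wf_diagram D' \<and> src D = tgt D'"
| "wf_diagram (Horiz D D') \<longleftrightarrow> wf_diagram D \<and> wf_diagram D'"

primrec deg :: "('v \<times> 'v) set \<Rightarrow> 'v diagram \<Rightarrow> int" where
  "deg A (Ident a) = 0"
| "deg A (Dot i) = 2"
| "deg A (Cross i j) = - cart A i j"
| "deg A (Vert D D') = deg A D + deg A D'"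
| "deg A (Horiz D D') = deg A D + deg A D'"

type_synonym 'v lin = "'v diagram \<Rightarrow>\<^sub>0 int"

definition vcomp :: "'v lin \<Rightarrow> 'v lin \<Rightarrow> 'v lin" (infixl "\<star>" 70) where
  "f \<star> g = frag_extend (\<lambda>D. frag_extend (\<lambda>D'. frag_of (Vert D D')) g) f"

definition hcomp :: "'v lin \<Rightarrow> 'v lin \<Rightarrow> 'v lin" where
  "hcomp f g = frag_extend (\<lambda>D. frag_extend (\<lambda>D'. frag_of (Horiz D D')) g) f"

definition free_hom :: "'v list \<Rightarrow> 'v list \<Rightarrow> 'v lin set" where
  "free_hom a b = {f. \<forall>D \<in> Poly_Mapping.keys f. wf_diagram D \<and> src D = a \<and> tgt D = b}"

text \<open>
  The generators on the strands of a word \<open>a\<close>; strands are numbered from \<open>0\<close>, and the crossing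
  in position \<open>k\<close> involves the strands \<open>k\<close> and \<open>k + 1\<close>.
\<close>

definition dot_at :: "nat \<Rightarrow> 'v list \<Rightarrow> 'v diagram" where
  "dot_at k a = Horiz (Ident (take k a)) (Horiz (Dot (a ! k)) (Ident (drop (Suc k) a)))"

definition cross_at :: "nat \<Rightarrow> 'v list \<Rightarrow> 'v diagram" where
  "cross_at k a = Horiz (Ident (take k a))
     (Horiz (Cross (a ! k) (a ! Suc k)) (Ident (drop (Suc (Suc k)) a)))"

text \<open>\<open>crossings [k\<^sub>1, \<dots>, k\<^sub>l] a\<close> is the composite \<open>\<psi>\<^bsub>k\<^sub>1\<^esub> \<cdots> \<psi>\<^bsub>k\<^sub>l\<^esub>\<close> with source \<open>a\<close>.\<close>

primrec crossings :: "nat list \<Rightarrow> 'v list \<Rightarrow> 'v diagram" where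
  "crossings [] a = Ident a"
| "crossings (k # ks) a = Vert (cross_at k (tgt (crossings ks a))) (crossings ks a)"

abbreviation dotm :: "nat \<Rightarrow> 'v list \<Rightarrow> 'v lin" where
  "dotm k a \<equiv> frag_of (dot_at k a)"

abbreviation crossm :: "nat list \<Rightarrow> 'v list \<Rightarrow> 'v lin" where
  "crossm ks a \<equiv> frag_of (crossings ks a)"

abbreviation idm :: "'v list \<Rightarrow> 'v lin" where
  "idm a \<equiv> frag_of (Ident a)"

inductive monoidal_rel :: "'v diagram \<Rightarrow> 'v diagram \<Rightarrow> bool" where
  vert_assoc: "monoidal_rel (Vert (Vert D D') D'') (Vert D (Vert D' D''))"
| vert_id_left: "monoidal_rel (Vert (Ident (tgt D)) D) D"
| vert_id_right: "monoidal_rel (Vert D (Ident (src D))) D"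
| horiz_assoc: "monoidal_rel (Horiz (Horiz D D') D'') (Horiz D (Horiz D' D''))"
| horiz_unit_left: "monoidal_rel (Horiz (Ident []) D) D"
| horiz_unit_right: "monoidal_rel (Horiz D (Ident [])) D"
| horiz_id: "monoidal_rel (Horiz (Ident a) (Ident b)) (Ident (a @ b))"
| interchange: "monoidal_rel (Vert (Horiz D\<^sub>1 D\<^sub>2) (Horiz D\<^sub>3 D\<^sub>4)) (Horiz (Vert D\<^sub>1 D\<^sub>3) (Vert D\<^sub>2 D\<^sub>4))"

inductive klr_rel :: "('v \<times> 'v) set \<Rightarrow> 'v lin \<Rightarrow> 'v lin \<Rightarrow> bool" for A where
  nilHecke_1: "klr_rel A
     (dotm 0 [i, i] \<star> crossm [0] [i, i] - crossm [0] [i, i] \<star> dotm 1 [i, i]) (idm [i, i])"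
| nilHecke_2: "klr_rel A
     (crossm [0] [i, i] \<star> dotm 0 [i, i] - dotm 1 [i, i] \<star> crossm [0] [i, i]) (idm [i, i])"
| slide_1: "i \<noteq> j \<Longrightarrow> klr_rel A
     (dotm 0 [j, i] \<star> crossm [0] [i, j]) (crossm [0] [i, j] \<star> dotm 1 [i, j])"
| slide_2: "i \<noteq> j \<Longrightarrow> klr_rel A
     (dotm 1 [j, i] \<star> crossm [0] [i, j]) (crossm [0] [i, j] \<star> dotm 0 [i, j])"
| double_same: "klr_rel A (crossm [0, 0] [i, i]) 0"
| double_far: "i \<noteq> j \<Longrightarrow> \<not> adjacent A i j \<Longrightarrow> klr_rel A (crossm [0, 0] [i, j]) (idm [i, j])"
| double_tail_head: "(i, j) \<in> A \<Longrightarrow> klr_rel A (crossm [0, 0] [i, j]) (dotm 0 [i, j] - dotm 1 [i, j])"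
| double_head_tail: "(j, i) \<in> A \<Longrightarrow> klr_rel A (crossm [0, 0] [i, j]) (dotm 1 [i, j] - dotm 0 [i, j])"
| braid: "\<not> (i = k \<and> adjacent A i j) \<Longrightarrow>
     klr_rel A (crossm [0, 1, 0] [i, j, k]) (crossm [1, 0, 1] [i, j, k])"
| braid_pos: "(i, j) \<in> A \<Longrightarrow>
     klr_rel A (crossm [0, 1, 0] [i, j, i] - crossm [1, 0, 1] [i, j, i]) (idm [i, j, i])"
| braid_neg: "(j, i) \<in> A \<Longrightarrow>
     klr_rel A (crossm [0, 1, 0] [i, j, i] - crossm [1, 0, 1] [i, j, i]) (- idm [i, j, i])"

text \<open>\<open>null A a b f\<close>: the formal combination \<open>f\<close> is zero as a morphism from \<open>a\<close> to \<open>b\<close>.\<close>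

inductive null :: "('v \<times> 'v) set \<Rightarrow> 'v list \<Rightarrow> 'v list \<Rightarrow> 'v lin \<Rightarrow> bool" for A where
  null_monoidal: "monoidal_rel D D' \<Longrightarrow> frag_of D \<in> free_hom a b \<Longrightarrow> frag_of D' \<in> free_hom a b
     \<Longrightarrow> null A a b (frag_of D - frag_of D')"
| null_klr: "klr_rel A f g \<Longrightarrow> f \<in> free_hom a b \<Longrightarrow> g \<in> free_hom a b \<Longrightarrow> null A a b (f - g)"
| null_zero: "null A a b 0"
| null_diff: "null A a b f \<Longrightarrow> null A a b g \<Longrightarrow> null A a b (f - g)"
| null_above: "null A a b f \<Longrightarrow> g \<in> free_hom b c \<Longrightarrow> null A a c (g \<star> f)"
| null_below: "null A a b f \<Longrightarrow> g \<in> free_hom c a \<Longrightarrow> null A c b (f \<star> g)"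
| null_left: "null A a b f \<Longrightarrow> g \<in> free_hom c d \<Longrightarrow> null A (c @ a) (d @ b) (hcomp g f)"
| null_right: "null A a b f \<Longrightarrow> g \<in> free_hom c d \<Longrightarrow> null A (a @ c) (b @ d) (hcomp f g)"

text \<open>The operators \<open>\<d>\<close>, \<open>\<z>\<close>, \<open>\<h>\<close> on formal combinations of diagrams.\<close>

primrec d_diagram :: "('v \<times> 'v) set \<Rightarrow> 'v diagram \<Rightarrow> 'v lin" where
  "d_diagram A (Ident a) = 0"
| "d_diagram A (Dot i) = frag_of (Vert (Dot i) (Dot i))"
| "d_diagram A (Cross i j) =
     (if i = j then - (dotm 0 [i, i] \<star> frag_of (Cross i i)) - frag_of (Cross i i) \<star> dotm 1 [i, i]
      else if adjacent A i j then dotm 0 [j, i] \<star> frag_of (Cross i j)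
      else 0)"
| "d_diagram A (Vert D D') = d_diagram A D \<star> frag_of D' + frag_of D \<star> d_diagram A D'"
| "d_diagram A (Horiz D D') = hcomp (d_diagram A D) (frag_of D') + hcomp (frag_of D) (d_diagram A D')"

primrec z_diagram :: "'v diagram \<Rightarrow> 'v lin" where
  "z_diagram (Ident a) = 0"
| "z_diagram (Dot i) = frag_of (Ident [i])"
| "z_diagram (Cross i j) = 0"
| "z_diagram (Vert D D') = z_diagram D \<star> frag_of D' + frag_of D \<star> z_diagram D'"
| "z_diagram (Horiz D D') = hcomp (z_diagram D) (frag_of D') + hcomp (frag_of D) (z_diagram D')"

definition d_lin :: "('v \<times> 'v) set \<Rightarrow> 'v lin \<Rightarrow> 'v lin" where
  "d_lin A = frag_extend (d_diagram A)"

definition z_lin :: "'v lin \<Rightarrow> 'v lin" where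
  "z_lin = frag_extend z_diagram"

definition h_lin :: "('v \<times> 'v) set \<Rightarrow> 'v lin \<Rightarrow> 'v lin" where
  "h_lin A = frag_extend (\<lambda>D. frag_cmul (deg A D) (frag_of D))"


section \<open>The polynomial ring with its $\mathfrak{sl}_2$-action\<close>

text \<open>
  Polynomials over the integers, as integer combinations of exponent functions; the variables of
  \<open>R\<^sub>n\<close> are \<open>x\<^sub>0, \<dots>, x\<^bsub>n-1\<^esub>\<close>.
\<close>

type_synonym zpoly = "(nat \<Rightarrow>\<^sub>0 nat) \<Rightarrow>\<^sub>0 int"

definition polys :: "nat \<Rightarrow> zpoly ring" where
  "polys n = \<lparr>carrier = {p. \<forall>m \<in> Poly_Mapping.keys p. Poly_Mapping.keys m \<subseteq> {..<n}},
     mult = (*), one = 1, zero = 0, add = (+)\<rparr>"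

definition pvar :: "nat \<Rightarrow> zpoly" where
  "pvar k = frag_of (Poly_Mapping.single k 1)"

definition pderiv_var :: "nat \<Rightarrow> zpoly \<Rightarrow> zpoly" where
  "pderiv_var k = frag_extend
     (\<lambda>m. frag_cmul (int (Poly_Mapping.lookup m k)) (frag_of (m - Poly_Mapping.single k 1)))"

definition d_poly :: "nat \<Rightarrow> zpoly \<Rightarrow> zpoly" where
  "d_poly n p = (\<Sum>k<n. pvar k ^ 2 * pderiv_var k p)"

definition z_poly :: "nat \<Rightarrow> zpoly \<Rightarrow> zpoly" where
  "z_poly n p = (\<Sum>k<n. pderiv_var k p)"

text \<open>Every variable has degree \<open>2\<close>.\<close>

definition monom_deg :: "(nat \<Rightarrow>\<^sub>0 nat) \<Rightarrow> int" where
  "monom_deg m = 2 * (\<Sum>k\<in>Poly_Mapping.keys m. int (Poly_Mapping.lookup m k))"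

definition h_poly :: "zpoly \<Rightarrow> zpoly" where
  "h_poly = frag_extend (\<lambda>m. frag_cmul (monom_deg m) (frag_of m))"


section \<open>Graded $(R_n,\mathfrak{sl}_2)$-modules\<close>

text \<open>\<open>mult\<close> and \<open>one\<close>, inherited from the record of rings, play no role for modules.\<close>

record 'm sl2_module = "(zpoly, 'm) module" +
  hom_comp :: "int \<Rightarrow> 'm set"
  d_op :: "'m \<Rightarrow> 'm"
  z_op :: "'m \<Rightarrow> 'm"
  h_op :: "'m \<Rightarrow> 'm"

definition internal_direct_sum :: "('m, 'x) ring_scheme \<Rightarrow> 'i set \<Rightarrow> ('i \<Rightarrow> 'm set) \<Rightarrow> bool" where
  "internal_direct_sum M I N \<longleftrightarrow>
     (\<forall>k\<in>I. additive_subgroup (N k) M) \<and>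
     (\<forall>m\<in>carrier M. \<exists>!f. f \<in> (\<Pi>\<^sub>E k\<in>I. N k) \<and> finite {k\<in>I. f k \<noteq> \<zero>\<^bsub>M\<^esub>} \<and>
        m = finsum M f {k\<in>I. f k \<noteq> \<zero>\<^bsub>M\<^esub>})"

text \<open>
  The \<open>\<s>\<l>\<^sub>2\<close>-triple \<open>(e, h, f)\<close> is \<open>(\<d>, \<h>, -\<z>)\<close>; the grading is the one by weights of \<open>\<h>\<close>.
\<close>

definition graded_sl2_module :: "nat \<Rightarrow> 'm sl2_module \<Rightarrow> bool" where
  "graded_sl2_module n M \<longleftrightarrow>
     module (polys n) M \<and>
     (\<forall>D \<in> {d_op M, z_op M, h_op M}. D \<in> carrier M \<rightarrow> carrier M \<and>
        (\<forall>m\<in>carrier M. \<forall>m'\<in>carrier M. D (m \<oplus>\<^bsub>M\<^esub> m') = D m \<oplus>\<^bsub>M\<^esub> D m')) \<and>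
     (\<forall>m\<in>carrier M. let e = d_op M; h = h_op M; f = (\<lambda>m. \<ominus>\<^bsub>M\<^esub> z_op M m) in
        h (e m) \<ominus>\<^bsub>M\<^esub> e (h m) = [(2::int)] \<cdot>\<^bsub>M\<^esub> e m \<and>
        h (f m) \<ominus>\<^bsub>M\<^esub> f (h m) = [(-2::int)] \<cdot>\<^bsub>M\<^esub> f m \<and>
        e (f m) \<ominus>\<^bsub>M\<^esub> f (e m) = h m) \<and>
     (\<forall>p\<in>carrier (polys n). \<forall>m\<in>carrier M.
        d_op M (p \<odot>\<^bsub>M\<^esub> m) = d_poly n p \<odot>\<^bsub>M\<^esub> m \<oplus>\<^bsub>M\<^esub> p \<odot>\<^bsub>M\<^esub> d_op M m \<and>
        z_op M (p \<odot>\<^bsub>M\<^esub> m) = z_poly n p \<odot>\<^bsub>M\<^esub> m \<oplus>\<^bsub>M\<^esub> p \<odot>\<^bsub>M\<^esub> z_op M m \<and>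
        h_op M (p \<odot>\<^bsub>M\<^esub> m) = h_poly p \<odot>\<^bsub>M\<^esub> m \<oplus>\<^bsub>M\<^esub> p \<odot>\<^bsub>M\<^esub> h_op M m) \<and>
     internal_direct_sum M UNIV (hom_comp M) \<and>
     (\<forall>l. \<forall>m\<in>hom_comp M l. (\<forall>k<n. pvar k \<odot>\<^bsub>M\<^esub> m \<in> hom_comp M (l + 2)) \<and>
        h_op M m = [l] \<cdot>\<^bsub>M\<^esub> m)"

definition quotient_sl2_module :: "'m sl2_module \<Rightarrow> 'm set \<Rightarrow> 'm set sl2_module" where
  "quotient_sl2_module M N =
     \<lparr>carrier = a_rcosets\<^bsub>M\<^esub> N, mult = undefined, one = undefined, zero = N, add = set_add M,
      smult = (\<lambda>p X. \<Union>x\<in>X. N +>\<^bsub>M\<^esub> (p \<odot>\<^bsub>M\<^esub> x)),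
      hom_comp = (\<lambda>l. (\<lambda>x. N +>\<^bsub>M\<^esub> x) ` hom_comp M l),
      d_op = (\<lambda>X. \<Union>x\<in>X. N +>\<^bsub>M\<^esub> d_op M x),
      z_op = (\<lambda>X. \<Union>x\<in>X. N +>\<^bsub>M\<^esub> z_op M x),
      h_op = (\<lambda>X. \<Union>x\<in>X. N +>\<^bsub>M\<^esub> h_op M x)\<rparr>"

definition restrict_sl2_module :: "'m sl2_module \<Rightarrow> 'm set \<Rightarrow> 'm sl2_module" where
  "restrict_sl2_module M N = M\<lparr>carrier := N, hom_comp := (\<lambda>l. hom_comp M l \<inter> N)\<rparr>"

definition sl2_module_iso :: "nat \<Rightarrow> 'm sl2_module \<Rightarrow> 'k sl2_module \<Rightarrow> ('m \<Rightarrow> 'k) \<Rightarrow> bool" where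
  "sl2_module_iso n M M' \<phi> \<longleftrightarrow>
     bij_betw \<phi> (carrier M) (carrier M') \<and>
     (\<forall>x\<in>carrier M. \<forall>y\<in>carrier M. \<phi> (x \<oplus>\<^bsub>M\<^esub> y) = \<phi> x \<oplus>\<^bsub>M'\<^esub> \<phi> y) \<and>
     (\<forall>p\<in>carrier (polys n). \<forall>x\<in>carrier M. \<phi> (p \<odot>\<^bsub>M\<^esub> x) = p \<odot>\<^bsub>M'\<^esub> \<phi> x) \<and>
     (\<forall>l. \<phi> ` hom_comp M l = hom_comp M' l) \<and>
     (\<forall>x\<in>carrier M. \<phi> (d_op M x) = d_op M' (\<phi> x) \<and> \<phi> (z_op M x) = z_op M' (\<phi> x) \<and>
        \<phi> (h_op M x) = h_op M' (\<phi> x))"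

text \<open>
  \<open>R\<^sub>n\<langle>p\<rangle>\<close> for \<open>p = \<Sum>k<n. c k * x\<^sub>k\<close>; the generator \<open>1\<^sub>p\<close> is the polynomial \<open>1\<close>.
\<close>

definition twisted_rank_one :: "nat \<Rightarrow> (nat \<Rightarrow> int) \<Rightarrow> zpoly sl2_module" where
  "twisted_rank_one n c =
     \<lparr>carrier = carrier (polys n), mult = undefined, one = undefined, zero = 0, add = (+),
      smult = (*),
      hom_comp = (\<lambda>l. {f \<in> carrier (polys n).
         \<forall>m \<in> Poly_Mapping.keys f. monom_deg m + (\<Sum>k<n. c k) = l}),
      d_op = (\<lambda>f. d_poly n f + f * (\<Sum>k<n. of_int (c k) * pvar k)),
      z_op = z_poly n,
      h_op = (\<lambda>f. h_poly f + f * of_int (\<Sum>k<n. c k))\<rparr>"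


section \<open>Downfree filtrations\<close>

definition span_over :: "nat \<Rightarrow> 'm sl2_module \<Rightarrow> 'i set \<Rightarrow> ('i \<Rightarrow> 'm) \<Rightarrow> 'm set" where
  "span_over n M I g = {\<Oplus>\<^bsub>M\<^esub>k\<in>I. r k \<odot>\<^bsub>M\<^esub> g k | r. r \<in> I \<rightarrow> carrier (polys n)}"

definition sum_over :: "'m sl2_module \<Rightarrow> 'i set \<Rightarrow> ('i \<Rightarrow> 'm set) \<Rightarrow> 'm set" where
  "sum_over M I N = {\<Oplus>\<^bsub>M\<^esub>k\<in>I. f k | f. f \<in> (\<Pi> k\<in>I. N k)}"

definition free_rank_one :: "nat \<Rightarrow> 'm sl2_module \<Rightarrow> 'm set \<Rightarrow> bool" where
  "free_rank_one n M N \<longleftrightarrow> (\<exists>l. \<exists>g\<in>hom_comp M l.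
     bij_betw (\<lambda>p. p \<odot>\<^bsub>M\<^esub> g) (carrier (polys n)) N)"

text \<open>
  The pairs of the order relation \<open>r\<close> on \<open>I\<close> are \<open>(i, j)\<close> with \<open>i \<le> j\<close>.  That \<open>M\<close> is free and
  finitely generated as a graded module is contained in the splitting into finitely many free
  graded submodules of rank one.
\<close>

definition downfree_filtration ::
  "nat \<Rightarrow> 'm sl2_module \<Rightarrow> 'i set \<Rightarrow> 'i rel \<Rightarrow> ('i \<Rightarrow> 'm set) \<Rightarrow> bool" where
  "downfree_filtration n M I r N \<longleftrightarrow>
     graded_sl2_module n M \<and> finite I \<and> partial_order_on I r \<and>
     (\<forall>i\<in>I. free_rank_one n M (N i)) \<and>
     internal_direct_sum M I N \<and>
     (\<forall>i\<in>I. z_op M ` N i \<subseteq> N i) \<and>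
     (\<forall>i\<in>I. d_op M ` N i \<subseteq> sum_over M {j\<in>I. (j, i) \<in> r} N)"

definition gr_piece ::
  "'m sl2_module \<Rightarrow> 'i set \<Rightarrow> 'i rel \<Rightarrow> ('i \<Rightarrow> 'm set) \<Rightarrow> 'i \<Rightarrow> 'm set sl2_module" where
  "gr_piece M I r N i = quotient_sl2_module
     (restrict_sl2_module M (sum_over M {j\<in>I. (j, i) \<in> r} N))
     (sum_over M {j\<in>I. (j, i) \<in> r \<and> j \<noteq> i} N)"

definition gr_class ::
  "'m sl2_module \<Rightarrow> 'i set \<Rightarrow> 'i rel \<Rightarrow> ('i \<Rightarrow> 'm set) \<Rightarrow> 'i \<Rightarrow> 'm \<Rightarrow> 'm set" where
  "gr_class M I r N i m = sum_over M {j\<in>I. (j, i) \<in> r \<and> j \<noteq> i} N +>\<^bsub>M\<^esub> m"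


section \<open>Hom spaces as modules over polynomial rings\<close>

primrec dot_power :: "'v \<Rightarrow> nat \<Rightarrow> 'v diagram" where
  "dot_power i 0 = Ident [i]"
| "dot_power i (Suc r) = Vert (Dot i) (dot_power i r)"

text \<open>\<open>e k\<close> dots on the \<open>k\<close>-th strand, for every \<open>k\<close>.\<close>

primrec dots :: "(nat \<Rightarrow> nat) \<Rightarrow> 'v list \<Rightarrow> 'v diagram" where
  "dots e [] = Ident []"
| "dots e (i # a) = Horiz (dot_power i (e 0)) (dots (\<lambda>k. e (Suc k)) a)"

definition poly_dots :: "zpoly \<Rightarrow> 'v list \<Rightarrow> 'v lin" where
  "poly_dots p a = frag_extend (\<lambda>m. frag_of (dots (Poly_Mapping.lookup m) a)) p"

definition formal_hom ::
  "('v \<times> 'v) set \<Rightarrow> (zpoly \<Rightarrow> 'v lin \<Rightarrow> 'v lin) \<Rightarrow> 'v list \<Rightarrow> 'v list \<Rightarrow> 'v lin sl2_module" where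
  "formal_hom A act a b =
     \<lparr>carrier = free_hom a b, mult = undefined, one = undefined, zero = 0, add = (+),
      smult = act,
      hom_comp = (\<lambda>l. {f \<in> free_hom a b. \<forall>D \<in> Poly_Mapping.keys f. deg A D = l}),
      d_op = d_lin A, z_op = z_lin, h_op = h_lin A\<rparr>"

text \<open>
  The Hom space from \<open>\<E>\<^sub>a\<close> to \<open>\<E>\<^sub>b\<close>, with polynomials acting on the left by dots on the target,
  respectively on the right by dots on the source (a right module over a commutative ring being
  regarded as a left module).  The underlying graded groups and operators agree.
\<close>

definition HomL :: "('v \<times> 'v) set \<Rightarrow> 'v list \<Rightarrow> 'v list \<Rightarrow> 'v lin set sl2_module" where
  "HomL A a b = quotient_sl2_module
     (formal_hom A (\<lambda>p f. poly_dots p b \<star> f) a b) {f. null A a b f}"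

definition HomR :: "('v \<times> 'v) set \<Rightarrow> 'v list \<Rightarrow> 'v list \<Rightarrow> 'v lin set sl2_module" where
  "HomR A a b = quotient_sl2_module
     (formal_hom A (\<lambda>p f. f \<star> poly_dots p a) a b) {f. null A a b f}"

definition mor_class :: "('v \<times> 'v) set \<Rightarrow> 'v list \<Rightarrow> 'v list \<Rightarrow> 'v lin \<Rightarrow> 'v lin set" where
  "mor_class A a b f = {g + f | g. null A a b g}"


section \<open>Reduced expressions and the Bruhat order\<close>

text \<open>\<open>S\<^sub>n\<close> is the group of permutations of \<open>{..<n}\<close>, with \<open>s\<^sub>k\<close> exchanging \<open>k\<close> and \<open>k + 1\<close>.\<close>

primrec word_perm :: "nat list \<Rightarrow> nat \<Rightarrow> nat" where
  "word_perm [] = id"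
| "word_perm (k # ks) = transpose k (Suc k) \<circ> word_perm ks"

definition expression_of :: "nat \<Rightarrow> (nat \<Rightarrow> nat) \<Rightarrow> nat list \<Rightarrow> bool" where
  "expression_of n w ks \<longleftrightarrow> (\<forall>k\<in>set ks. Suc k < n) \<and> word_perm ks = w"

definition cox_length :: "nat \<Rightarrow> (nat \<Rightarrow> nat) \<Rightarrow> nat" where
  "cox_length n w = (LEAST l. \<exists>ks. expression_of n w ks \<and> length ks = l)"

definition reduced_expression :: "nat \<Rightarrow> (nat \<Rightarrow> nat) \<Rightarrow> nat list \<Rightarrow> bool" where
  "reduced_expression n w ks \<longleftrightarrow> expression_of n w ks \<and> length ks = cox_length n w"

definition bruhat_step :: "nat \<Rightarrow> (nat \<Rightarrow> nat) \<Rightarrow> (nat \<Rightarrow> nat) \<Rightarrow> bool" where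
  "bruhat_step n v w \<longleftrightarrow> v permutes {..<n} \<and>
     (\<exists>a<n. \<exists>b<n. a \<noteq> b \<and> w = v \<circ> transpose a b) \<and> cox_length n v < cox_length n w"

definition bruhat_le :: "nat \<Rightarrow> (nat \<Rightarrow> nat) \<Rightarrow> (nat \<Rightarrow> nat) \<Rightarrow> bool" where
  "bruhat_le n = (bruhat_step n)\<^sup>*\<^sup>*"

definition seq_perms :: "'v list \<Rightarrow> 'v list \<Rightarrow> (nat \<Rightarrow> nat) set" where
  "seq_perms i j = {w. w permutes {..<length i} \<and> (\<forall>k<length i. i ! k = j ! w k)}"

definition bruhat_rel :: "'v list \<Rightarrow> 'v list \<Rightarrow> (nat \<Rightarrow> nat) rel" where
  "bruhat_rel i j = {(v, w). v \<in> seq_perms i j \<and> w \<in> seq_perms i j \<and> bruhat_le (length i) v w}"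

definition psi_class :: "('v \<times> 'v) set \<Rightarrow> 'v list \<Rightarrow> 'v list \<Rightarrow> nat list \<Rightarrow> 'v lin set" where
  "psi_class A i j ks = mor_class A i j (crossm ks i)"

text \<open>The coefficients of \<open>x\<^sub>k\<close> in \<open>p(w)\<close> for the left and for the right action.\<close>

definition p_left :: "('v \<times> 'v) set \<Rightarrow> 'v list \<Rightarrow> (nat \<Rightarrow> nat) \<Rightarrow> nat \<Rightarrow> int" where
  "p_left A j w k =
     (\<Sum>l | k < l \<and> l < length j \<and> inv_into UNIV w l < inv_into UNIV w k. - cart A (j ! k) (j ! l))"

definition p_right :: "('v \<times> 'v) set \<Rightarrow> 'v list \<Rightarrow> (nat \<Rightarrow> nat) \<Rightarrow> nat \<Rightarrow> int" where
  "p_right A i w k = (\<Sum>l | l < k \<and> w l > w k. - cart A (i ! l) (i ! k))"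

end

theory Submission
  imports Defs "HOL-Computational_Algebra.Polynomial_Factorial"
begin

text \<open>
  The theorem rests on the faithful action of \<open>\<U>\<^sup>+\<close> on polynomials, in which dots are multiplications by
  variables, crossings of equal colours are Demazure operators, and crossings of different colours
  are permutations of the variables, multiplied by a linear factor for one of the two crossings of
  each edge (\<open>rep\<close>, sound by \<open>null_rep\<close>).

  \<^emph>\<open>The three operators.\<close>  In this action \<open>\<z>\<close>, \<open>\<h>\<close> and \<open>\<d>\<close> are commutators with first order differential
  operators: \<open>\<Sum>\<partial>\<^sub>k\<close>, twice the Euler field plus a constant, and \<open>\<Sum>x\<^sub>k\<^sup>2 \<partial>\<^sub>k\<close> plus a linear function that
  depends on the word of colours (\<open>rep_z_lin\<close>, \<open>rep_h_lin\<close>, \<open>rep_d_lin\<close>).  Commutators are derivations,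
  so this only has to be checked on generators.  Once the action is known to be faithful, it follows
  that the three operators are compatible with the defining relations, satisfy the Leibniz rules over
  \<open>R\<^sub>n\<close>, and form an \<open>\<s>\<l>\<^sub>2\<close>-triple, the latter because the differential operators do (\<open>op_commutators\<close>).

  \<^emph>\<open>Spanning.\<close>  Modulo the relations, every morphism is a combination of normal forms with
  polynomials in the dots on the source (\<open>nf_spans\<close>).  The proof follows the coset decomposition of
  \<open>S\<^bsub>m+1\<^esub>\<close> by \<open>S\<^sub>m\<close>: sums of staircases \<open>\<psi>\<^sub>r \<cdots> \<psi>\<^bsub>m-1\<^esub>\<close> over morphisms in which only the first \<open>m\<close> strands
  cross are closed under all dots and under all crossings of the first \<open>m + 1\<close> strands.

  \<^emph>\<open>Triangularity.\<close>  Over the fraction field of the polynomial ring, the operator of \<open>\<psi>\<^sub>w\<close> is a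
  combination of permutations \<open>v\<close> of the variables with \<open>v \<le> w\<close> in the Bruhat order.  Its coefficient at \<open>w\<close> is a
  nonzero product over the inversions of \<open>w\<close>, which does not depend on the reduced expression.
  The operator of \<open>\<d>(\<psi>\<^sub>w)\<close> is supported on the same \<open>v\<close>, and its coefficient at \<open>w\<close> is that of \<open>\<psi>\<^sub>w\<close> times
  the left weight \<open>p(w)\<close>, because each crossing contributes minus a Cartan number times the dot on
  one of its strands (\<open>expn_crossings\<close>); the right weight becomes the left one when \<open>w\<close> permutes its
  variables.  Permutations are linearly independent by Artin's theorem on characters, so these
  coefficients are well defined.  Comparing them yields, in this order, the faithfulness of the
  action (\<open>null_iff\<close>), the basis property of \<open>{\<psi>\<^sub>w}\<close> for both actions (\<open>spans\<close>, \<open>independent\<close>), and the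
  shape of \<open>\<d>(\<psi>\<^sub>w)\<close> (\<open>d_\<psi>\<close>).  The left and the right action are treated alike: a polynomial acts on
  the coefficient at \<open>v\<close> directly, respectively after permutation of its variables by \<open>v\<close>.

  \<^emph>\<open>Filtration.\<close>  A homogeneous basis that is killed by \<open>\<z>\<close> and triangular for \<open>\<d>\<close> induces a downfree
  filtration, whose graded pieces are given by the diagonal entries of \<open>\<d>\<close> (\<open>downfree\<close>,
  \<open>gr_piece_iso\<close>).
\<close>

section \<open>Integer polynomials\<close>

lemma frag_cmul_diff_distrib2: "frag_cmul c (a - b) = frag_cmul c a - frag_cmul c b"
  by (rule poly_mapping_eqI) (simp add: lookup_minus right_diff_distrib)

lemma frag_cmul_eq_mult: "frag_cmul c p = of_int c * (p :: zpoly)"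
proof -
  have "frag_cmul c (frag_of m) = Poly_Mapping.single 0 c * (frag_of m :: zpoly)" for m
    by (rule poly_mapping_eqI) (simp add: mult_single lookup_single when_def)
  then have "frag_cmul c p = Poly_Mapping.single 0 c * p"
    by (induction p rule: frag_induction[OF subset_UNIV])
      (simp_all add: frag_cmul_diff_distrib2 right_diff_distrib)
  moreover have "Poly_Mapping.single 0 c = (of_int c :: zpoly)"
    using single_of_int[where ?'b = int, of c] by (simp only: of_int_eq_id id_apply)
  ultimately show ?thesis by simp
qed

lemma pvar_power: "pvar k ^ e = frag_of (Poly_Mapping.single k e)"
  by (induction e) (simp_all add: pvar_def mult_single flip: single_add)

lemma frag_of_sum: "finite I \<Longrightarrow> (frag_of (\<Sum>i\<in>I. f i) :: zpoly) = (\<Prod>i\<in>I. frag_of (f i))"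
proof (induction I rule: finite_induct)
  case (insert x F)
  have "(frag_of (f x + sum f F) :: zpoly) = frag_of (f x) * frag_of (sum f F)" by (simp add: mult_single)
  then show ?case using insert by simp
qed simp

lemma frag_of_eq_prod_pvar:
  "(frag_of m :: zpoly) = (\<Prod>k\<in>Poly_Mapping.keys m. pvar k ^ Poly_Mapping.lookup m k)"
proof -
  have "m = (\<Sum>k\<in>Poly_Mapping.keys m. Poly_Mapping.single k (Poly_Mapping.lookup m k))"
  proof (rule poly_mapping_eqI)
    fix k
    show "Poly_Mapping.lookup m k = Poly_Mapping.lookup
      (\<Sum>k\<in>Poly_Mapping.keys m. Poly_Mapping.single k (Poly_Mapping.lookup m k)) k"
      by (cases "k \<in> Poly_Mapping.keys m")
        (simp_all add: lookup_sum lookup_single when_def sum.delta not_in_keys_iff_lookup_eq_zero)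
  qed
  then have "(frag_of m :: zpoly) = frag_of \<dots>" by simp
  then show ?thesis by (simp add: frag_of_sum pvar_power)
qed

text \<open>
  Polynomials are generated by the variables under products and differences; almost every identity between
  additive operators on polynomials is checked this way.
\<close>

lemma zpoly_induct_on [consumes 1, case_names one var mult diff]:
  assumes p: "\<forall>m \<in> Poly_Mapping.keys p. Poly_Mapping.keys m \<subseteq> V"
    and one: "P 1" and var: "\<And>k. k \<in> V \<Longrightarrow> P (pvar k)"
    and mult: "\<And>a b. P a \<Longrightarrow> P b \<Longrightarrow> P (a * b)" and diff: "\<And>a b. P a \<Longrightarrow> P b \<Longrightarrow> P (a - b)"
  shows "P p"
proof -
  have pow: "P (pvar k ^ e)" if "k \<in> V" for k e
    using that by (induction e) (auto intro: one var mult)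
  have prod: "P (\<Prod>k\<in>K. pvar k ^ e k)" if "finite K" "K \<subseteq> V" for K e
    using that by (induction K rule: finite_induct) (auto intro: one mult pow)
  have "Poly_Mapping.keys p \<subseteq> {m. Poly_Mapping.keys m \<subseteq> V}" using p by auto
  then show ?thesis
  proof (induction rule: frag_induction)
    case zero
    show ?case using diff[OF one one] by simp
  next
    case (one m)
    then show ?case unfolding frag_of_eq_prod_pvar by (intro prod) auto
  next
    case (diff a b)
    then show ?case by (rule assms(5))
  qed
qed

lemma zpoly_induct [case_names one var mult diff]:
  assumes "P 1" "\<And>k. P (pvar k)" "\<And>a b. P a \<Longrightarrow> P b \<Longrightarrow> P (a * b)" "\<And>a b. P a \<Longrightarrow> P b \<Longrightarrow> P (a - b)"
  shows "P p"
  using zpoly_induct_on[of p UNIV P] assms by auto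

text \<open>A homomorphism from the monoid of monomials extends to a ring endomorphism.\<close>

lemma frag_extend_monomial_mult:
  assumes "f 0 = 1" "\<And>m m'. f (m + m') = f m * f m'"
  shows "frag_extend f (p * q :: zpoly) = frag_extend f p * (frag_extend f q :: zpoly)"
proof (induction p rule: frag_induction[OF subset_UNIV])
  case (2 m)
  show ?case
    by (induction q rule: frag_induction[OF subset_UNIV])
      (auto simp: mult_single assms frag_extend_diff right_diff_distrib)
qed (auto simp: frag_extend_diff left_diff_distrib)

section \<open>Permutations of the variables\<close>

text \<open>
  The ring automorphism \<open>x\<^sub>k \<mapsto> x\<^bsub>w k\<^esub>\<close>, for a bijection
  \<open>w\<close>.
\<close>

definition pact :: "(nat \<Rightarrow> nat) \<Rightarrow> zpoly \<Rightarrow> zpoly" where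
  "pact w = frag_extend (\<lambda>m. frag_of (Poly_Mapping.map_key (inv_into UNIV w) m))"

lemma pact_diff [simp]: "pact w (p - q) = pact w p - pact w q"
  by (simp add: pact_def frag_extend_diff)
lemma pact_add [simp]: "pact w (p + q) = pact w p + pact w q"
  by (simp add: pact_def frag_extend_add)
lemma pact_minus [simp]: "pact w (- p) = - pact w p"
  by (simp add: pact_def frag_extend_minus)
lemma pact_0 [simp]: "pact w 0 = 0"
  by (simp add: pact_def)
lemma pact_sum [simp]: "pact w (sum f I) = (\<Sum>i\<in>I. pact w (f i))"
  by (induction I rule: infinite_finite_induct) simp_all

lemma pact_mult [simp]: "bij w \<Longrightarrow> pact w (p * q) = pact w p * pact w q"
  unfolding pact_def
  by (rule frag_extend_monomial_mult)
    (auto simp: map_key_plus mult_single bij_is_inj bij_imp_bij_inv inj_imp_surj_inv)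

lemma pact_1 [simp]: "bij w \<Longrightarrow> pact w 1 = 1"
proof -
  assume "bij w"
  then have "pact w (frag_of 0) = frag_of 0" by (simp add: pact_def bij_is_inj bij_imp_bij_inv del: single_one)
  then show ?thesis by simp
qed

lemma pact_pvar [simp]: "bij w \<Longrightarrow> pact w (pvar k) = pvar (w k)"
  using map_key_single[of "inv_into UNIV w" "w k" "1 :: nat"]
  by (simp add: pact_def pvar_def bij_is_inj bij_imp_bij_inv)

lemma pact_of_nat [simp]: "bij w \<Longrightarrow> pact w (of_nat c) = of_nat c"
  by (induction c) simp_all
lemma pact_of_int [simp]: "bij w \<Longrightarrow> pact w (of_int c) = of_int c"
  by (cases c) simp_all
lemma pact_power [simp]: "bij w \<Longrightarrow> pact w (p ^ e) = pact w p ^ e"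
  by (induction e) simp_all

lemma pact_comp: "bij v \<Longrightarrow> bij w \<Longrightarrow> pact v (pact w p) = pact (v \<circ> w) p"
  by (induction p rule: zpoly_induct) (auto simp: bij_comp)

lemma pact_id [simp]: "pact id p = p"
  by (induction p rule: zpoly_induct) (simp_all del: id_apply add: id_apply[abs_def, symmetric], simp_all)

lemma pact_inj: "bij w \<Longrightarrow> pact w p = pact w q \<longleftrightarrow> p = q"
  by (metis bij_imp_bij_inv inv_o_cancel bij_is_inj pact_comp pact_id)

lemma pact_eq_0_iff [simp]: "bij w \<Longrightarrow> pact w p = 0 \<longleftrightarrow> p = 0"
  using pact_inj[of w p 0] by simp

lemma pvar_eq_iff [simp]: "pvar k = pvar l \<longleftrightarrow> k = l"
  unfolding pvar_def frag_of_eq by (metis keys_single one_neq_zero singleton_inject)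

section \<open>Vector fields on the polynomial ring\<close>

lemma pderiv_var_diff [simp]: "pderiv_var k (p - q) = pderiv_var k p - pderiv_var k q"
  by (simp add: pderiv_var_def frag_extend_diff)

lemma pderiv_var_mult: "pderiv_var k (p * q) = pderiv_var k p * q + p * pderiv_var k q"
proof (induction p rule: frag_induction[OF subset_UNIV])
  case (2 m)
  show ?case
  proof (induction q rule: frag_induction[OF subset_UNIV])
    case (2 m')
    have 1: "of_nat (Poly_Mapping.lookup a k) * frag_of (a + b - Poly_Mapping.single k 1)
       = of_nat (Poly_Mapping.lookup a k) * (frag_of (a - Poly_Mapping.single k 1) * frag_of b :: zpoly)" for a b
    proof (cases "Poly_Mapping.lookup a k = 0")
      case False
      then have "a + b - Poly_Mapping.single k 1 = (a - Poly_Mapping.single k 1) + b"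
        by (intro poly_mapping_eqI) (auto simp: lookup_add lookup_minus lookup_single when_def)
      then show ?thesis by (simp add: mult_single)
    qed simp
    show ?case
      using 1[of m m'] 1[of m' m]
      by (simp only: pderiv_var_def mult_single frag_cmul_eq_mult lookup_add distrib_right
          frag_extend_of of_int_add of_int_of_nat_eq of_nat_add mult_1 add.commute[of m' m] mult.assoc
          mult.left_commute[of "frag_of m"] mult.commute[of "frag_of m"])
  qed (auto simp: right_diff_distrib pderiv_var_def frag_extend_diff)
qed (auto simp: left_diff_distrib pderiv_var_def frag_extend_diff)

lemma pderiv_var_pvar [simp]: "pderiv_var k (pvar l) = (if k = l then 1 else 0)"
  by (auto simp: pderiv_var_def pvar_def frag_cmul_eq_mult lookup_single)

text \<open>
  The cases \<open>e = 0, 1, 2\<close> span the \<open>\<s>\<l>\<^sub>2\<close> of vector fields on the line,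
  acting diagonally; treating them together makes their Leibniz rules, commutators and permutation invariance
  one computation.
\<close>

definition vfield :: "nat \<Rightarrow> nat \<Rightarrow> zpoly \<Rightarrow> zpoly" where
  "vfield e n p = (\<Sum>k<n. pvar k ^ e * pderiv_var k p)"

lemma d_poly_eq_vfield: "d_poly n = vfield 2 n"
  by (simp add: fun_eq_iff d_poly_def vfield_def)
lemma z_poly_eq_vfield: "z_poly n = vfield 0 n"
  by (simp add: fun_eq_iff z_poly_def vfield_def)

lemma vfield_diff [simp]: "vfield e n (p - q) = vfield e n p - vfield e n q"
  by (simp add: vfield_def right_diff_distrib sum_subtractf)
lemma vfield_mult: "vfield e n (p * q) = vfield e n p * q + p * vfield e n q"
  by (simp add: vfield_def pderiv_var_mult sum.distrib algebra_simps sum_distrib_left)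
lemma vfield_0 [simp]: "vfield e n 0 = 0"
  using vfield_diff[of e n 0 0] by simp
lemma vfield_minus [simp]: "vfield e n (- p) = - vfield e n p"
  using vfield_diff[of e n 0 p] by simp
lemma vfield_add [simp]: "vfield e n (p + q) = vfield e n p + vfield e n q"
  using vfield_diff[of e n p "- q"] by simp
lemma vfield_1 [simp]: "vfield e n 1 = 0"
  using vfield_mult[of e n 1 1] by simp
lemma vfield_pvar [simp]: "vfield e n (pvar k) = (if k < n then pvar k ^ e else 0)"
  by (simp add: vfield_def if_distrib[of "(*) _"] sum.delta' cong: if_cong)
lemma vfield_of_nat [simp]: "vfield e n (of_nat c) = 0"
  by (induction c) simp_all
lemma vfield_of_int [simp]: "vfield e n (of_int c) = 0"
  by (cases c) simp_all

lemma vfield_pact: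
  assumes "w permutes {..<n}"
  shows "vfield e n (pact w p) = pact w (vfield e n p)"
proof (induction p rule: zpoly_induct)
  case (var k)
  then show ?case using permutes_in_image[OF assms, of k] permutes_bij[OF assms] by auto
qed (use permutes_bij[OF assms] in \<open>auto simp: vfield_mult\<close>)

lemma monom_deg_add: "monom_deg (m + m') = monom_deg m + monom_deg m'"
proof -
  have 1: "monom_deg a = 2 * (\<Sum>k\<in>Poly_Mapping.keys m \<union> Poly_Mapping.keys m'. int (Poly_Mapping.lookup a k))"
    if "Poly_Mapping.keys a \<subseteq> Poly_Mapping.keys m \<union> Poly_Mapping.keys m'" for a
    unfolding monom_deg_def using that
    by (subst sum.mono_neutral_left) (auto simp: in_keys_iff)
  show ?thesis
    using 1[of m] 1[of m'] 1[of "m + m'"] keys_add[of m m']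
    by (simp add: lookup_add sum.distrib)
qed

lemma h_poly_diff [simp]: "h_poly (p - q) = h_poly p - h_poly q"
  by (simp add: h_poly_def frag_extend_diff)

lemma h_poly_mult: "h_poly (p * q) = h_poly p * q + p * h_poly q"
proof (induction p rule: frag_induction[OF subset_UNIV])
  case (2 m)
  show ?case
    by (induction q rule: frag_induction[OF subset_UNIV])
     (auto simp: right_diff_distrib h_poly_def frag_extend_diff mult_single frag_cmul_eq_mult monom_deg_add algebra_simps)
qed (auto simp: left_diff_distrib h_poly_def frag_extend_diff)

lemma h_poly_1 [simp]: "h_poly 1 = 0"
  using h_poly_mult[of 1 1] by simp
lemma h_poly_0 [simp]: "h_poly 0 = 0"
  using h_poly_diff[of 0 0] by simp

lemma h_poly_pvar [simp]: "h_poly (pvar k) = 2 * pvar k"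
  by (simp add: h_poly_def pvar_def frag_cmul_eq_mult monom_deg_def)

lemma lookup_h_poly: "Poly_Mapping.lookup (h_poly p) m = monom_deg m * Poly_Mapping.lookup p m"
  by (induction p rule: frag_induction[OF subset_UNIV])
    (simp_all add: lookup_minus right_diff_distrib, simp add: h_poly_def)

abbreviation "Pn n \<equiv> carrier (polys n)"

lemma Pn_iff: "p \<in> Pn n \<longleftrightarrow> (\<forall>m \<in> Poly_Mapping.keys p. Poly_Mapping.keys m \<subseteq> {..<n})"
  by (simp add: polys_def)

lemma Pn_diff [intro]: "p \<in> Pn n \<Longrightarrow> q \<in> Pn n \<Longrightarrow> p - q \<in> Pn n"
  using keys_diff[of p q] by (auto simp: Pn_iff)
lemma Pn_0 [simp, intro]: "0 \<in> Pn n" by (simp add: Pn_iff)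
lemma Pn_1 [simp, intro]: "1 \<in> Pn n" by (simp add: Pn_iff)
lemma Pn_minus [intro]: "p \<in> Pn n \<Longrightarrow> - p \<in> Pn n"
  by (simp add: Pn_iff)
lemma Pn_add [intro]: "p \<in> Pn n \<Longrightarrow> q \<in> Pn n \<Longrightarrow> p + q \<in> Pn n"
  using Poly_Mapping.keys_add[of p q] by (fastforce simp: Pn_iff)
lemma Pn_mult [intro]:
  assumes "p \<in> Pn n" "q \<in> Pn n" shows "p * q \<in> Pn n"
proof -
  have "Poly_Mapping.keys m \<subseteq> {..<n}" if m: "m \<in> Poly_Mapping.keys (p * q)" for m
  proof -
    obtain a b where "m = a + b" "a \<in> Poly_Mapping.keys p" "b \<in> Poly_Mapping.keys q"
      using m keys_mult[of p q] by blast
    then show ?thesis using assms Poly_Mapping.keys_add[of a b] by (fastforce simp: Pn_iff)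
  qed
  then show ?thesis by (simp add: Pn_iff)
qed
lemma Pn_pvar [simp]: "pvar k \<in> Pn n \<longleftrightarrow> k < n"
  by (simp add: Pn_iff pvar_def)
lemma Pn_of_int [simp, intro]: "of_int c \<in> Pn n"
proof (cases c)
  case (nonneg m)
  have "of_nat m \<in> Pn n" by (induction m) auto
  then show ?thesis using nonneg by simp
next
  case (neg m)
  have "of_nat m \<in> Pn n" for m by (induction m) auto
  from this[of "Suc m"] show ?thesis using neg by (simp only: of_int_minus of_int_of_nat_eq) (rule Pn_minus)
qed
lemma Pn_sum [intro]: "(\<And>i. i \<in> I \<Longrightarrow> f i \<in> Pn n) \<Longrightarrow> sum f I \<in> Pn n"
  by (induction I rule: infinite_finite_induct) auto
lemma Pn_power [intro]: "p \<in> Pn n \<Longrightarrow> p ^ e \<in> Pn n"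
  by (induction e) auto

lemma Pn_induct [consumes 1, case_names one var mult diff]:
  assumes "p \<in> Pn n" "P 1" "\<And>k. k < n \<Longrightarrow> P (pvar k)"
    "\<And>a b. a \<in> Pn n \<Longrightarrow> b \<in> Pn n \<Longrightarrow> P a \<Longrightarrow> P b \<Longrightarrow> P (a * b)"
    "\<And>a b. a \<in> Pn n \<Longrightarrow> b \<in> Pn n \<Longrightarrow> P a \<Longrightarrow> P b \<Longrightarrow> P (a - b)"
  shows "P p"
  using zpoly_induct_on[of p "{..<n}" "\<lambda>p. p \<in> Pn n \<and> P p"] assms by (auto simp: Pn_iff[of p])

lemma Pn_pact: "p \<in> Pn n \<Longrightarrow> w permutes {..<n} \<Longrightarrow> pact w p \<in> Pn n"
  by (induction rule: Pn_induct) (auto simp: permutes_bij permutes_in_image[of w "{..<n}", simplified])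

lemma Pn_vfield: "p \<in> Pn n \<Longrightarrow> vfield e n p \<in> Pn n"
  by (induction rule: Pn_induct) (auto simp: vfield_mult)

lemma Pn_h_poly: "p \<in> Pn n \<Longrightarrow> h_poly p \<in> Pn n"
proof (induction rule: Pn_induct)
  case (var k)
  have "pvar k + pvar k \<in> Pn n" using var by (intro Pn_add) simp_all
  then show ?case by (simp only: h_poly_pvar mult_2)
qed (auto simp: h_poly_mult)

text \<open>
  Degrees count twice, hence the factor \<open>2\<close>; on variables outside \<open>R\<^sub>n\<close> the
  right-hand side vanishes.
\<close>

lemma h_poly_eq_vfield: "p \<in> Pn n \<Longrightarrow> h_poly p = 2 * vfield 1 n p"
  by (induction rule: Pn_induct) (simp_all add: h_poly_mult vfield_mult distrib_left right_diff_distrib mult_ac)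

section \<open>Demazure operators\<close>

abbreviation "sw k \<equiv> transpose k (Suc k)"

lemma bij_sw [simp]: "bij (sw k)" by (simp add: bij_swap_iff)

lemma pact_sw_invol [simp]: "pact (sw k) (pact (sw k) p) = p"
  by (simp add: pact_comp)

text \<open>
  If \<open>f\<close> and \<open>g\<close> are the divided differences of \<open>a\<close> and \<open>b\<close>,
  this is the divided difference of their product; it gives both the existence of Demazure operators and their
  Leibniz rule.
\<close>

lemma twisted_Leibniz_divided_difference:
  fixes x :: "'a :: comm_ring"
  assumes "x * f = a - a'" "x * g = b - b'"
  shows "x * (f * b + a' * g) = a * b - a' * b'"
proof -
  have "x * (f * b + a' * g) = (x * f) * b + a' * (x * g)" by (simp only: distrib_left mult_ac)
  also have "\<dots> = a * b - a' * b'" unfolding assms by (simp only: left_diff_distrib right_diff_distrib) simp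
  finally show ?thesis .
qed

lemma diff_diff_eq_swap: "(a - a') - (b - b') = (a - b) - (a' - b' :: 'a :: ab_group_add)"
  by simp

lemma dem_exists: "\<exists>g. (pvar k - pvar (Suc k)) * g = p - pact (sw k) p"
proof (induction p rule: zpoly_induct)
  case one show ?case by (rule exI[of _ 0]) simp
next
  case (var l)
  show ?case
    by (rule exI[of _ "if l = k then 1 else if l = Suc k then -1 else 0"])
      (simp add: transpose_apply_other)
next
  case (mult a b)
  then obtain f g where "(pvar k - pvar (Suc k)) * f = a - pact (sw k) a"
    "(pvar k - pvar (Suc k)) * g = b - pact (sw k) b" by blast
  then have "(pvar k - pvar (Suc k)) * (f * b + pact (sw k) a * g) = a * b - pact (sw k) (a * b)"
    unfolding pact_mult[OF bij_sw] by (rule twisted_Leibniz_divided_difference)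
  then show ?case by blast
next
  case (diff a b)
  then obtain f g where "(pvar k - pvar (Suc k)) * f = a - pact (sw k) a"
    "(pvar k - pvar (Suc k)) * g = b - pact (sw k) b" by blast
  then have "(pvar k - pvar (Suc k)) * (f - g) = a - b - pact (sw k) (a - b)"
    unfolding pact_diff right_diff_distrib by (simp only:) (rule diff_diff_eq_swap)
  then show ?case by blast
qed

definition dem :: "nat \<Rightarrow> zpoly \<Rightarrow> zpoly" where
  "dem k p = (SOME g. (pvar k - pvar (Suc k)) * g = p - pact (sw k) p)"

lemma dem: "(pvar k - pvar (Suc k)) * dem k p = p - pact (sw k) p"
  unfolding dem_def by (rule someI_ex[OF dem_exists])

lemma pvar_diff_cancel: "k \<noteq> l \<Longrightarrow> (pvar k - pvar l) * p = (pvar k - pvar l) * q \<Longrightarrow> p = q"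
  by (simp only: mult_cancel_left pvar_eq_iff right_minus_eq) simp

text \<open>
  Polynomials form a domain, so a divided difference is determined by its defining equation. All properties of
  Demazure operators are proved by exhibiting this equation.
\<close>

lemma dem_eqI: "(pvar k - pvar (Suc k)) * g = p - pact (sw k) p \<Longrightarrow> dem k p = g"
  by (rule pvar_diff_cancel[of k "Suc k"]) (simp_all only: dem n_not_Suc_n not_False_eq_True)

lemma dem_diff [simp]: "dem k (p - q) = dem k p - dem k q"
  by (rule dem_eqI) (simp only: right_diff_distrib dem pact_diff diff_diff_eq_swap)

lemma dem_mult: "dem k (f * p) = dem k f * p + pact (sw k) f * dem k p"
  by (rule dem_eqI) (simp only: pact_mult[OF bij_sw] twisted_Leibniz_divided_difference[OF dem dem])

lemma dem_pvar_left [simp]: "dem k (pvar k) = 1"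
  by (rule dem_eqI) simp
lemma dem_pvar_right [simp]: "dem k (pvar (Suc k)) = -1"
  by (rule dem_eqI) simp

lemma dem_invariant: "pact (sw k) f = f \<Longrightarrow> dem k (f * p) = f * dem k p"
  using dem_eqI[of k 0 f] by (simp add: dem_mult)

lemma pact_sw_dem [simp]: "pact (sw k) (dem k p) = dem k p"
proof -
  have "pact (sw k) ((pvar k - pvar (Suc k)) * dem k p) = pact (sw k) (p - pact (sw k) p)"
    by (simp only: dem)
  then have "(pvar (Suc k) - pvar k) * pact (sw k) (dem k p) = pact (sw k) p - p"
    by simp
  then have "(pvar k - pvar (Suc k)) * pact (sw k) (dem k p) = p - pact (sw k) p"
    by (metis minus_diff_eq mult_minus_left)
  then show ?thesis by (metis dem_eqI)
qed

lemma dem_dem [simp]: "dem k (dem k p) = 0"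
  by (rule dem_eqI) simp

lemma pact_dem:
  assumes "bij w" "w k = l" "w (Suc k) = Suc l"
  shows "pact w (dem k p) = dem l (pact w p)"
proof (rule dem_eqI[symmetric])
  have c: "w \<circ> sw k = sw l \<circ> w"
    using assms inj_eq[OF bij_is_inj[OF assms(1)]] by (simp add: fun_eq_iff transpose_def flip: assms(2,3)) metis
  have "pact w ((pvar k - pvar (Suc k)) * dem k p) = pact w (p - pact (sw k) p)"
    by (simp only: dem)
  then show "(pvar l - pvar (Suc l)) * pact w (dem k p) = pact w p - pact (sw l) (pact w p)"
    using assms c by (simp add: pact_comp)
qed

section \<open>The polynomial representation\<close>

text \<open>
  The polynomials \<open>Q\<close> of the Khovanov--Lauda--Rouquier representation: for an edge, one of the two
  crossings carries the factor \<open>x\<^sub>k - x\<^sub>l\<close> and the opposite one the factor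
  \<open>1\<close>, so that their product is the value of the double crossing.
\<close>

definition qfac :: "('v \<times> 'v) set \<Rightarrow> 'v \<Rightarrow> 'v \<Rightarrow> nat \<Rightarrow> nat \<Rightarrow> zpoly" where
  "qfac A i j k l = (if (j, i) \<in> A then pvar k - pvar l else 1)"

lemma pact_qfac [simp]: "bij w \<Longrightarrow> pact w (qfac A i j k l) = qfac A i j (w k) (w l)"
  by (simp add: qfac_def)

definition crossop :: "('v \<times> 'v) set \<Rightarrow> 'v \<Rightarrow> 'v \<Rightarrow> nat \<Rightarrow> zpoly \<Rightarrow> zpoly" where
  "crossop A i j k p = (if i = j then dem k p else qfac A i j k (Suc k) * pact (sw k) p)"

text \<open>
  A diagram acts on polynomials in all variables, its strands being numbered from \<open>s\<close>.  Strands of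
  equal colour cross by a Demazure operator, strands of different colours by a permutation of the variables.
  Keeping infinitely many variables and an explicit offset makes horizontal composition a plain composition of
  operators.
\<close>

primrec rep :: "('v \<times> 'v) set \<Rightarrow> 'v diagram \<Rightarrow> nat \<Rightarrow> zpoly \<Rightarrow> zpoly" where
  "rep A (Ident a) s p = p"
| "rep A (Dot i) s p = pvar s * p"
| "rep A (Cross i j) s p = crossop A i j s p"
| "rep A (Vert D D') s p = rep A D s (rep A D' s p)"
| "rep A (Horiz D D') s p = rep A D s (rep A D' (s + length (src D)) p)"

lemma crossop_diff [simp]: "crossop A i j k (p - q) = crossop A i j k p - crossop A i j k q"
  by (simp add: crossop_def right_diff_distrib)

lemma rep_diff [simp]: "rep A D s (p - q) = rep A D s p - rep A D s q"
  by (induction D arbitrary: s p q) (simp_all add: right_diff_distrib)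

lemma rep_0 [simp]: "rep A D s 0 = 0"
  using rep_diff[of A D s 0 0] by simp

text \<open>
  The operators that only involve the variables with index in \<open>{s..<t}\<close>, in the sense of commuting
  with the multiplications and the permutations of the other variables.
\<close>

definition local_op :: "nat \<Rightarrow> nat \<Rightarrow> (zpoly \<Rightarrow> zpoly) \<Rightarrow> bool" where
  "local_op s t T \<longleftrightarrow> (\<forall>p q. T (p - q) = T p - T q) \<and>
     (\<forall>l p. l < s \<or> t \<le> l \<longrightarrow> T (pvar l * p) = pvar l * T p) \<and>
     (\<forall>l p. Suc l < s \<or> t \<le> l \<longrightarrow> T (pact (sw l) p) = pact (sw l) (T p))"

lemma local_op_comp: "local_op s t T \<Longrightarrow> local_op s t T' \<Longrightarrow> local_op s t (\<lambda>p. T (T' p))"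
  by (simp add: local_op_def)

lemma local_op_mono: "local_op s t T \<Longrightarrow> s' \<le> s \<Longrightarrow> t \<le> t' \<Longrightarrow> local_op s' t' T"
  by (auto simp: local_op_def)

lemma sw_commute: "Suc k < l \<Longrightarrow> sw k \<circ> sw l = sw l \<circ> sw k"
  by (auto simp: fun_eq_iff transpose_def)

lemma pact_sw_commute: "Suc k < l \<Longrightarrow> pact (sw k) (pact (sw l) p) = pact (sw l) (pact (sw k) p)"
  using sw_commute[of k l] by (simp only: pact_comp bij_sw)

text \<open>
  Commuting with \<open>x\<^sub>l\<close>, \<open>x\<^bsub>l+1\<^esub>\<close> and \<open>s\<^sub>l\<close>
  forces commuting with the divided difference.
\<close>

lemma local_op_dem_commute:
  assumes "local_op s t T" "Suc l < s \<or> t \<le> l"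
  shows "T (dem l p) = dem l (T p)"
proof (rule dem_eqI[symmetric])
  have m: "T (pvar l * q) = pvar l * T q" "T (pvar (Suc l) * q) = pvar (Suc l) * T q" for q
    using assms by (auto simp: local_op_def)
  have d: "T (p - q) = T p - T q" for p q using assms by (auto simp: local_op_def)
  have c: "T (pact (sw l) p) = pact (sw l) (T p)" using assms unfolding local_op_def by blast
  have "T ((pvar l - pvar (Suc l)) * dem l p) = T (p - pact (sw l) p)"
    by (simp only: dem)
  then show "(pvar l - pvar (Suc l)) * T (dem l p) = T p - pact (sw l) (T p)"
    unfolding left_diff_distrib d m c .
qed

lemma local_op_cross: "local_op k (Suc (Suc k)) (crossop A i j k)"
proof -
  have 1: "local_op k (Suc (Suc k)) (pact (sw k))"
    unfolding local_op_def by (auto simp: transpose_apply_other pact_sw_commute)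
      (metis pact_sw_commute Suc_le_lessD)
  have 2: "local_op k (Suc (Suc k)) (dem k)"
    unfolding local_op_def
  proof (intro conjI allI impI)
    fix l p assume "l < k \<or> Suc (Suc k) \<le> l"
    then show "dem k (pvar l * p) = pvar l * dem k p"
      by (intro dem_invariant) (auto simp: transpose_apply_other)
  next
    fix l p assume "Suc l < k \<or> Suc (Suc k) \<le> l"
    then show "dem k (pact (sw l) p) = pact (sw l) (dem k p)"
      by (intro pact_dem[symmetric]) (auto simp: transpose_apply_other)
  qed simp
  have q: "pact (sw l) (qfac A i j k (Suc k)) = qfac A i j k (Suc k)"
    if "Suc l < k \<or> Suc (Suc k) \<le> l" for l
    using that by (auto simp: transpose_apply_other)
  show ?thesis
  proof (cases "i = j")
    case True
    have "crossop A i j k = dem k" using True by (simp add: fun_eq_iff crossop_def)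
    then show ?thesis using 2 by simp
  next
    case False
    have e: "crossop A i j k = (\<lambda>p. qfac A i j k (Suc k) * pact (sw k) p)"
      using False by (simp add: fun_eq_iff crossop_def)
    show ?thesis unfolding e local_op_def
    proof (intro conjI allI impI)
      fix l p assume l: "Suc l < k \<or> Suc (Suc k) \<le> l"
      have "pact (sw k) (pact (sw l) p) = pact (sw l) (pact (sw k) p)"
        using l 1 unfolding local_op_def by blast
      then show "qfac A i j k (Suc k) * pact (sw k) (pact (sw l) p) =
        pact (sw l) (qfac A i j k (Suc k) * pact (sw k) p)"
        by (simp only: pact_mult[OF bij_sw] q[OF l])
    next
      fix l p assume "l < k \<or> Suc (Suc k) \<le> l"
      then have "pact (sw k) (pvar l * p) = pvar l * pact (sw k) p"
        by (auto simp: transpose_apply_other)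
      then show "qfac A i j k (Suc k) * pact (sw k) (pvar l * p) =
        pvar l * (qfac A i j k (Suc k) * pact (sw k) p)"
        by (simp only: mult.left_commute)
    qed (simp add: right_diff_distrib)
  qed
qed

lemma length_tgt: "wf_diagram D \<Longrightarrow> length (tgt D) = length (src D)"
  by (induction D) auto

lemma local_op_rep: "wf_diagram D \<Longrightarrow> local_op s (s + length (src D)) (rep A D s)"
proof (induction D arbitrary: s)
  case (Cross i j)
  have "rep A (Cross i j) s = crossop A i j s" by (simp add: fun_eq_iff)
  then show ?case using local_op_cross[of s A i j] by simp
next
  case (Vert D D')
  have "length (src D) = length (src D')"
    using Vert.prems length_tgt[of D'] by simp
  then have "local_op s (s + length (src D')) (rep A D s)" "local_op s (s + length (src D')) (rep A D' s)"
    using Vert.IH[of s] Vert.prems by simp_all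
  from local_op_comp[OF this] show ?case by (simp add: local_op_def)
next
  case (Horiz D D')
  then have "local_op s (s + length (src D) + length (src D')) (rep A D s)"
    "local_op s (s + length (src D) + length (src D')) (rep A D' (s + length (src D)))"
    using local_op_mono[OF Horiz.IH(1)[of s]] local_op_mono[OF Horiz.IH(2)[of "s + length (src D)"]]
    by (auto simp: add.assoc)
  from local_op_comp[OF this] show ?case by (simp add: local_op_def add.assoc)
qed (auto simp: local_op_def right_diff_distrib mult.left_commute transpose_apply_other)

text \<open>
  Diagrams on disjoint sets of strands act by commuting operators, which is the interchange law.
\<close>

lemma local_op_rep_commute:
  assumes "local_op s t T" "wf_diagram D" "s' + length (src D) \<le> s \<or> t \<le> s'"
  shows "T (rep A D s' p) = rep A D s' (T p)"
  using assms(2,3)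
proof (induction D arbitrary: s' p)
  case (Dot i)
  then show ?case using assms(1) by (auto simp: local_op_def)
next
  case (Cross i j)
  then have l: "Suc s' < s \<or> t \<le> s'" by auto
  have m: "T (pvar l * q) = pvar l * T q" if "l = s' \<or> l = Suc s'" for l q
    using assms(1) l that by (auto simp: local_op_def)
  have d: "T (p - q) = T p - T q" for p q using assms(1) by (auto simp: local_op_def)
  have "T (qfac A i j s' (Suc s') * q) = qfac A i j s' (Suc s') * T q" for q
    by (simp add: qfac_def left_diff_distrib d m)
  moreover have "T (pact (sw s') p) = pact (sw s') (T p)"
    using assms(1) l unfolding local_op_def by blast
  ultimately show ?case using local_op_dem_commute[OF assms(1) l]
    by (simp add: crossop_def)
next
  case (Vert D D')
  then show ?case using length_tgt[of D'] by auto
qed auto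

definition rep_lin :: "('v \<times> 'v) set \<Rightarrow> 'v lin \<Rightarrow> nat \<Rightarrow> zpoly \<Rightarrow> zpoly" where
  "rep_lin A f s p = frag_extend (\<lambda>D. rep A D s p) f"

lemma rep_lin_of [simp]: "rep_lin A (frag_of D) s p = rep A D s p"
  by (simp add: rep_lin_def)
lemma rep_lin_diff [simp]: "rep_lin A (f - g) s p = rep_lin A f s p - rep_lin A g s p"
  by (simp add: rep_lin_def frag_extend_diff)
lemma rep_lin_add [simp]: "rep_lin A (f + g) s p = rep_lin A f s p + rep_lin A g s p"
  by (simp add: rep_lin_def frag_extend_add)
lemma rep_lin_minus [simp]: "rep_lin A (- f) s p = - rep_lin A f s p"
  by (simp add: rep_lin_def frag_extend_minus)
lemma rep_lin_0 [simp]: "rep_lin A 0 s p = 0"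
  by (simp add: rep_lin_def)
lemma rep_lin_sum: "rep_lin A (sum f I) s p = (\<Sum>i\<in>I. rep_lin A (f i) s p)"
  by (induction I rule: infinite_finite_induct) simp_all

lemma rep_lin_diff_right [simp]: "rep_lin A f s (p - q) = rep_lin A f s p - rep_lin A f s q"
  by (induction f rule: frag_induction[OF subset_UNIV]) simp_all
lemma rep_lin_0_right [simp]: "rep_lin A f s 0 = 0"
  using rep_lin_diff_right[of A f s 0 0] by simp
lemma rep_lin_minus_right [simp]: "rep_lin A f s (- p) = - rep_lin A f s p"
  using rep_lin_diff_right[of A f s 0 p] by simp
lemma rep_lin_add_right [simp]: "rep_lin A f s (p + q) = rep_lin A f s p + rep_lin A f s q"
  using rep_lin_diff_right[of A f s p "- q"] by simp

lemma vcomp_of [simp]: "frag_of D \<star> frag_of D' = frag_of (Vert D D')"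
  by (simp add: vcomp_def)
lemma vcomp_diff_left [simp]: "(f - g) \<star> h = f \<star> h - g \<star> h"
  by (simp add: vcomp_def frag_extend_diff)
lemma vcomp_diff_right [simp]: "h \<star> (f - g) = h \<star> f - h \<star> g"
proof (induction h rule: frag_induction[OF subset_UNIV])
  case 1 then show ?case by (simp add: vcomp_def)
next
  case (2 x) then show ?case by (simp add: vcomp_def frag_extend_diff)
next
  case (3 a b) then show ?case by simp
qed
lemma vcomp_0 [simp]: "f \<star> 0 = 0" "0 \<star> f = 0"
  using vcomp_diff_right[of f 0 0] vcomp_diff_left[of 0 0 f] by simp_all
lemma vcomp_minus [simp]: "f \<star> (- g) = - (f \<star> g)" "(- f) \<star> g = - (f \<star> g)"
  using vcomp_diff_right[of f 0 g] vcomp_diff_left[of 0 f g] by simp_all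
lemma vcomp_add_left [simp]: "(f + g) \<star> h = f \<star> h + g \<star> h"
  using vcomp_diff_left[of f "- g" h] by simp
lemma vcomp_add_right [simp]: "h \<star> (f + g) = h \<star> f + h \<star> g"
  using vcomp_diff_right[of h f "- g"] by simp

lemma hcomp_of [simp]: "hcomp (frag_of D) (frag_of D') = frag_of (Horiz D D')"
  by (simp add: hcomp_def)
lemma hcomp_diff_left [simp]: "hcomp (f - g) h = hcomp f h - hcomp g h"
  by (simp add: hcomp_def frag_extend_diff)
lemma hcomp_diff_right [simp]: "hcomp h (f - g) = hcomp h f - hcomp h g"
proof (induction h rule: frag_induction[OF subset_UNIV])
  case 1 then show ?case by (simp add: hcomp_def)
next
  case (2 x) then show ?case by (simp add: hcomp_def frag_extend_diff)
next
  case (3 a b) then show ?case by simp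
qed
lemma hcomp_0 [simp]: "hcomp f 0 = 0" "hcomp 0 f = 0"
  using hcomp_diff_right[of f 0 0] hcomp_diff_left[of 0 0 f] by simp_all
lemma hcomp_minus [simp]: "hcomp f (- g) = - hcomp f g" "hcomp (- f) g = - hcomp f g"
  using hcomp_diff_right[of f 0 g] hcomp_diff_left[of 0 f g] by simp_all
lemma hcomp_add_left [simp]: "hcomp (f + g) h = hcomp f h + hcomp g h"
  using hcomp_diff_left[of f "- g" h] by simp
lemma hcomp_add_right [simp]: "hcomp h (f + g) = hcomp h f + hcomp h g"
  using hcomp_diff_right[of h f "- g"] by simp

lemma free_hom_induct [consumes 1, case_names zero of diff]:
  assumes "f \<in> free_hom a b" "P 0"
    "\<And>D. wf_diagram D \<Longrightarrow> src D = a \<Longrightarrow> tgt D = b \<Longrightarrow> P (frag_of D)"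
    "\<And>f g. f \<in> free_hom a b \<Longrightarrow> g \<in> free_hom a b \<Longrightarrow> P f \<Longrightarrow> P g \<Longrightarrow> P (f - g)"
  shows "P f"
proof -
  have "Poly_Mapping.keys f \<subseteq> {D. wf_diagram D \<and> src D = a \<and> tgt D = b}"
    using assms(1) by (auto simp: free_hom_def)
  then have "f \<in> free_hom a b \<and> P f"
  proof (induction rule: frag_induction)
    case (diff f g)
    have "f - g \<in> free_hom a b" using diff keys_diff[of f g] by (auto simp: free_hom_def)
    then show ?case using diff assms(4) by auto
  qed (use assms in \<open>auto simp: free_hom_def\<close>)
  then show ?thesis by simp
qed

lemma free_hom_of [simp]: "frag_of D \<in> free_hom a b \<longleftrightarrow> wf_diagram D \<and> src D = a \<and> tgt D = b"
  by (simp add: free_hom_def)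
lemma free_hom_0 [simp]: "0 \<in> free_hom a b"
  by (simp add: free_hom_def)
lemma free_hom_diff: "f \<in> free_hom a b \<Longrightarrow> g \<in> free_hom a b \<Longrightarrow> f - g \<in> free_hom a b"
  using keys_diff[of f g] by (auto simp: free_hom_def)
lemma free_hom_minus: "f \<in> free_hom a b \<Longrightarrow> - f \<in> free_hom a b"
  by (simp add: free_hom_def)
lemma free_hom_add: "f \<in> free_hom a b \<Longrightarrow> g \<in> free_hom a b \<Longrightarrow> f + g \<in> free_hom a b"
  using free_hom_diff[of f a b "- g"] free_hom_minus[of g a b] by simp
lemma free_hom_sum: "(\<And>i. i \<in> I \<Longrightarrow> f i \<in> free_hom a b) \<Longrightarrow> sum f I \<in> free_hom a b"
  by (induction I rule: infinite_finite_induct) (auto intro: free_hom_add)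

lemma free_hom_vcomp:
  assumes "g \<in> free_hom b c" "f \<in> free_hom a b" shows "g \<star> f \<in> free_hom a c"
  using assms(1)
proof (induction rule: free_hom_induct)
  case (of D)
  from assms(2) show ?case
    by (induction rule: free_hom_induct) (auto simp: of intro: free_hom_diff)
qed (auto intro: free_hom_diff)

lemma free_hom_hcomp:
  assumes "g \<in> free_hom a b" "f \<in> free_hom c d" shows "hcomp g f \<in> free_hom (a @ c) (b @ d)"
  using assms(1)
proof (induction rule: free_hom_induct)
  case (of D)
  from assms(2) show ?case
    by (induction rule: free_hom_induct) (auto simp: of intro: free_hom_diff)
qed (auto intro: free_hom_diff)

lemma rep_lin_vcomp: "rep_lin A (f \<star> g) s p = rep_lin A f s (rep_lin A g s p)"
proof (induction f rule: frag_induction[OF subset_UNIV])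
  case (2 D)
  show ?case by (induction g rule: frag_induction[OF subset_UNIV])
     simp_all
qed simp_all

lemma rep_lin_hcomp:
  assumes "f \<in> free_hom a b"
  shows "rep_lin A (hcomp f g) s p = rep_lin A f s (rep_lin A g (s + length a) p)"
  using assms
proof (induction rule: free_hom_induct)
  case (of D)
  show ?case by (induction g rule: frag_induction[OF subset_UNIV])
     (simp_all add: of)
qed simp_all

section \<open>Soundness of the polynomial representation\<close>

lemma wf_dot_at [simp]: "wf_diagram (dot_at k a)" by (simp add: dot_at_def)
lemma wf_cross_at [simp]: "wf_diagram (cross_at k a)" by (simp add: cross_at_def)
lemma src_dot_at [simp]: "k < length a \<Longrightarrow> src (dot_at k a) = a"
  by (simp add: dot_at_def id_take_nth_drop[symmetric])
lemma tgt_dot_at [simp]: "k < length a \<Longrightarrow> tgt (dot_at k a) = a"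
  by (simp add: dot_at_def id_take_nth_drop[symmetric])
lemma src_cross_at [simp]: "Suc k < length a \<Longrightarrow> src (cross_at k a) = a"
  by (simp add: cross_at_def Cons_nth_drop_Suc id_take_nth_drop[symmetric])

lemma rep_dot_at [simp]: "k < length a \<Longrightarrow> rep A (dot_at k a) s p = pvar (s + k) * p"
  by (simp add: dot_at_def)
lemma rep_cross_at [simp]: "k < length a \<Longrightarrow> rep A (cross_at k a) s p = crossop A (a ! k) (a ! Suc k) (s + k) p"
  by (simp add: cross_at_def)

lemma rep_monoidal:
  assumes "monoidal_rel D D'" "wf_diagram D" "wf_diagram D'"
  shows "rep A D s p = rep A D' s p"
  using assms
proof (induction arbitrary: s p rule: monoidal_rel.induct)
  case (interchange D1 D2 D3 D4)
  have "rep A D2 (s + length (src D1)) (rep A D3 s q) = rep A D3 s (rep A D2 (s + length (src D1)) q)" for q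
    using interchange length_tgt[of D3]
    by (intro local_op_rep_commute[OF local_op_rep]) auto
  then show ?case using interchange length_tgt[of D3] by simp
qed (simp_all add: add.assoc)

lemma pact_sw3:
  "pact (sw k) (pact (sw (Suc k)) (pact (sw k) p)) = pact (transpose k (Suc (Suc k))) p"
  "pact (sw (Suc k)) (pact (sw k) (pact (sw (Suc k)) p)) = pact (transpose k (Suc (Suc k))) p"
proof -
  have "sw k \<circ> (sw (Suc k) \<circ> sw k) = transpose k (Suc (Suc k))"
    "sw (Suc k) \<circ> (sw k \<circ> sw (Suc k)) = transpose k (Suc (Suc k))"
    by (auto simp: fun_eq_iff transpose_def)
  then show "pact (sw k) (pact (sw (Suc k)) (pact (sw k) p)) = pact (transpose k (Suc (Suc k))) p"
    "pact (sw (Suc k)) (pact (sw k) (pact (sw (Suc k)) p)) = pact (transpose k (Suc (Suc k))) p"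
    by (simp_all only: pact_comp bij_sw bij_comp)
qed

text \<open>
  The divided difference for \<open>x\<^sub>k\<close> and \<open>x\<^bsub>k+2\<^esub>\<close>, obtained by
  conjugation with either simple transposition.  It is the middle part of the braid relation for the colours
  \<open>i, j, i\<close>.
\<close>

definition dem2 :: "nat \<Rightarrow> zpoly \<Rightarrow> zpoly" where
  "dem2 k p = pact (sw k) (dem (Suc k) (pact (sw k) p))"

lemma dem2: "(pvar k - pvar (Suc (Suc k))) * dem2 k p = p - pact (transpose k (Suc (Suc k))) p"
proof -
  have "pact (sw k) ((pvar (Suc k) - pvar (Suc (Suc k))) * dem (Suc k) (pact (sw k) p)) =
    pact (sw k) (pact (sw k) p - pact (sw (Suc k)) (pact (sw k) p))"
    by (simp only: dem)
  then show ?thesis by (simp add: dem2_def pact_sw3 transpose_apply_other)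
qed

lemma dem2_eqI:
  "(pvar k - pvar (Suc (Suc k))) * g = p - pact (transpose k (Suc (Suc k))) p \<Longrightarrow> dem2 k p = g"
  by (rule pvar_diff_cancel[of k "Suc (Suc k)", OF _ trans[OF dem2 sym]]) (simp, assumption)

lemma dem2_alt: "pact (sw (Suc k)) (dem k (pact (sw (Suc k)) p)) = dem2 k p"
proof -
  have "pact (sw (Suc k)) ((pvar k - pvar (Suc k)) * dem k (pact (sw (Suc k)) p)) =
    pact (sw (Suc k)) (pact (sw (Suc k)) p - pact (sw k) (pact (sw (Suc k)) p))"
    by (simp only: dem)
  then show ?thesis
    by (intro dem2_eqI[symmetric]) (simp add: pact_sw3 transpose_apply_other)
qed

lemma dem2_diff: "dem2 k (p - q) = dem2 k p - dem2 k q"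
  by (simp add: dem2_def)
lemma dem2_mult: "dem2 k (f * p) = dem2 k f * p + pact (transpose k (Suc (Suc k))) f * dem2 k p"
  by (rule dem2_eqI) (simp only: pact_mult[OF bij_transpose] twisted_Leibniz_divided_difference[OF dem2 dem2])
lemma dem2_pvar [simp]: "dem2 k (pvar (Suc k)) = 0" "dem2 k (pvar k) = 1" "dem2 k (pvar (Suc (Suc k))) = -1"
  by (rule dem2_eqI, simp add: transpose_apply_other)+
lemma dem2_1 [simp]: "dem2 k 1 = 0"
  by (rule dem2_eqI) simp

text \<open>
  Both sides are the antisymmetrisation of \<open>p\<close> divided by the product of the three differences of
  variables; after multiplication with this product only permuted copies of \<open>p\<close> remain.
\<close>

lemma dem_braid: "dem k (dem (Suc k) (dem k p)) = dem (Suc k) (dem k (dem (Suc k) p))"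
proof -
  let ?x = "pvar k" and ?y = "pvar (Suc k)" and ?z = "pvar (Suc (Suc k))"
  let ?s = "pact (sw k)" and ?t = "pact (sw (Suc k))"
  have ts: "?t ?x = ?x" "?s ?z = ?z" by (simp_all add: transpose_apply_other)
  define a b c where abc: "a = ?x - ?y" "b = ?y - ?z" "c = ?x - ?z"
  have ac: "?s a = - a" "?s b = c" "?s c = b" "?t a = c" "?t b = - b" "?t c = a"
    using ts by (simp_all add: abc)
  have nz: "a * b * c \<noteq> 0" by (simp add: abc)
  have da: "a * dem k q = q - ?s q" for q by (simp add: abc dem)
  have db: "b * dem (Suc k) q = q - ?t q" for q by (simp add: abc dem)
  have E: "a * b * c * a * dem k (dem (Suc k) (dem k p)) =
    a * (p - ?s p - ?t p + ?s (?t p) + ?t (?s p) - ?s (?t (?s p)))"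
  proof -
    have "?t (a * dem k p) = ?t (p - ?s p)" by (simp only: da)
    then have 1: "c * ?t (dem k p) = ?t p - ?t (?s p)" by (simp add: ac)
    have 2: "a * b * c * dem (Suc k) (dem k p) = c * (p - ?s p) - a * (?t p - ?t (?s p))"
    proof -
      have "a * b * c * dem (Suc k) (dem k p) = a * c * (b * dem (Suc k) (dem k p))" by (simp only: mult_ac)
      also have "\<dots> = c * (a * dem k p) - a * (c * ?t (dem k p))"
        by (simp only: db right_diff_distrib mult_ac)
      finally show ?thesis by (simp only: 1 da)
    qed
    then have "?s (a * b * c * dem (Suc k) (dem k p)) = ?s (c * (p - ?s p) - a * (?t p - ?t (?s p)))" by simp
    then have 3: "- (a * b * c * ?s (dem (Suc k) (dem k p))) = b * (?s p - p) + a * (?s (?t p) - ?s (?t (?s p)))"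
      by (simp add: ac mult_ac)
    have "a * b * c * a * dem k (dem (Suc k) (dem k p)) = a * b * c * (a * dem k (dem (Suc k) (dem k p)))"
      by (simp only: mult_ac)
    also have "\<dots> = c * (p - ?s p) - a * (?t p - ?t (?s p)) + (b * (?s p - p) + a * (?s (?t p) - ?s (?t (?s p))))"
      using 2 3 by (simp add: da right_diff_distrib)
    also have "\<dots> = a * (p - ?s p - ?t p + ?s (?t p) + ?t (?s p) - ?s (?t (?s p)))"
      by (simp add: abc algebra_simps)
    finally show ?thesis .
  qed
  have F: "a * b * c * b * dem (Suc k) (dem k (dem (Suc k) p)) =
    b * (p - ?s p - ?t p + ?s (?t p) + ?t (?s p) - ?s (?t (?s p)))"
  proof -
    have "?s (b * dem (Suc k) p) = ?s (p - ?t p)" by (simp only: db)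
    then have 1: "c * ?s (dem (Suc k) p) = ?s p - ?s (?t p)" by (simp add: ac)
    have 2: "a * b * c * dem k (dem (Suc k) p) = c * (p - ?t p) - b * (?s p - ?s (?t p))"
    proof -
      have "a * b * c * dem k (dem (Suc k) p) = b * c * (a * dem k (dem (Suc k) p))" by (simp only: mult_ac)
      also have "\<dots> = c * (b * dem (Suc k) p) - b * (c * ?s (dem (Suc k) p))"
        by (simp only: da right_diff_distrib mult_ac)
      finally show ?thesis by (simp only: 1 db)
    qed
    then have "?t (a * b * c * dem k (dem (Suc k) p)) = ?t (c * (p - ?t p) - b * (?s p - ?s (?t p)))" by simp
    then have 3: "- (a * b * c * ?t (dem k (dem (Suc k) p))) = a * (?t p - p) + b * (?t (?s p) - ?s (?t (?s p)))"
      by (simp add: ac mult_ac pact_sw3)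
    have "a * b * c * b * dem (Suc k) (dem k (dem (Suc k) p)) = a * b * c * (b * dem (Suc k) (dem k (dem (Suc k) p)))"
      by (simp only: mult_ac)
    also have "\<dots> = c * (p - ?t p) - b * (?s p - ?s (?t p)) + (a * (?t p - p) + b * (?t (?s p) - ?s (?t (?s p))))"
      using 2 3 by (simp add: db right_diff_distrib)
    also have "\<dots> = b * (p - ?s p - ?t p + ?s (?t p) + ?t (?s p) - ?s (?t (?s p)))"
      by (simp add: abc algebra_simps)
    finally show ?thesis .
  qed
  have ab0: "a \<noteq> 0" "b \<noteq> 0" by (simp_all add: abc)
  have "a * (a * b * c * dem k (dem (Suc k) (dem k p))) =
     a * (p - ?s p - ?t p + ?s (?t p) + ?t (?s p) - ?s (?t (?s p)))"
    using E by (simp only: mult_ac)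
  moreover have "b * (a * b * c * dem (Suc k) (dem k (dem (Suc k) p))) =
     b * (p - ?s p - ?t p + ?s (?t p) + ?t (?s p) - ?s (?t (?s p)))"
    using F by (simp only: mult_ac)
  ultimately have "a * b * c * dem k (dem (Suc k) (dem k p)) = a * b * c * dem (Suc k) (dem k (dem (Suc k) p))"
    using ab0 by (metis mult_left_cancel)
  then show ?thesis using nz by (metis mult_left_cancel)
qed

lemma qfac_sym_invariant:
  "pact (sw (Suc k)) (qfac A i j k (Suc k) * qfac A i j k (Suc (Suc k))) = qfac A i j k (Suc k) * qfac A i j k (Suc (Suc k))"
  "pact (sw k) (qfac A i j (Suc k) (Suc (Suc k)) * qfac A i j k (Suc (Suc k))) = qfac A i j (Suc k) (Suc (Suc k)) * qfac A i j k (Suc (Suc k))"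
  by (simp_all add: transpose_apply_other mult.commute)

text \<open>
  Three equal colours give \<open>dem_braid\<close>.  If \<open>i\<close> and \<open>k\<close> differ, at most
  one pair of strands has equal colours, and its Demazure operator passes through the other two crossings
  because their factors \<open>Q\<close> are symmetric.  If \<open>i = k \<noteq> j\<close>, both sides are
  \<open>Q \<partial> Q\<close> with \<open>\<partial>\<close> the divided difference of the outer variables;
  moving the linear factor \<open>Q\<close> through \<open>\<partial>\<close> produces the constant term.
\<close>

lemma crossop_braid:
  assumes A: "asym A"
  shows "crossop A j k s (crossop A i k (Suc s) (crossop A i j s p)) -
         crossop A i j (Suc s) (crossop A i k s (crossop A j k (Suc s) p)) =
    (if i = k \<and> (i, j) \<in> A then p else if i = k \<and> (j, i) \<in> A then - p else 0)"
proof -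
  have irr: "(x, x) \<notin> A" for x using A by (meson asymD)
  consider (d) "i \<noteq> j" "j \<noteq> k" "i \<noteq> k" | (e) "i = j" "j = k" | (l) "i = j" "j \<noteq> k" | (r) "i \<noteq> j" "j = k" | (o) "i = k" "i \<noteq> j"
    by blast
  then show ?thesis
  proof cases
    case d
    then show ?thesis by (simp add: crossop_def transpose_apply_other pact_sw3 mult_ac)
  next
    case e
    then show ?thesis using irr by (simp add: crossop_def dem_braid)
  next
    case l
    have "pact (sw s) (pact (sw (Suc s)) (dem s p)) = dem (Suc s) (pact (sw s) (pact (sw (Suc s)) p))"
      by (simp add: pact_comp bij_comp, rule pact_dem) (auto simp: bij_comp transpose_apply_other)
    then show ?thesis using l
      by (simp add: crossop_def transpose_apply_other mult.assoc[symmetric] dem_invariant[OF qfac_sym_invariant(1)])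
  next
    case r
    have "pact (sw (Suc s)) (pact (sw s) (dem (Suc s) p)) = dem s (pact (sw (Suc s)) (pact (sw s) p))"
      by (simp add: pact_comp bij_comp, rule pact_dem) (auto simp: bij_comp transpose_apply_other)
    then show ?thesis using r
      by (simp add: crossop_def transpose_apply_other mult.assoc[symmetric] dem_invariant[OF qfac_sym_invariant(2)])
  next
    case o
    have L: "crossop A j k s (crossop A i k (Suc s) (crossop A i j s p)) =
        qfac A j i s (Suc s) * dem2 s (qfac A i j (Suc s) s * p)"
      using o by (simp add: crossop_def dem2_def)
    have R: "crossop A i j (Suc s) (crossop A i k s (crossop A j k (Suc s) p)) =
        qfac A i j (Suc s) (Suc (Suc s)) * dem2 s (qfac A j i (Suc (Suc s)) (Suc s) * p)"
      using o by (simp add: crossop_def flip: dem2_alt)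
    show ?thesis
    proof (cases "(i, j) \<in> A")
      case True
      then have "(j, i) \<notin> A" using A by (meson asymD)
      then show ?thesis using True o unfolding L R
        by (simp add: qfac_def left_diff_distrib dem2_diff dem2_mult transpose_apply_other bij_swap_iff)
    next
      case False
      then show ?thesis using o unfolding L R
        by (simp add: qfac_def left_diff_distrib dem2_diff dem2_mult transpose_apply_other bij_swap_iff)
    qed
  qed
qed

lemma crossop_double:
  assumes "asym A"
  shows "crossop A j i s (crossop A i j s p) = (if i = j then 0 else if (i, j) \<in> A then (pvar s - pvar (Suc s)) * p
     else if (j, i) \<in> A then (pvar (Suc s) - pvar s) * p else p)"
  using asymD[OF assms] by (auto simp: crossop_def qfac_def)

lemma rep_lin_klr:
  assumes A: "asym A" and "klr_rel A f g"
  shows "rep_lin A f s p = rep_lin A g s p"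
  using assms(2)
proof cases
  case (braid i k j)
  then have "\<not> (i = k \<and> (i, j) \<in> A)" "\<not> (i = k \<and> (j, i) \<in> A)" by (auto simp: adjacent_def)
  then have "crossop A j k s (crossop A i k (Suc s) (crossop A i j s p)) -
         crossop A i j (Suc s) (crossop A i k s (crossop A j k (Suc s) p)) = 0"
    using crossop_braid[OF A, of j k s i p] by argo
  then show ?thesis using braid(1,2) by (simp add: cross_at_def numeral_2_eq_2)
next
  case (braid_pos i j)
  then show ?thesis using crossop_braid[OF A, of j i s i p] by (simp add: cross_at_def numeral_2_eq_2)
next
  case (braid_neg j i)
  then have "(i, j) \<notin> A" using A by (meson asymD)
  then show ?thesis using crossop_braid[OF A, of j i s i p] braid_neg by (simp add: cross_at_def numeral_2_eq_2)
next
  case (double_tail_head i j)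
  then have "i \<noteq> j" using A by (auto dest: asymD)
  then show ?thesis using double_tail_head crossop_double[OF A, of j i s p] by (simp add: cross_at_def left_diff_distrib)
next
  case (double_head_tail j i)
  then have "i \<noteq> j" "(i, j) \<notin> A" using A by (auto dest: asymD)
  then show ?thesis using double_head_tail crossop_double[OF A, of j i s p] by (simp add: cross_at_def left_diff_distrib)
next
  case (double_same i)
  then show ?thesis using crossop_double[OF A, of i i s p] by (simp add: cross_at_def)
next
  case (double_far i j)
  then show ?thesis using crossop_double[OF A, of j i s p] by (simp add: cross_at_def adjacent_def)
next
  case (nilHecke_1 i)
  then show ?thesis by (simp add: cross_at_def crossop_def dem_mult)
next
  case (nilHecke_2 i)
  then show ?thesis by (simp add: cross_at_def crossop_def dem_mult)
next
  case (slide_1 i j)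
  then show ?thesis by (simp add: cross_at_def crossop_def mult_ac)
next
  case (slide_2 i j)
  then show ?thesis by (simp add: cross_at_def crossop_def mult_ac)
qed

lemma null_free_hom: "null A a b f \<Longrightarrow> f \<in> free_hom a b"
  by (induction rule: null.induct) (auto intro: free_hom_diff free_hom_vcomp free_hom_hcomp)

theorem null_rep:
  assumes A: "asym A" and "null A a b f"
  shows "rep_lin A f s p = 0"
  using assms(2)
proof (induction arbitrary: s p rule: null.induct)
  case (null_monoidal D D' a b)
  then show ?case using rep_monoidal[of D D'] by simp
next
  case (null_klr f g a b)
  then show ?case using rep_lin_klr[OF A] by simp
next
  case (null_right a b f g c d)
  then show ?case by (simp add: rep_lin_hcomp[OF null_free_hom])
qed (auto simp: rep_lin_vcomp rep_lin_hcomp)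

section \<open>Twisted vector fields\<close>

text \<open>
  The values for which the polynomial representation intertwines \<open>\<d>\<close>: on the word
  \<open>a\<close> the operator is \<open>\<Sum>x\<^sub>k\<^sup>2 \<partial>\<^sub>k\<close> plus multiplication
  by \<open>\<Sum>\<^bsub>k < l\<^esub> cfac (a\<^sub>k) (a\<^sub>l) x\<^sub>k\<close>.  Equal colours need the
  correction \<open>-1\<close> by the formula for \<open>\<d>\<close> of the Demazure crossing; for an edge the
  correction is carried by the order of the two strands whose crossing has the nontrivial factor
  \<open>Q\<close>.
\<close>

definition cfac :: "('v \<times> 'v) set \<Rightarrow> 'v \<Rightarrow> 'v \<Rightarrow> int" where
  "cfac A i j = (if i = j then -1 else if (j, i) \<in> A then 1 else 0)"

primrec wsum :: "('v \<Rightarrow> int) \<Rightarrow> 'v list \<Rightarrow> nat \<Rightarrow> zpoly" where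
  "wsum u [] s = 0"
| "wsum u (i # a) s = of_int (u i) * pvar s + wsum u a (Suc s)"

text \<open>
  \<open>pot\<close> is the potential \<open>\<Sum>\<^bsub>k < l\<^esub> cfac (a\<^sub>k) (a\<^sub>l)
  x\<^sub>k\<close>, with strands numbered from \<open>s\<close>, and \<open>pot0\<close> its value at \<open>x
  = (1, 1, \<dots>)\<close>.
\<close>

primrec pot :: "('v \<times> 'v) set \<Rightarrow> 'v list \<Rightarrow> nat \<Rightarrow> zpoly" where
  "pot A [] s = 0"
| "pot A (i # a) s = of_int (\<Sum>j\<leftarrow>a. cfac A i j) * pvar s + pot A a (Suc s)"

primrec pot0 :: "('v \<times> 'v) set \<Rightarrow> 'v list \<Rightarrow> int" where
  "pot0 A [] = 0"
| "pot0 A (i # a) = (\<Sum>j\<leftarrow>a. cfac A i j) + pot0 A a"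

lemma wsum_append: "wsum u (a @ b) s = wsum u a s + wsum u b (s + length a)"
  by (induction a arbitrary: s) (simp_all add: add.assoc)

lemma pot_append:
  "pot A (a @ b) s = pot A a s + pot A b (s + length a) + wsum (\<lambda>i. \<Sum>j\<leftarrow>b. cfac A i j) a s"
  by (induction a arbitrary: s) (simp_all add: algebra_simps)

lemma pot0_append:
  "pot0 A (a @ b) = pot0 A a + pot0 A b + (\<Sum>i\<leftarrow>a. \<Sum>j\<leftarrow>b. cfac A i j)"
  by (induction a) simp_all

lemma mset_tgt: "wf_diagram D \<Longrightarrow> mset (tgt D) = mset (src D)"
  by (induction D) auto

lemma sum_list_tgt: "wf_diagram D \<Longrightarrow> (\<Sum>j\<leftarrow>tgt D. u j :: int) = (\<Sum>j\<leftarrow>src D. u j)"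
  by (metis mset_map mset_tgt sum_mset_sum_list)

lemma rep_minus [simp]: "rep A D s (- p) = - rep A D s p"
  using rep_diff[of A D s 0 p] by simp
lemma rep_add [simp]: "rep A D s (p + q) = rep A D s p + rep A D s q"
  using rep_diff[of A D s p "- q"] by simp

lemma rep_of_nat_mult: "rep A D s (of_nat c * p) = of_nat c * rep A D s p"
  by (induction c) (simp_all add: distrib_right)
lemma rep_of_int_mult: "rep A D s (of_int c * p) = of_int c * rep A D s p"
  by (cases c) (simp_all add: rep_of_nat_mult distrib_right left_diff_distrib del: of_nat_Suc)

lemma rep_outside_pvar:
  "wf_diagram D \<Longrightarrow> l < s \<or> s + length (src D) \<le> l \<Longrightarrow> rep A D s (pvar l * p) = pvar l * rep A D s p"
  using local_op_rep[of D s A] by (auto simp: local_op_def)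

lemma rep_outside_wsum:
  assumes "wf_diagram D" "l + length a \<le> s \<or> s + length (src D) \<le> l"
  shows "rep A D s (wsum u a l * p) = wsum u a l * rep A D s p"
  using assms(2)
proof (induction a arbitrary: l)
  case (Cons i a)
  then show ?case using assms(1)
    by (auto simp: distrib_right mult.assoc rep_of_int_mult rep_outside_pvar)
qed simp

lemma rep_outside_pot:
  assumes "wf_diagram D" "l + length a \<le> s \<or> s + length (src D) \<le> l"
  shows "rep A D s (pot A a l * p) = pot A a l * rep A D s p"
  using assms(2)
proof (induction a arbitrary: l)
  case (Cons i a)
  then show ?case using assms(1)
    by (auto simp: distrib_right mult.assoc rep_of_int_mult rep_outside_pvar)
qed simp

lemma dem_symmetric_sum: "dem k ((pvar k + pvar (Suc k)) * p) = (pvar k + pvar (Suc k)) * dem k p"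
  by (rule dem_invariant) (simp add: add.commute)

lemma dem_of_int_mult: "dem k (of_int c * p) = of_int c * dem k p"
  by (rule dem_invariant) simp

lemma crossop_wsum:
  "crossop A i j s ((of_int c * pvar s + of_int d * pvar (Suc s)) * p) =
    (of_int d * pvar s + of_int c * pvar (Suc s)) * crossop A i j s p" if "i = j \<Longrightarrow> c = d"
proof (cases "i = j")
  case True
  have "(of_int c * pvar s + of_int c * pvar (Suc s)) * q = of_int c * ((pvar s + pvar (Suc s)) * q)" for q
    by (simp only: distrib_left[symmetric] mult.assoc)
  moreover have "d = c" using True that by simp
  ultimately show ?thesis using True by (simp only: crossop_def dem_of_int_mult dem_symmetric_sum refl if_True)
next
  case False
  then show ?thesis by (simp add: crossop_def algebra_simps)
qed

text \<open>
  Weights that depend on the colour of a strand only follow the strands through a crossing: for different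
  colours the crossing permutes the variables, for equal ones the weighted sum is symmetric.  This handles the
  interaction terms between horizontal factors.
\<close>

lemma rep_wsum:
  "wf_diagram D \<Longrightarrow> rep A D s (wsum u (src D) s * p) = wsum u (tgt D) s * rep A D s p"
proof (induction D arbitrary: s p)
  case (Cross i j)
  show ?case using crossop_wsum[of i j "u i" "u j" A s p] by simp
next
  case (Horiz D D')
  have "rep A D' (s + length (src D)) (wsum u (src D) s * p) = wsum u (src D) s * rep A D' (s + length (src D)) p"
    using Horiz.prems by (intro rep_outside_wsum) auto
  moreover have "rep A D s (wsum u (tgt D') (s + length (src D)) * q) = wsum u (tgt D') (s + length (src D)) * rep A D s q" for q
    using Horiz.prems by (intro rep_outside_wsum) auto
  ultimately show ?case using Horiz length_tgt[of D] by (simp add: wsum_append distrib_right)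
qed (simp_all add: algebra_simps)

section \<open>The derivations in the polynomial representation\<close>

lemma d_diagram_free_hom: "wf_diagram D \<Longrightarrow> d_diagram A D \<in> free_hom (src D) (tgt D)"
proof (induction D)
  case (Cross i j)
  have 1: "frag_of (Vert (dot_at 0 [j, i]) (Cross i j)) \<in> free_hom [i, j] [j, i]"
    by simp
  have 2: "frag_of (Vert (Cross i j) (dot_at (Suc 0) [i, j])) \<in> free_hom [i, j] [j, i]"
    by simp
  from 1 2 show ?case by (auto intro!: free_hom_diff free_hom_minus)
qed (auto intro!: free_hom_add free_hom_vcomp free_hom_hcomp)

lemma z_diagram_free_hom: "wf_diagram D \<Longrightarrow> z_diagram D \<in> free_hom (src D) (tgt D)"
  by (induction D) (auto intro!: free_hom_add free_hom_vcomp free_hom_hcomp)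

lemma d_lin_of [simp]: "d_lin A (frag_of D) = d_diagram A D" by (simp add: d_lin_def)
lemma d_lin_0 [simp]: "d_lin A 0 = 0" by (simp add: d_lin_def)
lemma d_lin_diff [simp]: "d_lin A (f - g) = d_lin A f - d_lin A g" by (simp add: d_lin_def frag_extend_diff)
lemma d_lin_add [simp]: "d_lin A (f + g) = d_lin A f + d_lin A g" by (simp add: d_lin_def frag_extend_add)
lemma z_lin_of [simp]: "z_lin (frag_of D) = z_diagram D" by (simp add: z_lin_def)
lemma z_lin_0 [simp]: "z_lin 0 = 0" by (simp add: z_lin_def)
lemma z_lin_diff [simp]: "z_lin (f - g) = z_lin f - z_lin g" by (simp add: z_lin_def frag_extend_diff)
lemma z_lin_add [simp]: "z_lin (f + g) = z_lin f + z_lin g" by (simp add: z_lin_def frag_extend_add)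
lemma h_lin_of [simp]: "h_lin A (frag_of D) = frag_cmul (deg A D) (frag_of D)" by (simp add: h_lin_def)
lemma h_lin_0 [simp]: "h_lin A 0 = 0" by (simp add: h_lin_def)
lemma h_lin_diff [simp]: "h_lin A (f - g) = h_lin A f - h_lin A g" by (simp add: h_lin_def frag_extend_diff)
lemma h_lin_add [simp]: "h_lin A (f + g) = h_lin A f + h_lin A g" by (simp add: h_lin_def frag_extend_add)

lemma d_lin_free_hom: "f \<in> free_hom a b \<Longrightarrow> d_lin A f \<in> free_hom a b"
  by (induction rule: free_hom_induct) (use d_diagram_free_hom in \<open>auto intro: free_hom_diff\<close>)
lemma z_lin_free_hom: "f \<in> free_hom a b \<Longrightarrow> z_lin f \<in> free_hom a b"
  by (induction rule: free_hom_induct) (use z_diagram_free_hom in \<open>auto intro: free_hom_diff\<close>)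
lemma h_lin_free_hom: "f \<in> free_hom a b \<Longrightarrow> h_lin A f \<in> free_hom a b"
  by (induction rule: free_hom_induct) (auto simp: free_hom_def keys_cmul_iff in_keys_iff lookup_minus h_lin_diff)

lemma rep_lin_cmul: "rep_lin A (frag_cmul c f) s p = of_int c * rep_lin A f s p"
  by (simp add: rep_lin_def frag_extend_cmul frag_cmul_eq_mult)

lemma sw_permutes: "Suc k < n \<Longrightarrow> sw k permutes {..<n}"
  by (rule permutes_swap_id) auto

text \<open>
  All three identities come from applying the vector field to the equation that defines \<open>dem\<close>; the
  correction is the quotient of \<open>x\<^sub>k\<^sup>e - x\<^bsub>k+1\<^esub>\<^sup>e\<close> by
  \<open>x\<^sub>k - x\<^bsub>k+1\<^esub>\<close>.
\<close>

lemma vfield_dem: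
  assumes "Suc k < n"
  shows "vfield 0 n (dem k p) = dem k (vfield 0 n p)"
    "vfield 1 n (dem k p) = dem k (vfield 1 n p) - dem k p"
    "vfield 2 n (dem k p) = dem k (vfield 2 n p) - (pvar k + pvar (Suc k)) * dem k p"
proof -
  have e: "vfield e n ((pvar k - pvar (Suc k)) * dem k p) = vfield e n p - pact (sw k) (vfield e n p)" for e
    by (simp only: dem vfield_diff vfield_pact[OF sw_permutes[OF assms]])
  have *: "dem k (vfield e n p) = g + vfield e n (dem k p)"
    if "(pvar k ^ e - pvar (Suc k) ^ e) * dem k p = (pvar k - pvar (Suc k)) * g" for e g
    using e[of e] assms that by (intro dem_eqI) (simp add: vfield_mult distrib_left)
  show "vfield 0 n (dem k p) = dem k (vfield 0 n p)"
    using *[of 0 0] by simp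
  show "vfield 1 n (dem k p) = dem k (vfield 1 n p) - dem k p"
    using *[of 1 "dem k p"] by simp
  show "vfield 2 n (dem k p) = dem k (vfield 2 n p) - (pvar k + pvar (Suc k)) * dem k p"
    using *[of 2 "(pvar k + pvar (Suc k)) * dem k p"] by (simp add: power2_eq_square algebra_simps)
qed

text \<open>
  The operators on polynomials that represent \<open>\<d>\<close> and \<open>\<h>\<close> by commutators; for
  \<open>\<z>\<close> the vector field \<open>vfield 0 n\<close> needs no twist.
\<close>

definition dop :: "('v \<times> 'v) set \<Rightarrow> nat \<Rightarrow> 'v list \<Rightarrow> nat \<Rightarrow> zpoly \<Rightarrow> zpoly" where
  "dop A n a s p = vfield 2 n p + pot A a s * p"

definition hop :: "('v \<times> 'v) set \<Rightarrow> nat \<Rightarrow> 'v list \<Rightarrow> zpoly \<Rightarrow> zpoly" where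
  "hop A n a p = 2 * vfield 1 n p + of_int (pot0 A a) * p"

text \<open>
  Commutators with a family of operators, one for each word, satisfy the Leibniz rule for vertical composition
  automatically; what has to be checked are the generators and the additivity of the potential along horizontal
  composition.
\<close>

lemma rep_z_diagram:
  assumes "wf_diagram D" "s + length (src D) \<le> n"
  shows "rep_lin A (z_diagram D) s p = vfield 0 n (rep A D s p) - rep A D s (vfield 0 n p)"
  using assms
proof (induction D arbitrary: s p)
  case (Cross i j)
  then have k: "Suc s < n" by simp
  show ?case using k
    by (simp add: crossop_def vfield_dem[OF k] vfield_mult vfield_pact[OF sw_permutes[OF k]] qfac_def)
next
  case (Vert D D')
  then show ?case using length_tgt[of D'] by (simp add: rep_lin_vcomp)
next
  case (Horiz D D')
  have "rep_lin A (z_diagram D) s q = vfield 0 n (rep A D s q) - rep A D s (vfield 0 n q)" for q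
    using Horiz by auto
  moreover have "rep_lin A (z_diagram D') (s + length (src D)) p =
     vfield 0 n (rep A D' (s + length (src D)) p) - rep A D' (s + length (src D)) (vfield 0 n p)"
    using Horiz by auto
  ultimately show ?case using Horiz.prems z_diagram_free_hom[of D]
    by (simp add: rep_lin_hcomp[of _ "src D" "tgt D"])
qed (simp_all add: vfield_mult)

lemma rep_h_diagram:
  assumes "asym A" "wf_diagram D" "s + length (src D) \<le> n"
  shows "of_int (deg A D) * rep A D s p = hop A n (tgt D) (rep A D s p) - rep A D s (hop A n (src D) p)"
  using assms(2,3)
proof (induction D arbitrary: s p)
  case (Cross i j)
  then have k: "Suc s < n" by simp
  have "(i, i) \<notin> A" "(i, j) \<in> A \<Longrightarrow> (j, i) \<notin> A" using assms(1) by (auto dest: asymD)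
  have d2: "dem s (2 * q) = 2 * dem s q" for q using dem_of_int_mult[of s 2 q] by simp
  have p2: "pact (sw s) (2 * q) = 2 * pact (sw s) q" for q by (simp only: mult_2 pact_add)
  have c: "cfac A x x = -1" for x by (simp add: cfac_def)
  consider "i = j" | "i \<noteq> j" "(i, j) \<in> A" "(j, i) \<notin> A" | "i \<noteq> j" "(j, i) \<in> A" "(i, j) \<notin> A"
    | "i \<noteq> j" "(i, j) \<notin> A" "(j, i) \<notin> A" using asymD[OF assms(1)] by blast
  then show ?case
  proof cases
    case 1
    then show ?thesis
      by (simp add: hop_def cart_def c crossop_def vfield_dem[OF k] d2 right_diff_distrib del: One_nat_def)
  next
    case 2
    then show ?thesis
      by (simp add: hop_def cart_def cfac_def adjacent_def crossop_def vfield_pact[OF sw_permutes[OF k]]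
        p2 qfac_def del: One_nat_def)
  next
    case 3
    have "2 * ((pvar s - pvar (Suc s)) * q) - (pvar s - pvar (Suc s)) * q = (pvar s - pvar (Suc s)) * q" for q
      by (simp only: mult_2) simp
    then show ?thesis using 3 k
      by (simp add: hop_def cart_def cfac_def adjacent_def crossop_def vfield_mult vfield_pact[OF sw_permutes[OF k]]
        p2 qfac_def distrib_left mult.left_commute[of 2] del: One_nat_def)
  next
    case 4
    then show ?thesis
      by (simp add: hop_def cart_def cfac_def adjacent_def crossop_def vfield_pact[OF sw_permutes[OF k]]
        p2 qfac_def del: One_nat_def)
  qed
next
  case (Vert D D')
  then have 1: "of_int (deg A D) * rep A D s q = hop A n (tgt D) (rep A D s q) - rep A D s (hop A n (src D) q)" for q
    using length_tgt[of D'] by auto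
  have 2: "of_int (deg A D') * rep A D' s p = hop A n (tgt D') (rep A D' s p) - rep A D' s (hop A n (src D') p)"
    using Vert by auto
  have "of_int (deg A (Vert D D')) * rep A (Vert D D') s p =
    of_int (deg A D) * rep A D s (rep A D' s p) + rep A D s (of_int (deg A D') * rep A D' s p)"
    by (simp add: distrib_right rep_of_int_mult)
  also have "\<dots> = hop A n (tgt D) (rep A D s (rep A D' s p)) - rep A D s (rep A D' s (hop A n (src D') p))"
    unfolding 1 2 using Vert.prems by simp
  finally show ?case by simp
next
  case (Horiz D D')
  let ?s = "s + length (src D)"
  have 1: "of_int (deg A D) * rep A D s q = hop A n (tgt D) (rep A D s q) - rep A D s (hop A n (src D) q)" for q
    using Horiz by auto
  have 2: "of_int (deg A D') * rep A D' ?s p =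
     hop A n (tgt D') (rep A D' ?s p) - rep A D' ?s (hop A n (src D') p)"
    using Horiz by auto
  have 4: "(\<Sum>i\<leftarrow>tgt D. \<Sum>j\<leftarrow>tgt D'. cfac A i j) = (\<Sum>i\<leftarrow>src D. \<Sum>j\<leftarrow>src D'. cfac A i j)"
    using Horiz.prems by (simp add: sum_list_tgt)
  have 5: "rep A D s (2 * q) = 2 * rep A D s q" "rep A D' t (2 * q) = 2 * rep A D' t q" for q t
    using rep_of_int_mult[of A D s 2 q] rep_of_int_mult[of A D' t 2 q] by simp_all
  have "of_int (deg A (Horiz D D')) * rep A (Horiz D D') s p =
    of_int (deg A D) * rep A D s (rep A D' ?s p) + rep A D s (of_int (deg A D') * rep A D' ?s p)"
    by (simp add: distrib_right rep_of_int_mult)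
  also have "\<dots> = hop A n (tgt (Horiz D D')) (rep A (Horiz D D') s p) - rep A (Horiz D D') s (hop A n (src (Horiz D D')) p)"
    unfolding 1 2
    by (simp only: hop_def tgt.simps src.simps rep.simps pot0_append 4 of_int_add distrib_right rep_of_int_mult 5 rep_add rep_diff) simp
  finally show ?case .
next
  case (Dot i)
  then show ?case by (simp add: hop_def vfield_mult distrib_left)
qed (simp add: hop_def)

text \<open>
  For \<open>a @ b\<close> the potential is that of \<open>a\<close>, plus that of \<open>b\<close>, plus
  interaction terms in the variables of \<open>a\<close>.  The interaction depends on \<open>b\<close> only
  through the multiset of its colours, which diagrams preserve, so it passes through diagrams on either factor.
\<close>

lemma rep_d_diagram:
  assumes "asym A" "wf_diagram D" "s + length (src D) \<le> n"
  shows "rep_lin A (d_diagram A D) s p = dop A n (tgt D) s (rep A D s p) - rep A D s (dop A n (src D) s p)"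
  using assms(2,3)
proof (induction D arbitrary: s p)
  case (Dot i)
  then show ?case by (simp add: dop_def vfield_mult power2_eq_square algebra_simps)
next
  case (Cross i j)
  then have k: "Suc s < n" by simp
  have A: "(i, i) \<notin> A" "(i, j) \<in> A \<Longrightarrow> (j, i) \<notin> A" using assms(1) by (auto dest: asymD)
  consider "i = j" | "i \<noteq> j" "(i, j) \<in> A" | "i \<noteq> j" "(j, i) \<in> A" | "i \<noteq> j" "(i, j) \<notin> A" "(j, i) \<notin> A" by blast
  then show ?case
  proof cases
    case 1
    then show ?thesis using k
      by (simp add: dop_def cfac_def crossop_def vfield_dem[OF k] dem_mult algebra_simps)
  next
    case 2
    then show ?thesis using k A
      by (simp add: dop_def cfac_def adjacent_def crossop_def vfield_mult vfield_pact[OF sw_permutes[OF k]]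
          qfac_def algebra_simps)
  next
    case 3
    then have "(i, j) \<notin> A" using A by blast
    with 3 show ?thesis using k
      by (simp add: dop_def cfac_def adjacent_def crossop_def vfield_mult vfield_pact[OF sw_permutes[OF k]]
          qfac_def power2_eq_square algebra_simps)
  next
    case 4
    then show ?thesis using k A
      by (simp add: dop_def cfac_def adjacent_def crossop_def vfield_mult vfield_pact[OF sw_permutes[OF k]]
          qfac_def)
  qed
next
  case (Vert D D')
  then show ?case using length_tgt[of D'] by (simp add: rep_lin_vcomp)
next
  case (Horiz D D')
  let ?s = "s + length (src D)"
  have 1: "rep_lin A (d_diagram A D) s q = dop A n (tgt D) s (rep A D s q) - rep A D s (dop A n (src D) s q)" for q
    using Horiz by auto
  have 2: "rep_lin A (d_diagram A D') ?s p =
     dop A n (tgt D') ?s (rep A D' ?s p) - rep A D' ?s (dop A n (src D') ?s p)"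
    using Horiz by auto
  have 3: "rep A D s (pot A a ?s * q) = pot A a ?s * rep A D s q" for a q
    using Horiz.prems by (intro rep_outside_pot) auto
  have 4: "rep A D' ?s (pot A (src D) s * q) = pot A (src D) s * rep A D' ?s q"
     "rep A D' ?s (wsum u (src D) s * q) = wsum u (src D) s * rep A D' ?s q" for q u
    using Horiz.prems by (intro rep_outside_pot rep_outside_wsum; auto)+
  have 5: "(\<lambda>i. \<Sum>j\<leftarrow>tgt D'. cfac A i j) = (\<lambda>i. \<Sum>j\<leftarrow>src D'. cfac A i j)"
    using Horiz.prems by (simp add: sum_list_tgt)
  have L: "rep_lin A (d_diagram A (Horiz D D')) s p = rep_lin A (d_diagram A D) s (rep A D' ?s p)
     + rep A D s (rep_lin A (d_diagram A D') ?s p)"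
    using Horiz.prems d_diagram_free_hom[of D A]
    by (simp add: rep_lin_hcomp[of _ "src D" "tgt D"])
  have t: "length (tgt D) = length (src D)" using Horiz.prems length_tgt by auto
  have w: "rep A D s (wsum u (src D) s * q) = wsum u (tgt D) s * rep A D s q" for u q
    using Horiz.prems rep_wsum[of D] by auto
  show ?case unfolding L 1 2
    by (simp only: dop_def pot_append t 5 3 4 w distrib_right src.simps tgt.simps rep.simps rep_add rep_diff) simp
qed (simp_all add: dop_def)

lemma rep_z_lin:
  assumes "f \<in> free_hom a b" "s + length a \<le> n"
  shows "rep_lin A (z_lin f) s p = vfield 0 n (rep_lin A f s p) - rep_lin A f s (vfield 0 n p)"
  using assms by (induction rule: free_hom_induct) (simp_all add: rep_z_diagram)

lemma hop_diff [simp]: "hop A n a (p - q) = hop A n a p - hop A n a q"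
  by (simp add: hop_def algebra_simps)
lemma dop_diff [simp]: "dop A n a s (p - q) = dop A n a s p - dop A n a s q"
  by (simp add: dop_def algebra_simps)
lemma hop_0 [simp]: "hop A n a 0 = 0" by (simp add: hop_def)
lemma dop_0 [simp]: "dop A n a s 0 = 0" by (simp add: dop_def)

lemma rep_h_lin:
  assumes "asym A" "f \<in> free_hom a b" "s + length a \<le> n"
  shows "rep_lin A (h_lin A f) s p = hop A n b (rep_lin A f s p) - rep_lin A f s (hop A n a p)"
  using assms(2,3) by (induction rule: free_hom_induct) (auto simp: rep_lin_cmul rep_h_diagram[OF assms(1)])

lemma rep_d_lin:
  assumes "asym A" "f \<in> free_hom a b" "s + length a \<le> n"
  shows "rep_lin A (d_lin A f) s p = dop A n b s (rep_lin A f s p) - rep_lin A f s (dop A n a s p)"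
  using assms(2,3) by (induction rule: free_hom_induct) (auto simp: rep_d_diagram[OF assms(1)])

section \<open>The relations between twisted vector fields\<close>

text \<open>
  A commutator of derivations is a derivation, so it suffices to compare values on variables.
\<close>

lemma vfield_commutators:
  "vfield 0 n (vfield 2 n p) - vfield 2 n (vfield 0 n p) = 2 * vfield 1 n p"
  "vfield 1 n (vfield 2 n p) - vfield 2 n (vfield 1 n p) = vfield 2 n p"
  "vfield 1 n (vfield 0 n p) - vfield 0 n (vfield 1 n p) = - vfield 0 n p"
proof -
  have *: "vfield e n (vfield f n p) - vfield f n (vfield e n p) = c * vfield g n p"
    if "\<And>k. vfield e n (pvar k ^ f) - vfield f n (pvar k ^ e) = c * pvar k ^ g \<or> \<not> k < n" for e f g and c :: zpoly
  proof (induction p rule: zpoly_induct)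
    case one show ?case by simp
  next
    case (var k) then show ?case using that[of k] by auto
  next
    case (mult a b)
    have "vfield e n (vfield f n (a * b)) - vfield f n (vfield e n (a * b)) =
      (vfield e n (vfield f n a) - vfield f n (vfield e n a)) * b + a * (vfield e n (vfield f n b) - vfield f n (vfield e n b))"
      by (simp only: vfield_mult vfield_add left_diff_distrib right_diff_distrib) simp
    then show ?case unfolding mult by (simp only: vfield_mult distrib_left mult.assoc mult.left_commute[of a])
  next
    case (diff a b)
    have "vfield e n (vfield f n (a - b)) - vfield f n (vfield e n (a - b)) =
      (vfield e n (vfield f n a) - vfield f n (vfield e n a)) - (vfield e n (vfield f n b) - vfield f n (vfield e n b))"
      by simp
    then show ?case unfolding diff by (simp only: vfield_diff right_diff_distrib)
  qed
  have sq: "vfield e n (pvar k ^ 2) = 2 * pvar k * vfield e n (pvar k)" for e k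
    by (simp only: power2_eq_square vfield_mult mult_2 distrib_right
        mult.commute[of "vfield e n (pvar k)"])
  show "vfield 0 n (vfield 2 n p) - vfield 2 n (vfield 0 n p) = 2 * vfield 1 n p"
    by (rule *) (simp add: sq)
  show "vfield 1 n (vfield 2 n p) - vfield 2 n (vfield 1 n p) = vfield 2 n p"
  proof -
    have "vfield 1 n (pvar k ^ 2) - vfield 2 n (pvar k ^ 1) = 1 * pvar k ^ 2 \<or> \<not> k < n" for k
    proof -
      have "2 * x * x - x ^ 2 = 1 * x ^ 2" for x :: zpoly
        by (simp only: power2_eq_square mult_2 distrib_right add_diff_cancel_right' mult_1)
      then show ?thesis by (simp only: sq vfield_pvar power_one_right) simp
    qed
    from *[OF this] show ?thesis by simp
  qed
  show "vfield 1 n (vfield 0 n p) - vfield 0 n (vfield 1 n p) = - vfield 0 n p"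
    using *[of 1 0 "-1" 0] by simp
qed

lemma vfield_pot:
  assumes "s + length a \<le> n"
  shows "vfield 0 n (pot A a s) = of_int (pot0 A a)" "vfield 1 n (pot A a s) = pot A a s"
  using assms by (induction a arbitrary: s) (auto simp: vfield_mult)

text \<open>
  The potential is linear in the variables, so \<open>\<Sum>\<partial>\<^sub>k\<close> maps it to its
  coefficient sum and the Euler field fixes it; hence the twist does not disturb the commutators of the vector
  fields.
\<close>

lemma op_commutators:
  assumes "length a \<le> n"
  shows "vfield 0 n (dop A n a 0 p) - dop A n a 0 (vfield 0 n p) = hop A n a p"
    "hop A n a (dop A n a 0 p) - dop A n a 0 (hop A n a p) = 2 * dop A n a 0 p"
    "hop A n a (vfield 0 n p) - vfield 0 n (hop A n a p) = - 2 * vfield 0 n p"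
proof -
  have two: "vfield e n (2 * p) = 2 * vfield e n p" for e p
    by (simp only: mult_2 vfield_add)
  have p: "vfield 0 n (pot A a 0) = of_int (pot0 A a)" "vfield 1 n (pot A a 0) = pot A a 0"
    using vfield_pot[of 0 a n A] assms by auto
  have numeral: "vfield e n 2 = 0" for e using vfield_of_int[of e n 2] by simp
  note exp = numeral dop_def hop_def vfield_add vfield_diff vfield_mult p two distrib_left right_diff_distrib vfield_of_int
    mult_zero_left add_0_left mult.left_commute[of "pot A a 0"]
  show "vfield 0 n (dop A n a 0 p) - dop A n a 0 (vfield 0 n p) = hop A n a p"
    by (simp only: exp vfield_commutators(1)[symmetric]) simp
  have "hop A n a (dop A n a 0 p) - dop A n a 0 (hop A n a p) =
     2 * (vfield 1 n (vfield 2 n p) - vfield 2 n (vfield 1 n p)) + 2 * (pot A a 0 * p)"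
    by (simp only: exp) simp
  then show "hop A n a (dop A n a 0 p) - dop A n a 0 (hop A n a p) = 2 * dop A n a 0 p"
    unfolding vfield_commutators by (simp only: dop_def distrib_left)
  have "hop A n a (vfield 0 n p) - vfield 0 n (hop A n a p) = 2 * (vfield 1 n (vfield 0 n p) - vfield 0 n (vfield 1 n p))"
    by (simp only: exp) simp
  then show "hop A n a (vfield 0 n p) - vfield 0 n (hop A n a p) = - 2 * vfield 0 n p"
    unfolding vfield_commutators by simp
qed

section \<open>Inversions and length\<close>

abbreviation winv :: "(nat \<Rightarrow> nat) \<Rightarrow> nat \<Rightarrow> nat" where "winv w \<equiv> inv_into UNIV w"

definition Inv :: "nat \<Rightarrow> (nat \<Rightarrow> nat) \<Rightarrow> (nat \<times> nat) set" where
  "Inv n v = {(p, q). p < q \<and> q < n \<and> v q < v p}"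

text \<open>
  The inverse makes \<open>ell\<close> count inversions by the top positions of the strands, to which the
  variables in the leading coefficients below belong.  It is identified with \<open>cox_length\<close> below.
\<close>

definition ell :: "nat \<Rightarrow> (nat \<Rightarrow> nat) \<Rightarrow> nat" where
  "ell n w = card (Inv n (winv w))"

lemma finite_Inv [simp]: "finite (Inv n v)"
  by (rule finite_subset[of _ "{..<n} \<times> {..<n}"]) (auto simp: Inv_def)

text \<open>
  Exchanging the values at \<open>P < Q\<close> when they are in increasing order creates the inversion
  \<open>(P, Q)\<close> and loses none: an old inversion is moved by the transposition if the moved pair is
  still ordered, and stays an inversion otherwise.
\<close>

lemma card_Inv_transpose:
  assumes "inj v" "P < Q" "Q < n" "v P < v Q"
  shows "card (Inv n v) < card (Inv n (v \<circ> transpose P Q))"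
proof -
  let ?t = "transpose P Q"
  define \<phi> where "\<phi> = (\<lambda>(p, q). if ?t p < ?t q then (?t p, ?t q) else (p, q))"
  have inj: "inj_on \<phi> (Inv n v)"
  proof (rule inj_onI)
    fix x y assume "x \<in> Inv n v" "y \<in> Inv n v" "\<phi> x = \<phi> y"
    then show "x = y"
      by (cases x; cases y) (auto simp: \<phi>_def Inv_def split: if_splits dest: arg_cong[of _ _ "transpose P Q"])
  qed
  have sub: "\<phi> ` Inv n v \<subseteq> Inv n (v \<circ> ?t) - {(P, Q)}"
  proof (rule image_subsetI)
    fix x assume "x \<in> Inv n v"
    then obtain p q where x: "x = (p, q)" and pq: "(p, q) \<in> Inv n v" by (cases x) auto
    then have l: "p < q" "q < n" "v q < v p" by (auto simp: Inv_def)
    have "\<phi> (p, q) \<in> Inv n (v \<circ> ?t) - {(P, Q)}"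
    proof (cases "?t p < ?t q")
      case True
      have "?t q < n" using l assms by (auto simp: transpose_def)
      moreover have "(?t p, ?t q) \<noteq> (P, Q)" using l assms(2) by (auto simp: transpose_def split: if_splits)
      ultimately show ?thesis using True l by (auto simp: \<phi>_def Inv_def)
    next
      case False
      then show ?thesis using l assms by (auto simp: \<phi>_def Inv_def transpose_def split: if_splits)
    qed
    then show "\<phi> x \<in> Inv n (v \<circ> ?t) - {(P, Q)}" by (simp only: x)
  qed
  have PQ: "(P, Q) \<in> Inv n (v \<circ> ?t)" using assms by (auto simp: Inv_def)
  have "card (Inv n v) = card (\<phi> ` Inv n v)" using inj by (simp add: card_image)
  also have "\<dots> \<le> card (Inv n (v \<circ> ?t) - {(P, Q)})" by (intro card_mono sub) auto
  also have "\<dots> < card (Inv n (v \<circ> ?t))" using PQ by (intro psubset_card_mono) auto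
  finally show ?thesis .
qed

lemma Inv_sw:
  assumes "bij v" "v p0 = k" "v q0 = Suc k" "p0 < q0" "q0 < n"
  shows "Inv n (sw k \<circ> v) = insert (p0, q0) (Inv n v)" "(p0, q0) \<notin> Inv n v"
proof -
  have i: "v p = k \<longleftrightarrow> p = p0" "v p = Suc k \<longleftrightarrow> p = q0" for p
    using inj_eq[OF bij_is_inj[OF assms(1)], of p p0] inj_eq[OF bij_is_inj[OF assms(1)], of p q0] assms(2,3) by simp_all
  have "sw k (v q) < sw k (v p) \<longleftrightarrow> (p = p0 \<and> q = q0) \<or> v q < v p" if "p < q" for p q
  proof -
    consider "v p = k" "v q = Suc k" | "v p = Suc k" "v q = k" | "v p = k" "v q \<noteq> k" "v q \<noteq> Suc k"
      | "v p = Suc k" "v q \<noteq> k" "v q \<noteq> Suc k" | "v q = k" "v p \<noteq> k" "v p \<noteq> Suc k"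
      | "v q = Suc k" "v p \<noteq> k" "v p \<noteq> Suc k" | "v p \<noteq> k" "v p \<noteq> Suc k" "v q \<noteq> k" "v q \<noteq> Suc k"
      | "v p = v q" by fastforce
    then show ?thesis
      using that assms(4) i[of p] i[of q] by cases (simp_all add: transpose_apply_other, arith+)
  qed
  then show "Inv n (sw k \<circ> v) = insert (p0, q0) (Inv n v)"
    using assms by (auto simp: Inv_def)
  show "(p0, q0) \<notin> Inv n v" using assms by (auto simp: Inv_def)
qed

lemma winv_winv [simp]: "bij w \<Longrightarrow> winv w (w k) = k" "bij w \<Longrightarrow> w (winv w k) = k"
  by (simp_all add: bij_is_inj bij_is_surj surj_f_inv_f)

lemma winv_comp: "bij u \<Longrightarrow> bij w \<Longrightarrow> winv (u \<circ> w) = winv w \<circ> winv u"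
  by (rule o_inv_distrib)

lemma winv_transpose [simp]: "winv (transpose a b) = transpose a b"
  by (rule inv_unique_comp) auto

lemma Inv_winv_sw:
  assumes "w permutes {..<n}" "Suc k < n" "w k < w (Suc k)"
  shows "Inv n (winv (w \<circ> sw k)) = insert (w k, w (Suc k)) (Inv n (winv w))"
    "(w k, w (Suc k)) \<notin> Inv n (winv w)"
proof -
  have b: "bij w" using assms by (simp add: permutes_bij)
  have q: "w (Suc k) < n" using permutes_in_image[OF assms(1), of "Suc k"] assms by auto
  have e: "winv (w \<circ> sw k) = sw k \<circ> winv w" using b by (simp add: winv_comp)
  show "Inv n (winv (w \<circ> sw k)) = insert (w k, w (Suc k)) (Inv n (winv w))"
    "(w k, w (Suc k)) \<notin> Inv n (winv w)"
    unfolding e using Inv_sw[of "winv w" "w k" k "w (Suc k)" n] b q assms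
    by (simp_all only: bij_imp_bij_inv winv_winv simp_thms)
qed

lemma ell_sw:
  assumes "w permutes {..<n}" "Suc k < n"
  shows "ell n (w \<circ> sw k) = (if w k < w (Suc k) then Suc (ell n w) else ell n w - 1)"
    "\<not> w k < w (Suc k) \<Longrightarrow> 0 < ell n w"
proof -
  have up: "ell n (u \<circ> sw k) = Suc (ell n u)" if "u permutes {..<n}" "u k < u (Suc k)" for u
    using Inv_winv_sw[OF that(1) assms(2) that(2)] by (simp add: ell_def)
  have p: "w \<circ> sw k permutes {..<n}"
    using assms sw_permutes by (intro permutes_compose)
  have "w k \<noteq> w (Suc k)" using assms(1) by (metis n_not_Suc_n permutes_inj injD)
  moreover have "w \<circ> sw k \<circ> sw k = w" by (simp add: comp_assoc)
  ultimately show "ell n (w \<circ> sw k) = (if w k < w (Suc k) then Suc (ell n w) else ell n w - 1)"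
    "\<not> w k < w (Suc k) \<Longrightarrow> 0 < ell n w"
    using up[OF assms(1)] up[OF p] by auto
qed

lemma ell_transpose:
  assumes "w permutes {..<n}" "a < b" "b < n"
  shows "ell n w < ell n (w \<circ> transpose a b) \<longleftrightarrow> w a < w b"
proof -
  have up: "ell n u < ell n (u \<circ> transpose a b)" if u: "u permutes {..<n}" and l: "u a < u b" for u
  proof -
    have b: "bij u" using u by (simp add: permutes_bij)
    have "winv (u \<circ> transpose a b) = winv u \<circ> transpose (u a) (u b)"
      using b by (auto simp: winv_comp fun_eq_iff transpose_def)
    moreover have "u b < n" using u assms permutes_in_image[OF u, of b] by auto
    ultimately show ?thesis
      using card_Inv_transpose[of "winv u" "u a" "u b" n] b l assms
      by (simp add: ell_def bij_imp_bij_inv bij_is_inj)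
  qed
  have p: "w \<circ> transpose a b permutes {..<n}"
    using assms by (intro permutes_compose permutes_swap_id) auto
  have "w a \<noteq> w b" using assms by (metis less_irrefl permutes_inj injD)
  moreover have "w \<circ> transpose a b \<circ> transpose a b = w" by (simp add: comp_assoc)
  ultimately show ?thesis using up[OF assms(1)] up[OF p]
    by (metis comp_apply linorder_neqE_nat order.asym transpose_apply_first transpose_apply_second)
qed

section \<open>Words and normal forms\<close>

lemma word_perm_append: "word_perm (ks @ ls) = word_perm ks \<circ> word_perm ls"
  by (induction ks) (simp_all add: comp_assoc)

lemma word_perm_snoc: "word_perm (ks @ [k]) = word_perm ks \<circ> sw k"
  by (simp only: word_perm_append word_perm.simps comp_id)

lemma word_perm_permutes: "\<forall>k\<in>set ks. Suc k < n \<Longrightarrow> word_perm ks permutes {..<n}"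
  by (induction ks) (auto intro!: permutes_compose sw_permutes permutes_id simp del: id_apply)

lemma bij_word_perm [simp]: "bij (word_perm ks)"
proof (induction ks)
  case Nil show ?case by (simp only: word_perm.simps bij_id)
next
  case (Cons k ks) show ?case by (simp only: word_perm.simps bij_comp[OF Cons bij_sw])
qed

lemma word_perm_rev: "word_perm (rev ks) \<circ> word_perm ks = id" "word_perm ks \<circ> word_perm (rev ks) = id"
proof -
  show 1: "word_perm (rev ks) \<circ> word_perm ks = id" for ks
  proof (induction ks)
    case (Cons k ks)
    have "word_perm (rev (k # ks)) \<circ> word_perm (k # ks) =
      word_perm (rev ks) \<circ> (sw k \<circ> sw k) \<circ> word_perm ks"
      by (simp only: rev.simps word_perm_append word_perm.simps comp_assoc comp_id)
    also have "\<dots> = word_perm (rev ks) \<circ> word_perm ks" by (simp only: transpose_comp_involutory comp_id)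
    finally show ?case unfolding Cons .
  qed (simp only: rev.simps word_perm.simps comp_id)
  show "word_perm ks \<circ> word_perm (rev ks) = id" using 1[of "rev ks"] by (simp only: rev_rev_ident)
qed

lemma ell_word_le: "\<forall>k\<in>set ks. Suc k < n \<Longrightarrow> ell n (word_perm ks) \<le> length ks"
proof (induction ks rule: rev_induct)
  case Nil
  have "winv id = id" by (rule inv_unique_comp) auto
  moreover have "Inv n id = {}" by (auto simp: Inv_def)
  ultimately show ?case by (simp only: ell_def word_perm.simps card.empty list.size order_refl)
next
  case (snoc k ks)
  then have k: "Suc k < n" "\<forall>k\<in>set ks. Suc k < n" by auto
  have "ell n (word_perm ks \<circ> sw k) \<le> Suc (ell n (word_perm ks))"
    using ell_sw(1)[OF word_perm_permutes[OF k(2)] k(1)] by presburger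
  then show ?case using snoc.IH[OF k(2)] unfolding word_perm_snoc length_append_singleton by linarith
qed

text \<open>
  The normal form that moves the strand ending at the top position \<open>w m\<close> last: \<open>[w
  m..<m]\<close> carries the strand \<open>m\<close> to its place, after a normal form on the strands below
  \<open>m\<close>.
\<close>

fun nf :: "nat \<Rightarrow> (nat \<Rightarrow> nat) \<Rightarrow> nat list" where
  "nf 0 w = []"
| "nf (Suc m) w = [w m..<m] @ nf m (word_perm (rev [w m..<m]) \<circ> w)"

lemma word_perm_upt_top: "r \<le> m \<Longrightarrow> word_perm [r..<m] m = r"
proof (induction r rule: inc_induct)
  case (step r)
  then show ?case by (simp add: upt_conv_Cons)
qed simp

lemma word_perm_fixes: "\<forall>k\<in>set ks. p < k \<or> Suc k < p \<Longrightarrow> word_perm ks p = p"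
  by (induction ks) (auto simp: transpose_apply_other)

lemma nf_step_permutes:
  assumes "w permutes {..<Suc m}"
  shows "word_perm (rev [w m..<m]) \<circ> w permutes {..<m}" "w m \<le> m"
proof -
  show le: "w m \<le> m" using permutes_in_image[OF assms, of m] by auto
  let ?u = "word_perm (rev [w m..<m]) \<circ> w"
  have "?u permutes {..<Suc m}"
    by (intro permutes_compose assms word_perm_permutes) auto
  moreover have "?u m = m"
    using word_perm_upt_top[OF le] fun_cong[OF word_perm_rev(1)[of "[w m..<m]"], of m] by simp
  moreover have "x \<in> {..<Suc m} - {..<m} \<Longrightarrow> x = m" for x by auto
  ultimately show "?u permutes {..<m}"
    by (metis permutes_superset)
qed

lemma nf_word:
  "w permutes {..<m} \<Longrightarrow> word_perm (nf m w) = w \<and> (\<forall>k\<in>set (nf m w). Suc k < m)"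
proof (induction m arbitrary: w)
  case (Suc m)
  note p = nf_step_permutes[OF Suc.prems]
  define u where "u = word_perm (rev [w m..<m]) \<circ> w"
  have w: "word_perm [w m..<m] \<circ> u = w"
    unfolding u_def by (simp only: comp_assoc[symmetric] word_perm_rev id_comp)
  have "word_perm (nf m u) = u" "\<forall>k\<in>set (nf m u). Suc k < m"
    using Suc.IH[of u] p unfolding u_def by blast+
  then show ?case using w by (auto simp: word_perm_append simp flip: u_def)
qed simp

lemma nf_append:
  assumes "w permutes {..<m}" "r \<le> m"
  shows "[r..<m] @ nf m w = nf (Suc m) (word_perm [r..<m] \<circ> w)"
proof -
  have "w m = m" using assms(1) by (simp add: permutes_not_in)
  then have "(word_perm [r..<m] \<circ> w) m = r" using word_perm_upt_top[OF assms(2)] by simp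
  moreover have "word_perm (rev [r..<m]) \<circ> (word_perm [r..<m] \<circ> w) = w"
    by (simp only: comp_assoc[symmetric] word_perm_rev id_comp)
  ultimately show ?thesis by (simp add: comp_assoc)
qed

text \<open>
  Each letter of \<open>[r..<m]\<close> makes the strand \<open>m\<close> cross one that it has not crossed
  before.
\<close>

lemma ell_upt_ge:
  assumes "w permutes {..<m}" "m < n" "r \<le> m"
  shows "m - r + ell n w \<le> ell n (word_perm [r..<m] \<circ> w)"
  using assms(3)
proof (induction r rule: inc_induct)
  case (step r)
  let ?u = "word_perm [Suc r..<m] \<circ> w"
  have b: "bij w" "bij ?u" using assms(1) by (auto simp: permutes_bij bij_comp)
  have wm: "w m = m" using assms(1) by (simp add: permutes_not_in)
  have "?u m = Suc r" using wm word_perm_upt_top[of "Suc r" m] step by simp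
  then have 1: "winv ?u (Suc r) = m" using b by (metis winv_winv(1))
  have "?u (winv w r) = r" using b word_perm_fixes[of "[Suc r..<m]" r] by auto
  then have 2: "winv ?u r = winv w r" using b by (metis winv_winv(1))
  have "winv w r < m" using permutes_in_image[OF permutes_inv[OF assms(1)], of r] step by auto
  then have "card (Inv n (winv ?u)) < card (Inv n (winv ?u \<circ> sw r))"
    using 1 2 b step assms by (intro card_Inv_transpose) (auto simp: bij_imp_bij_inv bij_is_inj)
  moreover have "winv (word_perm [r..<m] \<circ> w) = winv ?u \<circ> sw r"
  proof -
    have "word_perm [r..<m] \<circ> w = sw r \<circ> ?u" using step by (simp add: upt_conv_Cons comp_assoc)
    then show ?thesis using winv_comp[OF bij_sw b(2)] by (simp only: winv_transpose)
  qed
  ultimately have "ell n ?u < ell n (word_perm [r..<m] \<circ> w)" by (simp only: ell_def)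
  then show ?case using step by linarith
qed (simp add: ell_def)

lemma length_nf_le: "w permutes {..<m} \<Longrightarrow> m \<le> n \<Longrightarrow> length (nf m w) \<le> ell n w"
proof (induction m arbitrary: w)
  case (Suc m)
  note p = nf_step_permutes[OF Suc.prems(1)]
  let ?u = "word_perm (rev [w m..<m]) \<circ> w"
  have "word_perm [w m..<m] \<circ> ?u = w"
    by (simp only: comp_assoc[symmetric] word_perm_rev id_comp)
  then have "m - w m + ell n ?u \<le> ell n w" using ell_upt_ge[OF p(1), of n "w m"] p(2) Suc.prems by simp
  moreover have "length (nf m ?u) \<le> ell n ?u" using Suc.IH[OF p(1)] Suc.prems(2) by linarith
  moreover have "length (nf (Suc m) w) = m - w m + length (nf m ?u)" by simp
  ultimately show ?case by linarith
qed simp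

text \<open>
  Words have at least \<open>ell\<close> letters and normal forms at most \<open>ell\<close>, so normal forms
  are reduced and \<open>ell\<close> is the Coxeter length.
\<close>

lemma length_nf: "w permutes {..<n} \<Longrightarrow> length (nf n w) = ell n w"
  using length_nf_le[of w n n] nf_word[of w n] ell_word_le[of "nf n w" n] by auto

lemma cox_length_eq_ell: "w permutes {..<n} \<Longrightarrow> cox_length n w = ell n w"
  unfolding cox_length_def
  using nf_word[of w n] length_nf[of w n] ell_word_le
  by (intro Least_equality) (auto simp: expression_of_def)

lemma reduced_iff:
  "reduced_expression n w ks \<longleftrightarrow> (\<forall>k\<in>set ks. Suc k < n) \<and> word_perm ks = w \<and> length ks = ell n w"
  using word_perm_permutes[of ks n] cox_length_eq_ell[of w n]
  by (auto simp: reduced_expression_def expression_of_def)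

lemma reduced_nf: "w permutes {..<n} \<Longrightarrow> reduced_expression n w (nf n w)"
  using nf_word length_nf by (simp add: reduced_iff)

lemma reduced_snoc:
  assumes "reduced_expression n w (ks @ [k])"
  shows "reduced_expression n (word_perm ks) ks" "Suc k < n"
    "w = word_perm ks \<circ> sw k" "word_perm ks k < word_perm ks (Suc k)"
proof -
  have ks: "\<forall>k\<in>set ks. Suc k < n" and k: "Suc k < n" and w: "w = word_perm ks \<circ> sw k"
    and l: "Suc (length ks) = ell n w"
    using assms unfolding reduced_iff word_perm_snoc by auto
  have p: "word_perm ks permutes {..<n}" using ks by (rule word_perm_permutes)
  have le: "ell n (word_perm ks) \<le> length ks" using ks by (rule ell_word_le)
  show lt: "word_perm ks k < word_perm ks (Suc k)"
    using ell_sw(1)[OF p k] le l w by (auto split: if_splits)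
  then show "reduced_expression n (word_perm ks) ks"
    using ell_sw(1)[OF p k] l w ks by (simp add: reduced_iff)
  show "Suc k < n" "w = word_perm ks \<circ> sw k" by fact+
qed

section \<open>The Bruhat order\<close>

lemma bruhat_step_iff:
  "bruhat_step n v w \<longleftrightarrow> v permutes {..<n} \<and> (\<exists>a b. a < b \<and> b < n \<and> w = v \<circ> transpose a b \<and> v a < v b)"
proof -
  have p: "v \<circ> transpose a b permutes {..<n}" if "v permutes {..<n}" "a < n" "b < n" for a b
    using that by (intro permutes_compose permutes_swap_id) auto
  show ?thesis
  proof
    assume "bruhat_step n v w"
    then obtain a b where v: "v permutes {..<n}" and ab: "a < n" "b < n" "a \<noteq> b" and w: "w = v \<circ> transpose a b"
      and l: "cox_length n v < cox_length n w" by (auto simp: bruhat_step_def)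
    have l': "ell n v < ell n w" using l v p[OF v] ab w by (simp add: cox_length_eq_ell)
    show "v permutes {..<n} \<and> (\<exists>a b. a < b \<and> b < n \<and> w = v \<circ> transpose a b \<and> v a < v b)"
    proof (cases "a < b")
      case True then show ?thesis using ell_transpose[OF v True] l' w v ab by blast
    next
      case False
      then have "b < a" using ab by simp
      moreover have "w = v \<circ> transpose b a" using w by (simp only: transpose_commute)
      ultimately show ?thesis using ell_transpose[OF v \<open>b < a\<close>] l' v ab by blast
    qed
  next
    assume "v permutes {..<n} \<and> (\<exists>a b. a < b \<and> b < n \<and> w = v \<circ> transpose a b \<and> v a < v b)"
    then obtain a b where v: "v permutes {..<n}" and ab: "a < b" "b < n" and w: "w = v \<circ> transpose a b" and l: "v a < v b"
      by blast
    have "ell n v < ell n w" using ell_transpose[OF v ab] l w by simp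
    moreover have "w permutes {..<n}" using v ab w p[OF v, of a b] by simp
    ultimately show "bruhat_step n v w" unfolding bruhat_step_def using v ab w
      by (metis cox_length_eq_ell less_trans nat_neq_iff)
  qed
qed

lemma bruhat_step_permutes: "bruhat_step n v w \<Longrightarrow> v permutes {..<n} \<and> w permutes {..<n} \<and> ell n v < ell n w"
  by (auto simp: bruhat_step_iff ell_transpose intro!: permutes_compose permutes_swap_id)

lemma bruhat_le_ell: "bruhat_le n v w \<Longrightarrow> v = w \<or> ell n v < ell n w"
  unfolding bruhat_le_def by (induction rule: converse_rtranclp_induct) (auto dest!: bruhat_step_permutes)

lemma bruhat_le_refl [simp]: "bruhat_le n w w" by (simp add: bruhat_le_def)
lemma bruhat_le_trans: "bruhat_le n u v \<Longrightarrow> bruhat_le n v w \<Longrightarrow> bruhat_le n u w" by (simp add: bruhat_le_def)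
lemma bruhat_le_antisym: "bruhat_le n u v \<Longrightarrow> bruhat_le n v u \<Longrightarrow> u = v"
  using bruhat_le_ell[of n u v] bruhat_le_ell[of n v u] by auto

text \<open>
  Conjugating the transposition by \<open>s\<^sub>k\<close> keeps its two entries in order, unless it is
  \<open>s\<^sub>k\<close> itself.
\<close>

lemma bruhat_step_sw:
  assumes "bruhat_step n u u'" "Suc k < n"
  shows "u' = u \<circ> sw k \<or> bruhat_step n (u \<circ> sw k) (u' \<circ> sw k)"
proof -
  obtain a b where u: "u permutes {..<n}" and ab: "a < b" "b < n" and u': "u' = u \<circ> transpose a b" and l: "u a < u b"
    using assms(1) by (auto simp: bruhat_step_iff)
  show ?thesis
  proof (cases "a = k \<and> b = Suc k")
    case True then show ?thesis using u' by simp
  next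
    case False
    have "sw k a < sw k b" "sw k b < n" using ab False assms(2) by (auto simp: transpose_def)
    moreover have "u' \<circ> sw k = u \<circ> sw k \<circ> transpose (sw k a) (sw k b)"
      using u' by (auto simp: fun_eq_iff transpose_def)
    moreover have "u \<circ> sw k permutes {..<n}" using u assms(2) by (intro permutes_compose sw_permutes)
    moreover have "(u \<circ> sw k) (sw k a) < (u \<circ> sw k) (sw k b)" using l by simp
    ultimately show ?thesis unfolding bruhat_step_iff by blast
  qed
qed

text \<open>
  The lifting property of the Bruhat order, in the form in which a reduced word grows by one letter on the
  right.
\<close>

lemma bruhat_le_sw:
  assumes "bruhat_le n v w" "w permutes {..<n}" "Suc k < n" "w k < w (Suc k)"
  shows "bruhat_le n v (w \<circ> sw k)" "bruhat_le n (v \<circ> sw k) (w \<circ> sw k)"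
proof -
  have s: "bruhat_le n w (w \<circ> sw k)"
    unfolding bruhat_le_def using assms by (intro r_into_rtranclp) (auto simp: bruhat_step_iff)
  show "bruhat_le n v (w \<circ> sw k)" using bruhat_le_trans[OF assms(1) s] .
  show "bruhat_le n (v \<circ> sw k) (w \<circ> sw k)"
    using assms(1) unfolding bruhat_le_def
  proof (induction rule: converse_rtranclp_induct)
    case (step v v')
    show ?case
    proof (cases "v' = v \<circ> sw k")
      case True
      then have "(bruhat_step n)\<^sup>*\<^sup>* (v \<circ> sw k) w" using step(2) by (simp only:)
      then show ?thesis using s unfolding bruhat_le_def by (rule rtranclp_trans)
    next
      case False
      then have "bruhat_step n (v \<circ> sw k) (v' \<circ> sw k)" using bruhat_step_sw step assms by blast
      then show ?thesis using step by (meson converse_rtranclp_into_rtranclp)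
    qed
  qed simp
qed

lemma partial_order_bruhat_rel: "partial_order_on (seq_perms i j) (bruhat_rel i j)"
  unfolding partial_order_on_def preorder_on_def bruhat_rel_def
  by (auto intro!: refl_onI transI antisymI dest: bruhat_le_trans bruhat_le_antisym)

lemma finite_seq_perms [simp]: "finite (seq_perms i j)"
  by (rule finite_subset[OF _ finite_permutations[of "{..<length i}"]]) (auto simp: seq_perms_def)

section \<open>Crossing diagrams of words\<close>

lemma tgt_cross_at: "Suc k < length a \<Longrightarrow> tgt (cross_at k a) = take k a @ [a ! Suc k, a ! k] @ drop (Suc (Suc k)) a"
  by (simp add: cross_at_def)

lemma length_tgt_cross_at [simp]: "Suc k < length a \<Longrightarrow> length (tgt (cross_at k a)) = length a"
  by (simp add: tgt_cross_at)

lemma nth_tgt_cross_at: "Suc k < length a \<Longrightarrow> p < length a \<Longrightarrow> tgt (cross_at k a) ! p = a ! sw k p"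
proof -
  assume a: "Suc k < length a" "p < length a"
  consider "p < k" | "p = k" | "p = Suc k" | "Suc (Suc k) \<le> p" by linarith
  then show ?thesis
  proof cases
    case 4
    then obtain r where "p = Suc (Suc (k + r))" by (metis add_Suc le_Suc_ex)
    with a show ?thesis by (simp add: tgt_cross_at nth_append transpose_apply_other)
  qed (use a in \<open>auto simp: tgt_cross_at nth_append transpose_apply_other\<close>)
qed

definition valid :: "nat list \<Rightarrow> 'v list \<Rightarrow> bool" where
  "valid ks a \<longleftrightarrow> (\<forall>k\<in>set ks. Suc k < length a)"

lemma crossings_wf: "valid ks a \<Longrightarrow> wf_diagram (crossings ks a) \<and> src (crossings ks a) = a \<and>
    length (tgt (crossings ks a)) = length a"
  by (induction ks) (auto simp: valid_def)

lemma nth_tgt_crossings: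
  "valid ks a \<Longrightarrow> p < length a \<Longrightarrow> tgt (crossings ks a) ! word_perm ks p = a ! p"
proof (induction ks)
  case (Cons k ks)
  have v: "valid ks a" and k: "Suc k < length a" using Cons.prems by (auto simp: valid_def)
  have "word_perm ks p < length a"
    using word_perm_permutes[of ks "length a"] v Cons.prems permutes_in_image[of "word_perm ks" "{..<length a}" p]
    by (auto simp: valid_def)
  moreover from this have "sw k (word_perm ks p) < length a" using k by (auto simp: transpose_def)
  ultimately show ?case using Cons.IH[OF v] Cons.prems crossings_wf[OF v] k
    by (simp add: nth_tgt_cross_at)
qed simp

lemma tgt_crossings_eq_iff:
  assumes "valid ks a" "length b = length a"
  shows "tgt (crossings ks a) = b \<longleftrightarrow> word_perm ks \<in> seq_perms a b"
proof -
  have p: "word_perm ks permutes {..<length a}" using assms word_perm_permutes by (auto simp: valid_def)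
  have "tgt (crossings ks a) = b \<longleftrightarrow> (\<forall>q<length a. tgt (crossings ks a) ! q = b ! q)"
    using crossings_wf[OF assms(1)] assms(2) by (auto simp: list_eq_iff_nth_eq)
  also have "\<dots> \<longleftrightarrow> (\<forall>k<length a. tgt (crossings ks a) ! word_perm ks k = b ! word_perm ks k)"
  proof (intro iffI allI impI)
    fix k assume "\<forall>q<length a. tgt (crossings ks a) ! q = b ! q" "k < length a"
    then show "tgt (crossings ks a) ! word_perm ks k = b ! word_perm ks k"
      using permutes_in_image[OF p, of k] by auto
  next
    fix q assume *: "\<forall>k<length a. tgt (crossings ks a) ! word_perm ks k = b ! word_perm ks k" "q < length a"
    have "winv (word_perm ks) q < length a" using permutes_in_image[OF permutes_inv[OF p], of q] *(2) by auto
    with * have "tgt (crossings ks a) ! word_perm ks (winv (word_perm ks) q) = b ! word_perm ks (winv (word_perm ks) q)" by blast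
    then show "tgt (crossings ks a) ! q = b ! q" by simp
  qed
  also have "\<dots> \<longleftrightarrow> word_perm ks \<in> seq_perms a b"
    using p nth_tgt_crossings[OF assms(1)] by (auto simp: seq_perms_def)
  finally show ?thesis .
qed

lemma crossings_free_hom:
  assumes "reduced_expression (length a) w ks" "w \<in> seq_perms a b" "length b = length a"
  shows "crossm ks a \<in> free_hom a b" "valid ks a"
  using assms tgt_crossings_eq_iff[of ks a b] crossings_wf[of ks a]
  by (auto simp: reduced_iff valid_def)

text \<open>Diagrams are built from the top, whereas the inductions below remove the bottom letter.\<close>

lemma crossings_snoc:
  assumes "valid (ks @ [k]) a"
  shows "tgt (crossings (ks @ [k]) a) = tgt (crossings ks (tgt (cross_at k a)))"
    "rep A (crossings (ks @ [k]) a) s p = rep A (crossings ks (tgt (cross_at k a))) s (rep A (cross_at k a) s p)"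
    "deg A (crossings (ks @ [k]) a) = deg A (crossings ks (tgt (cross_at k a))) + deg A (cross_at k a)"
proof -
  show t: "tgt (crossings (ks @ [k]) a) = tgt (crossings ks (tgt (cross_at k a)))" for ks
    by (induction ks) auto
  show "rep A (crossings (ks @ [k]) a) s p = rep A (crossings ks (tgt (cross_at k a))) s (rep A (cross_at k a) s p)"
    by (induction ks) (auto simp: t)
  show "deg A (crossings (ks @ [k]) a) = deg A (crossings ks (tgt (cross_at k a))) + deg A (cross_at k a)"
    by (induction ks) (auto simp: t)
qed

section \<open>The weights p(w) as sums over inversions\<close>

lemma cart_sym: "cart A i j = cart A j i"
  by (auto simp: cart_def adjacent_def)

text \<open>
  With \<open>g k = x\<^sub>k\<close> the left-hand side is \<open>p(w)\<close>, and with \<open>g k = 1\<close>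
  it is the degree of its generator. The left and the right weight give the same sum over inversions, because
  \<open>w\<close> carries dots on the source to dots on the target.
\<close>

lemma sum_p_left:
  assumes "length j = n"
  shows "(\<Sum>k<n. of_int (p_left A j w k) * g k) = (\<Sum>(p, q)\<in>Inv n (winv w). of_int (- cart A (j ! p) (j ! q)) * (g p :: 'a :: comm_ring_1))"
proof -
  have "(\<Sum>k<n. of_int (p_left A j w k) * g k) =
    (\<Sum>k<n. \<Sum>l | k < l \<and> l < n \<and> winv w l < winv w k. of_int (- cart A (j ! k) (j ! l)) * g k)"
    by (simp add: p_left_def assms sum_distrib_right)
  also have "\<dots> = (\<Sum>(p, q)\<in>(SIGMA k:{..<n}. {l. k < l \<and> l < n \<and> winv w l < winv w k}). of_int (- cart A (j ! p) (j ! q)) * g p)"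
    by (rule sum.Sigma) auto
  also have "(SIGMA k:{..<n}. {l. k < l \<and> l < n \<and> winv w l < winv w k}) = Inv n (winv w)"
    by (auto simp: Inv_def)
  finally show ?thesis .
qed

lemma sum_p_right:
  assumes "length i = n" "length j = n" "w \<in> seq_perms i j"
  shows "(\<Sum>k<n. of_int (p_right A i w k) * g (w k)) = (\<Sum>(p, q)\<in>Inv n (winv w). of_int (- cart A (j ! p) (j ! q)) * (g p :: 'a :: comm_ring_1))"
proof -
  have p: "w permutes {..<n}" and c: "\<And>k. k < n \<Longrightarrow> i ! k = j ! w k" using assms by (auto simp: seq_perms_def)
  have b: "bij w" using p by (rule permutes_bij)
  have in_n: "w k < n \<longleftrightarrow> k < n" "winv w k < n \<longleftrightarrow> k < n" for k
    using permutes_in_image[OF p, of k] permutes_in_image[OF permutes_inv[OF p], of k] by auto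
  have "(\<Sum>k<n. of_int (p_right A i w k) * g (w k)) =
    (\<Sum>k<n. \<Sum>l | l < k \<and> w l > w k. of_int (- cart A (i ! l) (i ! k)) * g (w k))"
    by (simp add: p_right_def sum_distrib_right)
  also have "\<dots> = (\<Sum>(k, l)\<in>(SIGMA k:{..<n}. {l. l < k \<and> w l > w k}). of_int (- cart A (i ! l) (i ! k)) * g (w k))"
    by (rule sum.Sigma) auto
  also have "\<dots> = (\<Sum>(k, l)\<in>(SIGMA k:{..<n}. {l. l < k \<and> w l > w k}). of_int (- cart A (j ! w k) (j ! w l)) * g (w k))"
  proof (rule sum.cong[OF refl])
    fix x assume "x \<in> (SIGMA k:{..<n}. {l. l < k \<and> w l > w k})"
    then obtain k l where "x = (k, l)" "k < n" "l < n" by auto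
    then show "(case x of (k, l) \<Rightarrow> of_int (- cart A (i ! l) (i ! k)) * g (w k)) =
      (case x of (k, l) \<Rightarrow> of_int (- cart A (j ! w k) (j ! w l)) * g (w k))"
      using c cart_sym[of A "j ! w l" "j ! w k"] by simp
  qed
  also have "\<dots> = (\<Sum>(p, q)\<in>Inv n (winv w). of_int (- cart A (j ! p) (j ! q)) * g p)"
    by (rule sum.reindex_bij_witness[of _ "\<lambda>(p, q). (winv w p, winv w q)" "\<lambda>(k, l). (w k, w l)"])
      (auto simp: Inv_def in_n b)
  finally show ?thesis .
qed

section \<open>Equality of morphisms\<close>

text \<open>
  Equality of the morphisms represented by \<open>f\<close> and \<open>g\<close>; requiring well-formedness
  makes it a congruence without side conditions.
\<close>

definition eqv :: "('v \<times> 'v) set \<Rightarrow> 'v list \<Rightarrow> 'v list \<Rightarrow> 'v lin \<Rightarrow> 'v lin \<Rightarrow> bool" where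
  "eqv A a b f g \<longleftrightarrow> f \<in> free_hom a b \<and> g \<in> free_hom a b \<and> null A a b (f - g)"

lemma null_uminus: "null A a b f \<Longrightarrow> null A a b (- f)"
  using null_diff[OF null_zero] by fastforce
lemma null_plus: "null A a b f \<Longrightarrow> null A a b g \<Longrightarrow> null A a b (f + g)"
  using null_diff[of A a b f "- g"] null_uminus[of A a b g] by simp

lemma eqv_refl: "f \<in> free_hom a b \<Longrightarrow> eqv A a b f f"
  by (simp add: eqv_def null_zero)
lemma eqv_sym: "eqv A a b f g \<Longrightarrow> eqv A a b g f"
  unfolding eqv_def using null_uminus by fastforce
lemma eqv_trans [trans]: "eqv A a b f g \<Longrightarrow> eqv A a b g h \<Longrightarrow> eqv A a b f h"
  unfolding eqv_def using null_plus[of A a b "f - g" "g - h"] by simp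
lemma eqv_diff: "eqv A a b f f' \<Longrightarrow> eqv A a b g g' \<Longrightarrow> eqv A a b (f - g) (f' - g')"
  unfolding eqv_def using null_diff[of A a b "f - f'" "g - g'"] by (simp add: free_hom_diff algebra_simps)
lemma eqv_add: "eqv A a b f f' \<Longrightarrow> eqv A a b g g' \<Longrightarrow> eqv A a b (f + g) (f' + g')"
  unfolding eqv_def using null_plus[of A a b "f - f'" "g - g'"] by (simp add: free_hom_add algebra_simps)
lemma eqv_vcomp:
  assumes "eqv A b c f f'" "eqv A a b g g'"
  shows "eqv A a c (f \<star> g) (f' \<star> g')"
proof -
  have "null A a c ((f - f') \<star> g)" "null A a c (f' \<star> (g - g'))"
    using assms by (auto simp: eqv_def simp del: vcomp_diff_left vcomp_diff_right intro: null_below null_above)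
  from null_plus[OF this] show ?thesis using assms by (auto simp: eqv_def intro: free_hom_vcomp)
qed
lemma eqv_hcomp:
  assumes "eqv A a b f f'" "eqv A c d g g'"
  shows "eqv A (a @ c) (b @ d) (hcomp f g) (hcomp f' g')"
proof -
  have "null A (a @ c) (b @ d) (hcomp (f - f') g)" "null A (a @ c) (b @ d) (hcomp f' (g - g'))"
    using assms by (auto simp: eqv_def simp del: hcomp_diff_left hcomp_diff_right intro: null_left null_right)
  from null_plus[OF this] show ?thesis using assms by (auto simp: eqv_def intro: free_hom_hcomp)
qed

text \<open>
  For single diagrams source and target need not be mentioned, which suits the long chains of monoidal
  identities below.
\<close>

definition deq :: "('v \<times> 'v) set \<Rightarrow> 'v diagram \<Rightarrow> 'v diagram \<Rightarrow> bool" where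
  "deq A D D' \<longleftrightarrow> eqv A (src D) (tgt D) (frag_of D) (frag_of D')"

lemma deqD: "deq A D D' \<Longrightarrow> wf_diagram D \<and> wf_diagram D' \<and> src D' = src D \<and> tgt D' = tgt D"
  by (simp add: deq_def eqv_def)
lemma deq_eqv: "deq A D D' \<Longrightarrow> src D = a \<Longrightarrow> tgt D = b \<Longrightarrow> eqv A a b (frag_of D) (frag_of D')"
  by (auto simp: deq_def)

lemma deq_refl: "wf_diagram D \<Longrightarrow> deq A D D"
  by (simp add: deq_def eqv_refl)
lemma deq_sym: "deq A D D' \<Longrightarrow> deq A D' D"
  using deqD[of A D D'] by (auto simp: deq_def intro: eqv_sym)
lemma deq_trans [trans]: "deq A D D' \<Longrightarrow> deq A D' D'' \<Longrightarrow> deq A D D''"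
  using deqD[of A D D'] by (auto simp: deq_def intro: eqv_trans)
lemma deq_Vert: "deq A D1 D1' \<Longrightarrow> deq A D2 D2' \<Longrightarrow> src D1 = tgt D2 \<Longrightarrow> deq A (Vert D1 D2) (Vert D1' D2')"
  using eqv_vcomp[of A "src D1" "tgt D1" "frag_of D1" "frag_of D1'" "src D2" "frag_of D2" "frag_of D2'"]
  by (simp add: deq_def)
lemma deq_Horiz: "deq A D1 D1' \<Longrightarrow> deq A D2 D2' \<Longrightarrow> deq A (Horiz D1 D2) (Horiz D1' D2')"
  using eqv_hcomp[of A "src D1" "tgt D1" "frag_of D1" "frag_of D1'" "src D2" "tgt D2" "frag_of D2" "frag_of D2'"]
  by (simp add: deq_def)

lemma deq_monoidal:
  "monoidal_rel D D' \<Longrightarrow> wf_diagram D \<Longrightarrow> wf_diagram D' \<Longrightarrow> src D' = src D \<Longrightarrow> tgt D' = tgt D \<Longrightarrow> deq A D D'"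
  by (simp add: deq_def eqv_def null_monoidal)

lemma deq_Vassoc: "wf_diagram (Vert (Vert D D') D'') \<Longrightarrow> deq A (Vert (Vert D D') D'') (Vert D (Vert D' D''))"
  by (rule deq_monoidal[OF vert_assoc]) auto
lemma deq_VidL: "wf_diagram D \<Longrightarrow> a = tgt D \<Longrightarrow> deq A (Vert (Ident a) D) D"
  using deq_monoidal[OF vert_id_left] by auto
lemma deq_VidR: "wf_diagram D \<Longrightarrow> a = src D \<Longrightarrow> deq A (Vert D (Ident a)) D"
  using deq_monoidal[OF vert_id_right] by auto
lemma deq_Hassoc: "wf_diagram D \<Longrightarrow> wf_diagram D' \<Longrightarrow> wf_diagram D'' \<Longrightarrow> deq A (Horiz (Horiz D D') D'') (Horiz D (Horiz D' D''))"
  by (rule deq_monoidal[OF horiz_assoc]) auto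
lemma deq_HidL: "wf_diagram D \<Longrightarrow> deq A (Horiz (Ident []) D) D"
  by (rule deq_monoidal[OF horiz_unit_left]) auto
lemma deq_HidR: "wf_diagram D \<Longrightarrow> deq A (Horiz D (Ident [])) D"
  by (rule deq_monoidal[OF horiz_unit_right]) auto
lemma deq_HId: "deq A (Horiz (Ident a) (Ident b)) (Ident (a @ b))"
  by (rule deq_monoidal[OF horiz_id]) auto
lemma deq_interchange:
  "wf_diagram D1 \<Longrightarrow> wf_diagram D2 \<Longrightarrow> wf_diagram D3 \<Longrightarrow> wf_diagram D4 \<Longrightarrow> src D1 = tgt D3 \<Longrightarrow> src D2 = tgt D4
    \<Longrightarrow> deq A (Vert (Horiz D1 D2) (Horiz D3 D4)) (Horiz (Vert D1 D3) (Vert D2 D4))"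
  by (rule deq_monoidal[OF interchange]) auto

lemma deq_pad_right:
  assumes "wf_diagram G"
  shows "deq A (Horiz (Ident p) (Horiz G (Ident (q @ d)))) (Horiz (Horiz (Ident p) (Horiz G (Ident q))) (Ident d))"
proof -
  have "deq A (Horiz (Ident p) (Horiz G (Ident (q @ d)))) (Horiz (Ident p) (Horiz G (Horiz (Ident q) (Ident d))))"
    using assms by (intro deq_Horiz deq_refl deq_sym[OF deq_HId]) auto
  also have "deq A \<dots> (Horiz (Ident p) (Horiz (Horiz G (Ident q)) (Ident d)))"
    using assms by (intro deq_Horiz deq_refl deq_sym[OF deq_Hassoc]) auto
  also have "deq A \<dots> (Horiz (Horiz (Ident p) (Horiz G (Ident q))) (Ident d))"
    using assms by (intro deq_sym[OF deq_Hassoc]) auto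
  finally show ?thesis .
qed

lemma deq_pad_left:
  assumes "wf_diagram G"
  shows "deq A (Horiz (Ident (c @ p)) G) (Horiz (Ident c) (Horiz (Ident p) G))"
proof -
  have "deq A (Horiz (Ident (c @ p)) G) (Horiz (Horiz (Ident c) (Ident p)) G)"
    using assms by (intro deq_Horiz deq_refl deq_sym[OF deq_HId]) auto
  also have "deq A \<dots> (Horiz (Ident c) (Horiz (Ident p) G))"
    using assms by (intro deq_Hassoc) auto
  finally show ?thesis .
qed

lemma cross_at_right: "Suc k < length c \<Longrightarrow> deq A (cross_at k (c @ d)) (Horiz (cross_at k c) (Ident d))"
  using deq_pad_right[of "Cross (c ! k) (c ! Suc k)" A "take k c" "drop (Suc (Suc k)) c" d]
  by (simp add: cross_at_def nth_append)
lemma cross_at_left: "Suc k < length d \<Longrightarrow> deq A (cross_at (length c + k) (c @ d)) (Horiz (Ident c) (cross_at k d))"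
  using deq_pad_left[of "Horiz (Cross (d ! k) (d ! Suc k)) (Ident (drop (Suc (Suc k)) d))" A c "take k d"]
  by (simp add: cross_at_def nth_append)
lemma dot_at_right: "k < length c \<Longrightarrow> deq A (dot_at k (c @ d)) (Horiz (dot_at k c) (Ident d))"
  using deq_pad_right[of "Dot (c ! k)" A "take k c" "drop (Suc k) c" d]
  by (simp add: dot_at_def nth_append)
lemma dot_at_left: "k < length d \<Longrightarrow> deq A (dot_at (length c + k) (c @ d)) (Horiz (Ident c) (dot_at k d))"
  using deq_pad_left[of "Horiz (Dot (d ! k)) (Ident (drop (Suc k) d))" A c "take k d"]
  by (simp add: dot_at_def nth_append)

lemma deq_Horiz_factor:
  assumes "wf_diagram D" "wf_diagram D'"
  shows "deq A (Vert (Horiz D (Ident (tgt D'))) (Horiz (Ident (src D)) D')) (Horiz D D')"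
    "deq A (Vert (Horiz (Ident (tgt D)) D') (Horiz D (Ident (src D')))) (Horiz D D')"
proof -
  show "deq A (Vert (Horiz D (Ident (tgt D'))) (Horiz (Ident (src D)) D')) (Horiz D D')"
    using assms by (intro deq_trans[OF deq_interchange] deq_Horiz deq_VidL deq_VidR) auto
  show "deq A (Vert (Horiz (Ident (tgt D)) D') (Horiz D (Ident (src D')))) (Horiz D D')"
    using assms by (intro deq_trans[OF deq_interchange] deq_Horiz deq_VidL deq_VidR) auto
qed

text \<open>
  Two diagrams on disjoint groups of strands can be composed in either order; the assumptions recognise padded
  generators as horizontal composites.
\<close>

lemma deq_far:
  assumes "deq A L1 (Horiz D (Ident (tgt D')))" "deq A R1 (Horiz (Ident (src D)) D')"
    "deq A L2 (Horiz (Ident (tgt D)) D')" "deq A R2 (Horiz D (Ident (src D')))"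
  shows "deq A (Vert L1 R1) (Vert L2 R2)"
proof -
  have wf: "wf_diagram D" "wf_diagram D'" using deqD[OF assms(1)] deqD[OF assms(2)] by auto
  have "deq A (Vert L1 R1) (Vert (Horiz D (Ident (tgt D'))) (Horiz (Ident (src D)) D'))"
    using assms deqD[OF assms(1)] deqD[OF assms(2)] by (intro deq_Vert) auto
  also have "deq A \<dots> (Horiz D D')" by (rule deq_Horiz_factor[OF wf])
  also have "deq A \<dots> (Vert (Horiz (Ident (tgt D)) D') (Horiz D (Ident (src D'))))"
    by (rule deq_sym[OF deq_Horiz_factor(2)[OF wf]])
  also have "deq A \<dots> (Vert L2 R2)"
    using deqD[OF assms(3)] deqD[OF assms(4)] by (intro deq_Vert deq_sym[OF assms(3)] deq_sym[OF assms(4)]) auto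
  finally show ?thesis .
qed

lemma eqv_vassoc:
  assumes "f \<in> free_hom c d" "g \<in> free_hom b c" "h \<in> free_hom a b"
  shows "eqv A a d ((f \<star> g) \<star> h) (f \<star> (g \<star> h))"
  using assms(1)
proof (induction rule: free_hom_induct)
  case (of D)
  from assms(2) show ?case
  proof (induction rule: free_hom_induct)
    case (of D')
    from assms(3) show ?case
    proof (induction rule: free_hom_induct)
      case (of D'')
      then show ?case using \<open>wf_diagram D\<close> \<open>wf_diagram D'\<close> \<open>src D = c\<close> \<open>tgt D = d\<close> \<open>src D' = b\<close> \<open>tgt D' = c\<close>
        deq_eqv[OF deq_Vassoc[of D D' D'' A], of a d] by simp
    qed (auto intro: eqv_diff simp: eqv_refl)
  qed (auto intro: eqv_diff simp: eqv_refl)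
qed (auto intro: eqv_diff simp: eqv_refl)

lemma eqv_id_left:
  assumes "f \<in> free_hom a b" shows "eqv A a b (idm b \<star> f) f"
  using assms
proof (induction rule: free_hom_induct)
  case (of D)
  then show ?case using deq_eqv[OF deq_VidL[of D b A], of a b] by simp
qed (auto intro: eqv_diff simp: eqv_refl)

section \<open>The defining relations in the middle of a word\<close>

abbreviation ctx :: "'v list \<Rightarrow> 'v list \<Rightarrow> 'v lin \<Rightarrow> 'v lin" where
  "ctx p q f \<equiv> hcomp (idm p) (hcomp f (idm q))"

lemma eqv_ctx: "eqv A a b f g \<Longrightarrow> eqv A (p @ a @ q) (p @ b @ q) (ctx p q f) (ctx p q g)"
  by (intro eqv_hcomp eqv_refl) auto

lemma ctx_free_hom: "f \<in> free_hom a b \<Longrightarrow> ctx p q f \<in> free_hom (p @ a @ q) (p @ b @ q)"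
  by (intro free_hom_hcomp) auto

lemma deq_ctx_Vert:
  assumes "wf_diagram D" "wf_diagram D'" "src D = tgt D'"
  shows "deq A (Horiz (Ident p) (Horiz (Vert D D') (Ident q)))
    (Vert (Horiz (Ident p) (Horiz D (Ident q))) (Horiz (Ident p) (Horiz D' (Ident q))))"
proof -
  have i: "deq A (Vert (Ident x) (Ident x)) (Ident x)" for x by (rule deq_VidL) auto
  have "deq A (Vert (Horiz (Ident p) (Horiz D (Ident q))) (Horiz (Ident p) (Horiz D' (Ident q))))
    (Horiz (Vert (Ident p) (Ident p)) (Vert (Horiz D (Ident q)) (Horiz D' (Ident q))))"
    using assms by (intro deq_interchange) auto
  also have "deq A \<dots> (Horiz (Ident p) (Horiz (Vert D D') (Vert (Ident q) (Ident q))))"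
    using assms by (intro deq_Horiz i deq_interchange) auto
  also have "deq A \<dots> (Horiz (Ident p) (Horiz (Vert D D') (Ident q)))"
    using assms by (intro deq_Horiz i deq_refl) auto
  finally show ?thesis by (rule deq_sym)
qed

lemma ctx_vcomp:
  assumes "f \<in> free_hom b c" "g \<in> free_hom a b"
  shows "eqv A (p @ a @ q) (p @ c @ q) (ctx p q (f \<star> g)) (ctx p q f \<star> ctx p q g)"
  using assms(1)
proof (induction rule: free_hom_induct)
  case (of D)
  from assms(2) show ?case
  proof (induction rule: free_hom_induct)
    case (of D')
    then show ?case using \<open>wf_diagram D\<close> \<open>src D = b\<close> \<open>tgt D = c\<close>
      deq_eqv[OF deq_ctx_Vert[of D D' A p q], of "p @ a @ q" "p @ c @ q"] by simp
  qed (auto intro: eqv_diff simp: eqv_refl)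
qed (auto intro: eqv_diff simp: eqv_refl)

lemma ctx_idm: "eqv A (p @ a @ q) (p @ a @ q) (ctx p q (idm a)) (idm (p @ a @ q))"
proof -
  have "deq A (Horiz (Ident p) (Horiz (Ident a) (Ident q))) (Ident (p @ a @ q))"
    by (rule deq_trans[OF deq_Horiz[OF deq_refl deq_HId] deq_HId]) simp
  then show ?thesis using deq_eqv by fastforce
qed

text \<open>\<open>sx k b\<close> is the word after a crossing in position \<open>k\<close>.\<close>

abbreviation X :: "nat \<Rightarrow> 'v list \<Rightarrow> 'v lin" where "X k b \<equiv> frag_of (cross_at k b)"
abbreviation sx :: "nat \<Rightarrow> 'v list \<Rightarrow> 'v list" where "sx k b \<equiv> tgt (cross_at k b)"

lemma sx_ctx: "Suc k < length u \<Longrightarrow> sx (length p + k) (p @ u @ q) = p @ sx k u @ q"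
  by (simp add: tgt_cross_at nth_append)

lemma deq_ctx_gen:
  shows "k < length u \<Longrightarrow> deq A (Horiz (Ident p) (Horiz (dot_at k u) (Ident q))) (dot_at (length p + k) (p @ u @ q))"
    and "Suc k < length u \<Longrightarrow> deq A (Horiz (Ident p) (Horiz (cross_at k u) (Ident q))) (cross_at (length p + k) (p @ u @ q))"
proof -
  assume k: "k < length u"
  have "deq A (dot_at (length p + k) (p @ u @ q)) (Horiz (Ident p) (dot_at k (u @ q)))"
    using k by (intro dot_at_left) auto
  also have "deq A \<dots> (Horiz (Ident p) (Horiz (dot_at k u) (Ident q)))"
    using k by (intro deq_Horiz dot_at_right deq_refl) auto
  finally show "deq A (Horiz (Ident p) (Horiz (dot_at k u) (Ident q))) (dot_at (length p + k) (p @ u @ q))"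
    by (rule deq_sym)
next
  assume k: "Suc k < length u"
  have "deq A (cross_at (length p + k) (p @ u @ q)) (Horiz (Ident p) (cross_at k (u @ q)))"
    using k by (intro cross_at_left) auto
  also have "deq A \<dots> (Horiz (Ident p) (Horiz (cross_at k u) (Ident q)))"
    using k by (intro deq_Horiz cross_at_right deq_refl) auto
  finally show "deq A (Horiz (Ident p) (Horiz (cross_at k u) (Ident q))) (cross_at (length p + k) (p @ u @ q))"
    by (rule deq_sym)
qed

lemma ctx_dot: "k < length u \<Longrightarrow> eqv A (p @ u @ q) (p @ u @ q) (ctx p q (dotm k u)) (dotm (length p + k) (p @ u @ q))"
  using deq_eqv[OF deq_ctx_gen(1)[of k u A p q], of "p @ u @ q" "p @ u @ q"] by simp
lemma ctx_cross: "Suc k < length u \<Longrightarrow> eqv A (p @ u @ q) (p @ sx k u @ q) (ctx p q (X k u)) (X (length p + k) (p @ u @ q))"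
  using deq_eqv[OF deq_ctx_gen(2)[of k u A p q], of "p @ u @ q" "p @ sx k u @ q"] by simp

lemma ctx_crossings:
  assumes "valid ks u"
  shows "eqv A (p @ u @ q) (p @ tgt (crossings ks u) @ q) (ctx p q (crossm ks u)) (crossm (map ((+) (length p)) ks) (p @ u @ q))
    \<and> tgt (crossings (map ((+) (length p)) ks) (p @ u @ q)) = p @ tgt (crossings ks u) @ q"
  using assms
proof (induction ks)
  case Nil
  then show ?case using ctx_idm by simp
next
  case (Cons k ks)
  let ?c = "tgt (crossings ks u)" and ?ks = "map ((+) (length p)) ks"
  have v: "valid ks u" and k: "Suc k < length u" using Cons.prems by (auto simp: valid_def)
  note w = crossings_wf[OF v]
  have k': "Suc k < length ?c" using k w by simp
  have "eqv A (p @ u @ q) (p @ sx k ?c @ q) (ctx p q (X k ?c \<star> crossm ks u)) (ctx p q (X k ?c) \<star> ctx p q (crossm ks u))"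
    using w k' by (intro ctx_vcomp) auto
  also have "eqv A (p @ u @ q) (p @ sx k ?c @ q) \<dots> (X (length p + k) (p @ ?c @ q) \<star> crossm ?ks (p @ u @ q))"
    using Cons.IH[OF v] k' by (intro eqv_vcomp[OF ctx_cross]) auto
  finally show ?case using Cons.IH[OF v] sx_ctx[OF k'] by simp
qed

lemma klr_ctx:
  assumes "klr_rel A f g" "f \<in> free_hom u v" "g \<in> free_hom u v"
  shows "eqv A (p @ u @ q) (p @ v @ q) (ctx p q f) (ctx p q g)"
  using assms null_klr[OF assms] by (intro eqv_ctx) (simp add: eqv_def)

lemma split2:
  assumes "Suc k < length b"
  obtains p q where "b = p @ [b ! k, b ! Suc k] @ q" "length p = k"
proof
  show "b = take k b @ [b ! k, b ! Suc k] @ drop (Suc (Suc k)) b"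
    using assms by (simp add: Cons_nth_drop_Suc id_take_nth_drop[symmetric])
  show "length (take k b) = k" using assms by simp
qed

lemma split3:
  assumes "Suc (Suc k) < length b"
  obtains p q where "b = p @ [b ! k, b ! Suc k, b ! Suc (Suc k)] @ q" "length p = k"
proof
  show "b = take k b @ [b ! k, b ! Suc k, b ! Suc (Suc k)] @ drop (Suc (Suc (Suc k))) b"
    using assms by (simp add: Cons_nth_drop_Suc id_take_nth_drop[symmetric])
  show "length (take k b) = k" using assms by simp
qed

lemma eqv_crossm_vcomp:
  assumes "Suc k < length b"
  shows "eqv A b (sx k (sx k b)) (X k (sx k b) \<star> X k b) (crossm [k, k] b)"
  using assms deq_VidR[of "cross_at k b" b A]
  by (simp only: crossings.simps vcomp_of[symmetric] tgt.simps)
    (intro eqv_vcomp eqv_refl, auto intro!: deq_eqv deq_sym deq_VidR simp del: vcomp_of simp: vcomp_of)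

text \<open>
  Spanning only needs the shape of the defining relations, so this lemma and the next ones record the possible
  values or error terms, and not for which colours they occur.
\<close>

lemma rel_double:
  assumes "Suc k < length b"
  shows "sx k (sx k b) = b"
    "\<exists>e \<in> {0, idm b, dotm k b - dotm (Suc k) b, dotm (Suc k) b - dotm k b}. eqv A b b (X k (sx k b) \<star> X k b) e"
proof -
  show t: "sx k (sx k b) = b"
    using assms by (intro nth_equalityI) (auto simp: nth_tgt_cross_at transpose_def)
  obtain p q where b: "b = p @ [b ! k, b ! Suc k] @ q" and p: "length p = k" using split2[OF assms] .
  let ?i = "b ! k" and ?j = "b ! Suc k"
  have "\<exists>e \<in> {0, idm [?i,?j], dotm 0 [?i,?j] - dotm 1 [?i,?j], dotm 1 [?i,?j] - dotm 0 [?i,?j]}. klr_rel A (crossm [0, 0] [?i,?j]) e"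
  proof -
    consider "?i = ?j" | "?i \<noteq> ?j" "\<not> adjacent A ?i ?j" | "(?i, ?j) \<in> A" | "(?j, ?i) \<in> A"
      unfolding adjacent_def by blast
    then show ?thesis
    proof cases
      case 1
      then have "klr_rel A (crossm [0, 0] [?i,?j]) 0" using double_same[of A ?i] by (simp only:)
      then show ?thesis by (rule bexI) simp
    next
      case 2
      from double_far[OF this] show ?thesis by (rule bexI) simp
    next
      case 3
      from double_tail_head[OF this] show ?thesis by (rule bexI) simp
    next
      case 4
      from double_head_tail[OF this] show ?thesis by (rule bexI) simp
    qed
  qed
  then obtain e where e: "e \<in> {0, idm [?i,?j], dotm 0 [?i,?j] - dotm 1 [?i,?j], dotm 1 [?i,?j] - dotm 0 [?i,?j]}"
    and r: "klr_rel A (crossm [0, 0] [?i,?j]) e" by blast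
  have eh: "e \<in> free_hom [?i,?j] [?i,?j]" using e by (auto intro: free_hom_diff)
  have ch: "crossm [0, 0] [?i,?j] \<in> free_hom [?i,?j] [?i,?j]" by (simp add: cross_at_def)
  have v: "valid [0, 0] [?i, ?j]" by (simp add: valid_def)
  have t': "tgt (crossings [0,0] [?i,?j]) = [?i,?j]" by (simp add: cross_at_def)
  have "eqv A b b (X k (sx k b) \<star> X k b) (crossm [k, k] b)"
    using eqv_crossm_vcomp[OF assms, of A] t by simp
  also have "eqv A b b \<dots> (ctx p q (crossm [0, 0] [?i,?j]))"
    using eqv_sym[OF conjunct1[OF ctx_crossings[OF v, of A p q]]] unfolding t' b[symmetric] by (simp add: p)
  also have "eqv A b b \<dots> (ctx p q e)"
    using klr_ctx[OF r ch eh, of p q] unfolding b[symmetric] .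
  finally have E: "eqv A b b (X k (sx k b) \<star> X k b) (ctx p q e)" .
  have d: "eqv A b b (ctx p q (dotm 0 [?i,?j])) (dotm k b)" "eqv A b b (ctx p q (dotm 1 [?i,?j])) (dotm (Suc k) b)"
    using ctx_dot[of 0 "[?i,?j]" A p q] ctx_dot[of 1 "[?i,?j]" A p q] unfolding b[symmetric] by (simp_all add: p)
  have i: "eqv A b b (ctx p q (idm [?i,?j])) (idm b)" using ctx_idm[of A p "[?i,?j]" q] unfolding b[symmetric] .
  have "\<exists>e' \<in> {0, idm b, dotm k b - dotm (Suc k) b, dotm (Suc k) b - dotm k b}. eqv A b b (ctx p q e) e'"
    using e i eqv_diff[OF d] eqv_diff[OF d(2,1)] by (auto simp: eqv_refl simp del: hcomp_of)
  then show "\<exists>e \<in> {0, idm b, dotm k b - dotm (Suc k) b, dotm (Suc k) b - dotm k b}. eqv A b b (X k (sx k b) \<star> X k b) e"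
    using eqv_trans[OF E] by blast
qed

text \<open>
  The error is an identity, which can only occur if the braid preserves the word of colours.
\<close>

lemma rel_braid:
  assumes "Suc (Suc k) < length b"
  shows "tgt (crossings [Suc k, k, Suc k] b) = tgt (crossings [k, Suc k, k] b)"
    "\<exists>e \<in> {0, idm b, - idm b}. (e \<noteq> 0 \<longrightarrow> tgt (crossings [k, Suc k, k] b) = b) \<and>
      eqv A b (tgt (crossings [k, Suc k, k] b)) (crossm [k, Suc k, k] b) (crossm [Suc k, k, Suc k] b + e)"
proof -
  obtain p q where b: "b = p @ [b ! k, b ! Suc k, b ! Suc (Suc k)] @ q" and p: "length p = k" using split3[OF assms] .
  let ?u = "[b ! k, b ! Suc k, b ! Suc (Suc k)]" and ?v = "[b ! Suc (Suc k), b ! Suc k, b ! k]"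
  have v: "valid [0, 1, 0] ?u" "valid [1, 0, 1] ?u" by (simp_all add: valid_def)
  have t: "tgt (crossings [0, 1, 0] ?u) = ?v" "tgt (crossings [1, 0, 1] ?u) = ?v"
    by (simp_all add: cross_at_def numeral_2_eq_2)
  have C: "eqv A b (p @ ?v @ q) (ctx p q (crossm [0,1,0] ?u)) (crossm [k, Suc k, k] b)"
    "tgt (crossings [k, Suc k, k] b) = p @ ?v @ q"
    "eqv A b (p @ ?v @ q) (ctx p q (crossm [1,0,1] ?u)) (crossm [Suc k, k, Suc k] b)"
    "tgt (crossings [Suc k, k, Suc k] b) = p @ ?v @ q"
    using ctx_crossings[OF v(1), of A p q] ctx_crossings[OF v(2), of A p q] unfolding t b[symmetric]
    by (simp_all only: list.map p add_0_right One_nat_def add_Suc_right)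
  then show "tgt (crossings [Suc k, k, Suc k] b) = tgt (crossings [k, Suc k, k] b)" by simp
  have h: "crossm [0,1,0] ?u \<in> free_hom ?u ?v" "crossm [1,0,1] ?u \<in> free_hom ?u ?v"
    using t crossings_wf[OF v(1)] crossings_wf[OF v(2)] by simp_all
  have i: "eqv A b b (ctx p q (idm ?u)) (idm b)" using ctx_idm[of A p ?u q] unfolding b[symmetric] .
  define T where "T = p @ ?v @ q"
  have "\<exists>e \<in> {0, idm b, - idm b}. (e \<noteq> 0 \<longrightarrow> T = b) \<and>
      eqv A b T (ctx p q (crossm [0,1,0] ?u)) (ctx p q (crossm [1,0,1] ?u) + e)"
  proof (cases "b ! k = b ! Suc (Suc k) \<and> adjacent A (b ! k) (b ! Suc k)")
    case False
    then have "klr_rel A (crossm [0,1,0] ?u) (crossm [1,0,1] ?u)" by (rule braid)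
    from klr_ctx[OF this h, of p q] have "eqv A b T (ctx p q (crossm [0,1,0] ?u)) (ctx p q (crossm [1,0,1] ?u))"
      unfolding T_def b[symmetric] .
    then show ?thesis by (intro bexI[of _ 0]) auto
  next
    case True
    then have uv: "?v = ?u" by simp
    then have T: "T = b" using b unfolding T_def by metis
    have "\<exists>e \<in> {idm ?u, - idm ?u}. klr_rel A (crossm [0,1,0] ?u - crossm [1,0,1] ?u) e"
      using True braid_pos[of "b ! k" "b ! Suc k" A] braid_neg[of "b ! Suc k" "b ! k" A] by (auto simp: adjacent_def)
    then obtain e where e: "e \<in> {idm ?u, - idm ?u}" and r: "klr_rel A (crossm [0,1,0] ?u - crossm [1,0,1] ?u) e" by blast
    have "idm ?u \<in> free_hom ?u ?u" by simp
    then have eh: "e \<in> free_hom ?u ?v" unfolding uv using e free_hom_minus by blast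
    have "eqv A b T (ctx p q (crossm [0,1,0] ?u - crossm [1,0,1] ?u)) (ctx p q e)"
      using klr_ctx[OF r free_hom_diff[OF h] eh, of p q] unfolding T_def b[symmetric] .
    moreover have "\<exists>e' \<in> {idm b, - idm b}. eqv A b T (ctx p q e) e'"
    proof (cases "e = idm ?u")
      case True
      then show ?thesis using i unfolding T by blast
    next
      case False
      then have "e = - idm ?u" using e by blast
      then have "ctx p q e = 0 - ctx p q (idm ?u)" by (simp only: hcomp_minus diff_0)
      moreover have "eqv A b b (0 - ctx p q (idm ?u)) (0 - idm b)" by (rule eqv_diff[OF eqv_refl[OF free_hom_0] i])
      ultimately show ?thesis unfolding T by (metis diff_0 insertCI)
    qed
    ultimately obtain e' where e': "e' \<in> {idm b, - idm b}"
       "eqv A b T (ctx p q (crossm [0,1,0] ?u - crossm [1,0,1] ?u)) e'" by (meson eqv_trans)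
    have "ctx p q (crossm [1,0,1] ?u) \<in> free_hom b T"
      using ctx_free_hom[OF h(2), of p q] unfolding T_def b[symmetric] .
    from eqv_add[OF e'(2) eqv_refl[OF this]]
    have "eqv A b T (ctx p q (crossm [0,1,0] ?u)) (ctx p q (crossm [1,0,1] ?u) + e')"
      by (simp only: hcomp_diff_right hcomp_diff_left diff_add_cancel add.commute[of e'])
    then show ?thesis using e'(1) T by blast
  qed
  then obtain e where e: "e \<in> {0, idm b, - idm b}" "e \<noteq> 0 \<longrightarrow> T = b"
      "eqv A b T (ctx p q (crossm [0,1,0] ?u)) (ctx p q (crossm [1,0,1] ?u) + e)" by blast
  have "e \<in> free_hom b T" using e(1,2) free_hom_minus[of "idm b" b b] by auto
  then have "eqv A b T (crossm [k, Suc k, k] b) (crossm [Suc k, k, Suc k] b + e)"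
    using eqv_trans[OF eqv_sym[OF C(1)[folded T_def]] eqv_trans[OF e(3) eqv_add[OF C(3)[folded T_def] eqv_refl]]] by blast
  then show "\<exists>e \<in> {0, idm b, - idm b}. (e \<noteq> 0 \<longrightarrow> tgt (crossings [k, Suc k, k] b) = b) \<and>
      eqv A b (tgt (crossings [k, Suc k, k] b)) (crossm [k, Suc k, k] b) (crossm [Suc k, k, Suc k] b + e)"
    using e unfolding C(2) T_def by blast
qed

lemma rel_far:
  assumes "Suc k < l" "Suc l < length b"
  shows "sx l (sx k b) = sx k (sx l b)"
    "eqv A b (sx l (sx k b)) (X l (sx k b) \<star> X k b) (X k (sx l b) \<star> X l b)"
proof -
  define c d where cd: "c = take l b" "d = drop l b"
  have b: "b = c @ d" and c: "length c = l" "Suc k < length c" and d: "Suc 0 < length d"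
    using assms by (simp_all add: cd)
  have s: "sx k b = sx k c @ d" "sx l b = c @ sx 0 d"
    using sx_ctx[of k c "[]" d] sx_ctx[of 0 d c "[]"] c d by (simp_all add: b)
  show t: "sx l (sx k b) = sx k (sx l b)"
    using assms by (intro nth_equalityI) (auto simp: nth_tgt_cross_at transpose_def)
  have "deq A (Vert (cross_at k (sx l b)) (cross_at l b)) (Vert (cross_at l (sx k b)) (cross_at k b))"
  proof (rule deq_far[of A _ "cross_at k c" "cross_at 0 d"])
    show "deq A (cross_at k (sx l b)) (Horiz (cross_at k c) (Ident (sx 0 d)))"
      unfolding s by (rule cross_at_right[OF c(2)])
    show "deq A (cross_at l b) (Horiz (Ident (src (cross_at k c))) (cross_at 0 d))"
      using cross_at_left[OF d, of A c] c by (simp add: b)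
    show "deq A (cross_at l (sx k b)) (Horiz (Ident (sx k c)) (cross_at 0 d))"
      unfolding s using cross_at_left[OF d, of A "sx k c"] c by simp
    show "deq A (cross_at k b) (Horiz (cross_at k c) (Ident (src (cross_at 0 d))))"
      using cross_at_right[OF c(2), of A d] d by (simp add: b)
  qed
  from deq_eqv[OF deq_sym[OF this]] show "eqv A b (sx l (sx k b)) (X l (sx k b) \<star> X k b) (X k (sx l b) \<star> X l b)"
    using assms by simp
qed

lemma local_slide:
  "\<exists>e \<in> {0, idm [i, j], - idm [i, j]}. (e \<noteq> 0 \<longrightarrow> i = j) \<and>
    eqv A [i, j] [j, i] (dotm 0 [j, i] \<star> X 0 [i, j]) (X 0 [i, j] \<star> dotm 1 [i, j] + e)"
  "\<exists>e \<in> {0, idm [i, j], - idm [i, j]}. (e \<noteq> 0 \<longrightarrow> i = j) \<and>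
    eqv A [i, j] [j, i] (dotm 1 [j, i] \<star> X 0 [i, j]) (X 0 [i, j] \<star> dotm 0 [i, j] + e)"
proof -
  have t: "sx 0 [i, j] = [j, i]" by (simp add: tgt_cross_at)
  have c: "eqv A [i, j] [j, i] (X 0 [i, j]) (crossm [0] [i, j])"
    using deq_eqv[OF deq_sym[OF deq_VidR[of "cross_at 0 [i, j]" "[i, j]" A]]] t by simp
  have c': "crossm [0] [i, j] \<in> free_hom [i, j] [j, i]" using c by (simp only: eqv_def)
  have d: "dotm k [x, y] \<in> free_hom [x, y] [x, y]" if "k < 2" for k and x y :: 'a using that by simp
  have L: "eqv A [i, j] [j, i] (dotm k [j, i] \<star> X 0 [i, j]) (dotm k [j, i] \<star> crossm [0] [i, j])"
    "eqv A [i, j] [j, i] (crossm [0] [i, j] \<star> dotm k [i, j]) (X 0 [i, j] \<star> dotm k [i, j])" if "k < 2" for k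
    using eqv_vcomp[OF eqv_refl[OF d[OF that]] c] eqv_vcomp[OF eqv_sym[OF c] eqv_refl[OF d[OF that]]] by blast+
  have h: "dotm k [j, i] \<star> crossm [0] [i, j] \<in> free_hom [i, j] [j, i]"
    "crossm [0] [i, j] \<star> dotm k [i, j] \<in> free_hom [i, j] [j, i]" if "k < 2" for k
    using that by (auto intro!: free_hom_vcomp[OF d c'] free_hom_vcomp[OF c' d] simp del: vcomp_of crossings.simps)
  have id: "idm [j, j] \<in> free_hom [j, j] [j, j]" by simp
  show "\<exists>e \<in> {0, idm [i, j], - idm [i, j]}. (e \<noteq> 0 \<longrightarrow> i = j) \<and>
    eqv A [i, j] [j, i] (dotm 0 [j, i] \<star> X 0 [i, j]) (X 0 [i, j] \<star> dotm 1 [i, j] + e)"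
  proof (cases "i = j")
    case True
    have "null A [j, j] [j, j] (dotm 0 [j, j] \<star> crossm [0] [j, j] - crossm [0] [j, j] \<star> dotm 1 [j, j] - idm [j, j])"
      using h True by (intro null_klr nilHecke_1 free_hom_diff id) (simp_all only: one_less_numeral_iff semiring_norm zero_less_numeral)
    then have "eqv A [i, j] [j, i] (dotm 0 [j, i] \<star> crossm [0] [i, j]) (crossm [0] [i, j] \<star> dotm 1 [i, j] + idm [i, j])"
      using True h[of 0] h[of 1] id free_hom_add unfolding eqv_def diff_diff_eq by (metis one_less_numeral_iff semiring_norm(76) zero_less_numeral)
    with eqv_trans[OF L(1)[of 0] eqv_trans[OF this eqv_add[OF L(2)[of 1] eqv_refl[of "idm [i, j]"]]]]
    show ?thesis using True by (intro bexI[of _ "idm [i, j]"]) auto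
  next
    case False
    then have "eqv A [i, j] [j, i] (dotm 0 [j, i] \<star> crossm [0] [i, j]) (crossm [0] [i, j] \<star> dotm 1 [i, j])"
      using null_klr[OF slide_1[OF False] h(1)[of 0] h(2)[of 1]] h[of 0] h[of 1] by (simp add: eqv_def)
    with eqv_trans[OF L(1)[of 0] eqv_trans[OF this L(2)[of 1]]]
    show ?thesis by (intro bexI[of _ 0]) auto
  qed
  show "\<exists>e \<in> {0, idm [i, j], - idm [i, j]}. (e \<noteq> 0 \<longrightarrow> i = j) \<and>
    eqv A [i, j] [j, i] (dotm 1 [j, i] \<star> X 0 [i, j]) (X 0 [i, j] \<star> dotm 0 [i, j] + e)"
  proof (cases "i = j")
    case True
    have "null A [j, j] [j, j] (crossm [0] [j, j] \<star> dotm 0 [j, j] - dotm 1 [j, j] \<star> crossm [0] [j, j] - idm [j, j])"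
      using h True by (intro null_klr nilHecke_2 free_hom_diff id) (simp_all only: one_less_numeral_iff semiring_norm zero_less_numeral)
    from null_uminus[OF this]
    have "null A [j, j] [j, j] (dotm 1 [j, j] \<star> crossm [0] [j, j] - (crossm [0] [j, j] \<star> dotm 0 [j, j] + - idm [j, j]))"
      by (simp only: minus_diff_eq diff_minus_eq_add diff_add_eq_diff_diff_swap uminus_add_conv_diff) (simp add: algebra_simps)
    then have "eqv A [i, j] [j, i] (dotm 1 [j, i] \<star> crossm [0] [i, j]) (crossm [0] [i, j] \<star> dotm 0 [i, j] + - idm [i, j])"
      using True h[of 0] h[of 1] id free_hom_add free_hom_minus[OF id] unfolding eqv_def by (metis one_less_numeral_iff semiring_norm(76) zero_less_numeral)
    with eqv_trans[OF L(1)[of 1] eqv_trans[OF this eqv_add[OF L(2)[of 0] eqv_refl[of "- idm [i, j]"]]]]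
    show ?thesis using True free_hom_minus[OF id] by (intro bexI[of _ "- idm [i, j]"]) auto
  next
    case False
    then have "eqv A [i, j] [j, i] (dotm 1 [j, i] \<star> crossm [0] [i, j]) (crossm [0] [i, j] \<star> dotm 0 [i, j])"
      using null_klr[OF slide_2[OF False] h(1)[of 1] h(2)[of 0]] h[of 0] h[of 1] by (simp add: eqv_def)
    with eqv_trans[OF L(1)[of 1] eqv_trans[OF this L(2)[of 0]]]
    show ?thesis by (intro bexI[of _ 0]) auto
  qed
qed

lemma ctx_local:
  assumes "\<exists>e \<in> {0, idm [i, j], - idm [i, j]}. (e \<noteq> 0 \<longrightarrow> i = j) \<and> eqv A [i, j] [j, i] f (g + e)"
  shows "\<exists>e \<in> {0, idm (p @ [i, j] @ q), - idm (p @ [i, j] @ q)}. (e \<noteq> 0 \<longrightarrow> [j, i] = [i, j]) \<and>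
    eqv A (p @ [i, j] @ q) (p @ [j, i] @ q) (ctx p q f) (ctx p q g + e)"
proof -
  let ?B = "p @ [i, j] @ q" and ?T = "p @ [j, i] @ q"
  obtain e where e: "e \<in> {0, idm [i, j], - idm [i, j]}" "e \<noteq> 0 \<longrightarrow> i = j" "eqv A [i, j] [j, i] f (g + e)"
    using assms by blast
  have "idm [i, j] \<in> free_hom [i, j] [i, j]" by simp
  then have eh: "e \<in> free_hom [i, j] [j, i]" using e(1,2) free_hom_minus by fastforce
  have "g + e \<in> free_hom [i, j] [j, i]" using e(3) by (simp only: eqv_def)
  from free_hom_diff[OF this eh] have g: "g \<in> free_hom [i, j] [j, i]" by simp
  have E: "eqv A ?B ?T (ctx p q f) (ctx p q g + ctx p q e)"
    using eqv_ctx[OF e(3), of p q] by (simp only: hcomp_add_left hcomp_add_right)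
  have "\<exists>e' \<in> {0, idm ?B, - idm ?B}. (e' \<noteq> 0 \<longrightarrow> [j, i] = [i, j]) \<and> eqv A ?B ?T (ctx p q e) e'"
  proof (cases "e = 0")
    case True
    then show ?thesis by (intro bexI[of _ 0]) (simp_all add: eqv_refl)
  next
    case False
    then have ij: "j = i" using e(2) by simp
    have i: "eqv A (p @ [i, i] @ q) (p @ [i, i] @ q) (ctx p q (idm [i, i])) (idm (p @ [i, i] @ q))" by (rule ctx_idm)
    show ?thesis
    proof (cases "e = idm [i, j]")
      case True
      then show ?thesis using i unfolding ij by blast
    next
      case False
      then have "e = - idm [i, i]" using e(1) \<open>e \<noteq> 0\<close> unfolding ij by blast
      then have "ctx p q e = 0 - ctx p q (idm [i, i])" by (simp only: hcomp_minus diff_0)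
      moreover have "eqv A (p @ [i, i] @ q) (p @ [i, i] @ q) (0 - ctx p q (idm [i, i])) (0 - idm (p @ [i, i] @ q))"
        by (rule eqv_diff[OF eqv_refl[OF free_hom_0] i])
      ultimately show ?thesis unfolding ij by (metis diff_0 insertCI)
    qed
  qed
  then obtain e' where e': "e' \<in> {0, idm ?B, - idm ?B}" "e' \<noteq> 0 \<longrightarrow> [j, i] = [i, j]" "eqv A ?B ?T (ctx p q e) e'" by blast
  from eqv_trans[OF E eqv_add[OF eqv_refl[OF ctx_free_hom[OF g]] e'(3)]] e'(1,2) show ?thesis by blast
qed

text \<open>Replacing padded generators in a dot-slide relation by the generators of the long word.\<close>

lemma ctx_transport:
  assumes x: "eqv A B T (ctx p q x) x'" "x \<in> free_hom u v" and y: "y \<in> free_hom v v" and z: "z \<in> free_hom u u"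
    and y': "eqv A T T (ctx p q y) y'" and z': "eqv A B B (ctx p q z) z'"
    and r: "eqv A B T (ctx p q (y \<star> x)) (ctx p q (x \<star> z) + e)"
    and e: "e \<in> free_hom B T" and BT: "B = p @ u @ q" "T = p @ v @ q"
  shows "eqv A B T (y' \<star> x') (x' \<star> z' + e)"
proof -
  have "eqv A B T (y' \<star> x') (ctx p q y \<star> ctx p q x)"
    by (rule eqv_vcomp[OF eqv_sym[OF y'] eqv_sym[OF x(1)]])
  also have "eqv A B T \<dots> (ctx p q (y \<star> x))"
    using eqv_sym[OF ctx_vcomp[OF y x(2)]] BT by blast
  also note r
  also have "eqv A B T (ctx p q (x \<star> z) + e) (ctx p q x \<star> ctx p q z + e)"
    using eqv_add[OF ctx_vcomp[OF x(2) z, of A p q] eqv_refl[of e]] e BT by blast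
  also have "eqv A B T \<dots> (x' \<star> z' + e)"
    by (rule eqv_add[OF eqv_vcomp[OF x(1) z'] eqv_refl[OF e]])
  finally show ?thesis .
qed

text \<open>Dots slide down through crossings, to the strand that they lie on, up to an identity.\<close>

lemma rel_dot:
  assumes "Suc k < length b" "l < length b"
  shows "\<exists>e \<in> {0, idm b, - idm b}. (e \<noteq> 0 \<longrightarrow> sx k b = b) \<and>
    eqv A b (sx k b) (dotm l (sx k b) \<star> X k b) (X k b \<star> dotm (sw k l) b + e)"
proof -
  obtain p q where b: "b = p @ [b ! k, b ! Suc k] @ q" and p: "length p = k" using split2[OF assms(1)] .
  let ?u = "[b ! k, b ! Suc k]" and ?v = "[b ! Suc k, b ! k]"
  have sb: "sx k b = p @ ?v @ q" using sx_ctx[of 0 ?u p q] unfolding b[symmetric] by (simp add: p tgt_cross_at)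
  have cx: "eqv A b (sx k b) (ctx p q (X 0 ?u)) (X k b)"
    using ctx_cross[of 0 ?u A p q] p unfolding b[symmetric] sb by (simp add: tgt_cross_at)
  consider (l) "l < k" | (k) "l = k" | (Sk) "l = Suc k" | (r) "Suc k < l" by linarith
  then show ?thesis
  proof cases
    case l
    define c d where cd: "c = take k b" "d = drop k b"
    have bc: "b = c @ d" and c: "length c = k" and d: "Suc 0 < length d" using assms by (simp_all add: cd)
    have s: "sx k b = c @ sx 0 d" using sx_ctx[of 0 d c "[]"] c d by (simp add: bc)
    have "deq A (Vert (dot_at l (sx k b)) (cross_at k b)) (Vert (cross_at k b) (dot_at l b))"
    proof (rule deq_far[of A _ "dot_at l c" "cross_at 0 d"])
      show "deq A (dot_at l (sx k b)) (Horiz (dot_at l c) (Ident (sx 0 d)))"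
        unfolding s using l c by (intro dot_at_right) simp
      show "deq A (cross_at k b) (Horiz (Ident (src (dot_at l c))) (cross_at 0 d))"
        "deq A (cross_at k b) (Horiz (Ident (tgt (dot_at l c))) (cross_at 0 d))"
        using cross_at_left[OF d, of A c] c l by (simp_all add: bc)
      show "deq A (dot_at l b) (Horiz (dot_at l c) (Ident (src (cross_at 0 d))))"
        using l c d dot_at_right[of l c A d] by (simp add: bc)
    qed
    from deq_eqv[OF this] show ?thesis using assms l by (intro bexI[of _ 0]) (auto simp: transpose_apply_other)
  next
    case r
    define c d where cd: "c = take (Suc (Suc k)) b" "d = drop (Suc (Suc k)) b"
    obtain m where m: "l = Suc (Suc k) + m" using r by (metis less_iff_Suc_add add_Suc_right add_Suc)
    have bc: "b = c @ d" and c: "length c = Suc (Suc k)" and d: "m < length d" using assms m by (simp_all add: cd)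
    have s: "sx k b = sx k c @ d" using sx_ctx[of k c "[]" d] c by (simp add: bc)
    have dl: "deq A (dot_at l (c' @ d)) (Horiz (Ident c') (dot_at m d))" if "length c' = length c" for c'
      using dot_at_left[OF d, of A c'] that c m by simp
    have "deq A (Vert (cross_at k b) (dot_at l b)) (Vert (dot_at l (sx k b)) (cross_at k b))"
    proof (rule deq_far[of A _ "cross_at k c" "dot_at m d"])
      show "deq A (cross_at k b) (Horiz (cross_at k c) (Ident (tgt (dot_at m d))))"
        "deq A (cross_at k b) (Horiz (cross_at k c) (Ident (src (dot_at m d))))"
        using cross_at_right[of k c A d] c d by (simp_all add: bc)
      show "deq A (dot_at l b) (Horiz (Ident (src (cross_at k c))) (dot_at m d))"
        using dl[of c] c by (simp add: bc)
      show "deq A (dot_at l (sx k b)) (Horiz (Ident (sx k c)) (dot_at m d))"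
        unfolding s using dl[of "sx k c"] c by simp
    qed
    from deq_eqv[OF deq_sym[OF this]] show ?thesis using assms r by (intro bexI[of _ 0]) (auto simp: transpose_apply_other)
  next
    case k
    have "eqv A b (sx k b) (dotm k (sx k b) \<star> X k b) (X k b \<star> dotm (Suc k) b + e)"
      if "eqv A b (sx k b) (ctx p q (dotm 0 ?v \<star> X 0 ?u)) (ctx p q (X 0 ?u \<star> dotm 1 ?u) + e)"
        "e \<in> free_hom b (sx k b)" for e
    proof (rule ctx_transport[OF cx _ _ _ _ _ that b sb])
      show "eqv A (sx k b) (sx k b) (ctx p q (dotm 0 ?v)) (dotm k (sx k b))"
        using ctx_dot[of 0 ?v A p q] p unfolding sb by simp
      show "eqv A b b (ctx p q (dotm 1 ?u)) (dotm (Suc k) b)"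
        using ctx_dot[of 1 ?u A p q] p unfolding b[symmetric] by simp
    qed (simp_all add: tgt_cross_at)
    moreover obtain e where e: "e \<in> {0, idm b, - idm b}" "e \<noteq> 0 \<longrightarrow> ?v = ?u"
      "eqv A b (sx k b) (ctx p q (dotm 0 ?v \<star> X 0 ?u)) (ctx p q (X 0 ?u \<star> dotm 1 ?u) + e)"
      using ctx_local[OF local_slide(1)[of "b ! k" "b ! Suc k" A], of p q] unfolding b[symmetric] sb[symmetric] by blast
    moreover have "e \<noteq> 0 \<longrightarrow> sx k b = b" using e(2) sb b by metis
    moreover from this have "e \<in> free_hom b (sx k b)" using e(1) free_hom_minus[of "idm b" b b] by auto
    ultimately show ?thesis using k by (intro bexI[of _ e]) auto
  next
    case Sk
    have "eqv A b (sx k b) (dotm (Suc k) (sx k b) \<star> X k b) (X k b \<star> dotm k b + e)"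
      if "eqv A b (sx k b) (ctx p q (dotm 1 ?v \<star> X 0 ?u)) (ctx p q (X 0 ?u \<star> dotm 0 ?u) + e)"
        "e \<in> free_hom b (sx k b)" for e
    proof (rule ctx_transport[OF cx _ _ _ _ _ that b sb])
      show "eqv A (sx k b) (sx k b) (ctx p q (dotm 1 ?v)) (dotm (Suc k) (sx k b))"
        using ctx_dot[of 1 ?v A p q] p unfolding sb by simp
      show "eqv A b b (ctx p q (dotm 0 ?u)) (dotm k b)"
        using ctx_dot[of 0 ?u A p q] p unfolding b[symmetric] by simp
    qed (simp_all add: tgt_cross_at)
    moreover obtain e where e: "e \<in> {0, idm b, - idm b}" "e \<noteq> 0 \<longrightarrow> ?v = ?u"
      "eqv A b (sx k b) (ctx p q (dotm 1 ?v \<star> X 0 ?u)) (ctx p q (X 0 ?u \<star> dotm 0 ?u) + e)"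
      using ctx_local[OF local_slide(2)[of "b ! k" "b ! Suc k" A], of p q] unfolding b[symmetric] sb[symmetric] by blast
    moreover have "e \<noteq> 0 \<longrightarrow> sx k b = b" using e(2) sb b by metis
    moreover from this have "e \<in> free_hom b (sx k b)" using e(1) free_hom_minus[of "idm b" b b] by auto
    ultimately show ?thesis using Sk by (intro bexI[of _ e]) auto
  qed
qed

section \<open>Applying words of crossings to a morphism\<close>

abbreviation wd :: "nat list \<Rightarrow> 'v list \<Rightarrow> 'v list" where "wd ks b \<equiv> tgt (crossings ks b)"

text \<open>
  The letters are composed one at a time onto \<open>f\<close>; in contrast to \<open>crossm ks b \<star>
  f\<close>, concatenation of words is then literal composition, and relations apply to a subword without
  reassociating.
\<close>

primrec papp :: "nat list \<Rightarrow> 'v list \<Rightarrow> 'v lin \<Rightarrow> 'v lin" where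
  "papp [] b f = f"
| "papp (k # ks) b f = X k (wd ks b) \<star> papp ks b f"

lemma valid_Cons [simp]: "valid (k # ks) b \<longleftrightarrow> Suc k < length b \<and> valid ks b"
  by (auto simp: valid_def)
lemma valid_Nil [simp]: "valid [] b" by (simp add: valid_def)
lemma valid_append [simp]: "valid (ks @ ls) b \<longleftrightarrow> valid ks b \<and> valid ls b"
  by (auto simp: valid_def)
lemma valid_length: "length b = length c \<Longrightarrow> valid ks b \<longleftrightarrow> valid ks c"
  by (simp add: valid_def)
lemma length_wd [simp]: "valid ks b \<Longrightarrow> length (wd ks b) = length b"
  using crossings_wf by blast

lemma wd_append: "wd (ks @ ls) b = wd ks (wd ls b)"
  by (induction ks) simp_all

lemma papp_append: "papp (ks @ ls) b f = papp ks (wd ls b) (papp ls b f)"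
  by (induction ks) (simp_all add: wd_append)

lemma papp_diff: "papp ks b (f - g) = papp ks b f - papp ks b g"
  by (induction ks) simp_all
lemma papp_0 [simp]: "papp ks b 0 = 0"
  using papp_diff[of ks b 0 0] by simp
lemma papp_sum: "papp ks b (sum f I) = (\<Sum>i\<in>I. papp ks b (f i))"
proof (induction I rule: infinite_finite_induct)
  case (insert i I)
  have "papp ks b (g + h) = papp ks b g + papp ks b h" for g h :: "'a lin"
    using papp_diff[of ks b "g + h" h] by (simp add: algebra_simps)
  then show ?case using insert by simp
qed simp_all

lemma X_free_hom: "Suc k < length b \<Longrightarrow> X k b \<in> free_hom b (sx k b)"
  by simp

lemma papp_free_hom: "f \<in> free_hom a b \<Longrightarrow> valid ks b \<Longrightarrow> papp ks b f \<in> free_hom a (wd ks b)"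
  by (induction ks) (auto intro!: free_hom_vcomp[OF X_free_hom])

lemma eqv_free_hom: "eqv A a b f g \<Longrightarrow> f \<in> free_hom a b" "eqv A a b f g \<Longrightarrow> g \<in> free_hom a b"
  by (auto simp: eqv_def)

lemma eqv_X: "eqv A a b f g \<Longrightarrow> Suc k < length b \<Longrightarrow> eqv A a (sx k b) (X k b \<star> f) (X k b \<star> g)"
  by (intro eqv_vcomp[of A b] eqv_refl X_free_hom)

lemma eqv_papp: "eqv A a b f g \<Longrightarrow> valid ks b \<Longrightarrow> eqv A a (wd ks b) (papp ks b f) (papp ks b g)"
  by (induction ks) (auto intro!: eqv_X)

lemma papp_swap_far:
  assumes "Suc k < l \<or> Suc l < k" "valid [k, l] b" "f \<in> free_hom a b"
  shows "wd [l, k] b = wd [k, l] b" "eqv A a (wd [l, k] b) (papp [l, k] b f) (papp [k, l] b f)"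
proof -
  have *: "sx l (sx k b) = sx k (sx l b) \<and>
    eqv A a (sx l (sx k b)) (X l (sx k b) \<star> (X k b \<star> f)) (X k (sx l b) \<star> (X l b \<star> f))"
    if kl: "Suc k < l" "Suc l < length b" for k l
  proof -
    have k: "Suc k < length b" using kl by simp
    have "eqv A a (sx l (sx k b)) (X l (sx k b) \<star> (X k b \<star> f)) ((X l (sx k b) \<star> X k b) \<star> f)"
      using kl k by (intro eqv_sym[OF eqv_vassoc[of _ "sx k b" _ _ b]] X_free_hom assms) simp_all
    also have "eqv A a (sx l (sx k b)) \<dots> ((X k (sx l b) \<star> X l b) \<star> f)"
      by (intro eqv_vcomp[of A b] eqv_refl assms rel_far(2) kl)
    also have "eqv A a (sx l (sx k b)) \<dots> (X k (sx l b) \<star> (X l b \<star> f))"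
      unfolding rel_far(1)[OF kl] using kl k by (intro eqv_vassoc[of _ "sx l b" _ _ b] X_free_hom assms) simp_all
    finally show ?thesis using rel_far(1)[OF kl] by blast
  qed
  have "wd [l, k] b = wd [k, l] b \<and> eqv A a (wd [l, k] b) (papp [l, k] b f) (papp [k, l] b f)"
  proof (cases "Suc k < l")
    case True
    moreover have "Suc l < length b" using assms(2) by simp
    ultimately show ?thesis using *[of k l] unfolding crossings.simps tgt.simps papp.simps by blast
  next
    case False
    then have "Suc l < k" using assms(1) by simp
    moreover have "Suc k < length b" using assms(2) by simp
    ultimately have "sx k (sx l b) = sx l (sx k b)"
      "eqv A a (sx k (sx l b)) (X k (sx l b) \<star> (X l b \<star> f)) (X l (sx k b) \<star> (X k b \<star> f))"
      using *[of l k] by blast+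
    from eqv_sym[OF this(2)] this(1) show ?thesis unfolding crossings.simps tgt.simps papp.simps by metis
  qed
  then show "wd [l, k] b = wd [k, l] b" "eqv A a (wd [l, k] b) (papp [l, k] b f) (papp [k, l] b f)" by auto
qed

lemma papp_move_far:
  assumes "\<forall>u\<in>set us. Suc k < u \<or> Suc u < k" "valid (k # us) b" "f \<in> free_hom a b"
  shows "wd (k # us) b = wd (us @ [k]) b \<and> eqv A a (wd (k # us) b) (papp (k # us) b f) (papp (us @ [k]) b f)"
  using assms
proof (induction us)
  case Nil
  then show ?case by (auto intro!: eqv_refl free_hom_vcomp X_free_hom)
next
  case (Cons u us)
  have v: "valid [k, u] (wd us b)" "valid us b" using Cons.prems(2) by auto
  have h: "papp us b f \<in> free_hom a (wd us b)" using papp_free_hom Cons.prems(3) v(2) by blast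
  have ku: "Suc u < k \<or> Suc k < u" using Cons.prems(1) by auto
  note s = papp_swap_far[OF ku _ h]
  have IH: "wd (k # us) b = wd (us @ [k]) b" "eqv A a (wd (k # us) b) (papp (k # us) b f) (papp (us @ [k]) b f)"
    using Cons by auto
  have w: "wd (k # u # us) b = wd [k, u] (wd us b)" "wd (u # k # us) b = wd [u, k] (wd us b)"
    by simp_all
  have p: "papp (k # u # us) b f = papp [k, u] (wd us b) (papp us b f)" "papp (u # k # us) b f = papp [u, k] (wd us b) (papp us b f)"
    by simp_all
  have v': "valid [u, k] (wd us b)" using v by simp
  have e1: "eqv A a (wd (k # u # us) b) (papp (k # u # us) b f) (papp (u # k # us) b f)" "wd (k # u # us) b = wd (u # k # us) b"
    using s v' unfolding w p by auto
  have e2: "eqv A a (wd (u # k # us) b) (papp (u # k # us) b f) (papp (u # us @ [k]) b f)"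
    using eqv_X[OF IH(2), of u] IH(1) v by simp
  show ?case using e1 e2 IH(1) eqv_trans by fastforce
qed

text \<open>Two words that involve no common or neighbouring positions commute.\<close>

lemma papp_commute_far:
  assumes "\<forall>u\<in>set us. \<forall>v\<in>set vs. Suc v < u \<or> Suc u < v" "valid us b" "valid vs b" "f \<in> free_hom a b"
  shows "wd (vs @ us) b = wd (us @ vs) b \<and> eqv A a (wd (vs @ us) b) (papp (vs @ us) b f) (papp (us @ vs) b f)"
  using assms
proof (induction vs)
  case Nil
  then show ?case by (auto intro!: eqv_refl papp_free_hom)
next
  case (Cons v vs)
  then have IH: "wd (vs @ us) b = wd (us @ vs) b" "eqv A a (wd (vs @ us) b) (papp (vs @ us) b f) (papp (us @ vs) b f)"
    by auto
  have h: "papp vs b f \<in> free_hom a (wd vs b)" using papp_free_hom Cons.prems by auto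
  have vl: "valid us (wd vs b)" "Suc v < length b" using Cons.prems by (auto simp: valid_length[of "wd vs b" b])
  have "\<forall>u\<in>set us. Suc v < u \<or> Suc u < v" using Cons.prems(1) by auto
  from papp_move_far[OF this _ h, of A] have m: "wd (v # us @ vs) b = wd (us @ v # vs) b"
    "eqv A a (wd (v # us @ vs) b) (papp (v # us @ vs) b f) (papp (us @ v # vs) b f)"
    using vl Cons.prems by (auto simp: wd_append papp_append)
  have "eqv A a (wd (v # vs @ us) b) (papp (v # vs @ us) b f) (papp (v # us @ vs) b f)"
    using eqv_X[OF IH(2), of v] IH(1) vl Cons.prems by simp
  then show ?case using m IH(1) eqv_trans by fastforce
qed

lemma dot_free_hom: "k < length b \<Longrightarrow> dotm k b \<in> free_hom b b"
  by simp

lemma papp_double: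
  assumes "Suc k < length b" "f \<in> free_hom a b"
  shows "\<exists>g \<in> {0, f, dotm k b \<star> f - dotm (Suc k) b \<star> f, dotm (Suc k) b \<star> f - dotm k b \<star> f}.
    eqv A a b (papp [k, k] b f) g"
proof -
  obtain e where e: "e \<in> {0, idm b, dotm k b - dotm (Suc k) b, dotm (Suc k) b - dotm k b}"
    "eqv A b b (X k (sx k b) \<star> X k b) e" using rel_double(2)[OF assms(1)] by blast
  have "eqv A a b (papp [k, k] b f) ((X k (sx k b) \<star> X k b) \<star> f)"
    using eqv_sym[OF eqv_vassoc[of "X k (sx k b)" "sx k b" "sx k (sx k b)" "X k b" b f a A]] assms rel_double(1)[OF assms(1)]
    by simp
  also have "eqv A a b \<dots> (e \<star> f)" by (rule eqv_vcomp[OF e(2) eqv_refl[OF assms(2)]])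
  finally have E: "eqv A a b (papp [k, k] b f) (e \<star> f)" .
  show ?thesis
  proof (cases "e = idm b")
    case True
    then show ?thesis using eqv_trans[OF E[unfolded True] eqv_id_left[OF assms(2)]] by blast
  next
    case False
    then have "e \<star> f \<in> {0, dotm k b \<star> f - dotm (Suc k) b \<star> f, dotm (Suc k) b \<star> f - dotm k b \<star> f}"
      using e(1) by (elim insertE) (simp_all only: insert_iff vcomp_0 vcomp_diff_left simp_thms empty_iff)
    then show ?thesis using E by blast
  qed
qed

lemma papp_eqv_crossings:
  assumes "valid ks b" "f \<in> free_hom a b"
  shows "eqv A a (wd ks b) (papp ks b f) (crossm ks b \<star> f)"
  using assms(1)
proof (induction ks)
  case Nil
  then show ?case using eqv_sym[OF eqv_id_left[OF assms(2)]] by simp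
next
  case (Cons l ks)
  then have v: "valid ks b" and l: "Suc l < length (wd ks b)" by auto
  have "eqv A a (wd (l # ks) b) (papp (l # ks) b f) (X l (wd ks b) \<star> (crossm ks b \<star> f))"
    using eqv_X[OF Cons.IH[OF v] l] by simp
  also have "eqv A a (wd (l # ks) b) \<dots> ((X l (wd ks b) \<star> crossm ks b) \<star> f)"
    using crossings_wf[OF v] l assms(2) by (intro eqv_sym[OF eqv_vassoc[of _ "wd ks b" _ _ b]]) auto
  finally show ?case by simp
qed

lemma eqv_signed_id:
  assumes "e \<in> {0, idm b, - idm b}" "f \<in> free_hom a b"
  shows "\<exists>g \<in> {0, f, - f}. eqv A a b (e \<star> f) g"
proof -
  have i: "eqv A a b (idm b \<star> f) f" by (rule eqv_id_left[OF assms(2)])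
  have "eqv A a b (0 - idm b \<star> f) (0 - f)" by (rule eqv_diff[OF eqv_refl[OF free_hom_0] i])
  then have "eqv A a b ((- idm b) \<star> f) (- f)" by (simp only: vcomp_minus diff_0)
  then show ?thesis using assms(1) i eqv_refl[OF free_hom_0, of A a b] by (elim insertE) (auto simp del: vcomp_minus)
qed

lemma papp_braid:
  assumes "Suc (Suc k) < length b" "f \<in> free_hom a b"
  shows "wd [Suc k, k, Suc k] b = wd [k, Suc k, k] b"
    "\<exists>g \<in> {0, f, - f}. (g \<noteq> 0 \<longrightarrow> wd [k, Suc k, k] b = b) \<and>
      eqv A a (wd [k, Suc k, k] b) (papp [Suc k, k, Suc k] b f) (papp [k, Suc k, k] b f + g)"
proof -
  let ?T = "wd [k, Suc k, k] b"
  show t: "wd [Suc k, k, Suc k] b = ?T" by (rule rel_braid(1)[OF assms(1)])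
  have v: "valid [k, Suc k, k] b" "valid [Suc k, k, Suc k] b" using assms by auto
  note P = papp_eqv_crossings[OF _ assms(2), of _ A]
  obtain e where e: "e \<in> {0, idm b, - idm b}" "e \<noteq> 0 \<longrightarrow> ?T = b"
    "eqv A b ?T (crossm [k, Suc k, k] b) (crossm [Suc k, k, Suc k] b + e)" using rel_braid(2)[OF assms(1)] by blast
  have eT: "e \<in> free_hom b ?T" using e(1,2) free_hom_minus[of "idm b" b b] by auto
  have "eqv A a ?T (crossm [k, Suc k, k] b \<star> f) ((crossm [Suc k, k, Suc k] b + e) \<star> f)"
    by (rule eqv_vcomp[OF e(3) eqv_refl[OF assms(2)]])
  then have "eqv A a ?T (crossm [k, Suc k, k] b \<star> f) (crossm [Suc k, k, Suc k] b \<star> f + e \<star> f)"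
    by (simp only: vcomp_add_left)
  from eqv_diff[OF eqv_trans[OF P[OF v(1)] this] eqv_refl[OF free_hom_vcomp[OF eT assms(2)]]]
  have "eqv A a ?T (papp [k, Suc k, k] b f - e \<star> f) (crossm [Suc k, k, Suc k] b \<star> f)" by (simp only: add_diff_cancel_right')
  then have M: "eqv A a ?T (papp [Suc k, k, Suc k] b f) (papp [k, Suc k, k] b f - e \<star> f)"
    using eqv_trans[OF P[OF v(2)]] eqv_sym t by metis
  show "\<exists>g \<in> {0, f, - f}. (g \<noteq> 0 \<longrightarrow> ?T = b) \<and>
      eqv A a ?T (papp [Suc k, k, Suc k] b f) (papp [k, Suc k, k] b f + g)"
  proof (cases "e = 0")
    case True
    then show ?thesis using M by (intro bexI[of _ 0]) simp_all
  next
    case False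
    then have T: "?T = b" using e(2) by blast
    obtain g where g: "g \<in> {0, f, - f}" "eqv A a b (e \<star> f) g" using eqv_signed_id[OF e(1) assms(2)] by blast
    have "eqv A a ?T (papp [k, Suc k, k] b f - e \<star> f) (papp [k, Suc k, k] b f - g)"
      using g(2) papp_free_hom[OF assms(2) v(1)] unfolding T by (intro eqv_diff eqv_refl) simp_all
    from eqv_trans[OF M this] show ?thesis using g(1) T by (intro bexI[of _ "- g"]) (auto simp del: papp.simps)
  qed
qed

lemma papp_dot:
  assumes "Suc k < length b" "l < length b" "f \<in> free_hom a b"
  shows "\<exists>g \<in> {0, f, - f}. (g \<noteq> 0 \<longrightarrow> sx k b = b) \<and>
    eqv A a (sx k b) (dotm l (sx k b) \<star> (X k b \<star> f)) (X k b \<star> (dotm (sw k l) b \<star> f) + g)"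
proof -
  obtain e where e: "e \<in> {0, idm b, - idm b}" "e \<noteq> 0 \<longrightarrow> sx k b = b"
    "eqv A b (sx k b) (dotm l (sx k b) \<star> X k b) (X k b \<star> dotm (sw k l) b + e)"
    using rel_dot[OF assms(1,2)] by blast
  have l': "sw k l < length b" using assms by (auto simp: transpose_def)
  have l'': "l < length (sx k b)" using assms by simp
  have "eqv A a (sx k b) (dotm l (sx k b) \<star> (X k b \<star> f)) ((dotm l (sx k b) \<star> X k b) \<star> f)"
    by (rule eqv_sym[OF eqv_vassoc[OF dot_free_hom[OF l''] X_free_hom[OF assms(1)] assms(3)]])
  also have "eqv A a (sx k b) \<dots> ((X k b \<star> dotm (sw k l) b + e) \<star> f)"
    by (rule eqv_vcomp[OF e(3) eqv_refl[OF assms(3)]])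
  finally have E: "eqv A a (sx k b) (dotm l (sx k b) \<star> (X k b \<star> f)) ((X k b \<star> dotm (sw k l) b) \<star> f + e \<star> f)"
    by (simp only: vcomp_add_left)
  have S: "eqv A a (sx k b) ((X k b \<star> dotm (sw k l) b) \<star> f) (X k b \<star> (dotm (sw k l) b \<star> f))"
    by (rule eqv_vassoc[OF X_free_hom[OF assms(1)] dot_free_hom[OF l'] assms(3)])
  show ?thesis
  proof (cases "e = 0")
    case True
    have "eqv A a (sx k b) (dotm l (sx k b) \<star> (X k b \<star> f)) ((X k b \<star> dotm (sw k l) b) \<star> f)"
      using E unfolding True by (simp only: vcomp_0 add_0_right)
    from eqv_trans[OF this S] show ?thesis by (intro bexI[of _ 0]) simp_all
  next
    case False
    then have T: "sx k b = b" using e(2) by blast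
    obtain g where g: "g \<in> {0, f, - f}" "eqv A a b (e \<star> f) g" using eqv_signed_id[OF e(1) assms(3)] by blast
    have "eqv A a (sx k b) (e \<star> f) g" unfolding T by (rule g(2))
    from eqv_trans[OF E eqv_add[OF S this]] show ?thesis
      by (intro bexI[of _ g] conjI impI T g(1))
  qed
qed

section \<open>Morphisms generated by the first crossings\<close>

text \<open>
  The morphisms generated from identities by dots in all positions and by the crossings
  \<open>\<psi>\<^sub>k\<close> with \<open>k + 1 < m\<close>, that is, by the crossings of the first
  \<open>m\<close> strands.
\<close>

inductive gen :: "('v \<times> 'v) set \<Rightarrow> 'v list \<Rightarrow> nat \<Rightarrow> 'v list \<Rightarrow> 'v lin \<Rightarrow> bool" for A a m where
  gen_id: "gen A a m a (idm a)"
| gen_dot: "gen A a m b f \<Longrightarrow> k < length b \<Longrightarrow> gen A a m b (dotm k b \<star> f)"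
| gen_cross: "gen A a m b f \<Longrightarrow> Suc k < m \<Longrightarrow> Suc k < length b \<Longrightarrow> gen A a m (sx k b) (X k b \<star> f)"
| gen_zero: "length b = length a \<Longrightarrow> gen A a m b 0"
| gen_diff: "gen A a m b f \<Longrightarrow> gen A a m b g \<Longrightarrow> gen A a m b (f - g)"
| gen_eqv: "gen A a m b f \<Longrightarrow> eqv A a b f g \<Longrightarrow> gen A a m b g"

lemma gen_free_hom: "gen A a m b f \<Longrightarrow> f \<in> free_hom a b \<and> length b = length a"
  by (induction rule: gen.induct)
    (auto intro: free_hom_vcomp[OF X_free_hom] free_hom_vcomp[OF dot_free_hom] free_hom_diff eqv_free_hom)

lemma gen_papp: "gen A a m b f \<Longrightarrow> valid ks b \<Longrightarrow> \<forall>k\<in>set ks. Suc k < m \<Longrightarrow> gen A a m (wd ks b) (papp ks b f)"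
  by (induction ks) (auto intro!: gen_cross)

text \<open>
  The sums of terms \<open>\<psi>\<^sub>r \<psi>\<^bsub>r+1\<^esub> \<cdots> \<psi>\<^bsub>m-1\<^esub> g\<close> with \<open>r \<ge> r0\<close> and \<open>g\<close> generated by the crossings of the first
  \<open>m\<close> strands.  This mirrors the coset decomposition of \<open>S\<^bsub>m+1\<^esub>\<close> by \<open>S\<^sub>m\<close>.  The span for \<open>r0 = 0\<close> is closed under
  dots and under all crossings of the first \<open>m + 1\<close> strands, hence contains all that they generate.
\<close>

inductive stair :: "('v \<times> 'v) set \<Rightarrow> 'v list \<Rightarrow> nat \<Rightarrow> nat \<Rightarrow> 'v list \<Rightarrow> 'v lin \<Rightarrow> bool" for A a m r0 where
  stair_base: "gen A a m b g \<Longrightarrow> r0 \<le> r \<Longrightarrow> r \<le> m \<Longrightarrow> stair A a m r0 (wd [r..<m] b) (papp [r..<m] b g)"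
| stair_zero: "length b = length a \<Longrightarrow> stair A a m r0 b 0"
| stair_diff: "stair A a m r0 b f \<Longrightarrow> stair A a m r0 b g \<Longrightarrow> stair A a m r0 b (f - g)"
| stair_eqv: "stair A a m r0 b f \<Longrightarrow> eqv A a b f g \<Longrightarrow> stair A a m r0 b g"

lemma valid_upt: "m < length b \<Longrightarrow> valid [r..<m] b"
  by (auto simp: valid_def)

context
  fixes A :: "('v \<times> 'v) set" and a :: "'v list" and m :: nat
  assumes m: "m < length a"
begin

lemma stair_free_hom: "stair A a m r0 b f \<Longrightarrow> f \<in> free_hom a b \<and> length b = length a"
proof (induction rule: stair.induct)
  case (stair_base b g r)
  then show ?case using m gen_free_hom[of A a m b g] by (auto intro!: papp_free_hom simp: valid_upt)
qed (auto intro: free_hom_diff eqv_free_hom)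

lemma stair_mono: "stair A a m r b f \<Longrightarrow> r' \<le> r \<Longrightarrow> stair A a m r' b f"
  by (induction rule: stair.induct) (auto intro: stair.intros)

lemma stair_minus: "stair A a m r b f \<Longrightarrow> stair A a m r b (- f)"
  using stair_diff[OF stair_zero, of b a A m r f] stair_free_hom by fastforce
lemma stair_add: "stair A a m r b f \<Longrightarrow> stair A a m r b g \<Longrightarrow> stair A a m r b (f + g)"
  using stair_diff[of A a m r b f "- g"] stair_minus by simp

lemma stair_signed: "g \<in> {0, f, - f} \<Longrightarrow> stair A a m r b f \<Longrightarrow> stair A a m r b g"
  using stair_minus stair_zero stair_free_hom by blast

lemma eqv_dot: "eqv A a b f g \<Longrightarrow> k < length b \<Longrightarrow> eqv A a b (dotm k b \<star> f) (dotm k b \<star> g)"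
  by (intro eqv_vcomp[of A b] eqv_refl dot_free_hom)

lemma stair_cross_before:
  assumes "stair A a m (Suc r) b f" "r < m"
  shows "stair A a m r (sx r b) (X r b \<star> f)"
  using assms(1)
proof (induction rule: stair.induct)
  case (stair_base b g r')
  note g = gen_free_hom[OF stair_base(1)]
  have v: "valid [r'..<m] b" using m g by (simp add: valid_upt)
  show ?case
  proof (cases "r' = Suc r")
    case True
    then show ?thesis using stair.stair_base[OF stair_base(1), of r r] assms(2) by (simp add: upt_conv_Cons)
  next
    case False
    then have r': "Suc r < r'" using stair_base by simp
    have "wd (r # [r'..<m]) b = wd ([r'..<m] @ [r]) b \<and>
      eqv A a (wd (r # [r'..<m]) b) (papp (r # [r'..<m]) b g) (papp ([r'..<m] @ [r]) b g)"
      using r' v g m assms by (intro papp_move_far) auto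
    moreover have "gen A a m (wd [r] b) (papp [r] b g)"
      using stair_base r' g m by (intro gen_papp) auto
    from stair.stair_base[OF this, of r r'] have "stair A a m r (wd ([r'..<m] @ [r]) b) (papp ([r'..<m] @ [r]) b g)"
      using r' stair_base by (simp only: papp_append wd_append)
    ultimately have "stair A a m r (wd (r # [r'..<m]) b) (papp (r # [r'..<m]) b g)"
      using stair_eqv eqv_sym by metis
    then show ?thesis by simp
  qed
next
  case (stair_zero b)
  then show ?case using assms m by (simp add: stair.stair_zero)
next
  case (stair_diff b f g)
  then show ?case by (auto intro: stair.stair_diff)
next
  case (stair_eqv b f g)
  have "Suc r < length b" using stair_free_hom[OF stair_eqv(1)] m assms by simp
  then show ?case using stair_eqv eqv_X stair.stair_eqv by blast
qed

text \<open>
  A dot slides through the staircase \<open>[r..<m]\<close> from the top.  The error at the letter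
  \<open>r\<close> is the staircase without this letter.
\<close>

lemma stair_dot_base:
  assumes "gen A a m b g" "r \<le> m" "l < length b"
  shows "stair A a m r (wd [r..<m] b) (dotm l (wd [r..<m] b) \<star> papp [r..<m] b g)"
  using assms(2,3)
proof (induction r arbitrary: l rule: inc_induct)
  case base
  from stair_base[OF gen_dot[OF assms(1) base], of m m] show ?case by simp
next
  case (step r)
  let ?c = "wd [Suc r..<m] b" and ?h = "papp [Suc r..<m] b g"
  note g = gen_free_hom[OF assms(1)]
  have v: "valid [Suc r..<m] b" using m g by (simp add: valid_upt)
  have c: "length ?c = length b" "Suc r < length ?c" using v step m g by simp_all
  have h: "?h \<in> free_hom a ?c" using papp_free_hom g v by blast
  have e: "wd [r..<m] b = sx r ?c" "papp [r..<m] b g = X r ?c \<star> ?h"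
    using step by (simp_all add: upt_conv_Cons)
  obtain g' where g': "g' \<in> {0, ?h, - ?h}" "g' \<noteq> 0 \<longrightarrow> sx r ?c = ?c"
    "eqv A a (sx r ?c) (dotm l (sx r ?c) \<star> (X r ?c \<star> ?h)) (X r ?c \<star> (dotm (sw r l) ?c \<star> ?h) + g')"
    using papp_dot[OF c(2) _ h] step c by metis
  have "sw r l < length b" using step c by (auto simp: transpose_def)
  from stair_cross_before[OF step.IH[OF this]] step
  have 1: "stair A a m r (sx r ?c) (X r ?c \<star> (dotm (sw r l) ?c \<star> ?h))" by simp
  have 2: "stair A a m r (sx r ?c) g'"
  proof (cases "g' = 0")
    case True
    then show ?thesis using c g by (auto intro: stair_zero)
  next
    case False
    then have "sx r ?c = ?c" using g'(2) by blast
    moreover have "stair A a m r ?c ?h" using assms(1) step by (intro stair_base) auto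
    ultimately show ?thesis using stair_signed[OF g'(1)] by simp
  qed
  show ?case unfolding e by (rule stair_eqv[OF stair_add[OF 1 2] eqv_sym[OF g'(3)]])
qed

lemma stair_dot: "stair A a m r b f \<Longrightarrow> l < length b \<Longrightarrow> stair A a m r b (dotm l b \<star> f)"
proof (induction rule: stair.induct)
  case (stair_base b g r')
  have "valid [r'..<m] b" using m gen_free_hom[OF stair_base(1)] by (simp add: valid_upt)
  then show ?case using stair_dot_base[OF stair_base(1), of r' l] stair_base by (auto intro: stair_mono)
next
  case (stair_diff b f g)
  then show ?case by (auto intro: stair.stair_diff)
next
  case (stair_eqv b f g)
  then show ?case using eqv_dot stair.stair_eqv by blast
qed (auto intro: stair.stair_zero)

text \<open>
  A crossing \<open>\<psi>\<^sub>k\<close> on top of \<open>[r..<m]\<close>: it prolongs the staircase if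
  \<open>k + 1 = r\<close>, commutes past it if \<open>k + 1 < r\<close>, and produces a double crossing if
  \<open>k = r\<close>.  If \<open>k > r\<close>, it meets the letters \<open>k - 1, k\<close> of the staircase;
  after the braid relation, \<open>\<psi>\<^bsub>k-1\<^esub>\<close> comes out at the bottom.
\<close>

lemma stair_cross_base:
  assumes g: "gen A a m b g" and r: "r \<le> m" and k: "k < m"
  shows "stair A a m 0 (wd (k # [r..<m]) b) (papp (k # [r..<m]) b g)"
proof -
  note gh = gen_free_hom[OF g]
  have v: "valid [r..<m] b" for r using m gh by (simp add: valid_upt)
  have kb: "Suc k < length b" using k m gh by simp
  consider (near) "Suc k = r" | (far) "Suc k < r" | (eq) "k = r" | (gt) "r < k" by linarith
  then show ?thesis
  proof cases
    case near
    have "stair A a m (Suc k) (wd [r..<m] b) (papp [r..<m] b g)" using near g r by (intro stair_base) auto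
    from stair_mono[OF stair_cross_before[OF this k]] show ?thesis by simp
  next
    case far
    have "wd (k # [r..<m]) b = wd ([r..<m] @ [k]) b \<and>
      eqv A a (wd (k # [r..<m]) b) (papp (k # [r..<m]) b g) (papp ([r..<m] @ [k]) b g)"
      using far v kb gh by (intro papp_move_far) auto
    moreover have "gen A a m (wd [k] b) (papp [k] b g)"
      using far r kb by (intro gen_papp g) auto
    from stair_base[OF this, of 0 r] have "stair A a m 0 (wd ([r..<m] @ [k]) b) (papp ([r..<m] @ [k]) b g)"
      using r by (simp only: papp_append wd_append le0)
    ultimately show ?thesis using stair_eqv eqv_sym by metis
  next
    case eq
    let ?c = "wd [Suc k..<m] b" and ?h = "papp [Suc k..<m] b g"
    have e: "[r..<m] = k # [Suc k..<m]" using eq k by (simp add: upt_conv_Cons)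
    have c: "length ?c = length b" "Suc k < length ?c" using v kb by simp_all
    have h: "?h \<in> free_hom a ?c" using papp_free_hom gh v by blast
    have Zh: "stair A a m 0 ?c ?h" using g k by (intro stair_base) auto
    have Zd: "stair A a m 0 ?c (dotm l ?c \<star> ?h)" if "l < length ?c" for l by (rule stair_dot[OF Zh that])
    obtain f where f: "f \<in> {0, ?h, dotm k ?c \<star> ?h - dotm (Suc k) ?c \<star> ?h, dotm (Suc k) ?c \<star> ?h - dotm k ?c \<star> ?h}"
      "eqv A a ?c (papp [k, k] ?c ?h) f" using papp_double[OF c(2) h] by blast
    have "stair A a m 0 ?c f" using f(1) Zh Zd[of k] Zd[of "Suc k"] c kb gh
      by (elim insertE) (auto intro: stair_diff stair_zero)
    from stair_eqv[OF this eqv_sym[OF f(2)]] have "stair A a m 0 ?c (papp [k, k] ?c ?h)" .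
    then show ?thesis unfolding e using rel_double(1)[OF c(2)] by simp
  next
    case gt
    \<comment> \<open>the staircase is us, then k - 1, k, then vs\<close>
    define us where "us = [r..<k - 1]"
    define vs where "vs = [Suc k..<m]"
    obtain k' where k': "k = Suc k'" using gt by (cases k) auto
    have sp: "[r..<m] = us @ [k', k] @ vs"
    proof -
      have "[r..<m] = [r..<k'] @ [k'..<m]" using gt k k' upt_add_eq_append[of r k' "m - k'"] by simp
      then show ?thesis using k k' by (simp add: us_def vs_def upt_conv_Cons)
    qed
    let ?c = "wd vs b" and ?h = "papp vs b g"
    have vv: "valid vs b" "valid us b" using m gh k by (auto simp: vs_def us_def valid_def)
    have c: "length ?c = length b" using vv by simp
    have h: "?h \<in> free_hom a ?c" using papp_free_hom gh vv by blast
    have kc: "Suc (Suc k') < length ?c" using kb c k' by simp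
    \<comment> \<open>the letter k commutes with us and reaches the letters k - 1, k\<close>
    have h2: "papp [k', k] ?c ?h \<in> free_hom a (wd [k', k] ?c)"
      by (rule papp_free_hom[OF h]) (use kc k' in simp)
    have l2: "length (wd [k', k] ?c) = length b" by (subst length_wd) (use kc k' c in simp_all)
    have vk: "valid (k # us) (wd [k', k] ?c)"
      using vv(2) kb unfolding valid_Cons l2 valid_length[OF l2] by blast
    have fk: "\<forall>u\<in>set us. Suc k < u \<or> Suc u < k" by (auto simp: us_def)
    note M = papp_move_far[OF fk vk h2]
    have sp2: "papp (k # [r..<m]) b g = papp (k # us) (wd [k', k] ?c) (papp [k', k] ?c ?h)"
      "papp (us @ [k, k', k] @ vs) b g = papp (us @ [k]) (wd [k', k] ?c) (papp [k', k] ?c ?h)"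
      "wd (k # [r..<m]) b = wd (k # us) (wd [k', k] ?c)"
      "wd (us @ [k, k', k] @ vs) b = wd (us @ [k]) (wd [k', k] ?c)"
      unfolding sp by (simp_all only: papp_append[symmetric] wd_append[symmetric] append_Cons append_Nil append_assoc)
    from M have M1: "wd (k # [r..<m]) b = wd (us @ [k, k', k] @ vs) b"
      "eqv A a (wd (k # [r..<m]) b) (papp (k # [r..<m]) b g) (papp (us @ [k, k', k] @ vs) b g)"
      unfolding sp2 by blast+
    \<comment> \<open>k, k - 1, k becomes k - 1, k, k - 1, up to a term without these letters\<close>
    obtain f where f: "f \<in> {0, ?h, - ?h}" "f \<noteq> 0 \<longrightarrow> wd [k', k, k'] ?c = ?c"
      "eqv A a (wd [k', k, k'] ?c) (papp [k, k', k] ?c ?h) (papp [k', k, k'] ?c ?h + f)"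
      and wbr: "wd [k, k', k] ?c = wd [k', k, k'] ?c"
      using papp_braid[OF kc h] unfolding k' by blast
    let ?d = "wd [k', k, k'] ?c"
    have ld: "length ?d = length b" using c kc k' by simp
    have vus: "valid us ?d" using vv ld valid_length by blast
    have B: "eqv A a (wd us ?d) (papp us ?d (papp [k, k', k] ?c ?h)) (papp us ?d (papp [k', k, k'] ?c ?h) + papp us ?d f)"
    proof -
      have "papp us ?d (x + y) = papp us ?d x + papp us ?d y" for x y
        using papp_diff[of us ?d "x + y" y] by (simp add: algebra_simps)
      then show ?thesis using eqv_papp[OF f(3) vus] by (simp only:)
    qed
    have e1: "papp (us @ [k, k', k] @ vs) b g = papp us ?d (papp [k, k', k] ?c ?h)"
      "wd (us @ [k, k', k] @ vs) b = wd us ?d" using wbr by (simp_all add: papp_append wd_append)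
    \<comment> \<open>the lower letter k - 1 commutes with vs, which restores the staircase\<close>
    have 1: "stair A a m 0 (wd us ?d) (papp us ?d (papp [k', k, k'] ?c ?h))"
    proof -
      have "wd (k' # vs) b = wd (vs @ [k']) b \<and> eqv A a (wd (k' # vs) b) (papp (k' # vs) b g) (papp (vs @ [k']) b g)"
        using vv kb k' gh by (intro papp_move_far) (auto simp: vs_def)
      moreover have "wd (k' # vs) b = wd [k'] ?c" "wd (vs @ [k']) b = wd vs (wd [k'] b)"
        "papp (k' # vs) b g = papp [k'] ?c ?h" "papp (vs @ [k']) b g = papp vs (wd [k'] b) (papp [k'] b g)"
        by (simp_all add: papp_append wd_append)
      ultimately have w: "wd [k'] ?c = wd vs (wd [k'] b)" "eqv A a (wd [k'] ?c) (papp [k'] ?c ?h) (papp vs (wd [k'] b) (papp [k'] b g))"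
        by metis+
      have l1: "length (wd [k'] ?c) = length b" by (subst length_wd) (use kc k' c in simp_all)
      have v2: "valid (us @ [k', k]) (wd [k'] ?c)"
        using vv(2) kb k' unfolding valid_append valid_Cons l1 valid_length[OF l1] by simp
      have E: "eqv A a (wd us ?d) (papp us ?d (papp [k', k, k'] ?c ?h)) (papp [r..<m] (wd [k'] b) (papp [k'] b g))"
      proof -
        have "wd (us @ [k', k]) (wd [k'] ?c) = wd us ?d"
          "papp (us @ [k', k]) (wd [k'] ?c) (papp [k'] ?c ?h) = papp us ?d (papp [k', k, k'] ?c ?h)"
          by (simp_all add: papp_append wd_append)
        moreover have "papp (us @ [k', k]) (wd [k'] ?c) (papp vs (wd [k'] b) (papp [k'] b g)) = papp [r..<m] (wd [k'] b) (papp [k'] b g)"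
          unfolding sp w(1) by (simp only: papp_append wd_append)
        ultimately show ?thesis using eqv_papp[OF w(2) v2] by metis
      qed
      have "gen A a m (wd [k'] b) (papp [k'] b g)" using k k' kb by (intro gen_papp g) auto
      from stair_base[OF this, of 0 r] r have "stair A a m 0 (wd [r..<m] (wd [k'] b)) (papp [r..<m] (wd [k'] b) (papp [k'] b g))" by simp
      moreover have "wd [r..<m] (wd [k'] b) = wd us ?d"
      proof -
        have "wd [r..<m] (wd [k'] b) = wd (us @ [k', k]) (wd vs (wd [k'] b))"
          unfolding sp by (simp only: wd_append[symmetric] append_assoc)
        also have "\<dots> = wd us ?d" unfolding w(1)[symmetric] by (simp add: wd_append)
        finally show ?thesis .
      qed
      ultimately show ?thesis using stair_eqv[OF _ eqv_sym[OF E]] by metis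
    qed
    \<comment> \<open>the error term has the word us @ vs, and us commutes with the staircase vs\<close>
    have 2: "stair A a m 0 (wd us ?d) (papp us ?d f)"
    proof (cases "f = 0")
      case True
      then show ?thesis using vus ld gh by (auto intro: stair_zero)
    next
      case False
      then have d: "?d = ?c" using f(2) by blast
      have "wd (us @ vs) b = wd (vs @ us) b \<and> eqv A a (wd (us @ vs) b) (papp (us @ vs) b g) (papp (vs @ us) b g)"
        using vv gh k' by (intro papp_commute_far) (auto simp: us_def vs_def)
      moreover have "gen A a m (wd us b) (papp us b g)" using k vv by (intro gen_papp g) (auto simp: us_def)
      from stair_base[OF this, of 0 "Suc k"] k have "stair A a m 0 (wd (vs @ us) b) (papp (vs @ us) b g)"
        by (simp add: papp_append wd_append vs_def)
      ultimately have "stair A a m 0 (wd (us @ vs) b) (papp (us @ vs) b g)" using stair_eqv eqv_sym by metis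
      then have Zh: "stair A a m 0 (wd us ?c) (papp us ?c ?h)" by (simp only: papp_append wd_append)
      have "papp us ?c (- ?h) = - papp us ?c ?h" using papp_diff[of us ?c 0 ?h] by simp
      then have "papp us ?c f \<in> {0, papp us ?c ?h, - papp us ?c ?h}" using f(1) by auto
      from stair_signed[OF this Zh] show ?thesis unfolding d .
    qed
    show ?thesis
      using stair_eqv[OF stair_add[OF 1 2] eqv_sym[OF B]] stair_eqv eqv_sym[OF M1(2)] M1(1) unfolding e1 by metis
  qed
qed

lemma stair_cross:
  assumes "stair A a m 0 b f" "k < m"
  shows "stair A a m 0 (sx k b) (X k b \<star> f)"
  using assms(1)
proof (induction rule: stair.induct)
  case (stair_base b g r)
  then show ?case using stair_cross_base[OF stair_base(1,3) assms(2)] by simp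
next
  case (stair_zero b)
  then show ?case using assms m by (simp add: stair.stair_zero)
next
  case (stair_diff b f g)
  then show ?case by (auto intro: stair.stair_diff)
next
  case (stair_eqv b f g)
  have "Suc k < length b" using stair_free_hom[OF stair_eqv(1)] m assms by simp
  then show ?case using stair_eqv eqv_X stair.stair_eqv by blast
qed

lemma gen_Suc_stair: "gen A a (Suc m) b f \<Longrightarrow> stair A a m 0 b f"
proof (induction rule: gen.induct)
  case gen_id
  from stair_base[OF gen.gen_id, of 0 m m] show ?case by simp
next
  case (gen_dot b f k)
  then show ?case by (intro stair_dot)
next
  case (gen_cross b f k)
  then show ?case by (intro stair_cross) auto
qed (auto intro: stair.intros)

end

section \<open>All morphisms are generated by dots and crossings\<close>

lemma deq_ctx_Horiz:
  assumes "wf_diagram D" "wf_diagram D'"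
  shows "deq A (Horiz (Ident c) (Horiz (Horiz D D') (Ident d)))
    (Vert (Horiz (Ident c) (Horiz D (Ident (tgt D' @ d)))) (Horiz (Ident (c @ src D)) (Horiz D' (Ident d))))"
proof -
  let ?G = "Horiz D' (Ident d)"
  have i: "deq A (Ident c) (Vert (Ident c) (Ident c))" by (rule deq_sym[OF deq_VidL]) auto
  have "deq A (Horiz (Ident c) (Horiz (Horiz D D') (Ident d))) (Horiz (Ident c) (Horiz D ?G))"
    using assms by (intro deq_Horiz deq_refl deq_Hassoc) auto
  also have "deq A \<dots> (Horiz (Vert (Ident c) (Ident c)) (Vert (Horiz D (Ident (tgt ?G))) (Horiz (Ident (src D)) ?G)))"
    using assms by (intro deq_Horiz i deq_sym[OF deq_Horiz_factor(1)]) auto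
  also have "deq A \<dots> (Vert (Horiz (Ident c) (Horiz D (Ident (tgt ?G)))) (Horiz (Ident c) (Horiz (Ident (src D)) ?G)))"
    using assms by (intro deq_sym[OF deq_interchange]) auto
  also have "deq A \<dots> (Vert (Horiz (Ident c) (Horiz D (Ident (tgt ?G)))) (Horiz (Ident (c @ src D)) ?G))"
    using assms by (intro deq_Vert deq_refl deq_sym[OF deq_pad_left]) auto
  finally show ?thesis by simp
qed

lemma deq_pad_nil: "wf_diagram D \<Longrightarrow> deq A (Horiz (Ident []) (Horiz D (Ident []))) D"
  by (rule deq_trans[OF deq_Horiz[OF deq_refl deq_HidR] deq_HidL]) auto

text \<open>
  Induction on a diagram needs it padded by identities on both sides, so that the two factors of a horizontal
  composite can be applied one after the other.
\<close>

lemma gen_ctx: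
  assumes "wf_diagram D" "gen A a (length a) (c @ src D @ d) f"
  shows "gen A a (length a) (c @ tgt D @ d) (ctx c d (frag_of D) \<star> f)"
  using assms
proof (induction D arbitrary: c d f)
  case (Ident x)
  note f = gen_free_hom[OF Ident(2)]
  have f': "f \<in> free_hom a (c @ x @ d)" using f by simp
  have "eqv A a (c @ x @ d) (ctx c d (idm x) \<star> f) (idm (c @ x @ d) \<star> f)"
    by (rule eqv_vcomp[OF ctx_idm eqv_refl[OF f']])
  from eqv_sym[OF eqv_trans[OF this eqv_id_left[OF f']]] show ?case
    using Ident(2) gen_eqv unfolding src.simps tgt.simps by blast
next
  case (Dot i)
  let ?b = "c @ [i] @ d"
  have g: "gen A a (length a) ?b f" using Dot by simp
  note f = conjunct1[OF gen_free_hom[OF g]]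
  have "dot_at 0 [i] = Horiz (Ident []) (Horiz (Dot i) (Ident []))" by (simp add: dot_at_def)
  then have "deq A (Dot i) (dot_at 0 [i])" using deq_sym[OF deq_pad_nil[of "Dot i" A]] by simp
  from deq_Horiz[OF deq_refl[of "Ident c"] deq_Horiz[OF this deq_refl[of "Ident d"]]]
  have "deq A (Horiz (Ident c) (Horiz (Dot i) (Ident d))) (dot_at (length c) ?b)"
    using deq_ctx_gen(1)[of 0 "[i]" A c d] by (metis add_0_right deq_trans length_greater_0_conv list.distinct(1) wf_diagram.simps(1))
  from deq_eqv[OF this, of ?b ?b] have "eqv A ?b ?b (ctx c d (frag_of (Dot i))) (dotm (length c) ?b)" by simp
  from eqv_vcomp[OF eqv_sym[OF this] eqv_refl[OF f]] gen_dot[OF g, of "length c"]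
  have "gen A a (length a) ?b (ctx c d (frag_of (Dot i)) \<star> f)" by (auto intro: gen_eqv simp del: hcomp_of vcomp_of)
  then show ?case by simp
next
  case (Cross i j)
  let ?b = "c @ [i, j] @ d" and ?t = "c @ [j, i] @ d"
  have g: "gen A a (length a) ?b f" using Cross by simp
  note f = gen_free_hom[OF g]
  have "cross_at 0 [i, j] = Horiz (Ident []) (Horiz (Cross i j) (Ident []))" by (simp add: cross_at_def)
  then have "deq A (Cross i j) (cross_at 0 [i, j])" using deq_sym[OF deq_pad_nil[of "Cross i j" A]] by simp
  from deq_Horiz[OF deq_refl[of "Ident c"] deq_Horiz[OF this deq_refl[of "Ident d"]]]
  have 1: "deq A (Horiz (Ident c) (Horiz (Cross i j) (Ident d))) (Horiz (Ident c) (Horiz (cross_at 0 [i, j]) (Ident d)))" by simp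
  have "deq A (Horiz (Ident c) (Horiz (Cross i j) (Ident d))) (cross_at (length c) ?b)"
    using deq_trans[OF 1 deq_ctx_gen(2)[of 0 "[i, j]" A c d]] by simp
  from deq_eqv[OF this, of ?b ?t] have e: "eqv A ?b ?t (ctx c d (frag_of (Cross i j))) (X (length c) ?b)" by simp
  have t: "sx (length c) ?b = ?t" using eqv_free_hom(2)[OF e] by simp
  have "gen A a (length a) (sx (length c) ?b) (X (length c) ?b \<star> f)"
    using f by (intro gen_cross[OF g]) auto
  from gen_eqv[OF this[unfolded t] eqv_vcomp[OF eqv_sym[OF e] eqv_refl[OF conjunct1[OF f]]]] show ?case by simp
next
  case (Vert D D')
  have w: "wf_diagram D" "wf_diagram D'" "src D = tgt D'" using Vert.prems(1) by auto
  have g: "gen A a (length a) (c @ src D' @ d) f" using Vert.prems(2) by simp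
  have "gen A a (length a) (c @ tgt D @ d) (ctx c d (frag_of D) \<star> (ctx c d (frag_of D') \<star> f))"
    using Vert.IH(1)[OF w(1)] Vert.IH(2)[OF w(2) g] w(3) by simp
  moreover have "eqv A a (c @ tgt D @ d) (ctx c d (frag_of D) \<star> (ctx c d (frag_of D') \<star> f)) (ctx c d (frag_of (Vert D D')) \<star> f)"
  proof -
    have f: "f \<in> free_hom a (c @ src D' @ d)" using gen_free_hom[OF g] by simp
    have "eqv A a (c @ tgt D @ d) (ctx c d (frag_of D) \<star> (ctx c d (frag_of D') \<star> f)) ((ctx c d (frag_of D) \<star> ctx c d (frag_of D')) \<star> f)"
      using w by (intro eqv_sym[OF eqv_vassoc[OF _ _ f]]) (simp_all del: append_assoc)
    also have "eqv A a (c @ tgt D @ d) \<dots> (ctx c d (frag_of D \<star> frag_of D') \<star> f)"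
      using w by (intro eqv_vcomp[OF eqv_sym[OF ctx_vcomp] eqv_refl[OF f]]) simp_all
    finally show ?thesis by simp
  qed
  ultimately show ?case by (simp only: tgt.simps) (rule gen_eqv)
next
  case (Horiz D D')
  have w: "wf_diagram D" "wf_diagram D'" using Horiz.prems(1) by auto
  have g: "gen A a (length a) ((c @ src D) @ src D' @ d) f" using Horiz.prems(2) by simp
  from Horiz.IH(2)[OF w(2) g] have g': "gen A a (length a) (c @ src D @ (tgt D' @ d)) (ctx (c @ src D) d (frag_of D') \<star> f)" by simp
  from Horiz.IH(1)[OF w(1) g']
  have "gen A a (length a) (c @ (tgt D @ tgt D') @ d) (ctx c (tgt D' @ d) (frag_of D) \<star> (ctx (c @ src D) d (frag_of D') \<star> f))" by simp
  moreover have "eqv A a (c @ (tgt D @ tgt D') @ d) (ctx c (tgt D' @ d) (frag_of D) \<star> (ctx (c @ src D) d (frag_of D') \<star> f)) (ctx c d (frag_of (Horiz D D')) \<star> f)"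
  proof -
    have f: "f \<in> free_hom a (c @ (src D @ src D') @ d)" using gen_free_hom[OF g] by simp
    have "eqv A a (c @ (tgt D @ tgt D') @ d) (ctx c (tgt D' @ d) (frag_of D) \<star> (ctx (c @ src D) d (frag_of D') \<star> f))
      ((ctx c (tgt D' @ d) (frag_of D) \<star> ctx (c @ src D) d (frag_of D')) \<star> f)"
      using w by (intro eqv_sym[OF eqv_vassoc[OF _ _ f, of _ "c @ src D @ tgt D' @ d"]]) simp_all
    also have "eqv A a (c @ (tgt D @ tgt D') @ d) \<dots> (ctx c d (frag_of (Horiz D D')) \<star> f)"
      using deq_eqv[OF deq_sym[OF deq_ctx_Horiz[OF w, of A c d]], of "c @ (src D @ src D') @ d" "c @ (tgt D @ tgt D') @ d"]
      by (intro eqv_vcomp[OF _ eqv_refl[OF f]]) simp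
    finally show ?thesis .
  qed
  ultimately show ?case by (simp only: tgt.simps) (rule gen_eqv)
qed

lemma gen_all:
  assumes "f \<in> free_hom a b" "length b = length a"
  shows "gen A a (length a) b f"
  using assms(1)
proof (induction rule: free_hom_induct)
  case (of D)
  have "gen A a (length a) ([] @ tgt D @ []) (ctx [] [] (frag_of D) \<star> idm a)"
    using of by (intro gen_ctx) (simp_all add: gen_id)
  moreover have "eqv A a b (ctx [] [] (frag_of D) \<star> idm a) (frag_of D)"
  proof -
    have "deq A (Vert (Horiz (Ident []) (Horiz D (Ident []))) (Ident a)) D"
      using of by (intro deq_trans[OF deq_VidR deq_pad_nil]) auto
    from deq_eqv[OF this, of a b] of show ?thesis by simp
  qed
  ultimately show ?case using of gen_eqv by fastforce
qed (use assms gen_zero gen_diff in auto)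

section \<open>Polynomials of dots\<close>

lemma dots_wf [simp]: "wf_diagram (dots e a)" "src (dots e a) = a" "tgt (dots e a) = a"
proof -
  have "wf_diagram (dot_power i r) \<and> src (dot_power i r) = [i] \<and> tgt (dot_power i r) = [i]" for i :: 'a and r
    by (induction r) auto
  then have "wf_diagram (dots e a) \<and> src (dots e a) = a \<and> tgt (dots e a) = a"
    by (induction a arbitrary: e) auto
  then show "wf_diagram (dots e a)" "src (dots e a) = a" "tgt (dots e a) = a" by auto
qed

lemma dot_power_wf [simp]: "wf_diagram (dot_power i r)" "src (dot_power i r) = [i]" "tgt (dot_power i r) = [i]"
  by (induction r) auto

lemma poly_dots_diff [simp]: "poly_dots (p - q) a = poly_dots p a - poly_dots q a"
  by (simp add: poly_dots_def frag_extend_diff)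
lemma poly_dots_0 [simp]: "poly_dots 0 a = 0"
  by (simp add: poly_dots_def)
lemma poly_dots_add: "poly_dots (p + q) a = poly_dots p a + poly_dots q a"
  by (simp add: poly_dots_def frag_extend_add)

lemma poly_dots_free_hom: "poly_dots p a \<in> free_hom a a"
  by (induction p rule: frag_induction[OF subset_UNIV]) (auto simp: poly_dots_def frag_extend_diff intro: free_hom_diff)

lemma deq_dot_dots: "k < length a \<Longrightarrow> deq A (Vert (dot_at k a) (dots e a)) (dots (e(k := Suc (e k))) a)"
proof (induction a arbitrary: k e)
  case (Cons i a)
  show ?case
  proof (cases k)
    case 0
    have "deq A (dot_at 0 (i # a)) (Horiz (Dot i) (Ident a))"
      using deq_HidL[of "Horiz (Dot i) (Ident a)" A] by (simp add: dot_at_def)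
    then have "deq A (Vert (dot_at 0 (i # a)) (dots e (i # a))) (Vert (Horiz (Dot i) (Ident a)) (dots e (i # a)))"
      by (intro deq_Vert deq_refl) auto
    also have "deq A \<dots> (Horiz (Vert (Dot i) (dot_power i (e 0))) (Vert (Ident a) (dots (\<lambda>k. e (Suc k)) a)))"
      unfolding dots.simps by (intro deq_interchange) auto
    also have "deq A \<dots> (Horiz (dot_power i (Suc (e 0))) (dots (\<lambda>k. e (Suc k)) a))"
      unfolding dot_power.simps by (intro deq_Horiz deq_refl deq_VidL) auto
    finally show ?thesis using 0 by simp
  next
    case (Suc k')
    then have k': "k' < length a" using Cons.prems by simp
    have "deq A (dot_at k (i # a)) (Horiz (Ident [i]) (dot_at k' a))"
      using dot_at_left[of k' a A "[i]"] k' Suc by simp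
    then have "deq A (Vert (dot_at k (i # a)) (dots e (i # a))) (Vert (Horiz (Ident [i]) (dot_at k' a)) (dots e (i # a)))"
      using k' Suc by (intro deq_Vert deq_refl) auto
    also have "deq A \<dots> (Horiz (Vert (Ident [i]) (dot_power i (e 0))) (Vert (dot_at k' a) (dots (\<lambda>k. e (Suc k)) a)))"
      unfolding dots.simps using k' by (intro deq_interchange) auto
    also have "deq A \<dots> (Horiz (dot_power i (e 0)) (dots ((\<lambda>k. e (Suc k))(k' := Suc (e (Suc k')))) a))"
    proof (rule deq_Horiz)
      show "deq A (Vert (Ident [i]) (dot_power i (e 0))) (dot_power i (e 0))" by (rule deq_VidL) auto
    qed (rule Cons.IH[OF k'])
    also have "Horiz (dot_power i (e 0)) (dots ((\<lambda>k. e (Suc k))(k' := Suc (e (Suc k')))) a) = dots (e(k := Suc (e k))) (i # a)"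
    proof -
      have "(\<lambda>j. (e(k := Suc (e k))) (Suc j)) = (\<lambda>j. e (Suc j))(k' := Suc (e (Suc k')))"
        by (rule ext) (simp add: Suc)
      then show ?thesis unfolding dots.simps by (simp add: Suc)
    qed
    finally show ?thesis .
  qed
qed simp

lemma dot_poly_dots:
  assumes "k < length a"
  shows "eqv A a a (dotm k a \<star> poly_dots p a) (poly_dots (pvar k * p) a)"
proof (induction p rule: frag_induction[OF subset_UNIV])
  case (2 m)
  have "Poly_Mapping.lookup (Poly_Mapping.single k 1 + m) = (Poly_Mapping.lookup m)(k := Suc (Poly_Mapping.lookup m k))"
    by (auto simp: lookup_add lookup_single when_def)
  then show ?case using deq_eqv[OF deq_dot_dots[OF assms, of A "Poly_Mapping.lookup m"], of a a] assms
    by (simp add: poly_dots_def pvar_def mult_single)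
qed (auto simp: right_diff_distrib intro: eqv_diff eqv_refl)

lemma rep_dot_power: "rep A (dot_power i r) s q = pvar s ^ r * q"
  by (induction r) (simp_all add: mult.assoc)

lemma rep_dots: "rep A (dots e a) s q = (\<Prod>k<length a. pvar (s + k) ^ e k) * q"
  by (induction a arbitrary: e s q)
    (simp_all add: rep_dot_power prod.lessThan_Suc_shift mult.assoc del: prod.lessThan_Suc)

lemma rep_poly_dots:
  assumes "p \<in> Pn (length a)"
  shows "rep_lin A (poly_dots p a) 0 q = p * q"
proof -
  have "Poly_Mapping.keys p \<subseteq> {m. Poly_Mapping.keys m \<subseteq> {..<length a}}" using assms by (auto simp: Pn_iff)
  then show ?thesis
  proof (induction rule: frag_induction)
    case (one m)
    have "(\<Prod>k<length a. pvar k ^ Poly_Mapping.lookup m k) = (frag_of m :: zpoly)"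
      unfolding frag_of_eq_prod_pvar using one
      by (intro prod.mono_neutral_right) (auto simp: in_keys_iff)
    then show ?case by (simp add: poly_dots_def rep_dots)
  qed (auto simp: left_diff_distrib)
qed

section \<open>Normal forms span the Hom spaces\<close>

text \<open>
  Spans over the right action, with the normal forms on the first \<open>m\<close> strands.
\<close>

definition nf_span :: "('v \<times> 'v) set \<Rightarrow> 'v list \<Rightarrow> nat \<Rightarrow> 'v list \<Rightarrow> 'v lin \<Rightarrow> bool" where
  "nf_span A a m b f \<longleftrightarrow> (\<exists>R. (\<forall>w. R w \<in> Pn (length a)) \<and>
     eqv A a b f (\<Sum>w\<in>{w \<in> seq_perms a b. w permutes {..<m}}. crossm (nf m w) a \<star> poly_dots (R w) a))"

lemma nf_valid: "w permutes {..<m} \<Longrightarrow> m \<le> length a \<Longrightarrow> valid (nf m w) a"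
  using nf_word[of w m] by (fastforce simp: valid_def)

lemma nf_span_eqv: "nf_span A a m b f \<Longrightarrow> eqv A a b f g \<Longrightarrow> nf_span A a m b g"
  unfolding nf_span_def by (elim exE conjE) (rule exI, rule conjI, assumption, rule eqv_trans[OF eqv_sym])

lemma nf_span_0: "nf_span A a m b 0"
  unfolding nf_span_def by (rule exI[of _ "\<lambda>_. 0"]) (simp add: eqv_refl)

lemma nf_span_diff: "nf_span A a m b f \<Longrightarrow> nf_span A a m b g \<Longrightarrow> nf_span A a m b (f - g)"
proof -
  assume "nf_span A a m b f" "nf_span A a m b g"
  then obtain R R' where R: "\<And>w. R w \<in> Pn (length a)" "\<And>w. R' w \<in> Pn (length a)"
     "eqv A a b f (\<Sum>w\<in>{w \<in> seq_perms a b. w permutes {..<m}}. crossm (nf m w) a \<star> poly_dots (R w) a)"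
     "eqv A a b g (\<Sum>w\<in>{w \<in> seq_perms a b. w permutes {..<m}}. crossm (nf m w) a \<star> poly_dots (R' w) a)"
    unfolding nf_span_def by blast
  from eqv_diff[OF R(3,4)]
  have "eqv A a b (f - g) (\<Sum>w\<in>{w \<in> seq_perms a b. w permutes {..<m}}. crossm (nf m w) a \<star> poly_dots (R w - R' w) a)"
    by (simp add: sum_subtractf)
  then show ?thesis unfolding nf_span_def using R(1,2) by (intro exI[of _ "\<lambda>w. R w - R' w"]) auto
qed

lemma nf_span_sum: "(\<And>i. i \<in> I \<Longrightarrow> nf_span A a m b (f i)) \<Longrightarrow> nf_span A a m b (sum f I)"
proof (induction I rule: infinite_finite_induct)
  case (insert i I)
  have "nf_span A a m b (f i - (0 - sum f I))" using insert by (intro nf_span_diff nf_span_0) auto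
  then show ?case using insert by simp
qed (simp_all add: nf_span_0)

lemma nf_span_single:
  assumes "w permutes {..<m}" "m \<le> length a" "p \<in> Pn (length a)"
  shows "nf_span A a m (wd (nf m w) a) (crossm (nf m w) a \<star> poly_dots p a)"
proof -
  let ?b = "wd (nf m w) a"
  have v: "valid (nf m w) a" by (rule nf_valid) fact+
  have w: "w \<in> seq_perms a ?b"
    using tgt_crossings_eq_iff[OF v, of ?b] v nf_word[OF assms(1)] by simp
  have "(\<Sum>v\<in>{v \<in> seq_perms a ?b. v permutes {..<m}}. crossm (nf m v) a \<star> poly_dots (if v = w then p else 0) a)
    = (\<Sum>v\<in>{v \<in> seq_perms a ?b. v permutes {..<m}}. if v = w then crossm (nf m w) a \<star> poly_dots p a else 0)"
    by (rule sum.cong) auto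
  also have "\<dots> = crossm (nf m w) a \<star> poly_dots p a" using w assms(1) by (subst sum.delta) auto
  finally show ?thesis unfolding nf_span_def using assms(3) crossings_wf[OF v]
    by (intro exI[of _ "\<lambda>v. if v = w then p else 0"])
      (auto intro!: eqv_refl free_hom_vcomp[OF _ poly_dots_free_hom])
qed

text \<open>Without crossings, only polynomials in the dots remain.\<close>

lemma gen_0_poly:
  "gen A a 0 b f \<Longrightarrow> \<exists>p \<in> Pn (length a). eqv A a b f (if a = b then poly_dots p a else 0)"
proof (induction rule: gen.induct)
  case gen_id
  have "eqv A a a (idm a) (poly_dots 1 a)"
  proof -
    have d: "deq A (Ident a) (dots (\<lambda>_. 0) a)"
    proof (induction a)
      case (Cons i a)
      have "deq A (Ident ([i] @ a)) (Horiz (Ident [i]) (Ident a))" by (rule deq_sym[OF deq_HId])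
      also have "deq A \<dots> (dots (\<lambda>_. 0) (i # a))" using deq_Horiz[OF deq_refl[of "Ident [i]"] Cons] by simp
      finally show ?case by simp
    qed (simp add: deq_refl)
    have "poly_dots (frag_of 0) a = frag_of (dots (Poly_Mapping.lookup 0) a)"
      unfolding poly_dots_def by (rule frag_extend_of)
    moreover have "Poly_Mapping.lookup (0 :: nat \<Rightarrow>\<^sub>0 nat) = (\<lambda>_. 0)" by auto
    ultimately have "poly_dots 1 a = frag_of (dots (\<lambda>_. 0) a)" by simp
    then show ?thesis using deq_eqv[OF d, of a a] by simp
  qed
  then show ?case by (intro bexI[of _ 1]) auto
next
  case (gen_dot b f k)
  then obtain p where p: "p \<in> Pn (length a)" "eqv A a b f (if a = b then poly_dots p a else 0)" by blast
  have "eqv A a b (dotm k b \<star> f) (dotm k b \<star> (if a = b then poly_dots p a else 0))"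
    using gen_dot by (intro eqv_vcomp[OF eqv_refl p(2)]) simp
  then have "eqv A a b (dotm k b \<star> f) (if a = b then poly_dots (pvar k * p) a else 0)"
    using eqv_trans[OF _ dot_poly_dots[of k a A p]] gen_dot by auto
  moreover have "k < length a" using gen_dot gen_free_hom by metis
  ultimately show ?case using p(1) by (intro bexI[of _ "pvar k * p"]) auto
next
  case (gen_diff b f g)
  then obtain p q where "p \<in> Pn (length a)" "eqv A a b f (if a = b then poly_dots p a else 0)"
     "q \<in> Pn (length a)" "eqv A a b g (if a = b then poly_dots q a else 0)" by blast
  moreover from eqv_diff[OF this(2,4)] have "eqv A a b (f - g) (if a = b then poly_dots (p - q) a else 0)"
    by (cases "a = b") simp_all
  ultimately show ?case by (intro bexI[of _ "p - q"]) auto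
next
  case (gen_eqv b f g)
  then show ?case using eqv_trans eqv_sym by blast
next
  case (gen_zero b)
  show ?case by (intro bexI[of _ 0]) (auto simp: eqv_refl)
qed auto

text \<open>
  Induction on the number of strands that may cross: a morphism for \<open>m + 1\<close> strands is a sum of
  staircases \<open>[r..<m]\<close> over morphisms for \<open>m\<close> strands, and a staircase followed by a
  normal form for \<open>m\<close> strands is a normal form for \<open>m + 1\<close> strands.
\<close>

lemma gen_nf_span: "gen A a m b f \<Longrightarrow> m \<le> length a \<Longrightarrow> nf_span A a m b f"
proof (induction m arbitrary: b f)
  case 0
  obtain p where p: "p \<in> Pn (length a)" "eqv A a b f (if a = b then poly_dots p a else 0)"
    using gen_0_poly[OF 0(1)] by blast
  show ?case
  proof (cases "a = b")
    case True
    have "nf_span A a 0 a (crossm [] a \<star> poly_dots p a)"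
      using nf_span_single[of id 0 a p A] p(1) permutes_id[of "{..<0::nat}"] by simp
    moreover have "eqv A a a (crossm [] a \<star> poly_dots p a) (poly_dots p a)"
      using eqv_id_left[OF poly_dots_free_hom] by simp
    ultimately have "nf_span A a 0 a (poly_dots p a)" by (rule nf_span_eqv)
    moreover have "eqv A a a (poly_dots p a) f" using eqv_sym[OF p(2)] True by simp
    ultimately show ?thesis unfolding True[symmetric] by (rule nf_span_eqv)
  next
    case False
    then have "eqv A a b 0 f" using eqv_sym[OF p(2)] by simp
    then show ?thesis by (rule nf_span_eqv[OF nf_span_0])
  qed
next
  case (Suc m)
  have m: "m < length a" using Suc.prems by simp
  have "stair A a m 0 b f" by (rule gen_Suc_stair[OF m Suc.prems(1)])
  then show ?case
  proof (induction rule: stair.induct)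
    case (stair_base b g r)
    note g = gen_free_hom[OF stair_base(1)]
    have vr: "valid [r..<m] b" using m g by (simp add: valid_upt)
    let ?S = "{w \<in> seq_perms a b. w permutes {..<m}}"
    have "nf_span A a m b g" using Suc.IH[OF stair_base(1)] m by simp
    then obtain R where R: "\<And>w. R w \<in> Pn (length a)"
      "eqv A a b g (\<Sum>w\<in>?S. crossm (nf m w) a \<star> poly_dots (R w) a)" unfolding nf_span_def by blast
    have s: "nf_span A a (Suc m) (wd [r..<m] b) (papp [r..<m] b (crossm (nf m w) a \<star> poly_dots (R w) a))" if w: "w \<in> ?S" for w
    proof -
      have wp: "w permutes {..<m}" using w by simp
      have v: "valid (nf m w) a" by (rule nf_valid[OF wp]) (use m in simp)
      have wb: "wd (nf m w) a = b" using w tgt_crossings_eq_iff[OF v, of b] g nf_word[OF wp] by simp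
      have c: "crossm (nf m w) a \<in> free_hom a b" using crossings_wf[OF v] wb by simp
      have va: "valid [r..<m] a" using m by (simp add: valid_upt)
      let ?v = "word_perm [r..<m] \<circ> w"
      have nfv: "[r..<m] @ nf m w = nf (Suc m) ?v" by (rule nf_append[OF wp stair_base(3)])
      have vp: "?v permutes {..<Suc m}"
        by (rule permutes_compose[OF permutes_subset[OF wp] word_perm_permutes]) auto
      have vnf: "valid (nf (Suc m) ?v) a" by (rule nf_valid[OF vp]) (use m in simp)
      have wdv: "wd (nf (Suc m) ?v) a = wd [r..<m] b" unfolding nfv[symmetric] wd_append wb ..
      have P: "poly_dots (R w) a \<in> free_hom a a" by (rule poly_dots_free_hom)
      have ia: "idm a \<in> free_hom a a" by simp
      have "eqv A a (wd [r..<m] b) (papp [r..<m] b (crossm (nf m w) a \<star> poly_dots (R w) a)) (crossm [r..<m] b \<star> (crossm (nf m w) a \<star> poly_dots (R w) a))"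
        by (rule papp_eqv_crossings[OF vr free_hom_vcomp[OF c P]])
      also have "eqv A a (wd [r..<m] b) \<dots> ((crossm [r..<m] b \<star> crossm (nf m w) a) \<star> poly_dots (R w) a)"
        using crossings_wf[OF vr] by (intro eqv_sym[OF eqv_vassoc[OF _ c P]]) simp
      also have "eqv A a (wd [r..<m] b) \<dots> (crossm (nf (Suc m) ?v) a \<star> poly_dots (R w) a)"
      proof (rule eqv_vcomp[OF _ eqv_refl[OF P]])
        have 1: "eqv A a (wd [r..<m] b) (papp [r..<m] b (papp (nf m w) a (idm a))) (crossm [r..<m] b \<star> (crossm (nf m w) a \<star> idm a))"
          using eqv_trans[OF eqv_papp[OF papp_eqv_crossings[OF v ia, unfolded wb] vr] papp_eqv_crossings[OF vr free_hom_vcomp[OF c ia]]] .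
        have 2: "eqv A a b (crossm (nf m w) a \<star> idm a) (crossm (nf m w) a)"
          using deq_eqv[OF deq_VidR[of "crossings (nf m w) a" a A], of a b] crossings_wf[OF v] wb by simp
        have 3: "eqv A a (wd [r..<m] b) (crossm [r..<m] b \<star> (crossm (nf m w) a \<star> idm a)) (crossm [r..<m] b \<star> crossm (nf m w) a)"
          using crossings_wf[OF vr] by (intro eqv_vcomp[OF eqv_refl 2]) simp
        have 4: "papp [r..<m] b (papp (nf m w) a (idm a)) = papp (nf (Suc m) ?v) a (idm a)"
          unfolding nfv[symmetric] papp_append wb ..
        have 5: "eqv A a (wd [r..<m] b) (papp (nf (Suc m) ?v) a (idm a)) (crossm (nf (Suc m) ?v) a \<star> idm a)"
          using papp_eqv_crossings[OF vnf ia, of A] unfolding wdv .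
        have 6: "eqv A a (wd [r..<m] b) (crossm (nf (Suc m) ?v) a \<star> idm a) (crossm (nf (Suc m) ?v) a)"
          using deq_eqv[OF deq_VidR[of "crossings (nf (Suc m) ?v) a" a A], of a "wd [r..<m] b"] crossings_wf[OF vnf] wdv by simp
        show "eqv A a (wd [r..<m] b) (crossm [r..<m] b \<star> crossm (nf m w) a) (crossm (nf (Suc m) ?v) a)"
          using eqv_trans[OF eqv_sym[OF eqv_trans[OF 1 3]]] eqv_trans[OF 5 6] unfolding 4 by blast
      qed
      finally have E: "eqv A a (wd [r..<m] b) (papp [r..<m] b (crossm (nf m w) a \<star> poly_dots (R w) a)) (crossm (nf (Suc m) ?v) a \<star> poly_dots (R w) a)" .
      have "nf_span A a (Suc m) (wd [r..<m] b) (crossm (nf (Suc m) ?v) a \<star> poly_dots (R w) a)"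
        using nf_span_single[OF vp _ R(1), of A] m unfolding wdv by simp
      then show ?thesis by (rule nf_span_eqv[OF _ eqv_sym[OF E]])
    qed
    have "nf_span A a (Suc m) (wd [r..<m] b) (\<Sum>w\<in>?S. papp [r..<m] b (crossm (nf m w) a \<star> poly_dots (R w) a))"
      by (rule nf_span_sum[OF s])
    then show ?case by (rule nf_span_eqv[OF _ eqv_sym[OF eqv_papp[OF R(2) vr, unfolded papp_sum]]])
  next
    case (stair_diff b f g)
    then show ?case by (intro nf_span_diff)
  next
    case (stair_eqv b f g)
    then show ?case by (intro nf_span_eqv[of A a "Suc m" b f g])
  qed (rule nf_span_0)
qed

theorem nf_spans:
  assumes "f \<in> free_hom a b" "length b = length a"
  shows "\<exists>R. (\<forall>w. R w \<in> Pn (length a)) \<and>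
     eqv A a b f (\<Sum>w\<in>seq_perms a b. crossm (nf (length a) w) a \<star> poly_dots (R w) a)"
proof -
  have "{w \<in> seq_perms a b. w permutes {..<length a}} = seq_perms a b" by (auto simp: seq_perms_def)
  then show ?thesis using gen_nf_span[OF gen_all[OF assms, of A]] unfolding nf_span_def by simp
qed

section \<open>Expansions of operators over the fraction field\<close>

text \<open>Artin's theorem on the linear independence of characters, for a monoid.\<close>

lemma characters_independent:
  fixes \<chi> :: "'i \<Rightarrow> 'a :: monoid_mult \<Rightarrow> 'k :: field"
  assumes "finite V" "\<And>v f g. \<chi> v (f * g) = \<chi> v f * \<chi> v g" "\<And>v. \<chi> v 1 = 1"
    "\<And>u v. u \<in> V \<Longrightarrow> v \<in> V \<Longrightarrow> u \<noteq> v \<Longrightarrow> \<exists>f. \<chi> u f \<noteq> \<chi> v f"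
    "\<And>f. (\<Sum>v\<in>V. c v * \<chi> v f) = 0" "v \<in> V"
  shows "c v = 0"
  using assms(1,4,5,6)
proof (induction V arbitrary: c v rule: finite_induct)
  case (insert u V)
  have z: "c w = 0" if w: "w \<in> V" for w
  proof -
    obtain g where g: "\<chi> u g \<noteq> \<chi> w g" using insert.prems(1)[of u w] insert.hyps w by auto
    have "(\<Sum>v\<in>V. (c v * (\<chi> v g - \<chi> u g)) * \<chi> v f) = 0" for f
    proof -
      have "(\<Sum>v\<in>insert u V. c v * \<chi> v (g * f)) - \<chi> u g * (\<Sum>v\<in>insert u V. c v * \<chi> v f) = 0"
        by (simp only: insert.prems(2)) simp
      also have "(\<Sum>v\<in>insert u V. c v * \<chi> v (g * f)) - \<chi> u g * (\<Sum>v\<in>insert u V. c v * \<chi> v f)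
        = (\<Sum>v\<in>insert u V. (c v * (\<chi> v g - \<chi> u g)) * \<chi> v f)"
        unfolding sum_distrib_left sum_subtractf[symmetric] assms(2) by (rule sum.cong) (auto simp: algebra_simps)
      also have "\<dots> = (\<Sum>v\<in>V. (c v * (\<chi> v g - \<chi> u g)) * \<chi> v f)" using insert.hyps by simp
      finally show ?thesis .
    qed
    from insert.IH[OF insert.prems(1) this w] g show ?thesis by auto
  qed
  have "(\<Sum>v\<in>insert u V. c v * \<chi> v 1) = c u"
    using insert.hyps z by (simp add: assms(3))
  then have "c u = 0" using insert.prems(2)[of 1] by simp
  then show ?case using z insert.prems(3) by blast
qed simp

abbreviation Sym :: "nat \<Rightarrow> (nat \<Rightarrow> nat) set" where "Sym n \<equiv> {v. v permutes {..<n}}"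

text \<open>
  Over the fraction field every operator of the polynomial representation is a combination of permutations of
  the variables.  The coefficients make the Bruhat order visible.
\<close>

definition expn :: "nat \<Rightarrow> (zpoly \<Rightarrow> zpoly) \<Rightarrow> ((nat \<Rightarrow> nat) \<Rightarrow> zpoly fract) \<Rightarrow> bool" where
  "expn n g C \<longleftrightarrow> (\<forall>f. to_fract (g f) = (\<Sum>v\<in>Sym n. C v * to_fract (pact v f)))"

lemma finite_Sym [simp]: "finite (Sym n)"
  using finite_permutations[of "{..<n}"] by simp

lemma expn_zero:
  assumes "expn n (\<lambda>_. 0) C" "v \<in> Sym n"
  shows "C v = 0"
proof -
  define \<chi> where "\<chi> = (\<lambda>v f. if v \<in> Sym n then to_fract (pact v f) else 1)"
  show ?thesis
  proof (rule characters_independent[of "Sym n" \<chi> C])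
    show "\<chi> v (f * g) = \<chi> v f * \<chi> v g" for v f g by (auto simp: \<chi>_def permutes_bij)
    show "\<chi> v 1 = 1" for v by (auto simp: \<chi>_def permutes_bij)
    show "\<exists>f. \<chi> u f \<noteq> \<chi> v f" if uv: "u \<in> Sym n" "v \<in> Sym n" "u \<noteq> v" for u v
    proof -
      obtain k where "u k \<noteq> v k" using uv(3) by blast
      then have "\<chi> u (pvar k) \<noteq> \<chi> v (pvar k)" using uv by (simp add: \<chi>_def permutes_bij)
      then show ?thesis by blast
    qed
    show "(\<Sum>v\<in>Sym n. C v * \<chi> v f) = 0" for f
      using assms(1) by (simp add: expn_def \<chi>_def)
  qed (use assms in auto)
qed

lemma expn_diff: "expn n g C \<Longrightarrow> expn n h D \<Longrightarrow> expn n (\<lambda>f. g f - h f) (\<lambda>v. C v - D v)"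
  by (simp add: expn_def left_diff_distrib sum_subtractf)
lemma expn_0: "expn n (\<lambda>_. 0) (\<lambda>_. 0)"
  by (simp add: expn_def)
lemma expn_add: "expn n g C \<Longrightarrow> expn n h D \<Longrightarrow> expn n (\<lambda>f. g f + h f) (\<lambda>v. C v + D v)"
  by (simp add: expn_def distrib_right sum.distrib)
lemma expn_sum: "(\<And>i. i \<in> I \<Longrightarrow> expn n (g i) (C i)) \<Longrightarrow> expn n (\<lambda>f. \<Sum>i\<in>I. g i f) (\<lambda>v. \<Sum>i\<in>I. C i v)"
  by (induction I rule: infinite_finite_induct) (auto simp: expn_0 intro: expn_add)
lemma expn_left: "expn n g C \<Longrightarrow> expn n (\<lambda>f. p * g f) (\<lambda>v. C v * to_fract p)"
  by (simp add: expn_def sum_distrib_left mult_ac)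
lemma expn_right: "expn n g C \<Longrightarrow> expn n (\<lambda>f. g (p * f)) (\<lambda>v. C v * to_fract (pact v p))"
  unfolding expn_def by (intro allI, subst sum.cong[OF refl]) (auto simp: permutes_bij mult_ac)
text \<open>
  Distinct permutations are distinct characters of the multiplicative monoid of polynomials.
\<close>

lemma expn_unique: "expn n g C \<Longrightarrow> expn n g D \<Longrightarrow> v \<in> Sym n \<Longrightarrow> C v = D v"
  using expn_zero[of n "\<lambda>v. C v - D v" v] expn_diff[of n g C g D] by simp

text \<open>
  The coefficient of \<open>s\<^sub>k\<close> in the operator of a crossing of colours \<open>i, j\<close>, with
  \<open>p, q\<close> in place of the variables \<open>k, k + 1\<close>; a Demazure operator also has a term at
  the identity.
\<close>

definition cfrac :: "('v \<times> 'v) set \<Rightarrow> 'v \<Rightarrow> 'v \<Rightarrow> nat \<Rightarrow> nat \<Rightarrow> zpoly fract" where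
  "cfrac A i j p q = (if i = j then - 1 / to_fract (pvar p - pvar q) else to_fract (qfac A i j p q))"

text \<open>
  The coefficients of an operator precomposed with a crossing in position \<open>k\<close>.
\<close>

definition crossC :: "('v \<times> 'v) set \<Rightarrow> 'v \<Rightarrow> 'v \<Rightarrow> nat \<Rightarrow> ((nat \<Rightarrow> nat) \<Rightarrow> zpoly fract) \<Rightarrow> (nat \<Rightarrow> nat) \<Rightarrow> zpoly fract" where
  "crossC A i j k C v = (if i = j then C v / to_fract (pvar (v k) - pvar (v (Suc k))) else 0)
     + C (v \<circ> sw k) * cfrac A i j ((v \<circ> sw k) k) ((v \<circ> sw k) (Suc k))"

lemma to_fract_diff' [simp]: "to_fract (x - y) = to_fract x - to_fract (y :: zpoly)"
  by (metis add_diff_cancel_right' diff_add_cancel to_fract_add)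

lemma to_fract_pact_crossop:
  assumes "bij v"
  shows "to_fract (pact v (crossop A i j k f)) =
    (if i = j then to_fract (pact v f) / to_fract (pvar (v k) - pvar (v (Suc k))) else 0)
    + cfrac A i j (v k) (v (Suc k)) * to_fract (pact (v \<circ> sw k) f)"
proof (cases "i = j")
  case True
  have nz: "to_fract (pvar (v k) - pvar (v (Suc k))) \<noteq> 0"
    using assms by (simp del: to_fract_diff' add: bij_is_inj inj_eq)
  have "pact v ((pvar k - pvar (Suc k)) * dem k f) = pact v (f - pact (sw k) f)" by (simp only: dem)
  then have "(pvar (v k) - pvar (v (Suc k))) * pact v (dem k f) = pact v f - pact (v \<circ> sw k) f"
    using assms by (simp add: pact_comp)
  then have "to_fract (pvar (v k) - pvar (v (Suc k))) * to_fract (pact v (dem k f)) = to_fract (pact v f) - to_fract (pact (v \<circ> sw k) f)"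
    by (metis to_fract_mult to_fract_diff')
  then have "to_fract (pact v (dem k f)) = (to_fract (pact v f) - to_fract (pact (v \<circ> sw k) f)) / to_fract (pvar (v k) - pvar (v (Suc k)))"
    using nz by (metis nonzero_mult_div_cancel_left)
  then show ?thesis using True by (simp add: crossop_def cfrac_def diff_divide_distrib del: to_fract_diff')
next
  case False
  then show ?thesis using assms by (simp add: crossop_def cfrac_def pact_comp)
qed

lemma expn_crossop:
  assumes "expn n g C" "Suc k < n"
  shows "expn n (\<lambda>f. g (crossop A i j k f)) (crossC A i j k C)"
  unfolding expn_def
proof
  fix f
  let ?a = "\<lambda>v. if i = j then 1 / to_fract (pvar (v k) - pvar (v (Suc k))) else 0"
  have p: "v \<circ> sw k \<in> Sym n" if "v \<in> Sym n" for v
    using permutes_compose[OF sw_permutes[OF assms(2)], of v] that by simp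
  have "to_fract (g (crossop A i j k f)) = (\<Sum>v\<in>Sym n. C v * to_fract (pact v (crossop A i j k f)))"
    using assms(1) by (simp add: expn_def)
  also have "\<dots> = (\<Sum>v\<in>Sym n. C v * ?a v * to_fract (pact v f)) + (\<Sum>v\<in>Sym n. C v * cfrac A i j (v k) (v (Suc k)) * to_fract (pact (v \<circ> sw k) f))"
    unfolding sum.distrib[symmetric] by (rule sum.cong[OF refl]) (simp add: to_fract_pact_crossop permutes_bij distrib_left mult.assoc)
  also have "(\<Sum>v\<in>Sym n. C v * cfrac A i j (v k) (v (Suc k)) * to_fract (pact (v \<circ> sw k) f)) =
    (\<Sum>v\<in>Sym n. C (v \<circ> sw k) * cfrac A i j ((v \<circ> sw k) k) ((v \<circ> sw k) (Suc k)) * to_fract (pact v f))"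
  proof (rule sum.reindex_bij_witness[of _ "\<lambda>v. v \<circ> sw k" "\<lambda>v. v \<circ> sw k"])
    fix v :: "nat \<Rightarrow> nat"
    have vv: "v \<circ> sw k \<circ> sw k = v" by (simp only: comp_assoc transpose_comp_involutory comp_id)
    then show "v \<circ> sw k \<circ> sw k = v" "v \<circ> sw k \<circ> sw k = v" by this+
    show "C (v \<circ> sw k \<circ> sw k) * cfrac A i j ((v \<circ> sw k \<circ> sw k) k) ((v \<circ> sw k \<circ> sw k) (Suc k)) * to_fract (pact (v \<circ> sw k) f) =
         C v * cfrac A i j (v k) (v (Suc k)) * to_fract (pact (v \<circ> sw k) f)" unfolding vv ..
  qed (use p in blast)+
  also have "(\<Sum>v\<in>Sym n. C v * ?a v * to_fract (pact v f)) + \<dots> = (\<Sum>v\<in>Sym n. crossC A i j k C v * to_fract (pact v f))"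
    unfolding sum.distrib[symmetric] by (rule sum.cong[OF refl]) (simp add: crossC_def distrib_right)
  finally show "to_fract (g (crossop A i j k f)) = (\<Sum>v\<in>Sym n. crossC A i j k C v * to_fract (pact v f))" .
qed

section \<open>Expansions of crossing diagrams\<close>

text \<open>
  The leading data of a reduced diagram with target \<open>b\<close>, as functions of the permutation alone: its
  coefficient at \<open>w\<close>, the factor by which \<open>\<d>\<close> multiplies this coefficient, and its
  degree.
\<close>

definition lead :: "('v \<times> 'v) set \<Rightarrow> 'v list \<Rightarrow> nat \<Rightarrow> (nat \<Rightarrow> nat) \<Rightarrow> zpoly fract" where
  "lead A b n w = (\<Prod>(p, q)\<in>Inv n (winv w). cfrac A (b ! q) (b ! p) p q)"

definition dlead :: "('v \<times> 'v) set \<Rightarrow> 'v list \<Rightarrow> nat \<Rightarrow> (nat \<Rightarrow> nat) \<Rightarrow> zpoly" where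
  "dlead A b n w = (\<Sum>(p, q)\<in>Inv n (winv w). of_int (- cart A (b ! p) (b ! q)) * pvar p)"

definition glead :: "('v \<times> 'v) set \<Rightarrow> 'v list \<Rightarrow> nat \<Rightarrow> (nat \<Rightarrow> nat) \<Rightarrow> int" where
  "glead A b n w = (\<Sum>(p, q)\<in>Inv n (winv w). - cart A (b ! p) (b ! q))"

lemma cfrac_nonzero: "p \<noteq> q \<Longrightarrow> cfrac A i j p q \<noteq> 0"
  by (simp add: cfrac_def qfac_def del: to_fract_diff')

lemma lead_nonzero: "lead A b n w \<noteq> 0"
  unfolding lead_def prod_zero_iff[OF finite_Inv] by (auto simp: Inv_def cfrac_nonzero)

lemma rep_d_cross_at:
  assumes "asym A" "Suc k < length a"
  shows "rep_lin A (d_lin A (X k a)) 0 f = (if a ! k = a ! Suc k then f else 0)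
    - of_int (cart A (a ! k) (a ! Suc k)) * (pvar k * crossop A (a ! k) (a ! Suc k) k f)"
proof -
  let ?i = "a ! k" and ?j = "a ! Suc k"
  have "rep_lin A (d_lin A (X k a)) 0 f = rep_lin A (d_diagram A (Cross ?i ?j)) k f"
    using assms(2) d_diagram_free_hom[of "Cross ?i ?j" A]
    by (simp add: cross_at_def rep_lin_hcomp[of "idm _" "take k a" "take k a"]
        rep_lin_hcomp[of _ "[?i, ?j]" "[?j, ?i]"] del: hcomp_of d_diagram.simps(3))
  also have "\<dots> = (if ?i = ?j then f else 0) - of_int (cart A ?i ?j) * (pvar k * crossop A ?i ?j k f)"
  proof (cases "?i = ?j")
    case True
    have "crossop A ?j ?j k (pvar (Suc k) * f) = - f + pvar k * crossop A ?j ?j k f"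
      by (simp add: crossop_def dem_mult)
    moreover have "2 * x = x + x" for x :: zpoly by (rule mult_2)
    ultimately show ?thesis using True by (simp add: cart_def)
  next
    case False
    then show ?thesis by (simp add: cart_def)
  qed
  finally show ?thesis .
qed

lemma expn_cong: "expn n g C \<Longrightarrow> (\<And>f. g f = h f) \<Longrightarrow> expn n h C"
  by (simp add: expn_def)

lemma expn_coeff_cong:
  assumes "expn n g C" "\<And>v. v \<in> Sym n \<Longrightarrow> C v = D v"
  shows "expn n g D"
proof -
  have "(\<Sum>v\<in>Sym n. C v * to_fract (pact v f)) = (\<Sum>v\<in>Sym n. D v * to_fract (pact v f))" for f
    by (rule sum.cong[OF refl]) (simp only: assms(2))
  then show ?thesis using assms(1) by (simp add: expn_def)
qed

text \<open>
  If the support lies below \<open>u\<close> and \<open>u s\<^sub>k\<close> is longer than \<open>u\<close>,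
  then the support after a crossing lies below \<open>u s\<^sub>k\<close>, and only one summand contributes to
  the coefficient there.
\<close>

lemma crossC_support:
  assumes supp: "\<forall>v. C v \<noteq> 0 \<longrightarrow> bruhat_le n v u" and assms': "u permutes {..<n}" "Suc k < n" "u k < u (Suc k)"
  shows "crossC A i j k C v \<noteq> 0 \<Longrightarrow> bruhat_le n v (u \<circ> sw k)"
    "crossC A i j k C (u \<circ> sw k) = C u * cfrac A i j (u k) (u (Suc k))"
    "C (u \<circ> sw k) = 0"
proof -
  note assms = supp[rule_format] assms'
  have inv: "w \<circ> sw k \<circ> sw k = w" for w :: "nat \<Rightarrow> nat" by (simp only: comp_assoc transpose_comp_involutory comp_id)
  show "bruhat_le n v (u \<circ> sw k)" if "crossC A i j k C v \<noteq> 0"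
  proof (cases "C v = 0")
    case True
    then have "C (v \<circ> sw k) \<noteq> 0" using that unfolding crossC_def by (cases "i = j") simp_all
    from bruhat_le_sw(2)[OF assms(1)[OF this] assms(2-4)] show ?thesis unfolding inv .
  next
    case False
    from bruhat_le_sw(1)[OF assms(1)[OF this] assms(2-4)] show ?thesis .
  qed
  show z: "C (u \<circ> sw k) = 0"
  proof (rule ccontr)
    assume "C (u \<circ> sw k) \<noteq> 0"
    from bruhat_le_ell[OF assms(1)[OF this]] ell_sw(1)[OF assms(2,3)] assms(4) have "u \<circ> sw k = u" by simp
    then have "u (sw k k) = u k" by (metis comp_apply)
    then show False using assms(4) by simp
  qed
  show "crossC A i j k C (u \<circ> sw k) = C u * cfrac A i j (u k) (u (Suc k))"
    unfolding crossC_def inv z by simp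
qed

text \<open>
  Induction on a reduced word from the right: appending \<open>k\<close> adds one inversion, hence one factor to
  \<open>lead\<close> and one summand to \<open>dlead\<close> and \<open>glead\<close>.  For
  \<open>\<d>\<close>, the Leibniz rule expresses the new operator by that of the shorter word and by
  \<open>\<d>\<close> of a single crossing, which is minus the Cartan number times \<open>x\<^sub>k
  \<psi>\<^sub>k\<close>, up to an identity that does not reach the coefficient at \<open>w\<close>.
\<close>

lemma expn_crossings:
  assumes A: "asym A" and "reduced_expression n w ks" "length a = n" "b = wd ks a"
  shows "\<exists>C Cd. expn n (\<lambda>f. rep A (crossings ks a) 0 f) C \<and> expn n (\<lambda>f. rep_lin A (d_lin A (crossm ks a)) 0 f) Cd \<and>
    (\<forall>v. C v \<noteq> 0 \<longrightarrow> bruhat_le n v w) \<and> (\<forall>v. Cd v \<noteq> 0 \<longrightarrow> bruhat_le n v w) \<and>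
    C w = lead A b n w \<and> Cd w = to_fract (dlead A b n w) * lead A b n w \<and>
    deg A (crossings ks a) = glead A b n w"
  using assms(2-)
proof (induction ks arbitrary: a w rule: rev_induct)
  case Nil
  have w: "w = id" using Nil.prems(1) by (simp add: reduced_iff)
  have "winv id = id" by (rule inv_unique_comp) auto
  then have I: "Inv n (winv w) = {}" using w by (auto simp: Inv_def)
  have "(\<Sum>v\<in>Sym n. (if v = w then 1 else 0) * to_fract (pact v f)) = to_fract f" for f
  proof -
    have "(\<Sum>v\<in>Sym n. (if v = w then 1 else 0) * to_fract (pact v f)) = (\<Sum>v\<in>Sym n. if v = w then to_fract (pact v f) else 0)"
      by (rule sum.cong) auto
    also have "\<dots> = to_fract (pact w f)" using permutes_id[of "{..<n}"] unfolding w by (subst sum.delta) (simp_all only: finite_Sym mem_Collect_eq if_True)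
    finally show ?thesis unfolding w by (simp only: pact_id)
  qed
  then have "expn n (\<lambda>f. f) (\<lambda>v. if v = w then 1 else 0)" unfolding expn_def by (simp only: simp_thms)
  then show ?case using I by (intro exI[of _ "\<lambda>v. if v = w then 1 else 0"] exI[of _ "\<lambda>_. 0"])
    (auto simp: lead_def dlead_def glead_def expn_0)
next
  case (snoc k ks)
  let ?u = "word_perm ks" and ?a = "sx k a" and ?i = "a ! k" and ?j = "a ! Suc k"
  note red = reduced_snoc[OF snoc.prems(1)]
  have ka: "Suc k < length a" using red(2) snoc.prems by simp
  have la: "length ?a = n" using ka snoc.prems by simp
  have val: "valid (ks @ [k]) a" using snoc.prems by (auto simp: reduced_iff valid_def)
  have vks: "valid ks ?a" using val la snoc.prems by (simp add: valid_def)
  have b: "b = wd ks ?a" using snoc.prems(3) crossings_snoc(1)[OF val] by simp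
  have up: "?u permutes {..<n}" using red(1) by (auto simp: reduced_iff word_perm_permutes)
  obtain C Cd where C: "expn n (\<lambda>f. rep A (crossings ks ?a) 0 f) C"
    and Cd: "expn n (\<lambda>f. rep_lin A (d_lin A (crossm ks ?a)) 0 f) Cd"
    and s: "\<forall>v. C v \<noteq> 0 \<longrightarrow> bruhat_le n v ?u" "\<forall>v. Cd v \<noteq> 0 \<longrightarrow> bruhat_le n v ?u"
    and l: "C ?u = lead A b n ?u" "Cd ?u = to_fract (dlead A b n ?u) * lead A b n ?u"
    and dg: "deg A (crossings ks ?a) = glead A b n ?u"
    using snoc.IH[OF red(1) la b] by blast
  have bp: "b ! ?u k = ?j" "b ! ?u (Suc k) = ?i"
    using nth_tgt_crossings[OF vks, of k] nth_tgt_crossings[OF vks, of "Suc k"] ka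
    unfolding b by (simp_all add: nth_tgt_cross_at)
  note I = Inv_winv_sw[OF up red(2,4)]
  have lead: "lead A b n w = lead A b n ?u * cfrac A ?i ?j (?u k) (?u (Suc k))"
    unfolding lead_def red(3) I(1) using I(2) by (simp add: bp)
  have dlead: "dlead A b n w = dlead A b n ?u + of_int (- cart A ?j ?i) * pvar (?u k)"
    unfolding dlead_def red(3) I(1) using I(2) by (simp add: bp)
  have glead: "glead A b n w = glead A b n ?u - cart A ?j ?i"
    unfolding glead_def red(3) I(1) using I(2) by (simp add: bp)
  let ?C = "crossC A ?i ?j k C"
  have e1: "expn n (\<lambda>f. rep A (crossings (ks @ [k]) a) 0 f) ?C"
    by (rule expn_cong[OF expn_crossop[OF C red(2)]]) (use ka in \<open>simp add: crossings_snoc(2)[OF val]\<close>)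
  let ?c = "of_int (cart A ?i ?j) :: zpoly" and ?\<delta> = "if ?i = ?j then 1 else 0 :: zpoly fract"
  define Cx where "Cx = (\<lambda>v. C v * to_fract (pact v (?c * pvar k)))"
  have ex: "expn n (\<lambda>f. rep A (crossings ks ?a) 0 ((?c * pvar k) * f)) Cx"
    unfolding Cx_def by (rule expn_right[OF C])
  have sx: "\<forall>v. Cx v \<noteq> 0 \<longrightarrow> bruhat_le n v ?u" using s(1) by (auto simp: Cx_def)
  define D where "D = (\<lambda>v. crossC A ?i ?j k Cd v + (C v * to_fract (pact v (if ?i = ?j then 1 else 0)) - crossC A ?i ?j k Cx v))"
  have e2: "expn n (\<lambda>f. rep_lin A (d_lin A (crossm (ks @ [k]) a)) 0 f) D"
    unfolding D_def
  proof (rule expn_cong[OF expn_add[OF expn_crossop[OF Cd red(2)] expn_diff[OF expn_right[OF C] expn_crossop[OF ex red(2)]]]])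
    fix f
    let ?T = "\<lambda>f. rep A (crossings ks ?a) 0 f" and ?P = "crossop A ?i ?j k"
    have h1: "crossm (ks @ [k]) a \<in> free_hom a b" "crossm ks ?a \<in> free_hom ?a b" "X k a \<in> free_hom a ?a"
      using crossings_wf[OF val] crossings_wf[OF vks] snoc.prems(3) b ka by simp_all
    \<comment> \<open>the Leibniz rule, in terms of commutators\<close>
    have d1: "rep_lin A (d_lin A (crossm (ks @ [k]) a)) 0 f = dop A n b 0 (?T (?P f)) - ?T (?P (dop A n a 0 f))"
      using rep_d_lin[OF A h1(1), of 0 n f] snoc.prems ka by (simp add: crossings_snoc(2)[OF val])
    have d2: "rep_lin A (d_lin A (crossm ks ?a)) 0 (?P f) = dop A n b 0 (?T (?P f)) - ?T (dop A n ?a 0 (?P f))"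
      using rep_d_lin[OF A h1(2), of 0 n "?P f"] la by simp
    have d3: "rep_lin A (d_lin A (X k a)) 0 f = dop A n ?a 0 (?P f) - ?P (dop A n a 0 f)"
      using rep_d_lin[OF A h1(3), of 0 n f] snoc.prems ka by simp
    have "?T (rep_lin A (d_lin A (X k a)) 0 f) = ?T (dop A n ?a 0 (?P f)) - ?T (?P (dop A n a 0 f))"
      unfolding d3 by (rule rep_diff)
    then have "rep_lin A (d_lin A (crossm (ks @ [k]) a)) 0 f =
      rep_lin A (d_lin A (crossm ks ?a)) 0 (?P f) + ?T (rep_lin A (d_lin A (X k a)) 0 f)"
      unfolding d1 d2 by simp
    also have "?T (rep_lin A (d_lin A (X k a)) 0 f) = ?T ((if ?i = ?j then 1 else 0) * f) - ?T (?c * pvar k * ?P f)"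
      unfolding rep_d_cross_at[OF A ka] by (simp add: mult.assoc)
    finally show "rep_lin A (d_lin A (crossm ks ?a)) 0 (?P f) + (?T ((if ?i = ?j then 1 else 0) * f) - ?T (?c * pvar k * ?P f)) =
      rep_lin A (d_lin A (crossm (ks @ [k]) a)) 0 f" by simp
  qed
  note c1 = crossC_support[OF s(1) up red(2,4)] and c2 = crossC_support[OF s(2) up red(2,4)] and c3 = crossC_support[OF sx up red(2,4)]
  have sD: "bruhat_le n v w" if "D v \<noteq> 0" for v
  proof -
    have "crossC A ?i ?j k Cd v \<noteq> 0 \<or> C v \<noteq> 0 \<or> crossC A ?i ?j k Cx v \<noteq> 0" using that by (auto simp: D_def)
    then show ?thesis unfolding red(3)
    proof (elim disjE)
      assume "C v \<noteq> 0"
      from bruhat_le_sw(1)[OF s(1)[rule_format, OF this] up red(2,4)] show "bruhat_le n v (?u \<circ> sw k)" .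
    qed (erule c2(1), erule c3(1))
  qed
  have lD: "D w = to_fract (dlead A b n w) * lead A b n w"
  proof -
    have "D w = crossC A ?i ?j k Cd w - crossC A ?i ?j k Cx w" unfolding D_def using c1(3) red(3) by simp
    also have "\<dots> = to_fract (dlead A b n ?u) * lead A b n w - to_fract (?c * pvar (?u k)) * lead A b n w"
    proof -
      have cx: "Cx ?u = lead A b n ?u * to_fract (?c * pvar (?u k))"
        using up by (simp add: Cx_def l permutes_bij)
      show ?thesis unfolding red(3) c2(2) c3(2) lead[unfolded red(3)] l cx by (simp only: mult_ac)
    qed
    also have "\<dots> = to_fract (dlead A b n ?u - ?c * pvar (?u k)) * lead A b n w"
      by (simp only: to_fract_diff' left_diff_distrib)
    also have "dlead A b n ?u - ?c * pvar (?u k) = dlead A b n w"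
      unfolding dlead by (simp add: cart_sym[of A ?j ?i])
    finally show ?thesis .
  qed
  have dg': "deg A (crossings (ks @ [k]) a) = glead A b n w"
    unfolding crossings_snoc(3)[OF val] dg glead by (simp add: cross_at_def cart_sym[of A ?j ?i])
  show ?case
  proof (rule exI[of _ ?C], rule exI[of _ D], intro conjI allI impI)
    show "bruhat_le n v w" if "?C v \<noteq> 0" for v unfolding red(3) by (rule c1(1)[OF that])
    show "?C w = lead A b n w" unfolding lead l(1)[symmetric] unfolding red(3) by (rule c1(2))
  qed (fact e1 e2 sD lD dg')+
qed

section \<open>Faithfulness and the bases of crossing diagrams\<close>

text \<open>
  A linear system with Bruhat triangular matrix \<open>C\<close>: at an element \<open>u\<close> of maximal
  length among those outside \<open>\<Lambda>\<close> with \<open>\<rho> u u \<noteq> 0\<close>, the sum reduces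
  to the diagonal term.  Scalars \<open>\<rho> w v\<close> that depend on the column cover the right action,
  where a polynomial acts through the permutation \<open>v\<close>.
\<close>

lemma triangular_vanish:
  assumes fin: "finite S"
    and C: "\<And>w v. w \<in> S \<Longrightarrow> C w v \<noteq> 0 \<Longrightarrow> bruhat_le n v w"
    and L: "\<And>w. w \<in> S \<Longrightarrow> C w w \<noteq> (0 :: 'a :: idom)"
    and \<rho>: "\<And>w v. w \<in> S \<Longrightarrow> \<rho> w w = 0 \<Longrightarrow> \<rho> w v = 0"
    and low: "\<And>v w. w \<in> \<Lambda> \<Longrightarrow> bruhat_le n v w \<Longrightarrow> v \<in> \<Lambda>"
    and E: "\<And>v. v \<in> S \<Longrightarrow> v \<notin> \<Lambda> \<Longrightarrow> (\<Sum>w\<in>S. C w v * \<rho> w v) = 0"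
    and w: "w \<in> S" "w \<notin> \<Lambda>"
  shows "\<rho> w w = 0"
proof (rule ccontr)
  let ?B = "{w \<in> S. w \<notin> \<Lambda> \<and> \<rho> w w \<noteq> 0}"
  assume "\<rho> w w \<noteq> 0"
  then have "?B \<noteq> {}" "finite ?B" using w fin by auto
  then have "Max (ell n ` ?B) \<in> ell n ` ?B" by (intro Max_in) auto
  then obtain u where u0: "u \<in> ?B" "Max (ell n ` ?B) = ell n u" by blast
  have u: "u \<in> ?B" "\<And>v. v \<in> ?B \<Longrightarrow> ell n v \<le> ell n u"
    using u0(1) Max_ge[of "ell n ` ?B"] \<open>finite ?B\<close> unfolding u0(2)[symmetric] by auto
  have "C v u * \<rho> v u = 0" if v: "v \<in> S" "v \<noteq> u" for v
  proof (rule ccontr)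
    assume "C v u * \<rho> v u \<noteq> 0"
    then have c: "bruhat_le n u v" and r: "\<rho> v v \<noteq> 0" using C[OF v(1), of u] \<rho>[OF v(1), of u] by auto
    have "v \<notin> \<Lambda>" using low[OF _ c] u by blast
    then have "ell n v \<le> ell n u" using u(2) v r by blast
    then show False using bruhat_le_ell[OF c] v by auto
  qed
  then have "(\<Sum>w\<in>S - {u}. C w u * \<rho> w u) = 0" by (intro sum.neutral) blast
  then have "(\<Sum>w\<in>S. C w u * \<rho> w u) = C u u * \<rho> u u"
    using sum.remove[OF fin, of u "\<lambda>w. C w u * \<rho> w u"] u by simp
  then show False using E[of u] L[of u] u by auto
qed

locale hom_setup =
  fixes A :: "('v \<times> 'v) set" and n :: nat and i j :: "'v list" and rex :: "(nat \<Rightarrow> nat) \<Rightarrow> nat list"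
  assumes A: "asym A" and li: "length i = n" and lj: "length j = n"
    and rex: "\<And>w. w \<in> seq_perms i j \<Longrightarrow> reduced_expression n w (rex w)"
begin

abbreviation "S \<equiv> seq_perms i j"

definition \<psi> :: "(nat \<Rightarrow> nat) \<Rightarrow> 'v lin" where "\<psi> w = crossm (rex w) i"

text \<open>
  Both actions at once: the left action of \<open>R\<^sub>j\<close> if \<open>side\<close> holds, otherwise the
  right action of \<open>R\<^sub>i\<close>.
\<close>

definition act :: "bool \<Rightarrow> zpoly \<Rightarrow> 'v lin \<Rightarrow> 'v lin" where
  "act side p f = (if side then poly_dots p j \<star> f else f \<star> poly_dots p i)"

text \<open>
  The factor by which a polynomial multiplies the coefficient at \<open>v\<close> of an expansion.
\<close>

definition \<rho> :: "bool \<Rightarrow> zpoly \<Rightarrow> (nat \<Rightarrow> nat) \<Rightarrow> zpoly fract" where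
  "\<rho> side p v = to_fract (if side then p else pact v p)"

abbreviation rp :: "'v lin \<Rightarrow> zpoly \<Rightarrow> zpoly" where "rp f p \<equiv> rep_lin A f 0 p"

lemma eqv_rp: "eqv A a b f g \<Longrightarrow> rp f p = rp g p"
  using null_rep[OF A, of a b "f - g" 0 p] by (simp add: eqv_def)

lemma S_Sym: "w \<in> S \<Longrightarrow> w \<in> Sym n"
  using li by (auto simp: seq_perms_def)

lemma act_free_hom: "f \<in> free_hom i j \<Longrightarrow> act side p f \<in> free_hom i j"
  by (auto simp: act_def intro: free_hom_vcomp poly_dots_free_hom)

lemma act_0 [simp]: "act side 0 f = 0"
  by (simp add: act_def)

lemma rp_act: "p \<in> Pn n \<Longrightarrow> rp (act side p f) q = (if side then p * rp f q else rp f (p * q))"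
  by (simp add: act_def rep_lin_vcomp rep_poly_dots li lj)

lemma expn_act:
  assumes "p \<in> Pn n" "expn n (rp f) C"
  shows "expn n (rp (act side p f)) (\<lambda>v. C v * \<rho> side p v)"
proof (cases side)
  case True
  then show ?thesis using expn_left[OF assms(2), of p] rp_act[OF assms(1)] by (simp add: \<rho>_def)
next
  case False
  then show ?thesis using expn_right[OF assms(2), of p] rp_act[OF assms(1)] by (simp add: \<rho>_def)
qed

lemma \<rho>_eq_0: "v \<in> Sym n \<Longrightarrow> \<rho> side p v = 0 \<longleftrightarrow> p = 0"
  by (auto simp: \<rho>_def permutes_bij)

text \<open>
  The same analysis is applied to the normal forms, which are known to span, and to the given reduced
  expressions.
\<close>

definition fam :: "((nat \<Rightarrow> nat) \<Rightarrow> nat list) \<Rightarrow> bool" where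
  "fam r \<longleftrightarrow> (\<forall>w\<in>S. reduced_expression n w (r w))"

lemma fam_rex: "fam rex" by (simp add: fam_def rex)
lemma fam_nf: "fam (nf n)" using S_Sym reduced_nf by (auto simp: fam_def)

lemma fam_free_hom: "fam r \<Longrightarrow> w \<in> S \<Longrightarrow> crossm (r w) i \<in> free_hom i j"
  using crossings_free_hom(1)[of i w "r w" j] li lj by (simp add: fam_def)

lemma fam_expn:
  assumes "fam r" "w \<in> S"
  shows "\<exists>C Cd. expn n (rp (crossm (r w) i)) C \<and> expn n (rp (d_lin A (crossm (r w) i))) Cd \<and>
    (\<forall>v. C v \<noteq> 0 \<longrightarrow> bruhat_le n v w) \<and> (\<forall>v. Cd v \<noteq> 0 \<longrightarrow> bruhat_le n v w) \<and>
    C w = lead A j n w \<and> Cd w = to_fract (dlead A j n w) * lead A j n w \<and>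
    deg A (crossings (r w) i) = glead A j n w"
proof -
  have r: "reduced_expression n w (r w)" using assms by (simp add: fam_def)
  have "j = wd (r w) i" using fam_free_hom[OF assms] by simp
  from expn_crossings[OF A r li this] show ?thesis by simp
qed

lemma expn_rp_sum:
  assumes "\<And>w. w \<in> S \<Longrightarrow> expn n (rp (f w)) (C w)" "\<And>w. R w \<in> Pn n"
  shows "expn n (rp (\<Sum>w\<in>S. act side (R w) (f w))) (\<lambda>v. \<Sum>w\<in>S. C w v * \<rho> side (R w) v)"
  by (rule expn_cong[OF expn_sum[OF expn_act[OF assms(2,1)]]]) (auto simp: rep_lin_sum)

lemma fam_C:
  assumes "fam r"
  obtains C where "\<And>w. w \<in> S \<Longrightarrow> expn n (rp (crossm (r w) i)) (C w)"
    "\<And>w v. w \<in> S \<Longrightarrow> C w v \<noteq> 0 \<Longrightarrow> bruhat_le n v w" "\<And>w. w \<in> S \<Longrightarrow> C w w = lead A j n w"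
proof -
  have "\<forall>w\<in>S. \<exists>C. expn n (rp (crossm (r w) i)) C \<and> (\<forall>v. C v \<noteq> 0 \<longrightarrow> bruhat_le n v w) \<and> C w = lead A j n w"
    using fam_expn[OF assms] by blast
  from bchoice[OF this] show ?thesis using that by blast
qed

text \<open>
  The expansion of a combination of crossing diagrams bounds the combination itself: no coefficient can occur
  outside a Bruhat ideal that contains the support.
\<close>

lemma support_bound:
  assumes "fam r" "\<And>w. R w \<in> Pn n" "expn n (rp (\<Sum>w\<in>S. act side (R w) (crossm (r w) i))) E"
    "\<And>v w. w \<in> \<Lambda> \<Longrightarrow> bruhat_le n v w \<Longrightarrow> v \<in> \<Lambda>" "\<And>v. E v \<noteq> 0 \<Longrightarrow> v \<in> \<Lambda>" "w \<in> S" "w \<notin> \<Lambda>"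
  shows "R w = 0"
proof -
  obtain C where C: "\<And>w. w \<in> S \<Longrightarrow> expn n (rp (crossm (r w) i)) (C w)"
    "\<And>w v. w \<in> S \<Longrightarrow> C w v \<noteq> 0 \<Longrightarrow> bruhat_le n v w" "\<And>w. w \<in> S \<Longrightarrow> C w w = lead A j n w"
    using fam_C[OF assms(1)] by blast
  have e: "E v = (\<Sum>w\<in>S. C w v * \<rho> side (R w) v)" if "v \<in> Sym n" for v
    by (rule expn_unique[OF assms(3) expn_rp_sum[OF C(1) assms(2)] that])
  have "\<rho> side (R w) w = 0"
  proof (rule triangular_vanish[where \<Lambda> = \<Lambda> and S = S and C = C and n = n and \<rho> = "\<lambda>w. \<rho> side (R w)"])
    show "C w w \<noteq> 0" if "w \<in> S" for w using C(3)[OF that] lead_nonzero by metis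
    show "\<rho> side (R w) v = 0" if "w \<in> S" "\<rho> side (R w) w = 0" for w v
      using that \<rho>_eq_0[OF S_Sym] by (auto simp: \<rho>_def)
    show "(\<Sum>w\<in>S. C w v * \<rho> side (R w) v) = 0" if "v \<in> S" "v \<notin> \<Lambda>" for v
      using e[OF S_Sym[OF that(1)]] assms(5)[of v] that by auto
  qed (use C(2) assms in auto)
  then show ?thesis using \<rho>_eq_0[OF S_Sym[OF assms(6)]] by blast
qed

lemma nf_spn:
  assumes "f \<in> free_hom i j"
  shows "\<exists>R. (\<forall>w. R w \<in> Pn n) \<and> eqv A i j f (\<Sum>w\<in>S. act False (R w) (crossm (nf n w) i))"
  using nf_spans[OF assms, of A] li lj by (simp add: act_def)

text \<open>
  The polynomial representation is faithful.  A morphism is a combination of normal forms, and if it acts by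
  zero, the empty ideal bounds its support.
\<close>

theorem null_iff:
  assumes "f \<in> free_hom i j"
  shows "null A i j f \<longleftrightarrow> (\<forall>p. rp f p = 0)"
proof
  assume "null A i j f"
  then show "\<forall>p. rp f p = 0" using null_rep[OF A] by blast
next
  assume z: "\<forall>p. rp f p = 0"
  obtain R where R: "\<And>w. R w \<in> Pn n"
    "eqv A i j f (\<Sum>w\<in>S. act False (R w) (crossm (nf n w) i))"
    using nf_spn[OF assms] by blast
  let ?g = "\<Sum>w\<in>S. act False (R w) (crossm (nf n w) i)"
  have "rp ?g p = 0" for p
    using null_rep[OF A, of i j "f - ?g" 0 p] R(2) z by (simp add: eqv_def)
  then have "expn n (rp ?g) (\<lambda>_. 0)" by (simp add: expn_0 expn_cong[OF expn_0])
  from support_bound[OF fam_nf R(1) this, of "{}"] have "R w = 0" if "w \<in> S" for w using that by auto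
  then have "?g = 0" by (intro sum.neutral) (simp add: act_def)
  then show "null A i j f" using R(2) by (simp add: eqv_def)
qed

definition spn :: "bool \<Rightarrow> 'v lin \<Rightarrow> bool" where
  "spn side f \<longleftrightarrow> (\<exists>R. (\<forall>w. R w \<in> Pn n) \<and> eqv A i j f (\<Sum>w\<in>S. act side (R w) (\<psi> w)))"

lemma spn_0: "spn side 0"
  unfolding spn_def by (rule exI[of _ "\<lambda>_. 0"]) (simp add: eqv_refl)

lemma spn_add: "spn side f \<Longrightarrow> spn side g \<Longrightarrow> spn side (f + g)"
proof -
  assume "spn side f" "spn side g"
  then obtain R R' where R: "\<And>w. R w \<in> Pn n" "\<And>w. R' w \<in> Pn n"
     "eqv A i j f (\<Sum>w\<in>S. act side (R w) (\<psi> w))" "eqv A i j g (\<Sum>w\<in>S. act side (R' w) (\<psi> w))"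
    unfolding spn_def by blast
  have "act side (R w + R' w) (\<psi> w) = act side (R w) (\<psi> w) + act side (R' w) (\<psi> w)" for w
    by (simp add: act_def poly_dots_add)
  then have "eqv A i j (f + g) (\<Sum>w\<in>S. act side (R w + R' w) (\<psi> w))"
    using eqv_add[OF R(3,4)] by (simp add: sum.distrib)
  then show ?thesis unfolding spn_def using R(1,2) by (intro exI[of _ "\<lambda>w. R w + R' w"]) auto
qed

lemma spn_sum: "(\<And>w. w \<in> I \<Longrightarrow> spn side (f w)) \<Longrightarrow> spn side (sum f I)"
  by (induction I rule: infinite_finite_induct) (auto intro: spn_0 spn_add)

lemma spn_eqv: "spn side f \<Longrightarrow> eqv A i j g f \<Longrightarrow> spn side g"
  unfolding spn_def by (elim exE conjE) (rule exI, rule conjI, assumption, rule eqv_trans)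

lemma \<psi>_free_hom: "w \<in> S \<Longrightarrow> \<psi> w \<in> free_hom i j"
  unfolding \<psi>_def by (rule fam_free_hom[OF fam_rex])

lemma spn_single:
  assumes "w \<in> S" "p \<in> Pn n" shows "spn side (act side p (\<psi> w))"
proof -
  have "(\<Sum>v\<in>S. act side (if v = w then p else 0) (\<psi> v)) = (\<Sum>v\<in>S. if v = w then act side p (\<psi> w) else 0)"
    by (rule sum.cong) (auto simp: act_def)
  also have "\<dots> = act side p (\<psi> w)" using assms by (subst sum.delta) auto
  finally show ?thesis unfolding spn_def using assms act_free_hom[OF \<psi>_free_hom[OF assms(1)]]
    by (intro exI[of _ "\<lambda>v. if v = w then p else 0"]) (auto simp: eqv_refl)
qed

text \<open>
  Induction on the length: subtracting from a normal form the given diagram for the same permutation, with the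
  polynomial moved to the other side if necessary, cancels the leading coefficient and leaves an expansion
  supported in smaller length.
\<close>

lemma spn_bounded:
  assumes "f \<in> free_hom i j" "expn n (rp f) E" "\<And>v. v \<in> Sym n \<Longrightarrow> E v \<noteq> 0 \<Longrightarrow> ell n v < l"
  shows "spn side f"
  using assms
proof (induction l arbitrary: f E rule: less_induct)
  case (less l)
  obtain R where R: "\<And>w. R w \<in> Pn n"
    "eqv A i j f (\<Sum>w\<in>S. act False (R w) (crossm (nf n w) i))"
    using nf_spn[OF less.prems(1)] by blast
  let ?\<Lambda> = "{v. ell n v < l}" and ?E = "\<lambda>v. if v \<in> Sym n then E v else 0"
  have E: "expn n (rp f) ?E" by (rule expn_coeff_cong[OF less.prems(2)]) (simp only: if_True)
  have "rp f p = rp (\<Sum>w\<in>S. act False (R w) (crossm (nf n w) i)) p" for p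
    by (rule eqv_rp[OF R(2)])
  then have e: "expn n (rp (\<Sum>w\<in>S. act False (R w) (crossm (nf n w) i))) ?E" by (rule expn_cong[OF E])
  have lw: "ell n w < l" if "w \<in> S" "R w \<noteq> 0" for w
  proof (rule ccontr)
    assume "\<not> ell n w < l"
    then have w: "w \<notin> ?\<Lambda>" by simp
    have "R w = 0"
    proof (rule support_bound[OF fam_nf R(1) e _ _ that(1) w])
      show "v \<in> ?\<Lambda>" if "w \<in> ?\<Lambda>" "bruhat_le n v w" for v w
        using that bruhat_le_ell[OF that(2)] by auto
      show "v \<in> ?\<Lambda>" if "?E v \<noteq> 0" for v using that less.prems(3)[of v] by (auto split: if_splits)
    qed
    then show False using that by simp
  qed
  have "spn side (act False (R w) (crossm (nf n w) i))" if w: "w \<in> S" for w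
  proof (cases "R w = 0")
    case True
    then show ?thesis by (simp add: act_def spn_0)
  next
    case False
    \<comment> \<open>dots on the source slide through to dots on the target along w\<close>
    define p where "p = (if side then pact w (R w) else R w)"
    have p: "p \<in> Pn n" unfolding p_def using R(1) Pn_pact[OF R(1)] S_Sym[OF w] by auto
    let ?g = "act False (R w) (crossm (nf n w) i) - act side p (\<psi> w)"
    obtain C where C: "expn n (rp (crossm (nf n w) i)) C" "\<And>v. C v \<noteq> 0 \<Longrightarrow> bruhat_le n v w" "C w = lead A j n w"
      using fam_expn[OF fam_nf w] by blast
    obtain D where D: "expn n (rp (\<psi> w)) D" "\<And>v. D v \<noteq> 0 \<Longrightarrow> bruhat_le n v w" "D w = lead A j n w"
      using fam_expn[OF fam_rex w] unfolding \<psi>_def by blast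
    have "\<rho> False (R w) w = \<rho> side p w" by (simp add: \<rho>_def p_def)
    then have lead: "C w * \<rho> False (R w) w - D w * \<rho> side p w = 0" using C(3) D(3) by simp
    have gh: "?g \<in> free_hom i j"
      by (intro free_hom_diff act_free_hom \<psi>_free_hom fam_free_hom[OF fam_nf] w)
    have ge: "expn n (rp ?g) (\<lambda>v. C v * \<rho> False (R w) v - D v * \<rho> side p v)"
      by (rule expn_cong[OF expn_diff[OF expn_act[OF R(1) C(1)] expn_act[OF p D(1)]]]) simp
    have "spn side ?g"
    proof (rule less.IH[OF lw[OF w False] gh ge])
      fix v assume "C v * \<rho> False (R w) v - D v * \<rho> side p v \<noteq> 0"
      then have "v \<noteq> w" "C v \<noteq> 0 \<or> D v \<noteq> 0" using lead by auto
      then show "ell n v < ell n w" using bruhat_le_ell C(2) D(2) by blast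
    qed
    from spn_add[OF this spn_single[OF w p]] show ?thesis by simp
  qed
  then show ?case by (intro spn_eqv[OF spn_sum R(2)])
qed

theorem spans:
  assumes "f \<in> free_hom i j"
  shows "spn side f"
proof -
  obtain R where R: "\<And>w. R w \<in> Pn n"
    "eqv A i j f (\<Sum>w\<in>S. act False (R w) (crossm (nf n w) i))"
    using nf_spn[OF assms] by blast
  obtain C where C: "\<And>w. w \<in> S \<Longrightarrow> expn n (rp (crossm (nf n w) i)) (C w)"
    "\<And>w v. w \<in> S \<Longrightarrow> C w v \<noteq> 0 \<Longrightarrow> bruhat_le n v w" "\<And>w. w \<in> S \<Longrightarrow> C w w = lead A j n w"
    using fam_C[OF fam_nf] by blast
  have "rp f p = rp (\<Sum>w\<in>S. act False (R w) (crossm (nf n w) i)) p" for p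
    by (rule eqv_rp[OF R(2)])
  then have e: "expn n (rp f) (\<lambda>v. \<Sum>w\<in>S. C w v * \<rho> False (R w) v)"
    by (intro expn_cong[OF expn_rp_sum[of "\<lambda>w. crossm (nf n w) i" C R False, OF C(1) R(1)]]) simp_all
  show ?thesis
  proof (rule spn_bounded[OF assms e])
    fix v assume "v \<in> Sym n"
    then show "ell n v < Suc (Max (ell n ` Sym n))" by (intro le_imp_less_Suc Max_ge) auto
  qed
qed

theorem independent:
  assumes "\<And>w. R w \<in> Pn n" "null A i j (\<Sum>w\<in>S. act side (R w) (\<psi> w))" "w \<in> S"
  shows "R w = 0"
proof -
  have "expn n (rp (\<Sum>w\<in>S. act side (R w) (\<psi> w))) (\<lambda>_. 0)"
    by (rule expn_cong[OF expn_0]) (simp add: null_rep[OF A assms(2)])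
  from support_bound[OF fam_rex assms(1) this[unfolded \<psi>_def], of "{}"] assms(3) show ?thesis by auto
qed

definition pfun :: "bool \<Rightarrow> (nat \<Rightarrow> nat) \<Rightarrow> nat \<Rightarrow> int" where
  "pfun side = (if side then p_left A j else p_right A i)"

text \<open>
  The Bruhat support of the expansion of \<open>\<d>(\<psi>\<^sub>w)\<close> bounds its coefficients.  At
  \<open>w\<close> only the summand of \<open>\<psi>\<^sub>w\<close> contributes, so the factor
  \<open>dlead\<close> determines the coefficient there: it is the left weight \<open>p(w)\<close>, and the
  right weight with its variables permuted by \<open>w\<close>.
\<close>

theorem d_\<psi>:
  assumes w: "w \<in> S"
  shows "\<exists>R. (\<forall>v. R v \<in> Pn n) \<and> eqv A i j (d_lin A (\<psi> w)) (\<Sum>v\<in>S. act side (R v) (\<psi> v)) \<and>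
    (\<forall>v\<in>S. R v \<noteq> 0 \<longrightarrow> bruhat_le n v w) \<and> R w = (\<Sum>k<n. of_int (pfun side w k) * pvar k)"
proof -
  let ?P = "\<Sum>k<n. of_int (pfun side w k) * pvar k"
  have dh: "d_lin A (\<psi> w) \<in> free_hom i j" by (intro d_lin_free_hom \<psi>_free_hom w)
  obtain R where R: "\<And>w. R w \<in> Pn n" "eqv A i j (d_lin A (\<psi> w)) (\<Sum>v\<in>S. act side (R v) (\<psi> v))"
    using spans[OF dh, of side] unfolding spn_def by blast
  obtain C Cd where C: "expn n (rp (d_lin A (\<psi> w))) Cd" "\<forall>v. Cd v \<noteq> 0 \<longrightarrow> bruhat_le n v w"
     "Cd w = to_fract (dlead A j n w) * lead A j n w"
    using fam_expn[OF fam_rex w] unfolding \<psi>_def by blast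
  have "rp (d_lin A (\<psi> w)) p = rp (\<Sum>v\<in>S. act side (R v) (\<psi> v)) p" for p
    by (rule eqv_rp[OF R(2)])
  then have e: "expn n (rp (\<Sum>v\<in>S. act side (R v) (\<psi> v))) Cd" by (rule expn_cong[OF C(1)])
  have supp: "bruhat_le n v w" if "v \<in> S" "R v \<noteq> 0" for v
  proof (rule ccontr)
    assume "\<not> bruhat_le n v w"
    then have "R v = 0"
      using support_bound[OF fam_rex R(1) e[unfolded \<psi>_def], of "{v. bruhat_le n v w}" v] C(2) that(1)
      by (auto intro: bruhat_le_trans)
    then show False using that by simp
  qed
  obtain T where T: "\<And>w. w \<in> S \<Longrightarrow> expn n (rp (\<psi> w)) (T w)"
    "\<And>w v. w \<in> S \<Longrightarrow> T w v \<noteq> 0 \<Longrightarrow> bruhat_le n v w" "\<And>w. w \<in> S \<Longrightarrow> T w w = lead A j n w"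
    using fam_C[OF fam_rex] unfolding \<psi>_def by blast
  have "Cd w = (\<Sum>v\<in>S. T v w * \<rho> side (R v) w)"
    by (rule expn_unique[OF e expn_rp_sum[OF T(1) R(1)] S_Sym[OF w]])
  also have "\<dots> = T w w * \<rho> side (R w) w"
  proof -
    have "T v w * \<rho> side (R v) w = 0" if "v \<in> S" "v \<noteq> w" for v
    proof (rule ccontr)
      assume "T v w * \<rho> side (R v) w \<noteq> 0"
      then have "bruhat_le n w v" "R v \<noteq> 0" using T(2)[OF that(1)] \<rho>_eq_0[OF S_Sym[OF w]] by auto
      then show False using supp that bruhat_le_antisym by blast
    qed
    then have "(\<Sum>v\<in>S - {w}. T v w * \<rho> side (R v) w) = 0" by (intro sum.neutral) blast
    then show ?thesis using sum.remove[OF finite_seq_perms w, of "\<lambda>v. T v w * \<rho> side (R v) w"] by simp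
  qed
  finally have "\<rho> side (R w) w = to_fract (dlead A j n w)"
    using T(3)[OF w] C(3) lead_nonzero[of A j n w] by (simp add: mult.commute)
  then have eq: "(if side then R w else pact w (R w)) = dlead A j n w" by (simp add: \<rho>_def)
  have bw: "bij w" using S_Sym[OF w] permutes_bij by blast
  have "R w = ?P"
  proof (cases side)
    case True
    then show ?thesis using eq sum_p_left[OF lj, of A w pvar] by (simp add: dlead_def pfun_def)
  next
    case False
    have "pact w ?P = (\<Sum>k<n. of_int (p_right A i w k) * pvar (w k))" using bw False by (simp add: pfun_def)
    also have "\<dots> = dlead A j n w" unfolding dlead_def by (rule sum_p_right[OF li lj w])
    also have "\<dots> = pact w (R w)" using eq False by simp
    finally show ?thesis unfolding pact_inj[OF bw] by (rule sym)
  qed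
  then show ?thesis using R supp by blast
qed

lemma deg_\<psi>:
  assumes w: "w \<in> S"
  shows "deg A (crossings (rex w) i) = (\<Sum>k<n. pfun side w k)"
proof -
  have "deg A (crossings (rex w) i) = glead A j n w" using fam_expn[OF fam_rex w] by blast
  then show ?thesis using sum_p_left[OF lj, of A w "\<lambda>_. 1 :: int"] sum_p_right[OF li lj w, of A "\<lambda>_. 1 :: int"]
    by (simp add: glead_def pfun_def)
qed

lemma z_\<psi>: "z_lin (\<psi> w) = 0"
proof -
  have "z_diagram (cross_at k a) = 0" for k and a :: "'v list" by (simp add: cross_at_def del: hcomp_of)
  then have "z_diagram (crossings ks i) = 0" for ks by (induction ks) simp_all
  then show ?thesis by (simp add: \<psi>_def)
qed

end

section \<open>Quotients of modules with operators\<close>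

lemma additive_subgroup_intro:
  assumes "abelian_group Q" "N \<subseteq> carrier Q" "\<zero>\<^bsub>Q\<^esub> \<in> N"
    "\<And>x y. x \<in> N \<Longrightarrow> y \<in> N \<Longrightarrow> x \<oplus>\<^bsub>Q\<^esub> y \<in> N" "\<And>x. x \<in> N \<Longrightarrow> \<ominus>\<^bsub>Q\<^esub> x \<in> N"
  shows "additive_subgroup N Q"
  using assms unfolding a_inv_def by (intro additive_subgroupI subgroup.intro) auto

text \<open>
  Quotients occur twice: Hom spaces are quotients of formal ones, and the associated graded pieces are quotients
  of Hom spaces.  Only the additive group matters here; the operators on cosets are treated by
  \<open>coset_op\<close>.
\<close>

locale sl2_quotient =
  fixes Q :: "'m sl2_module" and N :: "'m set"
  assumes sg: "abelian_subgroup N Q"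
begin

sublocale abelian_subgroup N Q by (rule sg)

abbreviation cl :: "'m \<Rightarrow> 'm set" where "cl x \<equiv> N +>\<^bsub>Q\<^esub> x"
abbreviation QN :: "'m set sl2_module" where "QN \<equiv> quotient_sl2_module Q N"

lemma quot_carrier: "carrier QN = cl ` carrier Q"
  by (auto simp: quotient_sl2_module_def A_RCOSETS_def')

lemma quot_zero: "\<zero>\<^bsub>QN\<^esub> = cl \<zero>\<^bsub>Q\<^esub>"
  using a_rcos_const[OF additive_subgroup.zero_closed[OF additive_subgroup_axioms]] by (simp add: quotient_sl2_module_def)

lemma quot_add: "x \<in> carrier Q \<Longrightarrow> y \<in> carrier Q \<Longrightarrow> cl x \<oplus>\<^bsub>QN\<^esub> cl y = cl (x \<oplus>\<^bsub>Q\<^esub> y)"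
  using a_rcos_sum by (simp add: quotient_sl2_module_def)

lemma coset_eq_iff:
  assumes "x \<in> carrier Q" "y \<in> carrier Q"
  shows "cl x = cl y \<longleftrightarrow> x \<oplus>\<^bsub>Q\<^esub> \<ominus>\<^bsub>Q\<^esub> y \<in> N"
proof
  assume "cl x = cl y"
  then have "x \<in> cl y" using a_rcos_self[OF assms(1)] by simp
  then show "x \<oplus>\<^bsub>Q\<^esub> \<ominus>\<^bsub>Q\<^esub> y \<in> N" using a_rcos_module_imp assms by simp
next
  assume "x \<oplus>\<^bsub>Q\<^esub> \<ominus>\<^bsub>Q\<^esub> y \<in> N"
  then have "x \<in> cl y" using a_rcos_module_rev assms by simp
  then show "cl x = cl y" using a_repr_independence' assms by simp
qed

lemma coset_op:
  assumes F: "F \<in> carrier Q \<rightarrow> carrier Q" "\<And>x y. x \<in> carrier Q \<Longrightarrow> y \<in> carrier Q \<Longrightarrow> F (x \<oplus>\<^bsub>Q\<^esub> y) = F x \<oplus>\<^bsub>Q\<^esub> F y"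
    and N: "\<And>x. x \<in> N \<Longrightarrow> F x \<in> N" and x: "x \<in> carrier Q"
  shows "(\<Union>z\<in>cl x. cl (F z)) = cl (F x)"
proof -
  have "cl (F z) = cl (F x)" if z: "z \<in> cl x" for z
  proof -
    obtain h where h: "h \<in> N" "z = h \<oplus>\<^bsub>Q\<^esub> x" using z by (auto simp: a_r_coset_def')
    have c: "F h \<in> N" "F h \<in> carrier Q" "F x \<in> carrier Q" using h N F x a_subset by auto
    have "F z = F h \<oplus>\<^bsub>Q\<^esub> F x" using h F x a_subset by auto
    then have "F z \<in> cl (F x)" using c by (auto simp: a_r_coset_def')
    then show ?thesis using a_repr_independence' c by simp
  qed
  then show ?thesis using a_rcos_self[OF x] by blast
qed

lemma quot_abelian_group: "abelian_group QN"
proof (rule abelian_groupI)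
  fix X assume "X \<in> carrier QN"
  then obtain x where x: "x \<in> carrier Q" "X = cl x" unfolding quot_carrier by blast
  have "cl (\<ominus>\<^bsub>Q\<^esub> x) \<oplus>\<^bsub>QN\<^esub> X = \<zero>\<^bsub>QN\<^esub>"
    using x by (simp add: quot_add quot_zero l_neg)
  then show "\<exists>Y\<in>carrier QN. Y \<oplus>\<^bsub>QN\<^esub> X = \<zero>\<^bsub>QN\<^esub>" unfolding quot_carrier using x by blast
qed (auto simp: quot_carrier quot_add quot_zero a_ac)

lemma quot_minus: "x \<in> carrier Q \<Longrightarrow> \<ominus>\<^bsub>QN\<^esub> cl x = cl (\<ominus>\<^bsub>Q\<^esub> x)"
proof -
  assume x: "x \<in> carrier Q"
  interpret q: abelian_group QN by (rule quot_abelian_group)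
  show ?thesis
  proof (rule q.minus_equality)
    show "cl (\<ominus>\<^bsub>Q\<^esub> x) \<oplus>\<^bsub>QN\<^esub> cl x = \<zero>\<^bsub>QN\<^esub>" using x by (simp add: quot_add quot_zero l_neg)
  qed (use x in \<open>auto simp: quot_carrier\<close>)
qed

lemma quot_finsum:
  assumes "finite I" "f \<in> I \<rightarrow> carrier Q"
  shows "finsum QN (\<lambda>k. cl (f k)) I = cl (finsum Q f I)"
proof -
  interpret q: abelian_group QN by (rule quot_abelian_group)
  show ?thesis using assms
  proof (induction I rule: finite_induct)
    case empty
    then show ?case by (simp add: quot_zero)
  next
    case (insert k I)
    then have "f k \<in> carrier Q" "f \<in> I \<rightarrow> carrier Q" by auto
    moreover have "(\<lambda>k. cl (f k)) \<in> I \<rightarrow> carrier QN" using calculation by (auto simp: quot_carrier)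
    ultimately show ?case using insert by (simp add: quot_add) (simp add: quot_add quot_carrier)
  qed
qed

lemma quot_ops:
  "module.smult QN = (\<lambda>p X. \<Union>x\<in>X. cl (p \<odot>\<^bsub>Q\<^esub> x))" "hom_comp QN = (\<lambda>l. cl ` hom_comp Q l)"
  "d_op QN = (\<lambda>X. \<Union>x\<in>X. cl (d_op Q x))" "z_op QN = (\<lambda>X. \<Union>x\<in>X. cl (z_op Q x))"
  "h_op QN = (\<lambda>X. \<Union>x\<in>X. cl (h_op Q x))"
  by (simp_all add: quotient_sl2_module_def)

end

section \<open>Downfree filtrations from triangular bases\<close>

lemma polys_simps [simp]: "mult (polys n) = (*)" "one (polys n) = 1" "zero (polys n) = 0" "add (polys n) = (+)"
  by (simp_all add: polys_def)

lemma cring_polys: "cring (polys n)"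
proof (rule cringI)
  show "abelian_group (polys n)"
  proof (rule abelian_groupI)
    fix x assume "x \<in> Pn n"
    then show "\<exists>y\<in>Pn n. y \<oplus>\<^bsub>polys n\<^esub> x = \<zero>\<^bsub>polys n\<^esub>"
      by (intro bexI[of _ "- x"]) auto
  qed (auto simp: add.assoc add.commute)
  show "Group.comm_monoid (polys n)"
    by (rule comm_monoidI) (auto simp: mult.assoc mult.commute)
qed (auto simp: distrib_right)

lemma Pn_prod: "(\<And>i. i \<in> I \<Longrightarrow> f i \<in> Pn n) \<Longrightarrow> prod f I \<in> Pn n"
  by (induction I rule: infinite_finite_induct) auto

lemma Pn_h_twist: "p \<in> Pn n \<Longrightarrow> h_poly p + p * of_int c \<in> Pn n"
  by (intro Pn_add Pn_mult Pn_h_poly Pn_of_int)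

locale polys_module =
  fixes n :: nat and H :: "'m sl2_module"
  assumes mod: "Module.module (polys n) H"
begin

sublocale M: Module.module "polys n" H by (rule mod)

lemma smult_carrier [simp, intro]: "p \<in> Pn n \<Longrightarrow> m \<in> carrier H \<Longrightarrow> p \<odot>\<^bsub>H\<^esub> m \<in> carrier H"
  using M.smult_closed by simp

lemma smult_rules:
  "p \<in> Pn n \<Longrightarrow> q \<in> Pn n \<Longrightarrow> m \<in> carrier H \<Longrightarrow> (p + q) \<odot>\<^bsub>H\<^esub> m = p \<odot>\<^bsub>H\<^esub> m \<oplus>\<^bsub>H\<^esub> q \<odot>\<^bsub>H\<^esub> m"
  "p \<in> Pn n \<Longrightarrow> q \<in> Pn n \<Longrightarrow> m \<in> carrier H \<Longrightarrow> (p * q) \<odot>\<^bsub>H\<^esub> m = p \<odot>\<^bsub>H\<^esub> (q \<odot>\<^bsub>H\<^esub> m)"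
  "p \<in> Pn n \<Longrightarrow> m \<in> carrier H \<Longrightarrow> m' \<in> carrier H \<Longrightarrow> p \<odot>\<^bsub>H\<^esub> (m \<oplus>\<^bsub>H\<^esub> m') = p \<odot>\<^bsub>H\<^esub> m \<oplus>\<^bsub>H\<^esub> p \<odot>\<^bsub>H\<^esub> m'"
  "m \<in> carrier H \<Longrightarrow> 0 \<odot>\<^bsub>H\<^esub> m = \<zero>\<^bsub>H\<^esub>" "m \<in> carrier H \<Longrightarrow> 1 \<odot>\<^bsub>H\<^esub> m = m"
  "p \<in> Pn n \<Longrightarrow> p \<odot>\<^bsub>H\<^esub> \<zero>\<^bsub>H\<^esub> = \<zero>\<^bsub>H\<^esub>"
  using M.smult_l_distr[of p q m] M.smult_assoc1[of p q m] M.smult_r_distr[of p m m'] M.smult_l_null[of m] M.smult_one[of m]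
    M.smult_r_null[of p] by simp_all

lemma smult_minus: "p \<in> Pn n \<Longrightarrow> m \<in> carrier H \<Longrightarrow> (- p) \<odot>\<^bsub>H\<^esub> m = \<ominus>\<^bsub>H\<^esub> (p \<odot>\<^bsub>H\<^esub> m)"
proof -
  assume a: "p \<in> Pn n" "m \<in> carrier H"
  have "(- p) \<odot>\<^bsub>H\<^esub> m \<oplus>\<^bsub>H\<^esub> p \<odot>\<^bsub>H\<^esub> m = \<zero>\<^bsub>H\<^esub>"
    using a by (subst smult_rules(1)[symmetric]) (auto simp: smult_rules(4))
  then show ?thesis using a Pn_minus[OF a(1)] by (metis M.minus_equality smult_carrier)
qed

lemma int_multiple:
  assumes "m \<in> carrier H"
  shows "[l] \<cdot>\<^bsub>H\<^esub> m = of_int l \<odot>\<^bsub>H\<^esub> m"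
proof -
  have nat: "[k] \<cdot>\<^bsub>H\<^esub> m = of_nat k \<odot>\<^bsub>H\<^esub> m" for k :: nat
  proof (induction k)
    case 0
    then show ?case using assms by (simp add: smult_rules(4) add_pow_def)
  next
    case (Suc k)
    have "of_nat k \<in> Pn n" using Pn_of_int[of "int k" n] by simp
    moreover have "[Suc k] \<cdot>\<^bsub>H\<^esub> m = [k] \<cdot>\<^bsub>H\<^esub> m \<oplus>\<^bsub>H\<^esub> m" by (simp add: add_pow_def)
    ultimately show ?case using assms Suc by (simp add: smult_rules add.commute[of 1] M.a_comm)
  qed
  show ?thesis
  proof (cases "l \<ge> 0")
    case True
    then show ?thesis using nat[of "nat l"] by (simp add: add_pow_int_ge)
  next
    case False
    have "of_nat (nat (- l)) \<in> Pn n" using Pn_of_int[of "- l" n] False by simp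
    from smult_minus[OF this assms] show ?thesis using False nat[of "nat (- l)"] by (simp add: add_pow_int_lt)
  qed
qed

end

text \<open>
  A homogeneous basis that \<open>\<z>\<close> kills and on which \<open>\<d>\<close> is triangular for a partial order, with
  diagonal entries \<open>\<Sum>k. pc w k * x\<^sub>k\<close>.
\<close>

locale sl2_basis =
  fixes n :: nat and H :: "'m sl2_module" and S :: "'i set" and B :: "'i rel" and \<psi> :: "'i \<Rightarrow> 'm" and pc :: "'i \<Rightarrow> nat \<Rightarrow> int"
  assumes gr: "graded_sl2_module n H"
    and fin: "finite S" and po: "partial_order_on S B"
    and \<psi>_hom: "\<And>w. w \<in> S \<Longrightarrow> \<psi> w \<in> hom_comp H (\<Sum>k<n. pc w k)"
    and \<psi>_span: "\<And>m. m \<in> carrier H \<Longrightarrow> \<exists>r\<in>S \<rightarrow> Pn n. m = (\<Oplus>\<^bsub>H\<^esub>w\<in>S. r w \<odot>\<^bsub>H\<^esub> \<psi> w)"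
    and \<psi>_indep: "\<And>r w. r \<in> S \<rightarrow> Pn n \<Longrightarrow> (\<Oplus>\<^bsub>H\<^esub>w\<in>S. r w \<odot>\<^bsub>H\<^esub> \<psi> w) = \<zero>\<^bsub>H\<^esub> \<Longrightarrow> w \<in> S \<Longrightarrow> r w = 0"
    and \<psi>_z: "\<And>w. w \<in> S \<Longrightarrow> z_op H (\<psi> w) = \<zero>\<^bsub>H\<^esub>"
    and \<psi>_d: "\<And>w. w \<in> S \<Longrightarrow> \<exists>r\<in>S \<rightarrow> Pn n. d_op H (\<psi> w) = (\<Oplus>\<^bsub>H\<^esub>v\<in>S. r v \<odot>\<^bsub>H\<^esub> \<psi> v) \<and>
       (\<forall>v\<in>S. r v \<noteq> 0 \<longrightarrow> (v, w) \<in> B) \<and> r w = (\<Sum>k<n. of_int (pc w k) * pvar k)"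
begin

sublocale polys_module n H
  using gr by (intro polys_module.intro) (simp add: graded_sl2_module_def)

lemma op_closed: "F \<in> {d_op H, z_op H, h_op H} \<Longrightarrow> m \<in> carrier H \<Longrightarrow> F m \<in> carrier H"
  and op_add: "F \<in> {d_op H, z_op H, h_op H} \<Longrightarrow> m \<in> carrier H \<Longrightarrow> m' \<in> carrier H \<Longrightarrow> F (m \<oplus>\<^bsub>H\<^esub> m') = F m \<oplus>\<^bsub>H\<^esub> F m'"
  using gr unfolding graded_sl2_module_def by (blast dest: funcset_mem)+

lemma Leibniz:
  assumes "p \<in> Pn n" "m \<in> carrier H"
  shows "d_op H (p \<odot>\<^bsub>H\<^esub> m) = d_poly n p \<odot>\<^bsub>H\<^esub> m \<oplus>\<^bsub>H\<^esub> p \<odot>\<^bsub>H\<^esub> d_op H m"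
    "z_op H (p \<odot>\<^bsub>H\<^esub> m) = z_poly n p \<odot>\<^bsub>H\<^esub> m \<oplus>\<^bsub>H\<^esub> p \<odot>\<^bsub>H\<^esub> z_op H m"
    "h_op H (p \<odot>\<^bsub>H\<^esub> m) = h_poly p \<odot>\<^bsub>H\<^esub> m \<oplus>\<^bsub>H\<^esub> p \<odot>\<^bsub>H\<^esub> h_op H m"
  using gr assms unfolding graded_sl2_module_def by blast+

lemma hom_comp_subgroup: "additive_subgroup (hom_comp H l) H"
  using gr unfolding graded_sl2_module_def internal_direct_sum_def by blast

lemma hom_comp_carrier: "m \<in> hom_comp H l \<Longrightarrow> m \<in> carrier H"
  using additive_subgroup.a_subset[OF hom_comp_subgroup] by blast

lemma hom_comp_pvar: "m \<in> hom_comp H l \<Longrightarrow> k < n \<Longrightarrow> pvar k \<odot>\<^bsub>H\<^esub> m \<in> hom_comp H (l + 2)"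
  and hom_comp_h: "m \<in> hom_comp H l \<Longrightarrow> h_op H m = [l] \<cdot>\<^bsub>H\<^esub> m"
  using gr unfolding graded_sl2_module_def by blast+

lemma \<psi>_carrier [simp, intro]: "w \<in> S \<Longrightarrow> \<psi> w \<in> carrier H"
  using \<psi>_hom hom_comp_carrier by blast

subsection \<open>Coordinates\<close>

definition comb :: "('i \<Rightarrow> zpoly) \<Rightarrow> 'm" where
  "comb r = (\<Oplus>\<^bsub>H\<^esub>w\<in>S. r w \<odot>\<^bsub>H\<^esub> \<psi> w)"

abbreviation "Cf \<equiv> S \<rightarrow> Pn n"

lemma coeff_Pi: "r \<in> Cf \<Longrightarrow> (\<lambda>w. r w \<odot>\<^bsub>H\<^esub> \<psi> w) \<in> S \<rightarrow> carrier H"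
  by (auto dest: funcset_mem)

lemma comb_carrier [simp, intro]: "r \<in> Cf \<Longrightarrow> comb r \<in> carrier H"
  unfolding comb_def using coeff_Pi by (intro M.finsum_closed)

lemma comb_cong: "r \<in> Cf \<Longrightarrow> (\<And>w. w \<in> S \<Longrightarrow> r w = r' w) \<Longrightarrow> comb r = comb r'"
  unfolding comb_def using coeff_Pi[of r'] by (intro M.finsum_cong') (auto simp: Pi_def)

lemma comb_add: "r \<in> Cf \<Longrightarrow> r' \<in> Cf \<Longrightarrow> comb r \<oplus>\<^bsub>H\<^esub> comb r' = comb (\<lambda>w. r w + r' w)"
proof -
  assume r: "r \<in> Cf" "r' \<in> Cf"
  have "comb (\<lambda>w. r w + r' w) = (\<Oplus>\<^bsub>H\<^esub>w\<in>S. r w \<odot>\<^bsub>H\<^esub> \<psi> w \<oplus>\<^bsub>H\<^esub> r' w \<odot>\<^bsub>H\<^esub> \<psi> w)"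
    unfolding comb_def using r by (intro M.finsum_cong') (auto simp: smult_rules Pi_def)
  also have "\<dots> = comb r \<oplus>\<^bsub>H\<^esub> comb r'"
    unfolding comb_def by (rule M.finsum_addf[OF coeff_Pi[OF r(1)] coeff_Pi[OF r(2)]])
  finally show ?thesis by (rule sym)
qed

lemma comb_smult: "p \<in> Pn n \<Longrightarrow> r \<in> Cf \<Longrightarrow> p \<odot>\<^bsub>H\<^esub> comb r = comb (\<lambda>w. p * r w)"
  unfolding comb_def using fin
  by (subst M.finsum_smult_ldistr) (auto intro!: M.finsum_cong' simp: smult_rules Pi_def)

lemma comb_0: "comb (\<lambda>_. 0) = \<zero>\<^bsub>H\<^esub>"
  unfolding comb_def by (rule M.add.finprod_one_eqI) (simp add: smult_rules)

lemma comb_minus: "r \<in> Cf \<Longrightarrow> \<ominus>\<^bsub>H\<^esub> comb r = comb (\<lambda>w. - r w)"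
proof -
  assume r: "r \<in> Cf"
  then have r': "(\<lambda>w. - r w) \<in> Cf" by (auto simp: Pi_def)
  have "comb (\<lambda>w. - r w) \<oplus>\<^bsub>H\<^esub> comb r = \<zero>\<^bsub>H\<^esub>" using comb_add[OF r' r] comb_0 by simp
  then show ?thesis using r r' by (intro M.minus_equality) auto
qed

lemma comb_inj:
  assumes "r \<in> Cf" "r' \<in> Cf" "comb r = comb r'" "w \<in> S"
  shows "r w = r' w"
proof -
  have m: "(\<lambda>w. - r' w) \<in> Cf" and d: "(\<lambda>w. r w + - r' w) \<in> Cf" using assms by (auto simp: Pi_def)
  have "comb (\<lambda>w. r w + - r' w) = comb r \<oplus>\<^bsub>H\<^esub> \<ominus>\<^bsub>H\<^esub> comb r'"
    using assms(1,2) m by (simp only: comb_minus comb_add)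
  also have "\<dots> = \<zero>\<^bsub>H\<^esub>" using assms M.r_neg by simp
  finally have "r w + - r' w = 0" using \<psi>_indep[OF d _ assms(4)] unfolding comb_def by blast
  then show ?thesis by simp
qed

lemma comb_surj: "m \<in> carrier H \<Longrightarrow> \<exists>r\<in>Cf. m = comb r"
  unfolding comb_def by (rule \<psi>_span)

lemma partial_comb:
  assumes "J \<subseteq> S" "r \<in> J \<rightarrow> Pn n"
  shows "(\<Oplus>\<^bsub>H\<^esub>w\<in>J. r w \<odot>\<^bsub>H\<^esub> \<psi> w) = comb (\<lambda>w. if w \<in> J then r w else 0)"
  unfolding comb_def using assms fin
  by (intro M.add.finprod_mono_neutral_cong_left) (auto simp: smult_rules Pi_def)

lemma comb_single: "w \<in> S \<Longrightarrow> p \<in> Pn n \<Longrightarrow> p \<odot>\<^bsub>H\<^esub> \<psi> w = comb (\<lambda>v. if v = w then p else 0)"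
  using partial_comb[of "{w}" "\<lambda>_. p"] by (simp add: Pi_def)

lemma finsum_comb:
  assumes "finite J" "\<And>k. k \<in> J \<Longrightarrow> R k \<in> Cf"
  shows "(\<Oplus>\<^bsub>H\<^esub>k\<in>J. comb (R k)) = comb (\<lambda>v. \<Sum>k\<in>J. R k v)"
  using assms
proof (induction J rule: finite_induct)
  case (insert k J)
  have "(\<lambda>v. \<Sum>k\<in>J. R k v) \<in> Cf" "R k \<in> Cf" using insert.prems by (auto simp: Pi_def intro!: Pn_sum)
  moreover have "(\<lambda>k. comb (R k)) \<in> J \<rightarrow> carrier H" using insert.prems by auto
  ultimately show ?case using insert by (simp add: comb_add)
qed (simp add: comb_0)

lemma op_finsum:
  assumes "F \<in> {d_op H, z_op H, h_op H}" "finite J" "f \<in> J \<rightarrow> carrier H"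
  shows "F (finsum H f J) = (\<Oplus>\<^bsub>H\<^esub>k\<in>J. F (f k))"
proof -
  have "F \<zero>\<^bsub>H\<^esub> \<oplus>\<^bsub>H\<^esub> F \<zero>\<^bsub>H\<^esub> = F \<zero>\<^bsub>H\<^esub>"
    using op_add[OF assms(1), of "\<zero>\<^bsub>H\<^esub>" "\<zero>\<^bsub>H\<^esub>"] by simp
  then have F0: "F \<zero>\<^bsub>H\<^esub> = \<zero>\<^bsub>H\<^esub>" using op_closed[OF assms(1), of "\<zero>\<^bsub>H\<^esub>"]
    by (simp add: M.add.l_cancel_one)
  show ?thesis using assms(2,3)
  proof (induction J rule: finite_induct)
    case empty
    then show ?case by (simp add: F0)
  next
    case (insert k J)
    then have f: "f k \<in> carrier H" "f \<in> J \<rightarrow> carrier H" by auto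
    then have "F (f k) \<in> carrier H" "(\<lambda>k. F (f k)) \<in> J \<rightarrow> carrier H" using op_closed[OF assms(1)] by auto
    then show ?case using insert f op_add[OF assms(1), of "f k" "finsum H f J"] by simp
  qed
qed

text \<open>The columns of the matrix of \<open>\<d>\<close> in the given basis.\<close>

definition \<delta> :: "'i \<Rightarrow> 'i \<Rightarrow> zpoly" where
  "\<delta> w = (SOME r. r \<in> Cf \<and> d_op H (\<psi> w) = comb r \<and> (\<forall>v\<in>S. r v \<noteq> 0 \<longrightarrow> (v, w) \<in> B) \<and>
     r w = (\<Sum>k<n. of_int (pc w k) * pvar k))"

lemma \<delta>:
  assumes "w \<in> S"
  shows "\<delta> w \<in> Cf" "d_op H (\<psi> w) = comb (\<delta> w)" "v \<in> S \<Longrightarrow> \<delta> w v \<noteq> 0 \<Longrightarrow> (v, w) \<in> B"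
    "\<delta> w w = (\<Sum>k<n. of_int (pc w k) * pvar k)"
proof -
  have "\<exists>r. r \<in> Cf \<and> d_op H (\<psi> w) = comb r \<and> (\<forall>v\<in>S. r v \<noteq> 0 \<longrightarrow> (v, w) \<in> B) \<and>
     r w = (\<Sum>k<n. of_int (pc w k) * pvar k)"
    using \<psi>_d[OF assms] unfolding comb_def by blast
  from someI_ex[OF this] show "\<delta> w \<in> Cf" "d_op H (\<psi> w) = comb (\<delta> w)" "v \<in> S \<Longrightarrow> \<delta> w v \<noteq> 0 \<Longrightarrow> (v, w) \<in> B"
    "\<delta> w w = (\<Sum>k<n. of_int (pc w k) * pvar k)" unfolding \<delta>_def[symmetric] by blast+
qed

lemma d_smult_\<psi>:
  assumes "w \<in> S" "p \<in> Pn n"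
  shows "d_op H (p \<odot>\<^bsub>H\<^esub> \<psi> w) = comb (\<lambda>v. (if v = w then d_poly n p else 0) + p * \<delta> w v)"
proof -
  have dp: "d_poly n p \<in> Pn n" using assms by (simp add: d_poly_eq_vfield Pn_vfield)
  have "(\<lambda>v. p * \<delta> w v) \<in> Cf" using \<delta>(1)[OF assms(1)] assms(2) by (auto simp: Pi_def)
  moreover have "(\<lambda>v. if v = w then d_poly n p else 0) \<in> Cf" using dp by auto
  ultimately show ?thesis
    unfolding Leibniz(1)[OF assms(2) \<psi>_carrier[OF assms(1)]] comb_single[OF assms(1) dp] \<delta>(2)[OF assms(1)]
      comb_smult[OF assms(2) \<delta>(1)[OF assms(1)]] by (intro comb_add)
qed

lemma z_smult_\<psi>:
  assumes "w \<in> S" "p \<in> Pn n"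
  shows "z_op H (p \<odot>\<^bsub>H\<^esub> \<psi> w) = z_poly n p \<odot>\<^bsub>H\<^esub> \<psi> w"
  using assms by (simp add: Leibniz \<psi>_z smult_rules z_poly_eq_vfield Pn_vfield)

lemma h_smult_\<psi>:
  assumes "w \<in> S" "p \<in> Pn n"
  shows "h_op H (p \<odot>\<^bsub>H\<^esub> \<psi> w) = (h_poly p + p * of_int (\<Sum>k<n. pc w k)) \<odot>\<^bsub>H\<^esub> \<psi> w"
proof -
  have "h_op H (\<psi> w) = of_int (\<Sum>k<n. pc w k) \<odot>\<^bsub>H\<^esub> \<psi> w"
    using hom_comp_h[OF \<psi>_hom[OF assms(1)]] int_multiple assms by simp
  moreover have "of_int (\<Sum>k<n. pc w k) \<in> Pn n" by (rule Pn_of_int)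
  ultimately show ?thesis using assms Pn_h_poly[OF assms(2)] Pn_mult[OF assms(2)]
    by (simp add: Leibniz smult_rules del: of_int_sum)
qed

lemma h_comb:
  assumes "r \<in> Cf"
  shows "h_op H (comb r) = comb (\<lambda>w. h_poly (r w) + r w * of_int (\<Sum>k<n. pc w k))"
proof -
  have "h_op H (comb r) = (\<Oplus>\<^bsub>H\<^esub>w\<in>S. h_op H (r w \<odot>\<^bsub>H\<^esub> \<psi> w))"
    unfolding comb_def using coeff_Pi[OF assms] fin by (intro op_finsum) auto
  also have "\<dots> = comb (\<lambda>w. h_poly (r w) + r w * of_int (\<Sum>k<n. pc w k))"
    unfolding comb_def using assms
    by (intro M.finsum_cong') (auto simp: h_smult_\<psi> Pi_def Pn_h_twist simp del: of_int_sum)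
  finally show ?thesis .
qed

lemma int_comb: "r \<in> Cf \<Longrightarrow> [l] \<cdot>\<^bsub>H\<^esub> comb r = comb (\<lambda>w. of_int l * r w)"
  by (simp add: int_multiple comb_smult)

subsection \<open>Spans of subsets of the basis\<close>

text \<open>
  The span of the basis elements in \<open>J\<close>, in terms of coordinates with respect to the whole basis;
  it agrees with both \<open>span_over\<close> and \<open>sum_over\<close>, and inclusions and quotients are
  easier to read off.
\<close>

definition sub :: "'i set \<Rightarrow> 'm set" where
  "sub J = {comb r | r. r \<in> Cf \<and> (\<forall>w\<in>S. w \<notin> J \<longrightarrow> r w = 0)}"

lemma sub_carrier: "sub J \<subseteq> carrier H"
  by (auto simp: sub_def)

lemma sub_mono: "J \<subseteq> K \<Longrightarrow> sub J \<subseteq> sub K"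
proof
  fix x assume "J \<subseteq> K" "x \<in> sub J"
  then obtain r where "x = comb r" "r \<in> Cf" "\<forall>w\<in>S. w \<notin> K \<longrightarrow> r w = 0" unfolding sub_def by blast
  then show "x \<in> sub K" unfolding sub_def by blast
qed

lemma sub_subgroup: "additive_subgroup (sub J) H"
proof (rule additive_subgroup_intro)
  show "\<zero>\<^bsub>H\<^esub> \<in> sub J" unfolding sub_def using comb_0[symmetric] by auto
next
  fix x y assume "x \<in> sub J" "y \<in> sub J"
  then obtain r s where "x = comb r" "y = comb s" "r \<in> Cf" "s \<in> Cf" "\<forall>w\<in>S. w \<notin> J \<longrightarrow> r w = 0" "\<forall>w\<in>S. w \<notin> J \<longrightarrow> s w = 0"
    by (auto simp: sub_def)
  then show "x \<oplus>\<^bsub>H\<^esub> y \<in> sub J" unfolding sub_def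
    by (intro CollectI exI[of _ "\<lambda>w. r w + s w"]) (auto simp: comb_add Pi_def)
next
  fix x assume "x \<in> sub J"
  then obtain r where "x = comb r" "r \<in> Cf" "\<forall>w\<in>S. w \<notin> J \<longrightarrow> r w = 0"
    by (auto simp: sub_def)
  then show "\<ominus>\<^bsub>H\<^esub> x \<in> sub J" unfolding sub_def
    by (intro CollectI exI[of _ "\<lambda>w. - r w"]) (auto simp: comb_minus Pi_def)
qed (use M.abelian_group_axioms sub_carrier in auto)

lemma span_over_eq: "J \<subseteq> S \<Longrightarrow> span_over n H J \<psi> = sub J"
proof -
  assume J: "J \<subseteq> S"
  show ?thesis
  proof (intro equalityI subsetI)
    fix x assume "x \<in> span_over n H J \<psi>"
    then obtain r where r: "r \<in> J \<rightarrow> Pn n" "x = (\<Oplus>\<^bsub>H\<^esub>w\<in>J. r w \<odot>\<^bsub>H\<^esub> \<psi> w)" by (auto simp: span_over_def)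
    then show "x \<in> sub J" unfolding sub_def using partial_comb[OF J r(1)]
      by (intro CollectI exI[of _ "\<lambda>w. if w \<in> J then r w else 0"]) (auto simp: Pi_def)
  next
    fix x assume "x \<in> sub J"
    then obtain r where r: "x = comb r" "r \<in> Cf" "\<forall>w\<in>S. w \<notin> J \<longrightarrow> r w = 0" by (auto simp: sub_def)
    have rJ: "r \<in> J \<rightarrow> Pn n" using r(2) J by (auto simp: Pi_def)
    have "comb r = comb (\<lambda>w. if w \<in> J then r w else 0)" using r by (intro comb_cong) auto
    then have "x = (\<Oplus>\<^bsub>H\<^esub>w\<in>J. r w \<odot>\<^bsub>H\<^esub> \<psi> w)" using partial_comb[OF J rJ] r(1) by simp
    then show "x \<in> span_over n H J \<psi>" using rJ by (auto simp: span_over_def)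
  qed
qed

abbreviation Nw :: "'i \<Rightarrow> 'm set" where "Nw \<equiv> \<lambda>w. span_over n H {w} \<psi>"

lemma Nw_eq: "w \<in> S \<Longrightarrow> Nw w = (\<lambda>p. p \<odot>\<^bsub>H\<^esub> \<psi> w) ` Pn n"
proof -
  assume w: "w \<in> S"
  have "(\<Oplus>\<^bsub>H\<^esub>k\<in>{w}. r k \<odot>\<^bsub>H\<^esub> \<psi> k) = r w \<odot>\<^bsub>H\<^esub> \<psi> w" if "r w \<in> Pn n" for r
    using w that by (subst M.finsum_insert) auto
  note one = this
  show ?thesis
  proof (intro equalityI subsetI)
    fix x assume "x \<in> Nw w"
    then obtain r where "r \<in> {w} \<rightarrow> Pn n" "x = (\<Oplus>\<^bsub>H\<^esub>k\<in>{w}. r k \<odot>\<^bsub>H\<^esub> \<psi> k)" by (auto simp: span_over_def)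
    then show "x \<in> (\<lambda>p. p \<odot>\<^bsub>H\<^esub> \<psi> w) ` Pn n" using one[of r] by (simp only:) blast
  next
    fix x assume "x \<in> (\<lambda>p. p \<odot>\<^bsub>H\<^esub> \<psi> w) ` Pn n"
    then obtain p where p: "p \<in> Pn n" "x = p \<odot>\<^bsub>H\<^esub> \<psi> w" by blast
    then have "x = (\<Oplus>\<^bsub>H\<^esub>k\<in>{w}. (\<lambda>_. p) k \<odot>\<^bsub>H\<^esub> \<psi> k)" using one[of "\<lambda>_. p"] by simp
    then show "x \<in> Nw w" unfolding span_over_def using p(1)
      by (intro CollectI exI[of _ "\<lambda>_. p"]) simp
  qed
qed

lemma sum_over_eq:
  assumes J: "J \<subseteq> S"
  shows "sum_over H J Nw = sub J"
proof (intro equalityI subsetI)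
  fix x assume "x \<in> sum_over H J Nw"
  then obtain f where f: "f \<in> (\<Pi> k\<in>J. Nw k)" "x = (\<Oplus>\<^bsub>H\<^esub>k\<in>J. f k)" by (auto simp: sum_over_def)
  have "\<forall>k\<in>J. \<exists>p\<in>Pn n. f k = p \<odot>\<^bsub>H\<^esub> \<psi> k"
  proof
    fix k assume k: "k \<in> J"
    then have "f k \<in> Nw k" using f(1) by blast
    then show "\<exists>p\<in>Pn n. f k = p \<odot>\<^bsub>H\<^esub> \<psi> k" using Nw_eq[of k] J k by blast
  qed
  then obtain r where r: "\<forall>k\<in>J. r k \<in> Pn n \<and> f k = r k \<odot>\<^bsub>H\<^esub> \<psi> k" by metis
  have "x = (\<Oplus>\<^bsub>H\<^esub>k\<in>J. r k \<odot>\<^bsub>H\<^esub> \<psi> k)" unfolding f(2)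
    using r J by (intro M.finsum_cong') auto
  then have "x \<in> span_over n H J \<psi>" using r by (auto simp: span_over_def)
  then show "x \<in> sub J" using span_over_eq[OF J] by simp
next
  fix x assume "x \<in> sub J"
  then have "x \<in> span_over n H J \<psi>" using span_over_eq[OF J] by simp
  then obtain r where r: "r \<in> J \<rightarrow> Pn n" "x = (\<Oplus>\<^bsub>H\<^esub>w\<in>J. r w \<odot>\<^bsub>H\<^esub> \<psi> w)" by (auto simp: span_over_def)
  moreover have "(\<lambda>w. r w \<odot>\<^bsub>H\<^esub> \<psi> w) \<in> (\<Pi> k\<in>J. Nw k)" using r(1) J Nw_eq by blast
  ultimately show "x \<in> sum_over H J Nw" unfolding sum_over_def by blast
qed

lemma d_\<psi>_span: "w \<in> S \<Longrightarrow> d_op H (\<psi> w) \<in> span_over n H {v \<in> S. (v, w) \<in> B} \<psi>"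
  using \<delta>[of w] span_over_eq[of "{v \<in> S. (v, w) \<in> B}"] by (auto simp: sub_def)

lemma B_refl: "w \<in> S \<Longrightarrow> (w, w) \<in> B"
  using po by (auto simp: partial_order_on_def preorder_on_def refl_on_def)
lemma B_trans: "(u, v) \<in> B \<Longrightarrow> (v, w) \<in> B \<Longrightarrow> (u, w) \<in> B"
  using po unfolding partial_order_on_def preorder_on_def by (meson transD)
lemma B_antisym: "(u, v) \<in> B \<Longrightarrow> (v, u) \<in> B \<Longrightarrow> u = v"
  using po unfolding partial_order_on_def by (meson antisymD)

text \<open>
  Coefficients only contribute derivatives at the same basis element, so \<open>\<d>\<close> preserves the spans
  of lower sets.
\<close>

lemma d_sub:
  assumes "\<And>v w. w \<in> S \<Longrightarrow> w \<in> J \<Longrightarrow> v \<in> S \<Longrightarrow> (v, w) \<in> B \<Longrightarrow> v \<in> J" "x \<in> sub J"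
  shows "d_op H x \<in> sub J"
proof -
  obtain r where r: "x = comb r" "r \<in> Cf" "\<forall>w\<in>S. w \<notin> J \<longrightarrow> r w = 0" using assms(2) by (auto simp: sub_def)
  let ?R = "\<lambda>w v. (if v = w then d_poly n (r w) else 0) + r w * \<delta> w v"
  have R: "?R w \<in> Cf" if "w \<in> S" for w
    using r(2) \<delta>(1)[OF that] that by (auto simp: Pi_def d_poly_eq_vfield Pn_vfield intro!: Pn_add Pn_mult)
  have "d_op H x = (\<Oplus>\<^bsub>H\<^esub>w\<in>S. d_op H (r w \<odot>\<^bsub>H\<^esub> \<psi> w))"
    unfolding r(1) comb_def using coeff_Pi[OF r(2)] fin by (intro op_finsum) auto
  also have "\<dots> = (\<Oplus>\<^bsub>H\<^esub>w\<in>S. comb (?R w))"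
    using r(2) R by (intro M.finsum_cong') (auto simp: d_smult_\<psi> Pi_def)
  also have "\<dots> = comb (\<lambda>v. \<Sum>w\<in>S. ?R w v)" using R fin by (intro finsum_comb)
  finally have e: "d_op H x = comb (\<lambda>v. \<Sum>w\<in>S. ?R w v)" .
  have "(\<lambda>v. \<Sum>w\<in>S. ?R w v) \<in> Cf" using R by (auto simp: Pi_def intro!: Pn_sum)
  moreover have "(\<Sum>w\<in>S. ?R w v) = 0" if v: "v \<in> S" "v \<notin> J" for v
  proof (rule sum.neutral, rule ballI)
    fix w assume w: "w \<in> S"
    show "?R w v = 0"
    proof (cases "w \<in> J")
      case True
      then have "v \<noteq> w" "\<delta> w v = 0" using assms(1)[OF w True v(1)] \<delta>(3)[OF w v(1)] v by auto
      then show ?thesis by simp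
    next
      case False
      then have "r w = 0" using r(3) w by blast
      then show ?thesis by (simp add: d_poly_eq_vfield)
    qed
  qed
  ultimately show ?thesis unfolding sub_def e by blast
qed

lemma zh_sub:
  assumes "x \<in> sub J"
  shows "z_op H x \<in> sub J" "h_op H x \<in> sub J" "p \<in> Pn n \<Longrightarrow> p \<odot>\<^bsub>H\<^esub> x \<in> sub J"
proof -
  obtain r where r: "x = comb r" "r \<in> Cf" "\<forall>w\<in>S. w \<notin> J \<longrightarrow> r w = 0" using assms by (auto simp: sub_def)
  have "z_op H x = (\<Oplus>\<^bsub>H\<^esub>w\<in>S. z_op H (r w \<odot>\<^bsub>H\<^esub> \<psi> w))"
    unfolding r(1) comb_def using coeff_Pi[OF r(2)] fin by (intro op_finsum) auto
  also have "\<dots> = comb (\<lambda>w. z_poly n (r w))"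
    unfolding comb_def using r(2) by (intro M.finsum_cong') (auto simp: z_smult_\<psi> Pi_def z_poly_eq_vfield Pn_vfield)
  finally show "z_op H x \<in> sub J" unfolding sub_def using r
    by (intro CollectI exI[of _ "\<lambda>w. z_poly n (r w)"]) (auto simp: Pi_def z_poly_eq_vfield Pn_vfield)
  show "h_op H x \<in> sub J" unfolding sub_def r(1) using r(2,3)
    by (intro CollectI exI[of _ "\<lambda>w. h_poly (r w) + r w * of_int (\<Sum>k<n. pc w k)"])
      (auto simp: h_comb Pi_def Pn_h_twist simp del: of_int_sum)
  show "p \<odot>\<^bsub>H\<^esub> x \<in> sub J" if "p \<in> Pn n" unfolding sub_def r(1) using r(2,3) that
    by (intro CollectI exI[of _ "\<lambda>w. p * r w"]) (auto simp: comb_smult Pi_def)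
qed

lemma smult_\<psi>_sub: "w \<in> S \<Longrightarrow> w \<in> J \<Longrightarrow> p \<in> Pn n \<Longrightarrow> p \<odot>\<^bsub>H\<^esub> \<psi> w \<in> sub J"
  unfolding sub_def by (intro CollectI exI[of _ "\<lambda>v. if v = w then p else 0"]) (auto simp: comb_single)

lemma smult_\<psi>_inj:
  assumes "w \<in> S" "p \<in> Pn n" "q \<in> Pn n" "p \<odot>\<^bsub>H\<^esub> \<psi> w = q \<odot>\<^bsub>H\<^esub> \<psi> w"
  shows "p = q"
  using comb_inj[of "\<lambda>v. if v = w then p else 0" "\<lambda>v. if v = w then q else 0" w] assms
  by (auto simp: comb_single)

lemma free_rank_one_Nw: "w \<in> S \<Longrightarrow> free_rank_one n H (Nw w)"
  unfolding free_rank_one_def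
  by (rule exI[of _ "\<Sum>k<n. pc w k"], rule bexI[of _ "\<psi> w"])
    (auto simp: bij_betw_def Nw_eq inj_on_def intro: smult_\<psi>_inj \<psi>_hom)

lemma direct_sum: "internal_direct_sum H S Nw"
  unfolding internal_direct_sum_def
proof (intro conjI ballI)
  show "additive_subgroup (Nw k) H" if "k \<in> S" for k
    using sub_subgroup[of "{k}"] span_over_eq[of "{k}"] that by simp
next
  fix m assume m: "m \<in> carrier H"
  then obtain r where r: "r \<in> Cf" "m = comb r" using comb_surj by blast
  have sums: "finsum H f {k \<in> S. f k \<noteq> \<zero>\<^bsub>H\<^esub>} = comb s"
    if "\<And>k. k \<in> S \<Longrightarrow> f k = s k \<odot>\<^bsub>H\<^esub> \<psi> k" "s \<in> Cf" for f s
    unfolding comb_def using that fin coeff_Pi[OF that(2)]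
    by (intro M.add.finprod_mono_neutral_cong_left) auto
  let ?f = "restrict (\<lambda>k. r k \<odot>\<^bsub>H\<^esub> \<psi> k) S"
  show "\<exists>!f. f \<in> (\<Pi>\<^sub>E k\<in>S. Nw k) \<and> finite {k \<in> S. f k \<noteq> \<zero>\<^bsub>H\<^esub>} \<and> m = finsum H f {k \<in> S. f k \<noteq> \<zero>\<^bsub>H\<^esub>}"
  proof (intro ex1I[of _ ?f] conjI)
    show "?f \<in> (\<Pi>\<^sub>E k\<in>S. Nw k)" using r(1) Nw_eq by (auto simp: Pi_def)
    show "finite {k \<in> S. ?f k \<noteq> \<zero>\<^bsub>H\<^esub>}" using fin by simp
    show "m = finsum H ?f {k \<in> S. ?f k \<noteq> \<zero>\<^bsub>H\<^esub>}" using sums[of ?f r] r by simp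
  next
    fix g assume g: "g \<in> (\<Pi>\<^sub>E k\<in>S. Nw k) \<and> finite {k \<in> S. g k \<noteq> \<zero>\<^bsub>H\<^esub>} \<and> m = finsum H g {k \<in> S. g k \<noteq> \<zero>\<^bsub>H\<^esub>}"
    then have "\<forall>k\<in>S. \<exists>p\<in>Pn n. g k = p \<odot>\<^bsub>H\<^esub> \<psi> k" using Nw_eq by (fastforce simp: PiE_def Pi_def)
    then obtain s where s: "\<And>k. k \<in> S \<Longrightarrow> s k \<in> Pn n \<and> g k = s k \<odot>\<^bsub>H\<^esub> \<psi> k" by metis
    then have sc: "s \<in> Cf" by auto
    have "comb s = comb r" using sums[of g s] s sc g r by auto
    then have "s k = r k" if "k \<in> S" for k using comb_inj[OF sc r(1)] that by blast
    then show "g = ?f" using s g by (intro ext) (auto simp: PiE_def extensional_def)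
  qed
qed

theorem downfree: "downfree_filtration n H S B Nw"
  unfolding downfree_filtration_def
proof (intro conjI ballI)
  fix w assume w: "w \<in> S"
  show "free_rank_one n H (Nw w)" by (rule free_rank_one_Nw[OF w])
  have e: "Nw w = sub {w}" using span_over_eq[of "{w}"] w by simp
  show "z_op H ` Nw w \<subseteq> Nw w" unfolding e using zh_sub by blast
  have "Nw w \<subseteq> sub {j \<in> S. (j, w) \<in> B}" unfolding e using B_refl[OF w] w by (intro sub_mono) simp
  moreover have "sum_over H {j \<in> S. (j, w) \<in> B} Nw = sub {j \<in> S. (j, w) \<in> B}" by (rule sum_over_eq) auto
  moreover have "d_op H x \<in> sub {j \<in> S. (j, w) \<in> B}" if "x \<in> sub {j \<in> S. (j, w) \<in> B}" for x
    using that by (intro d_sub) (auto intro: B_trans)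
  ultimately show "d_op H ` Nw w \<subseteq> sum_over H {j \<in> S. (j, w) \<in> B} Nw" by auto
qed (fact gr fin po direct_sum)+

subsection \<open>The associated graded pieces\<close>

lemma hom_comp_pvar_power:
  assumes "k < n" "y \<in> hom_comp H l"
  shows "pvar k ^ r \<odot>\<^bsub>H\<^esub> y \<in> hom_comp H (2 * int r + l)"
proof (induction r)
  case 0
  then show ?case using assms by (simp add: smult_rules hom_comp_carrier)
next
  case (Suc r)
  have "pvar k ^ Suc r \<odot>\<^bsub>H\<^esub> y = pvar k \<odot>\<^bsub>H\<^esub> (pvar k ^ r \<odot>\<^bsub>H\<^esub> y)"
    unfolding power_Suc using assms by (intro smult_rules(2)) (auto simp: hom_comp_carrier)
  then show ?case using hom_comp_pvar[OF Suc assms(1)] by (simp add: algebra_simps)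
qed

lemma hom_comp_monom:
  assumes "finite K" "K \<subseteq> {..<n}" "y \<in> hom_comp H l"
  shows "(\<Prod>k\<in>K. pvar k ^ c k) \<odot>\<^bsub>H\<^esub> y \<in> hom_comp H (2 * (\<Sum>k\<in>K. int (c k)) + l)"
  using assms
proof (induction K rule: finite_induct)
  case empty
  then show ?case by (simp add: smult_rules hom_comp_carrier)
next
  case (insert k K)
  have P: "(\<Prod>k\<in>K. pvar k ^ c k) \<in> Pn n" using insert by (intro Pn_prod Pn_power) auto
  have "(\<Prod>k\<in>insert k K. pvar k ^ c k) \<odot>\<^bsub>H\<^esub> y = pvar k ^ c k \<odot>\<^bsub>H\<^esub> ((\<Prod>k\<in>K. pvar k ^ c k) \<odot>\<^bsub>H\<^esub> y)"
    using insert P by (subst smult_rules(2)[symmetric]) (auto simp: hom_comp_carrier)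
  then show ?case
    using hom_comp_pvar_power[of k "(\<Prod>k\<in>K. pvar k ^ c k) \<odot>\<^bsub>H\<^esub> y" "2 * (\<Sum>k\<in>K. int (c k)) + l" "c k"] insert
    by (simp add: algebra_simps)
qed

lemma hom_comp_smult:
  assumes "p \<in> Pn n" "\<And>m. m \<in> Poly_Mapping.keys p \<Longrightarrow> monom_deg m = e" "x \<in> hom_comp H l"
  shows "p \<odot>\<^bsub>H\<^esub> x \<in> hom_comp H (e + l)"
proof -
  note closed = additive_subgroup.zero_closed[OF hom_comp_subgroup] additive_subgroup.a_closed[OF hom_comp_subgroup]
    additive_subgroup.a_inv_closed[OF hom_comp_subgroup]
  have "Poly_Mapping.keys p \<subseteq> {m. Poly_Mapping.keys m \<subseteq> {..<n} \<and> monom_deg m = e}" using assms(1,2) by (auto simp: Pn_iff)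
  then have "p \<in> Pn n \<and> p \<odot>\<^bsub>H\<^esub> x \<in> hom_comp H (e + l)"
  proof (induction rule: frag_induction)
    case zero
    then show ?case using assms(3) closed(1) by (simp add: smult_rules hom_comp_carrier)
  next
    case (one m)
    have "frag_of m \<in> Pn n" using one by (simp add: Pn_iff)
    moreover have "frag_of m \<odot>\<^bsub>H\<^esub> x \<in> hom_comp H (monom_deg m + l)"
      unfolding frag_of_eq_prod_pvar monom_deg_def
      using hom_comp_monom[of "Poly_Mapping.keys m" x l "Poly_Mapping.lookup m"] one assms(3) by simp
    ultimately show ?case using one by simp
  next
    case (diff a b)
    have "(a - b) \<odot>\<^bsub>H\<^esub> x = a \<odot>\<^bsub>H\<^esub> x \<oplus>\<^bsub>H\<^esub> \<ominus>\<^bsub>H\<^esub> (b \<odot>\<^bsub>H\<^esub> x)"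
      using diff hom_comp_carrier[OF assms(3)] smult_rules(1)[of a "- b" x] by (simp add: smult_minus Pn_minus)
    then show ?case using diff by (auto simp: closed)
  qed
  then show ?thesis by simp
qed

text \<open>
  Modulo the strictly lower span, an element is determined by its coordinate at \<open>w\<close>, and
  \<open>\<d>(\<psi>\<^sub>w)\<close> is the diagonal entry times \<open>\<psi>\<^sub>w\<close>.
\<close>

theorem gr_piece_iso:
  assumes w: "w \<in> S"
  shows "\<exists>\<phi>. sl2_module_iso n (twisted_rank_one n (pc w)) (gr_piece H S B Nw w) \<phi> \<and> \<phi> 1 = gr_class H S B Nw w (\<psi> w)"
proof -
  let ?U = "{j \<in> S. (j, w) \<in> B}" and ?L = "{j \<in> S. (j, w) \<in> B \<and> j \<noteq> w}"
  define Q where "Q = restrict_sl2_module H (sub ?U)"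
  have U: "sum_over H ?U Nw = sub ?U" by (rule sum_over_eq) auto
  have L: "sum_over H ?L Nw = sub ?L" by (rule sum_over_eq) auto
  have Qs: "carrier Q = sub ?U" "add Q = add H" "zero Q = zero H" "module.smult Q = module.smult H" "d_op Q = d_op H"
    "z_op Q = z_op H" "h_op Q = h_op H" "hom_comp Q = (\<lambda>l. hom_comp H l \<inter> sub ?U)"
    by (simp_all add: Q_def restrict_sl2_module_def)
  interpret u: additive_subgroup "sub ?U" H by (rule sub_subgroup)
  interpret lo: additive_subgroup "sub ?L" H by (rule sub_subgroup)
  have LU: "sub ?L \<subseteq> sub ?U" by (rule sub_mono) blast
  have Qg: "abelian_group Q"
  proof (rule abelian_groupI, unfold Qs)
    fix x assume "x \<in> sub ?U"
    then show "\<exists>y\<in>sub ?U. y \<oplus>\<^bsub>H\<^esub> x = \<zero>\<^bsub>H\<^esub>" using M.l_neg[of x] u.a_Hcarr by blast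
  qed (auto simp: M.a_ac)
  have Qm: "\<ominus>\<^bsub>Q\<^esub> x = \<ominus>\<^bsub>H\<^esub> x" if "x \<in> sub ?U" for x
    using that Qg by (intro abelian_group.minus_equality[OF Qg]) (auto simp: Qs M.l_neg)
  have Lg: "additive_subgroup (sub ?L) Q"
    by (rule additive_subgroup_intro[OF Qg]) (use LU Qm in \<open>auto simp: Qs\<close>)
  interpret q: sl2_quotient Q "sub ?L" by (rule sl2_quotient.intro[OF abelian_subgroupI3[OF Lg Qg]])
  have cosets: "sub ?L +>\<^bsub>Q\<^esub> x = sub ?L +>\<^bsub>H\<^esub> x" for x by (simp add: a_r_coset_def' Qs)
  have piece: "gr_piece H S B Nw w = q.QN" unfolding gr_piece_def U L Q_def ..
  have wU: "w \<in> ?U" using w B_refl by simp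
  have opU: "F x \<in> sub ?U" if "F \<in> {d_op H, z_op H, h_op H}" "x \<in> sub ?U" for F x
    using that zh_sub by (auto intro!: d_sub intro: B_trans)
  have opL: "F x \<in> sub ?L" if "F \<in> {d_op H, z_op H, h_op H}" "x \<in> sub ?L" for F x
    using that zh_sub by (auto intro!: d_sub intro: B_trans dest: B_antisym)
  have op: "(\<Union>z\<in>q.cl x. q.cl (F z)) = q.cl (F x)" if F: "F \<in> {d_op H, z_op H, h_op H}" and x: "x \<in> sub ?U" for F x
    using F x opU[OF F] opL[OF F] op_add[OF F] by (intro q.coset_op) (auto simp: Qs)
  have sm: "(\<Union>z\<in>q.cl x. q.cl (p \<odot>\<^bsub>H\<^esub> z)) = q.cl (p \<odot>\<^bsub>H\<^esub> x)" if "p \<in> Pn n" "x \<in> sub ?U" for p x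
    using that zh_sub(3) by (intro q.coset_op) (auto simp: Qs smult_rules)
  define \<phi> where "\<phi> = (\<lambda>p. q.cl (p \<odot>\<^bsub>H\<^esub> \<psi> w))"
  have pU: "p \<odot>\<^bsub>H\<^esub> \<psi> w \<in> sub ?U" if "p \<in> Pn n" for p using smult_\<psi>_sub[OF w wU that] .
  \<comment> \<open>two elements of the upper span agree modulo the lower one iff their w-coordinates agree\<close>
  have key: "q.cl (comb r) = q.cl (comb s) \<longleftrightarrow> r w = s w"
    if "r \<in> Cf" "s \<in> Cf" "comb r \<in> sub ?U" "comb s \<in> sub ?U" for r s
  proof -
    have m: "(\<lambda>w. - s w) \<in> Cf" "(\<lambda>w. r w + - s w) \<in> Cf" using that by (auto simp: Pi_def)
    have zero: "r v = 0" "s v = 0" if "v \<in> S" "v \<notin> ?U" for v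
    proof -
      have "t v = 0" if t: "comb t \<in> sub ?U" "t \<in> Cf" for t
      proof -
        obtain t' where "comb t = comb t'" "t' \<in> Cf" "\<forall>w\<in>S. w \<notin> ?U \<longrightarrow> t' w = 0"
          using t(1) unfolding sub_def by blast
        then show ?thesis using comb_inj[of t t' v] t \<open>v \<in> S\<close> \<open>v \<notin> ?U\<close> by metis
      qed
      then show "r v = 0" "s v = 0" using \<open>r \<in> Cf\<close> \<open>s \<in> Cf\<close> \<open>comb r \<in> sub ?U\<close> \<open>comb s \<in> sub ?U\<close> by blast+
    qed
    have "q.cl (comb r) = q.cl (comb s) \<longleftrightarrow> comb (\<lambda>w. r w + - s w) \<in> sub ?L"
      using that m Qm by (subst q.coset_eq_iff) (auto simp: Qs comb_minus comb_add)
    also have "\<dots> \<longleftrightarrow> r w = s w"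
    proof
      assume "comb (\<lambda>w. r w + - s w) \<in> sub ?L"
      then obtain t where t: "comb (\<lambda>w. r w + - s w) = comb t" "t \<in> Cf" "\<forall>w\<in>S. w \<notin> ?L \<longrightarrow> t w = 0" by (auto simp: sub_def)
      have "r w + - s w = t w" by (rule comb_inj[OF m(2) t(2,1) w])
      moreover have "t w = 0" using t(3) w by blast
      ultimately show "r w = s w" by simp
    next
      assume "r w = s w"
      then have "\<forall>v\<in>S. v \<notin> ?L \<longrightarrow> r v + - s v = 0" using zero by (metis (mono_tags, lifting) add.right_inverse add_0 mem_Collect_eq neg_equal_0_iff_equal)
      then show "comb (\<lambda>w. r w + - s w) \<in> sub ?L" unfolding sub_def using m(2) by blast
    qed
    finally show ?thesis .
  qed
  have sc: "(\<lambda>v. if v = w then p else 0) \<in> Cf" if "p \<in> Pn n" for p using that by auto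
  have \<phi>_eq: "\<phi> p = q.cl x" if "p \<in> Pn n" "x = comb r" "r \<in> Cf" "x \<in> sub ?U" "r w = p" for p x r
  proof -
    have "q.cl (comb (\<lambda>v. if v = w then p else 0)) = q.cl (comb r)"
      using that pU[OF that(1)] comb_single[OF w that(1)] by (subst key) (auto simp: sc)
    then show ?thesis unfolding \<phi>_def using comb_single[OF w that(1)] that(2) by simp
  qed
  have "sl2_module_iso n (twisted_rank_one n (pc w)) q.QN \<phi>"
    unfolding sl2_module_iso_def
  proof (intro conjI ballI allI)
    show "bij_betw \<phi> (carrier (twisted_rank_one n (pc w))) (carrier q.QN)"
      unfolding bij_betw_def
    proof
      show "inj_on \<phi> (carrier (twisted_rank_one n (pc w)))"
      proof (rule inj_onI)
        fix x y assume "x \<in> carrier (twisted_rank_one n (pc w))" "y \<in> carrier (twisted_rank_one n (pc w))" "\<phi> x = \<phi> y"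
        then have xy: "x \<in> Pn n" "y \<in> Pn n" "q.cl (x \<odot>\<^bsub>H\<^esub> \<psi> w) = q.cl (y \<odot>\<^bsub>H\<^esub> \<psi> w)" by (simp_all add: twisted_rank_one_def \<phi>_def)
        have "q.cl (x \<odot>\<^bsub>H\<^esub> \<psi> w) = q.cl (y \<odot>\<^bsub>H\<^esub> \<psi> w) \<longleftrightarrow> (if w = w then x else 0) = (if w = w then y else 0)"
          using key[OF sc[OF xy(1)] sc[OF xy(2)]] pU[OF xy(1)] pU[OF xy(2)]
          unfolding comb_single[OF w xy(1)] comb_single[OF w xy(2)] by blast
        then show "x = y" using xy(3) by simp
      qed
      show "\<phi> ` carrier (twisted_rank_one n (pc w)) = carrier q.QN"
      proof (intro equalityI subsetI)
        fix X assume "X \<in> \<phi> ` carrier (twisted_rank_one n (pc w))"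
        then show "X \<in> carrier q.QN" using pU by (auto simp: twisted_rank_one_def \<phi>_def q.quot_carrier Qs)
      next
        fix X assume "X \<in> carrier q.QN"
        then obtain x where x: "x \<in> sub ?U" "X = q.cl x" by (auto simp: q.quot_carrier Qs)
        then obtain r where r: "x = comb r" "r \<in> Cf" by (auto simp: sub_def)
        have "r w \<in> Pn n" using r w by auto
        then show "X \<in> \<phi> ` carrier (twisted_rank_one n (pc w))"
          using \<phi>_eq[OF _ r x(1) refl] x(2) by (auto simp: twisted_rank_one_def)
      qed
    qed
  next
    fix x y assume "x \<in> carrier (twisted_rank_one n (pc w))" "y \<in> carrier (twisted_rank_one n (pc w))"
    then have xy: "x \<in> Pn n" "y \<in> Pn n" by (simp_all add: twisted_rank_one_def)
    show "\<phi> (x \<oplus>\<^bsub>twisted_rank_one n (pc w)\<^esub> y) = \<phi> x \<oplus>\<^bsub>q.QN\<^esub> \<phi> y"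
      using xy pU w by (simp add: twisted_rank_one_def \<phi>_def q.quot_add Qs smult_rules)
  next
    fix p x assume "p \<in> Pn n" "x \<in> carrier (twisted_rank_one n (pc w))"
    then have px: "p \<in> Pn n" "x \<in> Pn n" by (simp_all add: twisted_rank_one_def)
    show "\<phi> (p \<odot>\<^bsub>twisted_rank_one n (pc w)\<^esub> x) = p \<odot>\<^bsub>q.QN\<^esub> \<phi> x"
      using px pU w sm[OF px(1) pU[OF px(2)]] by (simp add: twisted_rank_one_def \<phi>_def q.quot_ops Qs smult_rules)
  next
    fix l
    show "\<phi> ` hom_comp (twisted_rank_one n (pc w)) l = hom_comp q.QN l"
    proof (intro equalityI subsetI)
      fix X assume "X \<in> \<phi> ` hom_comp (twisted_rank_one n (pc w)) l"
      then obtain p where p: "p \<in> Pn n" "\<And>m. m \<in> Poly_Mapping.keys p \<Longrightarrow> monom_deg m = l - (\<Sum>k<n. pc w k)" "X = \<phi> p"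
        by (fastforce simp: twisted_rank_one_def)
      from hom_comp_smult[OF p(1,2) \<psi>_hom[OF w]] have "p \<odot>\<^bsub>H\<^esub> \<psi> w \<in> hom_comp H l" by simp
      then show "X \<in> hom_comp q.QN l" using pU[OF p(1)] p(3) by (auto simp: q.quot_ops Qs \<phi>_def)
    next
      fix X assume "X \<in> hom_comp q.QN l"
      then obtain x where x: "x \<in> hom_comp H l" "x \<in> sub ?U" "X = q.cl x" by (auto simp: q.quot_ops Qs)
      then obtain r where r: "x = comb r" "r \<in> Cf" by (auto simp: sub_def)
      have rw: "r w \<in> Pn n" using r w by auto
      \<comment> \<open>homogeneous elements have homogeneous coordinates, because \<open>\<h>\<close> acts on monomials by their degree\<close>
      have hc: "(\<lambda>w. h_poly (r w) + r w * of_int (\<Sum>k<n. pc w k)) \<in> Cf" "(\<lambda>w. of_int l * r w) \<in> Cf"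
        using r by (auto simp: Pi_def Pn_h_twist simp del: of_int_sum)
      have "comb (\<lambda>w. h_poly (r w) + r w * of_int (\<Sum>k<n. pc w k)) = comb (\<lambda>w. of_int l * r w)"
        using hom_comp_h[OF x(1)] unfolding r(1) h_comb[OF r(2)] int_comb[OF r(2)] .
      from comb_inj[OF hc this w] have e: "h_poly (r w) + r w * of_int (\<Sum>k<n. pc w k) = of_int l * r w" .
      have "monom_deg m + (\<Sum>k<n. pc w k) = l" if m: "m \<in> Poly_Mapping.keys (r w)" for m
      proof -
        have li: "Poly_Mapping.lookup (of_int c * q) m = c * Poly_Mapping.lookup q m" for c and q :: zpoly
          by (simp flip: frag_cmul_eq_mult)
        have "Poly_Mapping.lookup (h_poly (r w) + of_int (\<Sum>k<n. pc w k) * r w) m = Poly_Mapping.lookup (of_int l * r w) m"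
          using e by (simp only: mult.commute[of "r w"])
        then have "(monom_deg m + (\<Sum>k<n. pc w k)) * Poly_Mapping.lookup (r w) m = l * Poly_Mapping.lookup (r w) m"
          unfolding lookup_add lookup_h_poly li by (simp add: distrib_right)
        then show ?thesis using m by (simp add: in_keys_iff)
      qed
      then have "r w \<in> hom_comp (twisted_rank_one n (pc w)) l" using rw by (simp add: twisted_rank_one_def)
      moreover have "X = \<phi> (r w)" using \<phi>_eq[OF rw r x(2) refl] x(3) by simp
      ultimately show "X \<in> \<phi> ` hom_comp (twisted_rank_one n (pc w)) l" by blast
    qed
  next
    fix x assume "x \<in> carrier (twisted_rank_one n (pc w))"
    then have x: "x \<in> Pn n" by (simp add: twisted_rank_one_def)
    let ?P = "\<Sum>k<n. of_int (pc w k) * pvar k"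
    have ops: "d_op q.QN (\<phi> x) = q.cl (d_op H (x \<odot>\<^bsub>H\<^esub> \<psi> w))" "z_op q.QN (\<phi> x) = q.cl (z_op H (x \<odot>\<^bsub>H\<^esub> \<psi> w))"
      "h_op q.QN (\<phi> x) = q.cl (h_op H (x \<odot>\<^bsub>H\<^esub> \<psi> w))"
      using op[OF _ pU[OF x]] by (simp_all add: q.quot_ops Qs \<phi>_def)
    have "\<phi> (d_poly n x + x * ?P) = q.cl (d_op H (x \<odot>\<^bsub>H\<^esub> \<psi> w))"
    proof (rule \<phi>_eq)
      show "d_op H (x \<odot>\<^bsub>H\<^esub> \<psi> w) = comb (\<lambda>v. (if v = w then d_poly n x else 0) + x * \<delta> w v)" by (rule d_smult_\<psi>[OF w x])
      show "(\<lambda>v. (if v = w then d_poly n x else 0) + x * \<delta> w v) \<in> Cf"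
        using x \<delta>(1)[OF w] by (auto simp: Pi_def d_poly_eq_vfield Pn_vfield intro!: Pn_add Pn_mult)
      show "d_op H (x \<odot>\<^bsub>H\<^esub> \<psi> w) \<in> sub ?U" using opU pU[OF x] by blast
      show "d_poly n x + x * ?P \<in> Pn n" using x by (auto simp: d_poly_eq_vfield Pn_vfield intro!: Pn_add Pn_mult Pn_sum)
    qed (simp add: \<delta>(4)[OF w])
    then show "\<phi> (d_op (twisted_rank_one n (pc w)) x) = d_op q.QN (\<phi> x)" unfolding ops by (simp add: twisted_rank_one_def)
    show "\<phi> (z_op (twisted_rank_one n (pc w)) x) = z_op q.QN (\<phi> x)" unfolding ops z_smult_\<psi>[OF w x]
      by (simp add: twisted_rank_one_def \<phi>_def)
    show "\<phi> (h_op (twisted_rank_one n (pc w)) x) = h_op q.QN (\<phi> x)" unfolding ops h_smult_\<psi>[OF w x]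
      by (simp add: twisted_rank_one_def \<phi>_def)
  qed
  moreover have "\<phi> 1 = gr_class H S B Nw w (\<psi> w)"
    unfolding \<phi>_def gr_class_def L cosets using w by (simp add: smult_rules)
  ultimately show ?thesis unfolding piece by blast
qed

end

section \<open>Hom spaces as graded modules\<close>

lemma rep_lin_of_int_mult: "rep_lin A f s (of_int c * p) = of_int c * rep_lin A f s p"
  by (induction f rule: frag_induction[OF subset_UNIV]) (simp_all add: rep_of_int_mult right_diff_distrib)

lemma rep_lin_double: "rep_lin A f s (2 * p) = 2 * rep_lin A f s p"
  using rep_lin_of_int_mult[of A f s 2 p] by simp

lemma dop_mult: "dop A n a s (p * q) = vfield 2 n p * q + p * dop A n a s q"
  by (simp add: dop_def vfield_mult algebra_simps)

lemma hop_mult: "hop A n a (p * q) = 2 * vfield 1 n p * q + p * hop A n a q"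
  by (simp add: hop_def vfield_mult algebra_simps)

lemma deg_dot_power: "deg A (dot_power i r) = 2 * int r"
  by (induction r) simp_all

lemma deg_dots: "deg A (dots e a) = 2 * (\<Sum>k<length a. int (e k))"
  by (induction a arbitrary: e) (simp_all add: deg_dot_power sum.lessThan_Suc_shift distrib_left del: sum.lessThan_Suc)

definition homog :: "('v \<times> 'v) set \<Rightarrow> 'v list \<Rightarrow> 'v list \<Rightarrow> int \<Rightarrow> 'v lin set" where
  "homog A a b l = {f \<in> free_hom a b. \<forall>D \<in> Poly_Mapping.keys f. deg A D = l}"

lemma homog_free_hom: "f \<in> homog A a b l \<Longrightarrow> f \<in> free_hom a b" by (simp add: homog_def)

lemma homog_of [simp]: "frag_of D \<in> homog A a b l \<longleftrightarrow> wf_diagram D \<and> src D = a \<and> tgt D = b \<and> deg A D = l"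
  by (auto simp: homog_def)

lemma homog_0 [simp]: "0 \<in> homog A a b l" by (simp add: homog_def)

lemma homog_diff: "f \<in> homog A a b l \<Longrightarrow> g \<in> homog A a b l \<Longrightarrow> f - g \<in> homog A a b l"
  using keys_diff[of f g] by (auto simp: homog_def intro: free_hom_diff)

lemma homog_cmul: "f \<in> homog A a b l \<Longrightarrow> frag_cmul c f \<in> homog A a b l"
  using keys_cmul[of c f] by (auto simp: homog_def free_hom_def)

lemma homog_induct [consumes 1, case_names zero of diff]:
  assumes "f \<in> homog A a b l" "P 0"
    "\<And>D. wf_diagram D \<Longrightarrow> src D = a \<Longrightarrow> tgt D = b \<Longrightarrow> deg A D = l \<Longrightarrow> P (frag_of D)"
    "\<And>f g. P f \<Longrightarrow> P g \<Longrightarrow> P (f - g)"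
  shows "P f"
proof -
  have "Poly_Mapping.keys f \<subseteq> {D. wf_diagram D \<and> src D = a \<and> tgt D = b \<and> deg A D = l}"
    using assms(1) by (auto simp: homog_def free_hom_def)
  then show ?thesis by (induction rule: frag_induction) (use assms in auto)
qed

lemma h_lin_homog: "f \<in> homog A a b l \<Longrightarrow> h_lin A f = frag_cmul l f"
  by (induction rule: homog_induct) (simp_all add: frag_cmul_diff_distrib2)

lemma homog_vcomp:
  assumes "g \<in> homog A b c k" "f \<in> homog A a b l" shows "g \<star> f \<in> homog A a c (k + l)"
  using assms(1)
proof (induction rule: homog_induct)
  case (of D)
  from assms(2) show ?case by (induction rule: homog_induct) (use of in \<open>auto intro: homog_diff\<close>)
qed (auto intro: homog_diff)

lemma pvar_dots_homog: "k < length a \<Longrightarrow> poly_dots (pvar k) a \<in> homog A a a 2"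
proof -
  assume k: "k < length a"
  have "(\<Sum>l<length a. int (Poly_Mapping.lookup (Poly_Mapping.single k (1 :: nat)) l)) = (\<Sum>l<length a. if l = k then 1 else 0)"
    by (intro sum.cong) (auto simp: lookup_single)
  also have "\<dots> = 1" using k by simp
  finally show ?thesis using poly_dots_free_hom[of "pvar k" a]
    by (simp add: poly_dots_def pvar_def deg_dots)
qed

definition homog_part :: "('v \<times> 'v) set \<Rightarrow> int \<Rightarrow> 'v lin \<Rightarrow> 'v lin" where
  "homog_part A l = frag_extend (\<lambda>D. if deg A D = l then frag_of D else 0)"

lemma homog_part_simps [simp]:
  "homog_part A l (f - g) = homog_part A l f - homog_part A l g" "homog_part A l 0 = 0"
  "homog_part A l (frag_of D) = (if deg A D = l then frag_of D else 0)"
  by (simp_all add: homog_part_def frag_extend_diff)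

lemma homog_part_homog: "f \<in> free_hom a b \<Longrightarrow> homog_part A l f \<in> homog A a b l"
  by (induction rule: free_hom_induct) (auto intro: homog_diff)

lemma sum_homog_parts:
  assumes "finite L" "deg A ` Poly_Mapping.keys f \<subseteq> L"
  shows "f = (\<Sum>l\<in>L. homog_part A l f)"
proof -
  have "Poly_Mapping.keys f \<subseteq> {D. deg A D \<in> L}" using assms(2) by blast
  then show ?thesis
  proof (induction rule: frag_induction)
    case (one D)
    then show ?case using assms(1) by simp
  qed (simp_all add: sum_subtractf)
qed

text \<open>
  The formal Hom space \<open>FH\<close> and its quotient \<open>HM\<close>, for one of the two actions.  By
  faithfulness every identity between morphisms is checked on the operators of the polynomial representation.
\<close>

locale hom_module = hom_setup +
  fixes side :: bool
begin

text \<open>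
  The ideal of null combinations is homogeneous.  Homogeneous parts are eigenvectors of \<open>\<h>\<close> for
  distinct eigenvalues, and polynomials are torsion free; by faithfulness, this separates the parts.
\<close>

lemma null_homog_parts:
  assumes "finite K" "\<And>l. l \<in> K \<Longrightarrow> e l \<in> homog A i j l" "null A i j (\<Sum>l\<in>K. e l)" "l \<in> K"
  shows "null A i j (e l)"
  using assms
proof (induction K arbitrary: e l rule: finite_induct)
  case (insert k K)
  have fh: "e l \<in> free_hom i j" if "l \<in> insert k K" for l using insert.prems(1)[OF that] by (rule homog_free_hom)
  have rp: "rp (\<Sum>l\<in>insert k K. e l) p = 0" for p by (rule null_rep[OF A insert.prems(2)])
  let ?e = "\<lambda>l. frag_cmul (l - k) (e l)"
  have "rp (\<Sum>l\<in>K. ?e l) p = 0" for p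
  proof -
    let ?g = "\<Sum>l\<in>insert k K. e l"
    have "rp (h_lin A ?g) p = 0"
      by (subst rep_h_lin[OF A, of _ i j 0 n]) (use li fh rp in \<open>auto intro: free_hom_sum\<close>)
    moreover have "h_lin A ?g = (\<Sum>l\<in>insert k K. frag_cmul l (e l))"
    proof -
      have sum: "h_lin A (sum f J) = (\<Sum>l\<in>J. h_lin A (f l))" for f and J :: "int set"
        by (induction J rule: infinite_finite_induct) simp_all
      show ?thesis unfolding sum by (rule sum.cong[OF refl h_lin_homog[OF insert.prems(1)]])
    qed
    ultimately have "(\<Sum>l\<in>insert k K. of_int l * rp (e l) p) = 0" by (simp add: rep_lin_sum rep_lin_cmul)
    moreover have "of_int k * (\<Sum>l\<in>insert k K. rp (e l) p) = 0" using rp[of p] by (simp add: rep_lin_sum)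
    ultimately have "(\<Sum>l\<in>insert k K. of_int (l - k) * rp (e l) p) = 0"
      by (simp only: of_int_diff left_diff_distrib sum_subtractf sum_distrib_left[symmetric]) simp
    then show ?thesis using insert.hyps by (simp add: rep_lin_sum rep_lin_cmul)
  qed
  then have nK: "null A i j (\<Sum>l\<in>K. ?e l)"
    by (subst null_iff) (simp_all add: free_hom_sum homog_free_hom[OF homog_cmul[OF insert.prems(1)]])
  have K: "null A i j (e l)" if "l \<in> K" for l
  proof -
    have "null A i j (?e l)"
      by (rule insert.IH[OF _ nK that]) (use insert.prems(1) in \<open>auto intro: homog_cmul\<close>)
    moreover have "l \<noteq> k" using that insert.hyps by blast
    ultimately show ?thesis
      using null_rep[OF A, of i j "?e l" 0] null_iff[OF fh[of l]] that by (auto simp: rep_lin_cmul)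
  qed
  have "rp (e k) p = 0" for p
    using rp[of p] null_rep[OF A K, of _ 0 p] insert.hyps by (simp add: rep_lin_sum)
  then have "null A i j (e k)" using null_iff[OF fh[of k]] by simp
  then show ?case using K insert.prems(3) by blast
qed simp

abbreviation "FH \<equiv> formal_hom A (act side) i j"

lemma FH_simps [simp]:
  "carrier FH = free_hom i j" "zero FH = 0" "add FH = (+)" "module.smult FH = act side"
  "hom_comp FH = homog A i j" "d_op FH = d_lin A" "z_op FH = z_lin" "h_op FH = h_lin A"
  by (simp_all add: formal_hom_def homog_def fun_eq_iff)

lemma FH_group: "abelian_group FH"
proof (rule abelian_groupI)
  fix f assume "f \<in> carrier FH"
  then show "\<exists>g\<in>carrier FH. g \<oplus>\<^bsub>FH\<^esub> f = \<zero>\<^bsub>FH\<^esub>" by (intro bexI[of _ "- f"]) (auto intro: free_hom_minus)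
qed (auto intro: free_hom_add simp: add_ac)

lemma FH_minus: "f \<in> free_hom i j \<Longrightarrow> \<ominus>\<^bsub>FH\<^esub> f = - f"
  by (intro abelian_group.minus_equality[OF FH_group]) (auto intro: free_hom_minus)

abbreviation "N \<equiv> {f. null A i j f}"

lemma null_subgroup: "abelian_subgroup N FH"
proof (rule abelian_subgroupI3[OF additive_subgroup_intro[OF FH_group] FH_group])
  have minus: "null A i j (- f)" if "null A i j f" for f using null_diff[OF null_zero that] by simp
  show "N \<subseteq> carrier FH" using null_free_hom by auto
  show "\<zero>\<^bsub>FH\<^esub> \<in> N" by (simp add: null_zero)
  show "f \<oplus>\<^bsub>FH\<^esub> g \<in> N" if "f \<in> N" "g \<in> N" for f g
    using that null_diff[OF _ minus, of f g] by simp
  show "\<ominus>\<^bsub>FH\<^esub> f \<in> N" if "f \<in> N" for f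
    using that minus FH_minus[OF null_free_hom] by simp
qed

sublocale q: sl2_quotient FH N
  by (rule sl2_quotient.intro[OF null_subgroup])

abbreviation "HM \<equiv> quotient_sl2_module FH N"
abbreviation "cl f \<equiv> N +>\<^bsub>FH\<^esub> f"

lemma cl_eq_iff:
  assumes "f \<in> free_hom i j" "g \<in> free_hom i j"
  shows "cl f = cl g \<longleftrightarrow> (\<forall>p. rp f p = rp g p)"
  using q.coset_eq_iff[of f g] assms null_iff[OF free_hom_diff[OF assms]] by (simp add: FH_minus)

lemma HM_carrier: "carrier HM = cl ` free_hom i j"
  using q.quot_carrier by simp

lemma HM_zero: "\<zero>\<^bsub>HM\<^esub> = cl 0"
  using q.quot_zero by simp

lemma HM_add: "f \<in> free_hom i j \<Longrightarrow> g \<in> free_hom i j \<Longrightarrow> cl f \<oplus>\<^bsub>HM\<^esub> cl g = cl (f + g)"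
  using q.quot_add by simp

lemma HM_group: "abelian_group HM" by (rule q.quot_abelian_group)

lemma HM_minus: "f \<in> free_hom i j \<Longrightarrow> \<ominus>\<^bsub>HM\<^esub> cl f = cl (- f)"
  using q.quot_minus by (simp add: FH_minus)

lemma HM_diff:
  assumes "f \<in> free_hom i j" "g \<in> free_hom i j"
  shows "cl f \<ominus>\<^bsub>HM\<^esub> cl g = cl (f - g)"
  unfolding a_minus_def HM_minus[OF assms(2)]
  by (subst HM_add) (use assms free_hom_minus in auto)

lemma act_add: "act side p (f + g) = act side p f + act side p g"
  by (simp add: act_def)

lemma null_act: "null A i j f \<Longrightarrow> null A i j (act side p f)"
  by (auto simp: act_def intro: null_above null_below poly_dots_free_hom)

lemma HM_smult: "f \<in> free_hom i j \<Longrightarrow> p \<odot>\<^bsub>HM\<^esub> cl f = cl (act side p f)"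
  unfolding q.quot_ops(1) FH_simps
  by (rule q.coset_op) (auto simp: act_free_hom act_add null_act)

lemma rp_ops:
  assumes "f \<in> free_hom i j"
  shows "rp (d_lin A f) p = dop A n j 0 (rp f p) - rp f (dop A n i 0 p)"
    "rp (z_lin f) p = vfield 0 n (rp f p) - rp f (vfield 0 n p)"
    "rp (h_lin A f) p = hop A n j (rp f p) - rp f (hop A n i p)"
  using rep_d_lin[OF A assms, of 0 n p] rep_z_lin[OF assms, of 0 n A p] rep_h_lin[OF A assms, of 0 n p] li by simp_all

text \<open>
  In the representation \<open>\<d>\<close>, \<open>\<z>\<close>, \<open>\<h>\<close> are commutators with fixed
  operators, which vanish together with the operator; so the three derivations are compatible with all defining
  relations at once.
\<close>

lemma null_ops:
  assumes "null A i j f"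
  shows "null A i j (d_lin A f)" "null A i j (z_lin f)" "null A i j (h_lin A f)"
proof -
  have f: "f \<in> free_hom i j" by (rule null_free_hom[OF assms])
  have z: "rp f p = 0" for p by (rule null_rep[OF A assms])
  show "null A i j (d_lin A f)" using null_iff[OF d_lin_free_hom[OF f]] rp_ops(1)[OF f] z by simp
  show "null A i j (z_lin f)" using null_iff[OF z_lin_free_hom[OF f]] rp_ops(2)[OF f] z by simp
  show "null A i j (h_lin A f)" using null_iff[OF h_lin_free_hom[OF f]] rp_ops(3)[OF f] z by simp
qed

lemma HM_ops:
  assumes "f \<in> free_hom i j"
  shows "d_op HM (cl f) = cl (d_lin A f)" "z_op HM (cl f) = cl (z_lin f)" "h_op HM (cl f) = cl (h_lin A f)"
  unfolding q.quot_ops FH_simps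
  by (rule q.coset_op; use assms in \<open>auto simp: d_lin_free_hom z_lin_free_hom h_lin_free_hom null_ops\<close>)+

lemma cmul_free_hom: "f \<in> free_hom i j \<Longrightarrow> frag_cmul c f \<in> free_hom i j"
  using keys_cmul[of c f] by (auto simp: free_hom_def)

lemma HM_finsum:
  assumes "finite I" "\<And>k. k \<in> I \<Longrightarrow> f k \<in> free_hom i j"
  shows "finsum HM (\<lambda>k. cl (f k)) I = cl (sum f I)"
proof -
  interpret F: abelian_group FH by (rule FH_group)
  have "finsum FH f I = sum f I" using assms
    by (induction I rule: finite_induct) (simp_all add: Pi_def)
  then show ?thesis using q.quot_finsum[of I f] assms by (simp add: Pi_def)
qed

lemma HM_module: "Module.module (polys n) HM"
proof (rule Module.module.intro[OF cring_polys HM_group Module.module_axioms.intro])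
  fix p X assume "p \<in> Pn n" "X \<in> carrier HM"
  then show "p \<odot>\<^bsub>HM\<^esub> X \<in> carrier HM" by (auto simp: HM_carrier HM_smult act_free_hom)
next
  fix p r X assume *: "p \<in> Pn n" "r \<in> Pn n" "X \<in> carrier HM"
  then obtain f where f: "f \<in> free_hom i j" "X = cl f" by (auto simp: HM_carrier)
  have pr: "p + r \<in> Pn n" "p * r \<in> Pn n" using * by auto
  have "cl (act side (p + r) f) = cl (act side p f + act side r f)"
    using * f pr by (subst cl_eq_iff) (auto simp: act_free_hom free_hom_add rp_act distrib_right)
  then show "(p \<oplus>\<^bsub>polys n\<^esub> r) \<odot>\<^bsub>HM\<^esub> X = p \<odot>\<^bsub>HM\<^esub> X \<oplus>\<^bsub>HM\<^esub> r \<odot>\<^bsub>HM\<^esub> X"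
    using f by (simp add: HM_smult HM_add act_free_hom)
  have "cl (act side (p * r) f) = cl (act side p (act side r f))"
    using * f pr by (subst cl_eq_iff) (auto simp: act_free_hom rp_act mult_ac)
  then show "(p \<otimes>\<^bsub>polys n\<^esub> r) \<odot>\<^bsub>HM\<^esub> X = p \<odot>\<^bsub>HM\<^esub> (r \<odot>\<^bsub>HM\<^esub> X)"
    using f by (simp add: HM_smult act_free_hom)
next
  fix p X Y assume *: "p \<in> Pn n" "X \<in> carrier HM" "Y \<in> carrier HM"
  then obtain f g where "f \<in> free_hom i j" "X = cl f" "g \<in> free_hom i j" "Y = cl g" by (auto simp: HM_carrier)
  then show "p \<odot>\<^bsub>HM\<^esub> (X \<oplus>\<^bsub>HM\<^esub> Y) = p \<odot>\<^bsub>HM\<^esub> X \<oplus>\<^bsub>HM\<^esub> p \<odot>\<^bsub>HM\<^esub> Y"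
    by (simp add: HM_smult HM_add act_free_hom free_hom_add act_add)
next
  fix X assume "X \<in> carrier HM"
  then obtain f where f: "f \<in> free_hom i j" "X = cl f" by (auto simp: HM_carrier)
  have "cl (act side 1 f) = cl f" using f by (subst cl_eq_iff) (auto simp: act_free_hom rp_act)
  then show "\<one>\<^bsub>polys n\<^esub> \<odot>\<^bsub>HM\<^esub> X = X" using f by (simp add: HM_smult)
qed

lemma HM_int_mult:
  assumes f: "f \<in> free_hom i j"
  shows "[(c::int)] \<cdot>\<^bsub>HM\<^esub> cl f = cl (frag_cmul c f)"
proof -
  interpret polys_module n HM by (rule polys_module.intro[OF HM_module])
  have "[c] \<cdot>\<^bsub>HM\<^esub> cl f = cl (act side (of_int c) f)"
    using int_multiple[of "cl f" c] f by (simp add: HM_carrier HM_smult)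
  also have "\<dots> = cl (frag_cmul c f)"
    using f by (subst cl_eq_iff) (auto simp: act_free_hom cmul_free_hom rp_act rep_lin_cmul rep_lin_of_int_mult)
  finally show ?thesis .
qed

lemma HM_sl2:
  assumes f: "f \<in> free_hom i j"
  shows "cl (h_lin A (d_lin A f) - d_lin A (h_lin A f)) = cl (frag_cmul 2 (d_lin A f))"
    "cl (h_lin A (- z_lin f) - (- z_lin (h_lin A f))) = cl (frag_cmul (-2) (- z_lin f))"
    "cl (d_lin A (- z_lin f) - (- z_lin (d_lin A f))) = cl (h_lin A f)"
proof -
  note fh = free_hom_diff free_hom_minus cmul_free_hom d_lin_free_hom z_lin_free_hom h_lin_free_hom
  have c: "hop A n a (dop A n a 0 p) = dop A n a 0 (hop A n a p) + 2 * dop A n a 0 p"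
    "hop A n a (vfield 0 n p) = vfield 0 n (hop A n a p) - 2 * vfield 0 n p"
    "vfield 0 n (dop A n a 0 p) = dop A n a 0 (vfield 0 n p) + hop A n a p" if "length a = n" for a p
    using op_commutators[of a n A p] that by (simp_all add: algebra_simps)
  have minus: "h_lin A (- g) = - h_lin A g" "d_lin A (- g) = - d_lin A g" for g
    using h_lin_diff[of A 0 g] d_lin_diff[of A 0 g] by simp_all
  show "cl (h_lin A (d_lin A f) - d_lin A (h_lin A f)) = cl (frag_cmul 2 (d_lin A f))"
    by (subst cl_eq_iff) (use f li lj in \<open>simp_all add: fh rp_ops rep_lin_cmul c rep_lin_double\<close>)
  show "cl (h_lin A (- z_lin f) - (- z_lin (h_lin A f))) = cl (frag_cmul (-2) (- z_lin f))"
    unfolding minus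
    by (subst cl_eq_iff) (use f li lj in \<open>simp_all add: fh rp_ops rep_lin_cmul c rep_lin_double\<close>)
  show "cl (d_lin A (- z_lin f) - (- z_lin (d_lin A f))) = cl (h_lin A f)"
    unfolding minus
    by (subst cl_eq_iff) (use f li lj in \<open>simp_all add: fh rp_ops c\<close>)
qed

lemma HM_Leibniz:
  assumes f: "f \<in> free_hom i j" and p: "p \<in> Pn n"
  shows "cl (d_lin A (act side p f)) = cl (act side (d_poly n p) f + act side p (d_lin A f))"
    "cl (z_lin (act side p f)) = cl (act side (z_poly n p) f + act side p (z_lin f))"
    "cl (h_lin A (act side p f)) = cl (act side (h_poly p) f + act side p (h_lin A f))"
proof -
  note fh = free_hom_add act_free_hom d_lin_free_hom z_lin_free_hom h_lin_free_hom
  note pn = p Pn_vfield[OF p] Pn_h_poly[OF p]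
  have h: "2 * vfield 1 n p = h_poly p" using h_poly_eq_vfield[OF p] by simp
  show "cl (d_lin A (act side p f)) = cl (act side (d_poly n p) f + act side p (d_lin A f))"
    unfolding d_poly_eq_vfield
    by (subst cl_eq_iff) (use f pn in \<open>simp_all add: fh rp_ops rp_act dop_mult right_diff_distrib\<close>)
  show "cl (z_lin (act side p f)) = cl (act side (z_poly n p) f + act side p (z_lin f))"
    unfolding z_poly_eq_vfield
    by (subst cl_eq_iff) (use f pn in \<open>simp_all add: fh rp_ops rp_act vfield_mult algebra_simps\<close>)
  show "cl (h_lin A (act side p f)) = cl (act side (h_poly p) f + act side p (h_lin A f))"
    by (subst cl_eq_iff) (use f pn in \<open>simp_all add: fh rp_ops rp_act hop_mult h[unfolded One_nat_def] right_diff_distrib\<close>)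
qed

lemma HM_hom_comp: "hom_comp HM l = cl ` homog A i j l"
  using q.quot_ops(2) by (simp add: fun_eq_iff)

text \<open>
  Uniqueness of the homogeneous components is \<open>null_homog_parts\<close> for the difference of two
  families.
\<close>

lemma HM_grading: "internal_direct_sum HM UNIV (hom_comp HM)"
  unfolding internal_direct_sum_def
proof (intro conjI ballI)
  interpret H: abelian_group HM by (rule HM_group)
  fix l :: int
  have minus: "- f \<in> homog A i j l" if "f \<in> homog A i j l" for f using homog_diff[OF homog_0 that] by simp
  have add: "f + g \<in> homog A i j l" if "f \<in> homog A i j l" "g \<in> homog A i j l" for f g
    using homog_diff[OF that(1) minus[OF that(2)]] by simp
  show "additive_subgroup (hom_comp HM l) HM"
    by (rule additive_subgroup_intro[OF HM_group])
      (use minus add in \<open>auto simp: HM_hom_comp HM_carrier HM_zero HM_add HM_minus homog_free_hom intro: imageI\<close>)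
next
  interpret H: abelian_group HM by (rule HM_group)
  fix X assume "X \<in> carrier HM"
  then obtain f where f: "f \<in> free_hom i j" "X = cl f" by (auto simp: HM_carrier)
  let ?L = "deg A ` Poly_Mapping.keys f"
  let ?g = "\<lambda>l. cl (homog_part A l f)"
  have part: "homog_part A l f \<in> free_hom i j" for l using homog_part_homog[OF f(1)] by (rule homog_free_hom)
  \<comment> \<open>a sum over the support is the sum over any larger finite set\<close>
  have supp: "finsum HM (\<lambda>l. cl (u l)) {l \<in> UNIV. cl (u l) \<noteq> \<zero>\<^bsub>HM\<^esub>} = cl (sum u K)"
    if "finite K" "{l. cl (u l) \<noteq> \<zero>\<^bsub>HM\<^esub>} \<subseteq> K" "\<And>l. u l \<in> free_hom i j" for u and K :: "int set"
  proof -
    have "finsum HM (\<lambda>l. cl (u l)) {l \<in> UNIV. cl (u l) \<noteq> \<zero>\<^bsub>HM\<^esub>} = finsum HM (\<lambda>l. cl (u l)) K"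
      by (rule H.add.finprod_mono_neutral_cong_left) (use that in \<open>auto simp: HM_carrier\<close>)
    then show ?thesis using HM_finsum[of K u] that by simp
  qed
  have zero: "homog_part A l f = 0" if "l \<notin> ?L" for l
  proof -
    have "Poly_Mapping.keys f \<subseteq> {D. deg A D \<noteq> l}" using that by blast
    then show ?thesis by (induction rule: frag_induction) auto
  qed
  have gL: "{l. ?g l \<noteq> \<zero>\<^bsub>HM\<^esub>} \<subseteq> ?L" using zero by (auto simp: HM_zero)
  show "\<exists>!g. g \<in> (\<Pi>\<^sub>E l\<in>UNIV. hom_comp HM l) \<and> finite {l \<in> UNIV. g l \<noteq> \<zero>\<^bsub>HM\<^esub>} \<and>
    X = finsum HM g {l \<in> UNIV. g l \<noteq> \<zero>\<^bsub>HM\<^esub>}"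
  proof (intro ex1I[of _ ?g] conjI)
    show "?g \<in> (\<Pi>\<^sub>E l\<in>UNIV. hom_comp HM l)" using homog_part_homog[OF f(1)] by (auto simp: HM_hom_comp)
    show "finite {l \<in> UNIV. ?g l \<noteq> \<zero>\<^bsub>HM\<^esub>}" using finite_subset[OF gL] by simp
    show "X = finsum HM ?g {l \<in> UNIV. ?g l \<noteq> \<zero>\<^bsub>HM\<^esub>}"
      unfolding f(2) supp[OF finite_imageI[OF finite_keys] gL part]
      using sum_homog_parts[of ?L A f] by simp
  next
    fix g assume g: "g \<in> (\<Pi>\<^sub>E l\<in>UNIV. hom_comp HM l) \<and> finite {l \<in> UNIV. g l \<noteq> \<zero>\<^bsub>HM\<^esub>} \<and>
      X = finsum HM g {l \<in> UNIV. g l \<noteq> \<zero>\<^bsub>HM\<^esub>}"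
    then have "\<forall>l. \<exists>u\<in>homog A i j l. g l = cl u" by (auto simp: HM_hom_comp PiE_def Pi_def)
    then obtain u where u: "\<And>l. u l \<in> homog A i j l" "\<And>l. g l = cl (u l)" by metis
    have g_eq: "g = (\<lambda>l. cl (u l))" using u(2) by blast
    let ?K = "{l. cl (u l) \<noteq> \<zero>\<^bsub>HM\<^esub>} \<union> ?L"
    have K: "finite ?K" using g unfolding g_eq by simp
    have "cl (sum u ?K) = cl f"
      using g supp[OF K _ homog_free_hom[OF u(1)]] unfolding g_eq f(2) by simp
    moreover have "f = (\<Sum>l\<in>?K. homog_part A l f)" by (rule sum_homog_parts[OF K]) blast
    ultimately have "cl (sum u ?K) = cl (\<Sum>l\<in>?K. homog_part A l f)" by simp
    then have "null A i j (sum u ?K - (\<Sum>l\<in>?K. homog_part A l f))"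
      using homog_free_hom[OF u(1)] part
      by (subst null_iff) (auto simp: cl_eq_iff free_hom_sum free_hom_diff)
    then have n: "null A i j (\<Sum>l\<in>?K. u l - homog_part A l f)" by (simp only: sum_subtractf)
    have "g l = ?g l" for l
    proof (cases "l \<in> ?K")
      case True
      have "null A i j (u l - homog_part A l f)"
        by (rule null_homog_parts[OF K homog_diff[OF u(1) homog_part_homog[OF f(1)]] n True])
      then show ?thesis using u(2) cl_eq_iff[OF homog_free_hom[OF u(1)] part] null_rep[OF A] by force
    next
      case False
      then show ?thesis using u(2) zero by (auto simp: HM_zero)
    qed
    then show "g = ?g" by blast
  qed
qed

lemma HM_graded: "graded_sl2_module n HM"
  unfolding graded_sl2_module_def Let_def
proof (intro conjI ballI allI impI HM_module HM_grading)
  fix D assume "D \<in> {d_op HM, z_op HM, h_op HM}"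
  then show "D \<in> carrier HM \<rightarrow> carrier HM"
    by (auto simp: HM_carrier HM_ops d_lin_free_hom z_lin_free_hom h_lin_free_hom)
next
  fix D X Y assume "D \<in> {d_op HM, z_op HM, h_op HM}" "X \<in> carrier HM" "Y \<in> carrier HM"
  then show "D (X \<oplus>\<^bsub>HM\<^esub> Y) = D X \<oplus>\<^bsub>HM\<^esub> D Y"
    by (auto simp: HM_carrier HM_ops HM_add free_hom_add d_lin_free_hom z_lin_free_hom h_lin_free_hom)
next
  fix X assume "X \<in> carrier HM"
  then obtain f where f: "f \<in> free_hom i j" "X = cl f" by (auto simp: HM_carrier)
  note s = HM_ops HM_minus HM_diff HM_int_mult d_lin_free_hom z_lin_free_hom h_lin_free_hom free_hom_minus
  show "h_op HM (d_op HM X) \<ominus>\<^bsub>HM\<^esub> d_op HM (h_op HM X) = [(2::int)] \<cdot>\<^bsub>HM\<^esub> d_op HM X"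
    unfolding f(2) using f(1) HM_sl2(1)[OF f(1)] by (simp only: s)
  show "h_op HM (\<ominus>\<^bsub>HM\<^esub> z_op HM X) \<ominus>\<^bsub>HM\<^esub> (\<ominus>\<^bsub>HM\<^esub> z_op HM (h_op HM X)) = [(-2::int)] \<cdot>\<^bsub>HM\<^esub> (\<ominus>\<^bsub>HM\<^esub> z_op HM X)"
    unfolding f(2) using f(1) HM_sl2(2)[OF f(1)] by (simp only: s)
  show "d_op HM (\<ominus>\<^bsub>HM\<^esub> z_op HM X) \<ominus>\<^bsub>HM\<^esub> (\<ominus>\<^bsub>HM\<^esub> z_op HM (d_op HM X)) = h_op HM X"
    unfolding f(2) using f(1) HM_sl2(3)[OF f(1)] by (simp only: s)
next
  fix p X assume p: "p \<in> Pn n" and "X \<in> carrier HM"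
  then obtain f where f: "f \<in> free_hom i j" "X = cl f" by (auto simp: HM_carrier)
  note s = HM_ops HM_smult HM_add act_free_hom d_lin_free_hom z_lin_free_hom h_lin_free_hom
  show "d_op HM (p \<odot>\<^bsub>HM\<^esub> X) = d_poly n p \<odot>\<^bsub>HM\<^esub> X \<oplus>\<^bsub>HM\<^esub> p \<odot>\<^bsub>HM\<^esub> d_op HM X"
    unfolding f(2) using f(1) HM_Leibniz(1)[OF f(1) p] by (simp only: s)
  show "z_op HM (p \<odot>\<^bsub>HM\<^esub> X) = z_poly n p \<odot>\<^bsub>HM\<^esub> X \<oplus>\<^bsub>HM\<^esub> p \<odot>\<^bsub>HM\<^esub> z_op HM X"
    unfolding f(2) using f(1) HM_Leibniz(2)[OF f(1) p] by (simp only: s)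
  show "h_op HM (p \<odot>\<^bsub>HM\<^esub> X) = h_poly p \<odot>\<^bsub>HM\<^esub> X \<oplus>\<^bsub>HM\<^esub> p \<odot>\<^bsub>HM\<^esub> h_op HM X"
    unfolding f(2) using f(1) HM_Leibniz(3)[OF f(1) p] by (simp only: s)
next
  fix l k X assume "X \<in> hom_comp HM l" and k: "k < n"
  then obtain f where f: "f \<in> homog A i j l" "X = cl f" by (auto simp: HM_hom_comp)
  have "act side (pvar k) f \<in> homog A i j (l + 2)"
    using homog_vcomp[OF pvar_dots_homog f(1), of k] homog_vcomp[OF f(1) pvar_dots_homog, of k] k li lj
    by (auto simp: act_def add.commute)
  then show "pvar k \<odot>\<^bsub>HM\<^esub> X \<in> hom_comp HM (l + 2)"
    unfolding f(2) HM_smult[OF homog_free_hom[OF f(1)]] HM_hom_comp by (rule imageI)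
next
  fix l X assume "X \<in> hom_comp HM l"
  then obtain f where f: "f \<in> homog A i j l" "X = cl f" by (auto simp: HM_hom_comp)
  show "h_op HM X = [l] \<cdot>\<^bsub>HM\<^esub> X"
    unfolding f(2) HM_ops(3)[OF homog_free_hom[OF f(1)]] HM_int_mult[OF homog_free_hom[OF f(1)]] h_lin_homog[OF f(1)] ..
qed

lemma HM_comb:
  "finsum HM (\<lambda>w. r w \<odot>\<^bsub>HM\<^esub> cl (\<psi> w)) S = cl (\<Sum>w\<in>S. act side (r w) (\<psi> w))"
proof -
  interpret H: abelian_group HM by (rule HM_group)
  have "finsum HM (\<lambda>w. r w \<odot>\<^bsub>HM\<^esub> cl (\<psi> w)) S = finsum HM (\<lambda>w. cl (act side (r w) (\<psi> w))) S"
    by (rule H.add.finprod_cong') (auto simp: HM_smult \<psi>_free_hom HM_carrier act_free_hom)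
  then show ?thesis using HM_finsum[OF finite_seq_perms, of i j "\<lambda>w. act side (r w) (\<psi> w)"] act_free_hom \<psi>_free_hom by simp
qed

lemma comb_free_hom: "(\<Sum>w\<in>S. act side (r w) (\<psi> w)) \<in> free_hom i j"
  by (intro free_hom_sum act_free_hom \<psi>_free_hom)

lemma cl_eqv: "f \<in> free_hom i j \<Longrightarrow> g \<in> free_hom i j \<Longrightarrow> eqv A i j f g \<Longrightarrow> cl f = cl g"
  using cl_eq_iff[of f g] eqv_rp by blast

lemma HM_basis: "sl2_basis n HM S (bruhat_rel i j) (\<lambda>w. cl (\<psi> w)) (pfun side)"
proof
  show "graded_sl2_module n HM" by (rule HM_graded)
  show "finite S" by (rule finite_seq_perms)
  show "partial_order_on S (bruhat_rel i j)" by (rule partial_order_bruhat_rel)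
next
  fix w assume w: "w \<in> S"
  have "\<psi> w \<in> homog A i j (\<Sum>k<n. pfun side w k)"
    using \<psi>_free_hom[OF w] deg_\<psi>[OF w, of side] by (simp add: \<psi>_def)
  then show "cl (\<psi> w) \<in> hom_comp HM (\<Sum>k<n. pfun side w k)" unfolding HM_hom_comp by (rule imageI)
  show "z_op HM (cl (\<psi> w)) = \<zero>\<^bsub>HM\<^esub>" by (simp add: HM_ops \<psi>_free_hom[OF w] z_\<psi> HM_zero)
  obtain R where R: "\<And>v. R v \<in> Pn n" "eqv A i j (d_lin A (\<psi> w)) (\<Sum>v\<in>S. act side (R v) (\<psi> v))"
    "\<forall>v\<in>S. R v \<noteq> 0 \<longrightarrow> bruhat_le n v w" "R w = (\<Sum>k<n. of_int (pfun side w k) * pvar k)"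
    using d_\<psi>[OF w, of side] by blast
  have "d_op HM (cl (\<psi> w)) = finsum HM (\<lambda>v. R v \<odot>\<^bsub>HM\<^esub> cl (\<psi> v)) S"
    unfolding HM_comb HM_ops(1)[OF \<psi>_free_hom[OF w]]
    by (rule cl_eqv[OF d_lin_free_hom[OF \<psi>_free_hom[OF w]] comb_free_hom R(2)])
  then show "\<exists>r\<in>S \<rightarrow> Pn n. d_op HM (cl (\<psi> w)) = finsum HM (\<lambda>v. r v \<odot>\<^bsub>HM\<^esub> cl (\<psi> v)) S \<and>
      (\<forall>v\<in>S. r v \<noteq> 0 \<longrightarrow> (v, w) \<in> bruhat_rel i j) \<and> r w = (\<Sum>k<n. of_int (pfun side w k) * pvar k)"
    using R w li by (intro bexI[of _ R]) (auto simp: bruhat_rel_def)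
next
  fix X assume "X \<in> carrier HM"
  then obtain f where f: "f \<in> free_hom i j" "X = cl f" by (auto simp: HM_carrier)
  obtain R where R: "\<And>w. R w \<in> Pn n" "eqv A i j f (\<Sum>w\<in>S. act side (R w) (\<psi> w))"
    using spans[OF f(1), of side] unfolding spn_def by blast
  have "X = finsum HM (\<lambda>w. R w \<odot>\<^bsub>HM\<^esub> cl (\<psi> w)) S"
    unfolding f(2) HM_comb by (rule cl_eqv[OF f(1) comb_free_hom R(2)])
  then show "\<exists>r\<in>S \<rightarrow> Pn n. X = finsum HM (\<lambda>w. r w \<odot>\<^bsub>HM\<^esub> cl (\<psi> w)) S" using R(1) by (intro bexI[of _ R]) auto
next
  fix r w assume r: "r \<in> S \<rightarrow> Pn n" "finsum HM (\<lambda>w. r w \<odot>\<^bsub>HM\<^esub> cl (\<psi> w)) S = \<zero>\<^bsub>HM\<^esub>" "w \<in> S"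
  let ?R = "\<lambda>w. if w \<in> S then r w else 0"
  have "(\<Sum>w\<in>S. act side (?R w) (\<psi> w)) = (\<Sum>w\<in>S. act side (r w) (\<psi> w))" by (rule sum.cong) auto
  moreover have "null A i j (\<Sum>w\<in>S. act side (r w) (\<psi> w))"
    using r(2) cl_eq_iff[OF comb_free_hom[of r] free_hom_0] null_iff[OF comb_free_hom[of r]] by (simp add: HM_comb HM_zero)
  ultimately have "?R w = 0" using r by (intro independent[where side = side and w = w]) auto
  then show "r w = 0" using r(3) by simp
qed

lemma psi_class_eq: "psi_class A i j (rex w) = cl (\<psi> w)"
  by (auto simp: psi_class_def mor_class_def a_r_coset_def' \<psi>_def)

theorem Hom_downfree:
  defines "N' \<equiv> \<lambda>w. span_over n HM {w} (\<lambda>w. psi_class A i j (rex w))"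
  shows "(\<forall>w\<in>S. psi_class A i j (rex w) \<in> carrier HM \<and> z_op HM (psi_class A i j (rex w)) = \<zero>\<^bsub>HM\<^esub> \<and>
         d_op HM (psi_class A i j (rex w)) \<in> span_over n HM {v \<in> S. (v, w) \<in> bruhat_rel i j} (\<lambda>w. psi_class A i j (rex w))) \<and>
      downfree_filtration n HM S (bruhat_rel i j) N' \<and>
      (\<forall>w\<in>S. \<exists>\<phi>. sl2_module_iso n (twisted_rank_one n (pfun side w)) (gr_piece HM S (bruhat_rel i j) N' w) \<phi> \<and>
            \<phi> 1 = gr_class HM S (bruhat_rel i j) N' w (psi_class A i j (rex w)))"
proof -
  interpret b: sl2_basis n HM S "bruhat_rel i j" "\<lambda>w. cl (\<psi> w)" "pfun side" by (rule HM_basis)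
  show ?thesis unfolding N'_def psi_class_eq
    using b.\<psi>_carrier b.\<psi>_z b.d_\<psi>_span b.downfree b.gr_piece_iso by blast
qed

end

theorem theorem4p5:
  fixes A :: "('v::finite \<times> 'v) set"
    and n :: nat
    and i j :: "'v list"
    and rex :: "(nat \<Rightarrow> nat) \<Rightarrow> nat list"
  assumes "oriented_ADE_graph A"
    and "length i = n" and "length j = n"
    and "\<And>w. w \<in> seq_perms i j \<Longrightarrow> reduced_expression n w (rex w)"
  shows "let S = seq_perms i j; B = bruhat_rel i j; \<psi> = (\<lambda>w. psi_class A i j (rex w)) in
    \<forall>(H, p) \<in> {(HomL A i j, p_left A j), (HomR A i j, p_right A i)}.
      (\<forall>w\<in>S. \<psi> w \<in> carrier H \<and>
         z_op H (\<psi> w) = \<zero>\<^bsub>H\<^esub> \<and>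
         d_op H (\<psi> w) \<in> span_over n H {v \<in> S. (v, w) \<in> B} \<psi>) \<and>
      (let N = (\<lambda>w. span_over n H {w} \<psi>) in
         downfree_filtration n H S B N \<and>
         (\<forall>w\<in>S. \<exists>\<phi>. sl2_module_iso n (twisted_rank_one n (p w)) (gr_piece H S B N w) \<phi> \<and>
            \<phi> 1 = gr_class H S B N w (\<psi> w)))"
proof -
  interpret s: hom_setup A n i j rex
    using assms by unfold_locales (auto simp: oriented_ADE_graph_def)
  have L: "HomL A i j = quotient_sl2_module (formal_hom A (s.act True) i j) {f. null A i j f}" and pL: "s.pfun True = p_left A j"
    and R: "HomR A i j = quotient_sl2_module (formal_hom A (s.act False) i j) {f. null A i j f}" and pR: "s.pfun False = p_right A i"
    by (simp_all add: HomL_def HomR_def s.act_def[abs_def] s.pfun_def)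
  interpret l: hom_module A n i j rex True by unfold_locales
  interpret r: hom_module A n i j rex False by unfold_locales
  show ?thesis
    using l.Hom_downfree r.Hom_downfree unfolding L[symmetric] R[symmetric] pL pR Let_def by blast
qed

end
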